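(* Let the data satisfy $u^0\in D(A^2)$, $v^0\in D(A^{3/2})$, $f(0)\in D(A)$, $f_t(0)\in D(A^{1/2})$, $f_{tt}(0)\in L^2(\Omega)$, $f,f_t,f_{tt},f_{ttt}\in L^2(0,T;L^2(\Omega))$, so that the weak solution $u$ of the biharmonic wave problem has $u,u_t,u_{tt}\in L^\infty(0,T;H^{2+\gamma_0}(\Omega))$ and $u_{tt},u_{ttt},u_{tttt}\in L^\infty(0,T;L^2(\Omega))$. Let $u_h:[0,T]\to V_h$ solve the semidiscrete problem $$(u_{htt},v_h)+a_h(u_h,v_h)=(f,v_h)\ \text{ for all }v_h\in V_h,\qquad u_h(0)=\mathcal R_hu^0,\quad u_{ht}(0)=\mathcal R_hv^0 .$$ Then there is a constant $C>0$, depending on $\alpha,\beta,T,C_1,C_2$ but independent of the mesh-size $h$, such that for every $t\in(0,T]$ $$\|u_t(t)-u_{ht}(t)\|+\|u(t)-u_h(t)\|_h\le C\,h^{\gamma_0}L_{(f,u)},$$ where $$L_{(f,u)}=\|f\|_{L^\infty(L^2)}+\|f_t\|_{L^2(L^2)}+\|u\|_{L^\infty(H^{2+\gamma_0})}+\|u_t\|_{L^\infty(H^{2+\gamma_0})}+\|u_{tt}\|_{L^\infty(L^2)}+\|u_{tt}\|_{L^2(H^{2+\gamma_0})}+\|u_{ttt}\|_{L^2(L^2)} .$$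
   Context: $\Omega\subset\mathbb R^2$ is a bounded polygonal Lipschitz domain, $T>0$; $(\cdot,\cdot)$ and $\|\cdot\|$ are the $L^2(\Omega)$ inner product and norm; $a(w,v)=\int_\Omega D^2w:D^2v\,dx$; $L^p(X)$ abbreviates $L^p(0,T;X)$ with $X=L^2(\Omega)$ or $H^{2+\gamma_0}(\Omega)$. The weak solution $u\in C^0([0,T];H^2_0(\Omega))\cap C^1([0,T];L^2(\Omega))$ satisfies $(u_{tt},v)+a(u,v)=(f,v)$ for all $v\in H^2_0(\Omega)$, $u(0)=u^0$, $u_t(0)=v^0$. $A\psi=\Delta^2\psi$ with $D(A)=\{\psi\in H^2_0(\Omega):\Delta^2\psi\in L^2(\Omega)\}$, and $D(A^r)=\{w\in L^2(\Omega):\sum_n\lambda_n^{2r}|(w,\psi_n)|^2<\infty\}$, where $(\lambda_n,\psi_n)$ are the eigenpairs of $A$, with $\{\psi_n\}$ an orthonormal basis of $L^2(\Omega)$. $\gamma_0\in(1/2,1]$ is the elliptic regularity index of the clamped biharmonic operator; $D(A)\subset H^{2+\gamma_0}(\Omega)$ continuously. Mesh: $\mathcal T$ is a shape-regular triangulation of $\overline\Omega$ with mesh-size $h=\max_{K\in\mathcal T}\mathrm{diam}(K)$, edges $\mathcal E$, vertices $\mathcal V$; $\mathcal V(e)$ is the set of endpoints of edge $e$ and $h_e$ its length; $[\![\cdot]\!]$ is the jump across an interior edge and the trace on a boundary edge; $\{\!\{\cdot\}\!\}$ is the average across an interior edge; $H^m(\mathcal T)$ is the space of piecewise $H^m$ functions;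 $P_r(\mathcal T)$ is the space of piecewise polynomials of degree at most $r$. Discrete space and form: $\mathrm M(\mathcal T)\subset P_2(\mathcal T)$ is the Morley space: piecewise quadratics continuous at interior vertices, with normal derivatives continuous at midpoints of interior edges, vanishing at boundary vertices and with normal derivatives vanishing at midpoints of boundary edges. $V_h\subset H^2(\mathcal T)$ is a finite-dimensional subspace; on $H^2_0(\Omega)+V_h$ one uses $$\|v\|_h^2=\sum_{K\in\mathcal T}|v|_{H^2(K)}^2+\sum_{e\in\mathcal E}\sum_{z\in\mathcal V(e)}h_e^{-2}\big|[\![v]\!](z)\big|^2+\sum_{e\in\mathcal E}\Big|\frac1{h_e}\int_e\Big[\!\Big[\frac{\partial v}{\partial n}\Big]\!\Big]ds\Big|^2 ,$$ and $a_h$ is a symmetric bilinear form on $V_h+\mathrm M(\mathcal T)$ such that, for all $w_h,v_h\in V_h$, $\alpha\|w_h\|_h^2\le a_h(w_h,w_h)$ and $a_h(w_h,v_h)\le\beta\|w_h\|_h\|v_h\|_h$ with constants $\alpha,\beta>0$ independent of $h$. (The Morley, quadratic discontinuous Galerkin and quadratic $C^0$ interior penalty methods are instances.) Smoother: $I_{\mathrm M}:H^2(\mathcal T)\to\mathrm M(\mathcal T)$ is the extended Morley interpolation: at each interior vertex $z$, $(I_{\mathrm M}v)(z)$ is the average of the values $(v|_K)(z)$ over the triangles $K$ containing $z$, and on each interior edge $\int_e\partial_n(I_{\mathrm M}v)\,ds=\int_e\{\!\{\partial_nv\}\!\}\,ds$ (boundary degrees of freedom vanish). $J:\mathrm M(\mathcal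 T)\to H^2_0(\Omega)$ is a fixed linear companion operator, with values in the sum of the Hsieh–Clough–Tocher space and $P_8(\mathcal T)$, such that for $w\in\mathrm M(\mathcal T)$: $Jw=w$ at all vertices, $\nabla(Jw)(z)$ is the average of $(\nabla w|_K)(z)$ over the triangles $K$ containing $z$ at every interior vertex $z$, and $\int_e\partial_n(Jw)\,ds=\int_e\partial_nw\,ds$ for every edge $e$. $Q:=J I_{\mathrm M}:V_h\to H^2_0(\Omega)$ satisfies, with $C_1>0$ independent of $h$, $$\|v_h-Qv_h\|_{H^s(\mathcal T)}\le C_1h^{2-s}\min_{v\in H^2_0(\Omega)}\|v-v_h\|_h,\qquad v_h\in V_h,\ 0\le s\le2 .$$ Modified Ritz projection $\mathcal R_h:H^2_0(\Omega)\to V_h$: $a_h(\mathcal R_hw,v_h)=a(w,Qv_h)$ for all $v_h\in V_h$. It satisfies, with $C_2>0$ independent of $h$, $\|v-\mathcal R_hv\|+h^{\gamma_0}\|v-\mathcal R_hv\|_h\le C_2h^{2\gamma_0}\|v\|_{H^{2+\gamma_0}(\Omega)}$ for all $v\in H^2_0(\Omega)\cap H^{2+\gamma_0}(\Omega)$. *)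

theory Defs
  imports "HOL-Analysis.Analysis"
begin

text \<open>
  Elements of function spaces over a planar set are represented by functions on the whole plane,
  of which only the restriction to that set, up to null sets, matters.
\<close>

type_synonym pt = "real^2"
type_synonym fn = "pt \<Rightarrow> real"

definition aeq :: "pt set \<Rightarrow> fn \<Rightarrow> fn \<Rightarrow> bool" where
  "aeq U v w \<longleftrightarrow> (AE x in lebesgue_on U. v x = w x)"

definition fminus :: "fn \<Rightarrow> fn \<Rightarrow> fn" where
  "fminus v w = (\<lambda>x. v x - w x)"

definition lincomb :: "real \<Rightarrow> fn \<Rightarrow> real \<Rightarrow> fn \<Rightarrow> fn" where
  "lincomb c v d w = (\<lambda>x. c * v x + d * w x)"

definition set_plus_fn :: "fn set \<Rightarrow> fn set \<Rightarrow> fn set" where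
  "set_plus_fn V W = {lincomb 1 v 1 w | v w. v \<in> V \<and> w \<in> W}"


section \<open>Polygonal Lipschitz domains\<close>

definition lipschitz_boundary :: "pt set \<Rightarrow> bool" where
  "lipschitz_boundary \<Omega> \<longleftrightarrow>
     (\<forall>p\<in>frontier \<Omega>. \<exists>a b r L \<phi>.
        norm a = 1 \<and> norm b = 1 \<and> a \<bullet> b = 0 \<and> 0 < r \<and> L-lipschitz_on (UNIV :: real set) \<phi> \<and>
        (\<forall>x\<in>ball p r. x \<in> \<Omega> \<longleftrightarrow> \<phi> ((x - p) \<bullet> a) < (x - p) \<bullet> b))"

definition polygonal_lipschitz_domain :: "pt set \<Rightarrow> bool" where
  "polygonal_lipschitz_domain \<Omega> \<longleftrightarrow>
     \<Omega> \<noteq> {} \<and> open \<Omega> \<and> connected \<Omega> \<and> bounded \<Omega> \<and> lipschitz_boundary \<Omega> \<and>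
     (\<exists>S. finite S \<and> frontier \<Omega> = (\<Union>(a, b)\<in>S. closed_segment a b))"


section \<open>Lebesgue and Sobolev spaces\<close>

definition L2 :: "pt set \<Rightarrow> fn set" where
  "L2 U = {v. v \<in> borel_measurable (lebesgue_on U) \<and> integrable (lebesgue_on U) (\<lambda>x. (v x)\<^sup>2)}"

definition ip :: "pt set \<Rightarrow> fn \<Rightarrow> fn \<Rightarrow> real" where
  "ip U v w = (LINT x|lebesgue_on U. v x * w x)"

definition L2norm :: "pt set \<Rightarrow> fn \<Rightarrow> real" where
  "L2norm U v = sqrt (ip U v v)"

text \<open>Iterated classical partial derivatives; the list collects the directions.\<close>

fun dpart :: "2 list \<Rightarrow> fn \<Rightarrow> fn" where
  "dpart [] \<phi> = \<phi>"
| "dpart (i # is) \<phi> = (\<lambda>x. frechet_derivative (dpart is \<phi>) (at x) (axis i 1))"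

definition smooth :: "fn \<Rightarrow> bool" where
  "smooth \<phi> \<longleftrightarrow> (\<forall>is x. dpart is \<phi> differentiable (at x))"

definition test_fun :: "pt set \<Rightarrow> fn set" where
  "test_fun U = {\<phi>. smooth \<phi> \<and> compact (closure {x. \<phi> x \<noteq> 0}) \<and> closure {x. \<phi> x \<noteq> 0} \<subseteq> U}"

definition weak_deriv :: "pt set \<Rightarrow> 2 list \<Rightarrow> fn \<Rightarrow> fn \<Rightarrow> bool" where
  "weak_deriv U is v g \<longleftrightarrow> v \<in> L2 U \<and> g \<in> L2 U \<and>
     (\<forall>\<phi>\<in>test_fun U. ip U v (dpart is \<phi>) = (- 1) ^ length is * ip U g \<phi>)"

definition wd :: "pt set \<Rightarrow> 2 list \<Rightarrow> fn \<Rightarrow> fn" where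
  "wd U is v = (SOME g. weak_deriv U is v g)"

text \<open>
  Sobolev--Slobodeckij spaces of real order \<open>s \<ge> 0\<close>. For integer \<open>s\<close> these are the usual spaces
  defined by weak derivatives. The weight \<open>1 - frac s\<close> in the norm gives an equivalent norm for each
  fixed \<open>s\<close>; without it the Gagliardo seminorm is unbounded as \<open>s\<close> increases to an integer, and no
  estimate with a constant uniform in \<open>s\<close> could hold.
\<close>

definition gagliardo :: "real \<Rightarrow> pt set \<Rightarrow> fn \<Rightarrow> ennreal" where
  "gagliardo \<sigma> U g =
     (\<integral>\<^sup>+ y. (\<integral>\<^sup>+ x. ennreal ((g x - g y)\<^sup>2 / norm (x - y) powr (2 + 2 * \<sigma>))
        \<partial>lebesgue_on U) \<partial>lebesgue_on U)"

definition Hs :: "real \<Rightarrow> pt set \<Rightarrow> fn set" where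
  "Hs s U = {v. (\<forall>is. length is \<le> nat \<lfloor>s\<rfloor> \<longrightarrow> (\<exists>g. weak_deriv U is v g)) \<and>
     (frac s \<noteq> 0 \<longrightarrow> (\<forall>is. length is = nat \<lfloor>s\<rfloor> \<longrightarrow> gagliardo (frac s) U (wd U is v) < \<infinity>))}"

definition Hs_norm :: "real \<Rightarrow> pt set \<Rightarrow> fn \<Rightarrow> real" where
  "Hs_norm s U v = sqrt (
     (\<Sum>is | length is \<le> nat \<lfloor>s\<rfloor>. (L2norm U (wd U is v))\<^sup>2) +
     (if frac s = 0 then 0
      else (1 - frac s) *
        (\<Sum>is | length is = nat \<lfloor>s\<rfloor>. enn2real (gagliardo (frac s) U (wd U is v)))))"

definition H20 :: "pt set \<Rightarrow> fn set" where
  "H20 \<Omega> = {v \<in> Hs 2 \<Omega>. \<exists>\<phi>. (\<forall>k. \<phi> k \<in> test_fun \<Omega>) \<and>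
     (\<lambda>k::nat. Hs_norm 2 \<Omega> (fminus v (\<phi> k))) \<longlonglongrightarrow> 0}"

definition hess_form :: "pt set \<Rightarrow> fn \<Rightarrow> fn \<Rightarrow> real" where
  "hess_form U w v =
     (LINT x|lebesgue_on U. (\<Sum>i\<in>UNIV. \<Sum>j\<in>UNIV. wd U [i, j] w x * wd U [i, j] v x))"


section \<open>The clamped biharmonic operator\<close>

definition weak_bilaplacian :: "pt set \<Rightarrow> fn \<Rightarrow> fn \<Rightarrow> bool" where
  "weak_bilaplacian \<Omega> \<psi> g \<longleftrightarrow> g \<in> L2 \<Omega> \<and>
     (\<forall>\<phi>\<in>test_fun \<Omega>. ip \<Omega> \<psi> (\<lambda>x. \<Sum>i\<in>UNIV. \<Sum>j\<in>UNIV. dpart [i, i, j, j] \<phi> x) = ip \<Omega> g \<phi>)"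

definition domA :: "pt set \<Rightarrow> fn set" where
  "domA \<Omega> = {\<psi> \<in> H20 \<Omega>. \<exists>g. weak_bilaplacian \<Omega> \<psi> g}"

definition opA :: "pt set \<Rightarrow> fn \<Rightarrow> fn" where
  "opA \<Omega> \<psi> = (SOME g. weak_bilaplacian \<Omega> \<psi> g)"

definition eigensystem :: "pt set \<Rightarrow> (nat \<Rightarrow> real) \<Rightarrow> (nat \<Rightarrow> fn) \<Rightarrow> bool" where
  "eigensystem \<Omega> \<mu> \<psi> \<longleftrightarrow>
     (\<forall>n. \<psi> n \<in> domA \<Omega> \<and> aeq \<Omega> (opA \<Omega> (\<psi> n)) (\<lambda>x. \<mu> n * \<psi> n x)) \<and>
     (\<forall>m n. ip \<Omega> (\<psi> m) (\<psi> n) = (if m = n then 1 else 0)) \<and>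
     (\<forall>w\<in>L2 \<Omega>. (\<lambda>N. L2norm \<Omega> (fminus w (\<lambda>x. \<Sum>n<N. ip \<Omega> w (\<psi> n) * \<psi> n x))) \<longlonglongrightarrow> 0)"

definition domA_pow :: "pt set \<Rightarrow> (nat \<Rightarrow> real) \<Rightarrow> (nat \<Rightarrow> fn) \<Rightarrow> real \<Rightarrow> fn set" where
  "domA_pow \<Omega> \<mu> \<psi> r = {w \<in> L2 \<Omega>. summable (\<lambda>n. \<mu> n powr (2 * r) * (ip \<Omega> w (\<psi> n))\<^sup>2)}"

definition regularity_index :: "pt set \<Rightarrow> real \<Rightarrow> bool" where
  "regularity_index \<Omega> \<gamma> \<longleftrightarrow> 1 / 2 < \<gamma> \<and> \<gamma> \<le> 1 \<and>
     (\<exists>c. \<forall>\<psi>\<in>domA \<Omega>. \<psi> \<in> Hs (2 + \<gamma>) \<Omega> \<and>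
        Hs_norm (2 + \<gamma>) \<Omega> \<psi> \<le> c * (L2norm \<Omega> \<psi> + L2norm \<Omega> (opA \<Omega> \<psi>)))"


section \<open>Functions of time with values in a function space\<close>

text \<open>Here \<open>X\<close> is a function space and \<open>N\<close> its norm.\<close>

definition time_cont :: "real \<Rightarrow> fn set \<Rightarrow> (fn \<Rightarrow> real) \<Rightarrow> (real \<Rightarrow> fn) \<Rightarrow> bool" where
  "time_cont T X N g \<longleftrightarrow> (\<forall>t\<in>{0..T}. g t \<in> X \<and>
     ((\<lambda>s. N (fminus (g s) (g t))) \<longlongrightarrow> 0) (at t within {0..T}))"

definition time_deriv :: "real \<Rightarrow> fn set \<Rightarrow> (fn \<Rightarrow> real) \<Rightarrow> (real \<Rightarrow> fn) \<Rightarrow> (real \<Rightarrow> fn) \<Rightarrow> bool" where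
  "time_deriv T X N g g' \<longleftrightarrow> (\<forall>t\<in>{0..T}. g t \<in> X \<and> g' t \<in> X \<and>
     ((\<lambda>s. N (\<lambda>x. (g s x - g t x) / (s - t) - g' t x)) \<longlongrightarrow> 0) (at t within {0..T}))"

definition simple_in_time :: "real \<Rightarrow> fn set \<Rightarrow> (real \<Rightarrow> fn) \<Rightarrow> bool" where
  "simple_in_time T X s \<longleftrightarrow> finite (s ` {0<..<T}) \<and> s ` {0<..<T} \<subseteq> X \<and>
     (\<forall>w. {t \<in> {0<..<T}. s t = w} \<in> sets lebesgue)"

definition strongly_measurable :: "real \<Rightarrow> fn set \<Rightarrow> (fn \<Rightarrow> real) \<Rightarrow> (real \<Rightarrow> fn) \<Rightarrow> bool" where
  "strongly_measurable T X N g \<longleftrightarrow> (AE t in lebesgue_on {0<..<T}. g t \<in> X) \<and>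
     (\<exists>s. (\<forall>k. simple_in_time T X (s k)) \<and>
        (AE t in lebesgue_on {0<..<T}. (\<lambda>k::nat. N (fminus (g t) (s k t))) \<longlonglongrightarrow> 0))"

definition bochner_L2 :: "real \<Rightarrow> fn set \<Rightarrow> (fn \<Rightarrow> real) \<Rightarrow> (real \<Rightarrow> fn) set" where
  "bochner_L2 T X N = {g. strongly_measurable T X N g \<and>
     integrable (lebesgue_on {0<..<T}) (\<lambda>t. (N (g t))\<^sup>2)}"

definition bochner_L2_norm :: "real \<Rightarrow> (fn \<Rightarrow> real) \<Rightarrow> (real \<Rightarrow> fn) \<Rightarrow> real" where
  "bochner_L2_norm T N g = sqrt (LINT t|lebesgue_on {0<..<T}. (N (g t))\<^sup>2)"

definition bochner_Linf :: "real \<Rightarrow> fn set \<Rightarrow> (fn \<Rightarrow> real) \<Rightarrow> (real \<Rightarrow> fn) set" where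
  "bochner_Linf T X N = {g. strongly_measurable T X N g \<and>
     (\<exists>M. AE t in lebesgue_on {0<..<T}. N (g t) \<le> M)}"

definition bochner_Linf_norm :: "real \<Rightarrow> (fn \<Rightarrow> real) \<Rightarrow> (real \<Rightarrow> fn) \<Rightarrow> real" where
  "bochner_Linf_norm T N g = Inf {M. 0 \<le> M \<and> (AE t in lebesgue_on {0<..<T}. N (g t) \<le> M)}"

definition time_test_fun :: "real \<Rightarrow> (real \<Rightarrow> real) set" where
  "time_test_fun T = {\<phi>. (\<forall>n t. (deriv ^^ n) \<phi> differentiable (at t)) \<and>
     closure {t. \<phi> t \<noteq> 0} \<subseteq> {0<..<T}}"

text \<open>
  Distributional time derivative of an \<open>L\<^sup>2(\<Omega>)\<close>-valued function; the identity between the two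
  Bochner integrals is expressed by pairing with arbitrary elements of \<open>L\<^sup>2(\<Omega>)\<close>.
\<close>

definition weak_time_deriv :: "pt set \<Rightarrow> real \<Rightarrow> (real \<Rightarrow> fn) \<Rightarrow> (real \<Rightarrow> fn) \<Rightarrow> bool" where
  "weak_time_deriv \<Omega> T g g' \<longleftrightarrow>
     g \<in> bochner_L2 T (L2 \<Omega>) (L2norm \<Omega>) \<and> g' \<in> bochner_L2 T (L2 \<Omega>) (L2norm \<Omega>) \<and>
     (\<forall>\<phi>\<in>time_test_fun T. \<forall>w\<in>L2 \<Omega>.
        (LINT t|lebesgue_on {0<..<T}. deriv \<phi> t * ip \<Omega> (g t) w) =
        - (LINT t|lebesgue_on {0<..<T}. \<phi> t * ip \<Omega> (g' t) w))"


section \<open>Triangulations\<close>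

text \<open>A triangle is given by the set of its three vertices, an edge by the set of its endpoints.\<close>

type_synonym mesh = "pt set set"

definition tri :: "pt set \<Rightarrow> pt set" where
  "tri k = interior (convex hull k)"

definition conforming_triangulation :: "pt set \<Rightarrow> mesh \<Rightarrow> bool" where
  "conforming_triangulation \<Omega> \<T> \<longleftrightarrow> finite \<T> \<and>
     (\<forall>k\<in>\<T>. card k = 3 \<and> \<not> affine_dependent k) \<and>
     (\<forall>k\<in>\<T>. \<forall>k'\<in>\<T>. (convex hull k) \<inter> (convex hull k') = convex hull (k \<inter> k')) \<and>
     (\<Union>k\<in>\<T>. convex hull k) = closure \<Omega>"

definition mesh_size :: "mesh \<Rightarrow> real" where
  "mesh_size \<T> = Max ((\<lambda>k. diameter (convex hull k)) ` \<T>)"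

definition shape_regular :: "real \<Rightarrow> mesh \<Rightarrow> bool" where
  "shape_regular \<kappa> \<T> \<longleftrightarrow>
     (\<forall>k\<in>\<T>. diameter (convex hull k) \<le> \<kappa> * Sup {r. \<exists>c. cball c r \<subseteq> convex hull k})"

definition vertices :: "mesh \<Rightarrow> pt set" where
  "vertices \<T> = \<Union> \<T>"

definition edges :: "mesh \<Rightarrow> pt set set" where
  "edges \<T> = {e. card e = 2 \<and> (\<exists>k\<in>\<T>. e \<subseteq> k)}"

definition boundary_edge :: "pt set \<Rightarrow> pt set \<Rightarrow> bool" where
  "boundary_edge \<Omega> e \<longleftrightarrow> convex hull e \<subseteq> frontier \<Omega>"

definition elements_of :: "mesh \<Rightarrow> pt set \<Rightarrow> pt set set" where
  "elements_of \<T> e = {k \<in> \<T>. e \<subseteq> k}"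

definition edge_length :: "pt set \<Rightarrow> real" where
  "edge_length e = diameter e"

definition barycentre :: "pt set \<Rightarrow> pt" where
  "barycentre k = (1 / real (card k)) *\<^sub>R \<Sum> k"

definition edge_normal :: "pt set \<Rightarrow> pt" where
  "edge_normal e = (SOME n. norm n = 1 \<and> (\<forall>a\<in>e. \<forall>b\<in>e. n \<bullet> (a - b) = 0))"

text \<open>\<open>1\<close> if the fixed normal of \<open>e\<close> points out of \<open>k\<close>, and \<open>- 1\<close> if it points into \<open>k\<close>.\<close>

definition side :: "pt set \<Rightarrow> pt set \<Rightarrow> real" where
  "side k e = sgn (edge_normal e \<bullet> (barycentre e - barycentre k))"

text \<open>Arc length measure on an edge.\<close>

definition edge_measure :: "pt set \<Rightarrow> pt measure" where
  "edge_measure e = (let (a, b) = (SOME (a, b). e = {a, b}) in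
     density (distr (restrict_space lborel {0..1}) borel (\<lambda>s. (1 - s) *\<^sub>R a + s *\<^sub>R b))
       (\<lambda>_. ennreal (edge_length e)))"

definition pwHs :: "real \<Rightarrow> mesh \<Rightarrow> fn set" where
  "pwHs s \<T> = {v. \<forall>k\<in>\<T>. v \<in> Hs s (tri k)}"

definition pwHs_norm :: "real \<Rightarrow> mesh \<Rightarrow> fn \<Rightarrow> real" where
  "pwHs_norm s \<T> v = sqrt (\<Sum>k\<in>\<T>. (Hs_norm s (tri k) v)\<^sup>2)"

text \<open>Point value at \<open>z\<close> of the continuous representative of the restriction of \<open>v\<close> to \<open>k\<close>.\<close>

definition trace_at :: "pt set \<Rightarrow> fn \<Rightarrow> pt \<Rightarrow> real" where
  "trace_at k v z = (THE c. \<exists>w. continuous_on (convex hull k) w \<and> aeq (tri k) w v \<and> w z = c)"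

text \<open>
  Trace on \<open>e\<close> of an \<open>H\<^sup>1\<close> function on \<open>k\<close>: the continuous extension, from \<open>H\<^sup>1\<close> of the triangle to
  \<open>L\<^sup>2\<close> of the edge, of the restriction of smooth functions.
\<close>

definition is_edge_trace :: "pt set \<Rightarrow> pt set \<Rightarrow> fn \<Rightarrow> fn \<Rightarrow> bool" where
  "is_edge_trace k e g \<tau> \<longleftrightarrow>
     \<tau> \<in> borel_measurable borel \<and> integrable (edge_measure e) (\<lambda>x. (\<tau> x)\<^sup>2) \<and>
     (\<exists>\<phi>. (\<forall>j. smooth (\<phi> j)) \<and>
        (\<lambda>j::nat. Hs_norm 1 (tri k) (fminus (\<phi> j) g)) \<longlonglongrightarrow> 0 \<and>
        (\<lambda>j. LINT x|edge_measure e. (\<phi> j x - \<tau> x)\<^sup>2) \<longlonglongrightarrow> 0)"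

definition edge_trace :: "pt set \<Rightarrow> pt set \<Rightarrow> fn \<Rightarrow> fn" where
  "edge_trace k e g = (SOME \<tau>. is_edge_trace k e g \<tau>)"

text \<open>Trace on \<open>e\<close> from \<open>k\<close> of the derivative in direction of the fixed normal of \<open>e\<close>.\<close>

definition normal_trace :: "pt set \<Rightarrow> pt set \<Rightarrow> fn \<Rightarrow> fn" where
  "normal_trace k e v = (\<lambda>x. \<Sum>i\<in>UNIV. edge_normal e $ i * edge_trace k e (wd (tri k) [i] v) x)"

text \<open>
  Jumps: difference of the two one-sided traces on interior edges (oriented by the fixed normal) and,
  up to the sign given by the orientation of the fixed normal, the trace itself on boundary edges.
\<close>

definition jump_at :: "mesh \<Rightarrow> pt set \<Rightarrow> fn \<Rightarrow> pt \<Rightarrow> real" where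
  "jump_at \<T> e v z = (\<Sum>k\<in>elements_of \<T> e. side k e * trace_at k v z)"

definition jump_normal :: "mesh \<Rightarrow> pt set \<Rightarrow> fn \<Rightarrow> fn" where
  "jump_normal \<T> e v = (\<lambda>x. \<Sum>k\<in>elements_of \<T> e. side k e * normal_trace k e v x)"

definition average_normal :: "mesh \<Rightarrow> pt set \<Rightarrow> fn \<Rightarrow> fn" where
  "average_normal \<T> e v = (\<lambda>x. (1 / 2) * (\<Sum>k\<in>elements_of \<T> e. normal_trace k e v x))"

definition hnorm :: "mesh \<Rightarrow> fn \<Rightarrow> real" where
  "hnorm \<T> v = sqrt (
     (\<Sum>k\<in>\<T>. hess_form (tri k) v v) +
     (\<Sum>e\<in>edges \<T>. \<Sum>z\<in>e. \<bar>jump_at \<T> e v z\<bar>\<^sup>2 / (edge_length e)\<^sup>2) +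
     (\<Sum>e\<in>edges \<T>. \<bar>(1 / edge_length e) * (LINT x|edge_measure e. jump_normal \<T> e v x)\<bar>\<^sup>2))"


section \<open>Discrete spaces and operators\<close>

definition poly_fn :: "nat \<Rightarrow> fn \<Rightarrow> bool" where
  "poly_fn r p \<longleftrightarrow> (\<exists>c. p = (\<lambda>x. \<Sum>(i, j) | i + j \<le> r. c i j * (x $ 1) ^ i * (x $ 2) ^ j))"

definition pw_poly :: "nat \<Rightarrow> mesh \<Rightarrow> fn set" where
  "pw_poly r \<T> = {v. \<forall>k\<in>\<T>. \<exists>p. poly_fn r p \<and> aeq (tri k) v p}"

definition normal_deriv_at :: "pt set \<Rightarrow> pt set \<Rightarrow> fn \<Rightarrow> pt \<Rightarrow> real" where
  "normal_deriv_at k e v z = (\<Sum>i\<in>UNIV. edge_normal e $ i * trace_at k (wd (tri k) [i] v) z)"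

definition morley :: "pt set \<Rightarrow> mesh \<Rightarrow> fn set" where
  "morley \<Omega> \<T> = {v \<in> pw_poly 2 \<T>.
     (\<forall>z\<in>vertices \<T> - frontier \<Omega>. \<forall>k\<in>elements_of \<T> {z}. \<forall>k'\<in>elements_of \<T> {z}.
        trace_at k v z = trace_at k' v z) \<and>
     (\<forall>z\<in>vertices \<T> \<inter> frontier \<Omega>. \<forall>k\<in>elements_of \<T> {z}. trace_at k v z = 0) \<and>
     (\<forall>e\<in>edges \<T>. \<not> boundary_edge \<Omega> e \<longrightarrow>
        (\<forall>k\<in>elements_of \<T> e. \<forall>k'\<in>elements_of \<T> e.
           normal_deriv_at k e v (barycentre e) = normal_deriv_at k' e v (barycentre e))) \<and>
     (\<forall>e\<in>edges \<T>. boundary_edge \<Omega> e \<longrightarrow>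
        (\<forall>k\<in>elements_of \<T> e. normal_deriv_at k e v (barycentre e) = 0))}"

definition extended_morley_interpolation :: "pt set \<Rightarrow> mesh \<Rightarrow> (fn \<Rightarrow> fn) \<Rightarrow> bool" where
  "extended_morley_interpolation \<Omega> \<T> I \<longleftrightarrow> (\<forall>v\<in>pwHs 2 \<T>. I v \<in> morley \<Omega> \<T> \<and>
     (\<forall>z\<in>vertices \<T> - frontier \<Omega>. \<forall>k\<in>elements_of \<T> {z}.
        trace_at k (I v) z =
          (\<Sum>k'\<in>elements_of \<T> {z}. trace_at k' v z) / real (card (elements_of \<T> {z}))) \<and>
     (\<forall>e\<in>edges \<T>. \<not> boundary_edge \<Omega> e \<longrightarrow> (\<forall>k\<in>elements_of \<T> e.
        (LINT x|edge_measure e. normal_trace k e (I v) x) =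
        (LINT x|edge_measure e. average_normal \<T> e v x))))"

text \<open>
  Hsieh--Clough--Tocher space with clamped boundary conditions: each triangle is split at its
  barycentre. A piecewise polynomial in \<open>H\<^sup>2\<close> is continuously differentiable.
\<close>

definition hct_refinement :: "mesh \<Rightarrow> mesh" where
  "hct_refinement \<T> = {insert (barycentre k) e | k e. k \<in> \<T> \<and> e \<subseteq> k \<and> card e = 2}"

definition hct :: "pt set \<Rightarrow> mesh \<Rightarrow> fn set" where
  "hct \<Omega> \<T> = H20 \<Omega> \<inter> pw_poly 3 (hct_refinement \<T>)"

definition companion :: "pt set \<Rightarrow> mesh \<Rightarrow> (fn \<Rightarrow> fn) \<Rightarrow> bool" where
  "companion \<Omega> \<T> J \<longleftrightarrow>
     (\<forall>v\<in>morley \<Omega> \<T>. \<forall>w\<in>morley \<Omega> \<T>. \<forall>c d.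
        aeq \<Omega> (J (lincomb c v d w)) (lincomb c (J v) d (J w))) \<and>
     (\<forall>w\<in>morley \<Omega> \<T>.
        J w \<in> H20 \<Omega> \<and> J w \<in> set_plus_fn (hct \<Omega> \<T>) (pw_poly 8 \<T>) \<and>
        (\<forall>z\<in>vertices \<T>. \<forall>k\<in>elements_of \<T> {z}. trace_at k (J w) z = trace_at k w z) \<and>
        (\<forall>z\<in>vertices \<T> - frontier \<Omega>. \<forall>k\<in>elements_of \<T> {z}. \<forall>i.
           trace_at k (wd (tri k) [i] (J w)) z =
             (\<Sum>k'\<in>elements_of \<T> {z}. trace_at k' (wd (tri k') [i] w) z)
               / real (card (elements_of \<T> {z}))) \<and>
        (\<forall>e\<in>edges \<T>. \<forall>k\<in>elements_of \<T> e.
           (LINT x|edge_measure e. normal_trace k e (J w) x) =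
           (LINT x|edge_measure e. normal_trace k e w x)))"

definition fin_dim_space :: "fn set \<Rightarrow> bool" where
  "fin_dim_space V \<longleftrightarrow> (\<exists>B. finite B \<and> V = {\<lambda>x. \<Sum>b\<in>B. c b * b x | c. True})"

definition sym_bilinear_on :: "fn set \<Rightarrow> (fn \<Rightarrow> fn \<Rightarrow> real) \<Rightarrow> bool" where
  "sym_bilinear_on W b \<longleftrightarrow> (\<forall>v\<in>W. \<forall>w\<in>W. b v w = b w v) \<and>
     (\<forall>u\<in>W. \<forall>v\<in>W. \<forall>w\<in>W. \<forall>c d. b (lincomb c u d v) w = c * b u w + d * b v w)"

definition discrete_form :: "pt set \<Rightarrow> mesh \<Rightarrow> real \<Rightarrow> real \<Rightarrow> fn set \<Rightarrow> (fn \<Rightarrow> fn \<Rightarrow> real) \<Rightarrow> bool" where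
  "discrete_form \<Omega> \<T> \<alpha> \<beta> V ah \<longleftrightarrow>
     sym_bilinear_on (set_plus_fn V (morley \<Omega> \<T>)) ah \<and>
     (\<forall>w\<in>V. \<alpha> * (hnorm \<T> w)\<^sup>2 \<le> ah w w) \<and>
     (\<forall>w\<in>V. \<forall>v\<in>V. ah w v \<le> \<beta> * hnorm \<T> w * hnorm \<T> v)"

definition smoother_estimate :: "pt set \<Rightarrow> mesh \<Rightarrow> real \<Rightarrow> fn set \<Rightarrow> (fn \<Rightarrow> fn) \<Rightarrow> bool" where
  "smoother_estimate \<Omega> \<T> C1 V Q \<longleftrightarrow> (\<forall>w\<in>V. \<forall>s\<in>{0..2}.
     pwHs_norm s \<T> (fminus w (Q w)) \<le>
       C1 * mesh_size \<T> powr (2 - s) * (INF v\<in>H20 \<Omega>. hnorm \<T> (fminus v w)))"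

definition ritz_projection ::
    "pt set \<Rightarrow> fn set \<Rightarrow> (fn \<Rightarrow> fn \<Rightarrow> real) \<Rightarrow> (fn \<Rightarrow> fn) \<Rightarrow> (fn \<Rightarrow> fn) \<Rightarrow> bool" where
  "ritz_projection \<Omega> V ah Q R \<longleftrightarrow>
     (\<forall>w\<in>H20 \<Omega>. R w \<in> V \<and> (\<forall>v\<in>V. ah (R w) v = hess_form \<Omega> w (Q v)))"

definition ritz_estimate :: "pt set \<Rightarrow> mesh \<Rightarrow> real \<Rightarrow> real \<Rightarrow> (fn \<Rightarrow> fn) \<Rightarrow> bool" where
  "ritz_estimate \<Omega> \<T> \<gamma> C2 R \<longleftrightarrow> (\<forall>v\<in>H20 \<Omega> \<inter> Hs (2 + \<gamma>) \<Omega>.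
     L2norm \<Omega> (fminus v (R v)) + mesh_size \<T> powr \<gamma> * hnorm \<T> (fminus v (R v)) \<le>
       C2 * mesh_size \<T> powr (2 * \<gamma>) * Hs_norm (2 + \<gamma>) \<Omega> v)"


section \<open>Continuous and semidiscrete problems\<close>

text \<open>\<open>ut\<close> and \<open>utt\<close> are the first (classical) and second (distributional) time derivatives of \<open>u\<close>.\<close>

definition weak_solution ::
    "pt set \<Rightarrow> real \<Rightarrow> (real \<Rightarrow> fn) \<Rightarrow> fn \<Rightarrow> fn \<Rightarrow>
     (real \<Rightarrow> fn) \<Rightarrow> (real \<Rightarrow> fn) \<Rightarrow> (real \<Rightarrow> fn) \<Rightarrow> bool" where
  "weak_solution \<Omega> T f u0 v0 u ut utt \<longleftrightarrow>
     time_cont T (H20 \<Omega>) (Hs_norm 2 \<Omega>) u \<and>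
     time_deriv T (L2 \<Omega>) (L2norm \<Omega>) u ut \<and> time_cont T (L2 \<Omega>) (L2norm \<Omega>) ut \<and>
     weak_time_deriv \<Omega> T ut utt \<and>
     (\<forall>v\<in>H20 \<Omega>. AE t in lebesgue_on {0<..<T}.
        ip \<Omega> (utt t) v + hess_form \<Omega> (u t) v = ip \<Omega> (f t) v) \<and>
     aeq \<Omega> (u 0) u0 \<and> aeq \<Omega> (ut 0) v0"

definition semidiscrete_solution ::
    "pt set \<Rightarrow> real \<Rightarrow> fn set \<Rightarrow> (fn \<Rightarrow> fn \<Rightarrow> real) \<Rightarrow> (fn \<Rightarrow> fn) \<Rightarrow> (real \<Rightarrow> fn) \<Rightarrow> fn \<Rightarrow> fn \<Rightarrow>
     (real \<Rightarrow> fn) \<Rightarrow> (real \<Rightarrow> fn) \<Rightarrow> (real \<Rightarrow> fn) \<Rightarrow> bool" where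
  "semidiscrete_solution \<Omega> T V ah R f u0 v0 uh uht uhtt \<longleftrightarrow>
     time_deriv T V (L2norm \<Omega>) uh uht \<and> time_deriv T V (L2norm \<Omega>) uht uhtt \<and>
     (\<forall>t\<in>{0..T}. \<forall>v\<in>V. ip \<Omega> (uhtt t) v + ah (uh t) v = ip \<Omega> (f t) v) \<and>
     aeq \<Omega> (uh 0) (R u0) \<and> aeq \<Omega> (uht 0) (R v0)"

text \<open>
  \<open>f\<close>, \<open>ft\<close>, \<open>ftt\<close> are the time-continuous representatives, whose values at \<open>0\<close> are the traces at the
  initial time.
\<close>

definition admissible_data ::
    "pt set \<Rightarrow> real \<Rightarrow> (nat \<Rightarrow> real) \<Rightarrow> (nat \<Rightarrow> fn) \<Rightarrow> fn \<Rightarrow> fn \<Rightarrow>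
     (real \<Rightarrow> fn) \<Rightarrow> (real \<Rightarrow> fn) \<Rightarrow> (real \<Rightarrow> fn) \<Rightarrow> (real \<Rightarrow> fn) \<Rightarrow> bool" where
  "admissible_data \<Omega> T \<mu> \<psi> u0 v0 f ft ftt fttt \<longleftrightarrow>
     time_cont T (L2 \<Omega>) (L2norm \<Omega>) f \<and> time_cont T (L2 \<Omega>) (L2norm \<Omega>) ft \<and>
     time_cont T (L2 \<Omega>) (L2norm \<Omega>) ftt \<and>
     weak_time_deriv \<Omega> T f ft \<and> weak_time_deriv \<Omega> T ft ftt \<and> weak_time_deriv \<Omega> T ftt fttt \<and>
     u0 \<in> domA_pow \<Omega> \<mu> \<psi> 2 \<and> v0 \<in> domA_pow \<Omega> \<mu> \<psi> (3 / 2) \<and>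
     f 0 \<in> domA \<Omega> \<and> ft 0 \<in> domA_pow \<Omega> \<mu> \<psi> (1 / 2) \<and> ftt 0 \<in> L2 \<Omega>"

definition solution_regularity ::
    "pt set \<Rightarrow> real \<Rightarrow> real \<Rightarrow>
     (real \<Rightarrow> fn) \<Rightarrow> (real \<Rightarrow> fn) \<Rightarrow> (real \<Rightarrow> fn) \<Rightarrow> (real \<Rightarrow> fn) \<Rightarrow> (real \<Rightarrow> fn) \<Rightarrow> bool" where
  "solution_regularity \<Omega> T \<gamma> u ut utt uttt utttt \<longleftrightarrow>
     weak_time_deriv \<Omega> T utt uttt \<and> weak_time_deriv \<Omega> T uttt utttt \<and>
     {u, ut, utt} \<subseteq> bochner_Linf T (Hs (2 + \<gamma>) \<Omega>) (Hs_norm (2 + \<gamma>) \<Omega>) \<and>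
     {utt, uttt, utttt} \<subseteq> bochner_Linf T (L2 \<Omega>) (L2norm \<Omega>)"

definition L_fu ::
    "pt set \<Rightarrow> real \<Rightarrow> real \<Rightarrow> (real \<Rightarrow> fn) \<Rightarrow> (real \<Rightarrow> fn) \<Rightarrow>
     (real \<Rightarrow> fn) \<Rightarrow> (real \<Rightarrow> fn) \<Rightarrow> (real \<Rightarrow> fn) \<Rightarrow> (real \<Rightarrow> fn) \<Rightarrow> real" where
  "L_fu \<Omega> T \<gamma> f ft u ut utt uttt =
     bochner_Linf_norm T (L2norm \<Omega>) f + bochner_L2_norm T (L2norm \<Omega>) ft +
     bochner_Linf_norm T (Hs_norm (2 + \<gamma>) \<Omega>) u + bochner_Linf_norm T (Hs_norm (2 + \<gamma>) \<Omega>) ut +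
     bochner_Linf_norm T (L2norm \<Omega>) utt + bochner_L2_norm T (Hs_norm (2 + \<gamma>) \<Omega>) utt +
     bochner_L2_norm T (L2norm \<Omega>) uttt"

end

theory Submission
 imports Defs
begin

text \<open>
  Write \<open>\<theta> = R u - u\<^sub>h\<close> and \<open>\<eta> = R u\<^sub>t - u\<^sub>h\<^sub>t\<close>. Testing the continuous equation with \<open>Q v\<close> and the
  semidiscrete one with \<open>v\<close> shows that \<open>(\<eta>\<^sub>t, v) + a\<^sub>h(\<theta>, v)\<close> is the sum of \<open>(R u\<^sub>t\<^sub>t - u\<^sub>t\<^sub>t, v)\<close> and the
  load \<open>G(v) = (f - u\<^sub>t\<^sub>t, Q v - v)\<close>. With \<open>v = \<eta> = \<theta>\<^sub>t\<close> the load is integrated by parts in time, so that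
  only \<open>\<theta>\<close>, which the energy controls, meets \<open>G\<close> and \<open>G\<^sub>t\<close>; the smoother estimate supplies the factor
  \<open>h\<^sup>2\<close> and the Ritz estimate the factor \<open>h\<^sup>2\<^sup>\<gamma>\<close>. As \<open>u\<^sub>t\<close> is only Lipschitz in time with values in
  \<open>H\<^sup>2\<^sup>+\<^sup>\<gamma>\<close>, the energy identity is replaced by an inequality for increments, summed over uniform partitions.
  That \<open>u\<close> and \<open>u\<^sub>t\<close> have the regularity at every time, and not only almost everywhere, follows from
  Bochner integration in \<open>H\<^sup>2\<^sup>+\<^sup>\<gamma>\<close>. The triangle inequality for the mesh-dependent norm rests on the
  Sobolev embedding and the trace theorem on triangles, both by density of smooth functions.
\<close>

text \<open>The term \<open>R utt\<close> cannot be used pointwise in time: \<open>R\<close> is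
  specified on \<open>H20\<close> only, and \<open>utt t\<close> is merely known to have
  \<open>H\<^sup>2\<^sup>+\<^sup>\<gamma>\<close> regularity for almost every \<open>t\<close>.
  Increments of \<open>R (ut t)\<close> take its place, and for these \<open>ut t\<close> must be
  shown to be clamped at every time. Increments bring in crude constants: a comparison of
  \<open>ah\<close> with the \<open>L\<^sup>2\<close> product on the finite-dimensional space,
  bounds of the discrete solution, Lipschitz constants. All of them may depend on the mesh. They are
  harmless because they occur only in terms quadratic in the length of the time step, which vanish
  when the partition is refined with the mesh fixed. Functions equal almost everywhere are not
  identified. The bilinear forms are therefore only semidefinite, \<open>R\<close> is linear only up
  to null functions, and that the null functions of \<open>ah\<close> and of the
  \<open>L\<^sup>2\<close> product agree on the discrete space has to be proved in both directions.
  Powers of \<open>h\<close> above \<open>h^\<gamma>\<close> are lowered by bounding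
  \<open>h\<close> by the diameter of the domain.\<close>

lemma lincomb_apply [simp]: "lincomb c v d w x = c * v x + d * w x" by (simp add: lincomb_def)

lemma fminus_apply [simp]: "fminus v w x = v x - w x" by (simp add: fminus_def)

lemma fminus_eq_lincomb: "fminus v w = lincomb 1 v (-1) w" by (simp add: fun_eq_iff)

section \<open>Semi-inner products on spaces of functions\<close>

text \<open>Discriminant criterion, the common source of the Cauchy--Schwarz inequalities in space
  and in time. A zero leading coefficient has to be allowed, as null functions and intervals of
  length zero occur.\<close>

lemma quadratic_nonneg_imp_square_le:
 fixes p q r :: real
 assumes "!!c. 0 <= p + 2 * c * q + c^2 * r" and "0 <= r"
 shows "q^2 <= p * r"
proof (cases "r = 0")
 case True
 have "q = 0"
 proof (rule ccontr)
  assume "q ~= 0"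
  \<comment> \<open>With \<open>r = 0\<close> the expression is affine in \<open>c\<close>, and this
    value makes it equal to -1.\<close>
  thus False using assms(1)[of "- (p + 1) / (2 * q)"] True by (simp add: field_simps)
 qed
 thus ?thesis using True by simp
next
 case False
 hence r: "0 < r" using assms by simp
 from assms(1)[of "- q / r"] have "0 <= p - q\<^sup>2 / r" using r by (simp add: power2_eq_square field_simps)
 thus ?thesis using r by (simp add: field_simps)
qed

locale semi_ip =
 fixes W :: "fn set" and b :: "fn => fn => real"
 assumes lincomb_mem: "v \<in> W ==> w \<in> W ==> lincomb c v d w \<in> W"
  and sym: "v \<in> W ==> w \<in> W ==> b v w = b w v"
  and lin: "u \<in> W ==> v \<in> W ==> w \<in> W ==> b (lincomb c u d v) w = c * b u w + d * b v w"
  and nonneg: "v \<in> W ==> 0 <= b v v"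
begin

abbreviation nrm :: "fn => real" where "nrm v \<equiv> sqrt (b v v)"

lemma lin_right: "u \<in> W ==> v \<in> W ==> w \<in> W ==> b w (lincomb c u d v) = c * b w u + d * b w v"
 using lin[of u v w c d] sym[of w "lincomb c u d v"] sym[of u w] sym[of v w] lincomb_mem[of u v c d] by simp

lemma fminus_mem: "v \<in> W ==> w \<in> W ==> fminus v w \<in> W" by (simp add: fminus_eq_lincomb lincomb_mem)

lemma diff_left: "u \<in> W ==> v \<in> W ==> w \<in> W ==> b (fminus u v) w = b u w - b v w" by (simp add: fminus_eq_lincomb lin)

lemma diff_right: "u \<in> W ==> v \<in> W ==> w \<in> W ==> b w (fminus u v) = b w u - b w v" by (simp add: fminus_eq_lincomb lin_right)

lemma zero_mem: "v \<in> W ==> (%x. 0) \<in> W" using lincomb_mem[of v v 0 0] by (simp add: lincomb_def)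

lemma expand: "v \<in> W ==> w \<in> W ==>
  b (lincomb c v d w) (lincomb c v d w) = c^2 * b v v + 2 * c * d * b v w + d^2 * b w w"
 using sym[of v w] by (simp add: lin lin_right lincomb_mem power2_eq_square algebra_simps)

lemma Cauchy_Schwarz: assumes "v \<in> W" "w \<in> W" shows "\<bar>b v w\<bar> <= nrm v * nrm w"
proof -
 have "(b v w)^2 <= b v v * b w w"
 proof (rule quadratic_nonneg_imp_square_le)
  show "0 <= b v v + 2 * c * b v w + c^2 * b w w" for c using nonneg[OF lincomb_mem[OF assms, of 1 c]] expand[OF assms, of 1 c] by simp
 qed (rule nonneg[OF assms(2)])
 hence "sqrt ((b v w)^2) <= sqrt (b v v * b w w)" by (rule real_sqrt_le_mono)
 thus ?thesis by (simp add: real_sqrt_mult)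
qed

lemma nrm_nonneg: "v \<in> W ==> 0 <= nrm v" using nonneg by simp

lemma nrm_sq: "v \<in> W ==> (nrm v)\<^sup>2 = b v v" using nonneg by simp

lemma nrm_lincomb: assumes "v \<in> W" "w \<in> W"
 shows "nrm (lincomb c v d w) <= \<bar>c\<bar> * nrm v + \<bar>d\<bar> * nrm w"
proof (rule real_le_lsqrt)
 show "0 <= \<bar>c\<bar> * nrm v + \<bar>d\<bar> * nrm w" using assms nonneg by simp
 have "2 * c * d * b v w <= \<bar>2 * c * d * b v w\<bar>" by simp
 also have "... = 2 * \<bar>c\<bar> * \<bar>d\<bar> * \<bar>b v w\<bar>" by (simp add: abs_mult)
 also have "... <= 2 * \<bar>c\<bar> * \<bar>d\<bar> * (nrm v * nrm w)" by (intro mult_left_mono Cauchy_Schwarz assms) simp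
 finally have "b (lincomb c v d w) (lincomb c v d w)
   <= c^2 * (nrm v)^2 + 2 * \<bar>c\<bar> * \<bar>d\<bar> * (nrm v * nrm w) + d^2 * (nrm w)^2" using expand[OF assms, of c d] nrm_sq assms by simp
 thus "b (lincomb c v d w) (lincomb c v d w) <= (\<bar>c\<bar> * nrm v + \<bar>d\<bar> * nrm w)^2" by (simp add: power2_sum power_mult_distrib mult_ac)
qed

lemma nrm_scale: assumes "v \<in> W" shows "nrm (%x. c * v x) = \<bar>c\<bar> * nrm v"
proof -
 have *: "(%x. c * v x) = lincomb c v 0 v" by (simp add: lincomb_def)
 show ?thesis unfolding * using expand[OF assms assms, of c 0] by (simp add: real_sqrt_mult)
qed

lemma nrm_triangle: assumes "u \<in> W" "v \<in> W" "w \<in> W"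
 shows "nrm (fminus u w) <= nrm (fminus u v) + nrm (fminus v w)"
proof -
 have "fminus u w = lincomb 1 (fminus u v) 1 (fminus v w)" by (simp add: fun_eq_iff)
 thus ?thesis using nrm_lincomb[of "fminus u v" "fminus v w" 1 1] assms by (simp add: fminus_mem)
qed

lemma nrm_commute: assumes "u \<in> W" "v \<in> W" shows "nrm (fminus u v) = nrm (fminus v u)"
 using nrm_scale[OF fminus_mem[OF assms], of "-1"] by (simp add: fminus_def)

lemma nrm_diff: assumes "u \<in> W" "v \<in> W" shows "\<bar>nrm u - nrm v\<bar> <= nrm (fminus u v)"
proof -
 have z: "fminus w (%x. 0) = w" for w by (simp add: fun_eq_iff)
 have "(%x. 0) \<in> W" using assms zero_mem by blast
 thus ?thesis using nrm_triangle[of u v "%x. 0"] nrm_triangle[of v u "%x. 0"] assms nrm_commute[of u v] by (simp add: z)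
qed

lemma nrm_le_add: assumes "u \<in> W" "v \<in> W" shows "nrm u <= nrm v + nrm (fminus u v)" using nrm_diff[OF assms] by simp

lemma null_left: assumes "v \<in> W" "w \<in> W" "b v v = 0" shows "b v w = 0" using Cauchy_Schwarz[OF assms(1,2)] assms(3) by simp

text \<open>Duality: \<open>v\<close> itself is the extremal test function. The second alternative
  covers a negative \<open>K\<close>.\<close>

lemma bounded_by_test:
 assumes "v \<in> W" and "!!w. w \<in> W ==> b v w <= K * nrm w" shows "nrm v <= K \<or> nrm v = 0"
proof (cases "nrm v = 0")
 case False
 hence p: "0 < nrm v" using nrm_nonneg[OF assms(1)] by linarith
 have "nrm v * nrm v <= K * nrm v" using assms(2)[OF assms(1)] nonneg[OF assms(1)] by simp
 thus ?thesis using mult_le_cancel_right_pos[OF p, of "nrm v" K] by blast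
qed simp

end

section \<open>Square-integrable functions and completeness\<close>

text \<open>The measure is kept general because completeness is needed both for Lebesgue measure on
  a set and for arc length on an edge.\<close>

definition l2 :: "pt measure => fn set" where
 "l2 M = {v. v \<in> borel_measurable M & integrable M (%x. (v x)^2)}"

definition ipM :: "pt measure => fn => fn => real" where
 "ipM M v w = (LINT x|M. v x * w x)"

lemma L2_eq_l2: "L2 U = l2 (lebesgue_on U)" by (simp add: L2_def l2_def)

lemma ip_eq_ipM: "ip U = ipM (lebesgue_on U)" by (simp add: fun_eq_iff ip_def ipM_def)

lemma l2_measurable: "v \<in> l2 M ==> v \<in> borel_measurable M"
 and l2_integrable_sq: "v \<in> l2 M ==> integrable M (%x. (v x)^2)" by (auto simp: l2_def)

lemma l2_integrable_mult:
 assumes "v \<in> l2 M" "w \<in> l2 M" shows "integrable M (%x. v x * w x)"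
proof (rule Bochner_Integration.integrable_bound)
 show "integrable M (%x. (v x)^2 + (w x)^2)" using assms by (intro Bochner_Integration.integrable_add l2_integrable_sq)
 show "(%x. v x * w x) \<in> borel_measurable M" using assms[THEN l2_measurable] by measurable
 have "\<bar>p * q\<bar> <= p^2 + q^2" for p q :: real
 proof -
  have "2 * (\<bar>p\<bar> * \<bar>q\<bar>) <= \<bar>p\<bar>\<^sup>2 + \<bar>q\<bar>\<^sup>2" using sum_squares_bound[of "\<bar>p\<bar>" "\<bar>q\<bar>"] by simp
  moreover have "0 <= \<bar>p\<bar> * \<bar>q\<bar>" by simp
  ultimately show ?thesis unfolding abs_mult power2_abs by linarith
 qed
 thus "AE x in M. norm (v x * w x) <= norm ((v x)^2 + (w x)^2)" by simp
qed

lemma l2_lincomb: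
 assumes "v \<in> l2 M" "w \<in> l2 M" shows "lincomb c v d w \<in> l2 M"
proof -
 have "integrable M (%x. c^2 * (v x)^2 + 2 * c * d * (v x * w x) + d^2 * (w x)^2)" using assms
  by (intro Bochner_Integration.integrable_add Bochner_Integration.integrable_mult_right
    l2_integrable_sq l2_integrable_mult)
 moreover have "(lincomb c v d w x)^2 = c^2 * (v x)^2 + 2 * c * d * (v x * w x) + d^2 * (w x)^2" for x by (simp add: power2_sum power_mult_distrib)
 ultimately have "integrable M (%x. (lincomb c v d w x)^2)" by (simp only:)
 moreover have "lincomb c v d w \<in> borel_measurable M" unfolding lincomb_def using assms[THEN l2_measurable] by measurable
 ultimately show ?thesis by (simp add: l2_def)
qed

interpretation l2: semi_ip "l2 M" "ipM M" for M
proof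
 fix u v w :: fn and c d :: real
 assume u: "u \<in> l2 M" and v: "v \<in> l2 M" and w: "w \<in> l2 M"
 have "ipM M (lincomb c u d v) w = (LINT x|M. c * (u x * w x) + d * (v x * w x))" by (simp add: ipM_def algebra_simps)
 also have "... = c * ipM M u w + d * ipM M v w" unfolding ipM_def using l2_integrable_mult[OF u w] l2_integrable_mult[OF v w] by simp
 finally show "ipM M (lincomb c u d v) w = c * ipM M u w + d * ipM M v w" .
qed (auto simp: l2_lincomb ipM_def mult.commute)

interpretation L2: semi_ip "L2 U" "ip U" for U unfolding L2_eq_l2 ip_eq_ipM by (rule l2.semi_ip_axioms)

lemma L2norm_nonneg [simp]: "0 <= L2norm U v" by (simp add: L2norm_def ip_def)

lemma L2norm_sq: "(L2norm U v)^2 = (LINT x|lebesgue_on U. (v x)^2)" by (simp add: L2norm_def ip_def power2_eq_square)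

lemma ipM_cong_AE:
 assumes "AE x in M. v x = v' x" "AE x in M. w x = w' x"
  and "v \<in> borel_measurable M" "w \<in> borel_measurable M" "v' \<in> borel_measurable M" "w' \<in> borel_measurable M"
 shows "ipM M v w = ipM M v' w'" unfolding ipM_def using assms by (intro integral_cong_AE) auto

lemma l2_nrm_eq_0_iff:
 assumes "v \<in> l2 M" shows "ipM M v v = 0 \<longleftrightarrow> (AE x in M. v x = 0)"
 using integral_nonneg_eq_0_iff_AE[of M "%x. (v x)^2"] l2_integrable_sq[OF assms] by (simp add: ipM_def power2_eq_square)

lemma L2norm_eq_0_iff:
 assumes "v \<in> L2 U" shows "L2norm U v = 0 \<longleftrightarrow> aeq U v (%x. 0)"
 using l2_nrm_eq_0_iff[of v "lebesgue_on U"] assms by (simp add: L2norm_def ip_eq_ipM L2_eq_l2 aeq_def)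

lemma l2_tendsto_AE_subseq:
 assumes f: "!!n. f n \<in> l2 M" and "g \<in> l2 M"
  and lim: "(%n. ipM M (fminus (f n) g) (fminus (f n) g)) \<longlonglongrightarrow> 0"
 shows "\<exists>r. strict_mono r & (AE x in M. (%n. f (r n) x) \<longlonglongrightarrow> g x)"
proof -
 have "\<exists>r. strict_mono r & (AE x in M. (%n. (fminus (f (r n)) g x)^2) \<longlonglongrightarrow> 0)"
 proof (rule tendsto_L1_AE_subseq[where u = "%n x. (fminus (f n) g x)^2"])
  show "integrable M (%x. (fminus (f n) g x)^2)" for n by (rule l2_integrable_sq[OF l2.fminus_mem[OF f assms(2)]])
  show "(%n. LINT x|M. norm ((fminus (f n) g x)^2)) \<longlonglongrightarrow> 0" using lim by (simp add: ipM_def power2_eq_square abs_mult)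
 qed
 then obtain r :: "nat => nat" where r: "strict_mono r" "AE x in M. (%n. (fminus (f (r n)) g x)^2) \<longlonglongrightarrow> 0" by blast
 have "AE x in M. (%n. f (r n) x) \<longlonglongrightarrow> g x" using r(2)
 proof eventually_elim
  case (elim x)
  have "(%n. sqrt ((fminus (f (r n)) g x)^2)) \<longlonglongrightarrow> sqrt 0" using elim by (rule tendsto_real_sqrt)
  hence "(%n. f (r n) x - g x) \<longlonglongrightarrow> 0" by (simp add: tendsto_rabs_zero_iff)
  thus ?case by (simp add: LIM_zero_iff)
 qed
 with r(1) show ?thesis by blast
qed

text \<open>Riesz--Fischer. Along a subsequence the squared increments have integrals below
  \<open>4^-k\<close>; weighted by \<open>2^k\<close> they are still summable almost everywhere,
  which forces pointwise convergence. Fatou's lemma then carries the Cauchy estimate over to the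
  pointwise limit.\<close>

lemma l2_complete:
 assumes f: "!!n. f n \<in> l2 M"
  and Cau: "!!e. 0 < e ==> \<exists>N. \<forall>m\<ge>N. \<forall>n\<ge>N. ipM M (fminus (f m) (f n)) (fminus (f m) (f n)) < e"
 shows "\<exists>g\<in>l2 M. (%n. ipM M (fminus (f n) g) (fminus (f n) g)) \<longlonglongrightarrow> 0"
proof -
 let ?q = "%v. ipM M v v"
 have "\<forall>k. \<exists>N. \<forall>m\<ge>N. \<forall>n\<ge>N. ?q (fminus (f m) (f n)) < (1/4) ^ k" using Cau by simp
 then obtain N where N: "!!k m n. N k <= m ==> N k <= n ==> ?q (fminus (f m) (f n)) < (1/4) ^ k" by metis
 \<comment> \<open>The sum makes \<open>r k\<close> exceed every earlier threshold
   \<open>N j\<close>, not only the \<open>k\<close>-th one.\<close>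
 define r where "r k = (\<Sum>i\<le>k. N i) + k" for k
 have rN: "N j <= r k" if "j <= k" for j k
 proof -
  have "N j <= (\<Sum>i\<le>k. N i)" using that by (intro member_le_sum) auto
  thus ?thesis by (simp add: r_def)
 qed
 let ?d = "%k x. f (r (Suc k)) x - f (r k) x"
 have fm[measurable]: "f n \<in> borel_measurable M" for n using f by (rule l2_measurable)
 have dint: "integrable M (%x. (?d k x)^2)" for k using l2_integrable_sq[OF l2.fminus_mem[OF f f]] by simp
 have "(\<integral>\<^sup>+x. (\<Sum>k. ennreal (2 ^ k * (?d k x)^2)) \<partial>M) = (\<Sum>k. \<integral>\<^sup>+x. ennreal (2 ^ k * (?d k x)^2) \<partial>M)"
  by (intro nn_integral_suminf) measurable
 also have "... <= (\<Sum>k. ennreal ((1/2) ^ k))"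
 proof (intro suminf_le)
  fix k
  have "(\<integral>\<^sup>+x. ennreal (2 ^ k * (?d k x)^2) \<partial>M) = ennreal (LINT x|M. 2 ^ k * (?d k x)^2)"
   using dint by (intro nn_integral_eq_integral) auto
  also have "(LINT x|M. 2 ^ k * (?d k x)^2) = 2 ^ k * ?q (fminus (f (r (Suc k))) (f (r k)))" by (simp add: ipM_def power2_eq_square)
  also have "... <= 2 ^ k * (1/4) ^ k" using N[of k "r (Suc k)" "r k"] rN[of k "Suc k"] rN[of k k] by (intro mult_left_mono) auto
  also have "... = (1/2) ^ k" by (simp flip: power_mult_distrib)
  finally show "(\<integral>\<^sup>+x. ennreal (2 ^ k * (?d k x)^2) \<partial>M) <= ennreal ((1/2) ^ k)" using ennreal_leI by blast
 qed auto
 also have "... < \<infinity>"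
 proof -
  have "(%k. (1/2::real) ^ k) sums 2" using geometric_sums[of "1/2::real"] by simp
  hence "(\<Sum>k. ennreal ((1/2) ^ k)) = ennreal 2" by (intro suminf_ennreal_eq) auto
  thus ?thesis by simp
 qed
 finally have fin: "(\<integral>\<^sup>+x. (\<Sum>k. ennreal (2 ^ k * (?d k x)^2)) \<partial>M) < \<infinity>" .
 have "AE x in M. (\<Sum>k. ennreal (2 ^ k * (?d k x)^2)) ~= \<infinity>" by (rule nn_integral_PInf_AE[OF _ less_imp_neq[OF fin]]) measurable
 hence AEconv: "AE x in M. convergent (%k. f (r k) x)"
 proof eventually_elim
  case (elim x)
  define d where "d k = ?d k x" for k
  have sm: "summable (%k. 2 ^ k * (d k)^2)" by (rule summable_suminf_not_top) (use elim in \<open>simp_all add: d_def\<close>)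
  \<comment> \<open>Young's inequality; with \<open>p = 2^k\<close> it turns summable weighted
    squares into absolutely summable increments, at the price of a geometric series.\<close>
  have "\<bar>y\<bar> <= p * y^2 + 1 / p" if "0 < p" for p y :: real
  proof -
   have "0 <= (p * \<bar>y\<bar> - 1 / 2)^2 / p" using that by simp
   also have "... = p * y^2 - \<bar>y\<bar> + (1 / 4) / p" using that by (simp add: power2_eq_square field_simps)
   finally show ?thesis using divide_right_mono[of "1/4" 1 p] that by simp
  qed
  hence dk: "\<bar>d k\<bar> <= 2 ^ k * (d k)^2 + (1/2) ^ k" for k by (simp add: power_one_over)
  have "summable (%k. d k)" by (rule summable_comparison_test'[OF summable_add[OF sm summable_geometric[of "1/2::real"]], of 0]) (use dk in auto)
  hence "convergent (%n. \<Sum>k<n. d k)" by (simp add: summable_iff_convergent)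
  moreover have "(\<Sum>k<n. d k) = f (r n) x - f (r 0) x" for n unfolding d_def by (rule sum_lessThan_telescope)
  ultimately have "convergent (%n. f (r n) x - f (r 0) x)" by simp
  hence "convergent (%n. (f (r n) x - f (r 0) x) + f (r 0) x)" by (intro convergent_add convergent_const)
  thus ?case by simp
 qed
 define g where "g x = lim (%k. f (r k) x)" for x
 have gm[measurable]: "g \<in> borel_measurable M" unfolding g_def by measurable
 have glim: "AE x in M. (%k. f (r k) x) \<longlonglongrightarrow> g x" using AEconv by eventually_elim (simp add: g_def convergent_LIMSEQ_iff)
 \<comment> \<open>Fatou's lemma in the second argument: the tail of the subsequence is replaced by
   its limit.\<close>
 have est: "(\<integral>\<^sup>+x. ennreal ((f n x - g x)^2) \<partial>M) <= ennreal ((1/4) ^ j)" if "N j <= n" for n j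
 proof -
  have "(\<integral>\<^sup>+x. ennreal ((f n x - g x)^2) \<partial>M) = (\<integral>\<^sup>+x. liminf (%k. ennreal ((f n x - f (r k) x)^2)) \<partial>M)"
  proof (rule nn_integral_cong_AE)
   show "AE x in M. ennreal ((f n x - g x)^2) = liminf (%k. ennreal ((f n x - f (r k) x)^2))" using glim
   proof eventually_elim
    case (elim x)
    have "(%k. ennreal ((f n x - f (r k) x)^2)) \<longlonglongrightarrow> ennreal ((f n x - g x)^2)" by (intro tendsto_ennrealI tendsto_intros elim)
    from lim_imp_Liminf[OF trivial_limit_sequentially this] show ?case by (rule sym)
   qed
  qed
  also have "... <= liminf (%k. \<integral>\<^sup>+x. ennreal ((f n x - f (r k) x)^2) \<partial>M)" by (rule nn_integral_liminf) measurable
  also have "... <= ennreal ((1/4) ^ j)"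
  proof (rule Liminf_le)
   show "\<forall>\<^sub>F k in sequentially. (\<integral>\<^sup>+x. ennreal ((f n x - f (r k) x)^2) \<partial>M) <= ennreal ((1/4) ^ j)"
    using eventually_ge_at_top[of j]
   proof eventually_elim
    case (elim k)
    have "(\<integral>\<^sup>+x. ennreal ((f n x - f (r k) x)^2) \<partial>M) = ennreal (?q (fminus (f n) (f (r k))))"
     using nn_integral_eq_integral[OF l2_integrable_sq[OF l2.fminus_mem[OF f[of n] f[of "r k"]]]] by (simp add: ipM_def power2_eq_square)
    also have "... <= ennreal ((1/4) ^ j)" using N[OF that rN[OF elim]] by (intro ennreal_leI) simp
    finally show ?case .
   qed
  qed simp
  finally show ?thesis .
 qed
 have int: "integrable M (%x. (f n x - g x)^2)" if "N j <= n" for n j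
  by (rule integrableI_bounded) (use le_less_trans[OF est[OF that] ennreal_less_top] in auto)
 have "fminus (f (N 0)) g \<in> l2 M" using int[of 0 "N 0"] by (simp add: l2_def fminus_def)
 hence "fminus (f (N 0)) (fminus (f (N 0)) g) \<in> l2 M" by (rule l2.fminus_mem[OF f])
 moreover have "fminus (f (N 0)) (fminus (f (N 0)) g) = g" by (simp add: fun_eq_iff)
 ultimately have gl2: "g \<in> l2 M" by (simp only:)
 have "(%n. ?q (fminus (f n) g)) \<longlonglongrightarrow> 0"
 proof (rule LIMSEQ_I)
  fix e :: real assume "0 < e"
  then obtain j where j: "(1/4::real) ^ j < e" using real_arch_pow_inv[of e "1/4"] by auto
  have "norm (?q (fminus (f n) g) - 0) < e" if "N j <= n" for n
  proof -
   have "ennreal (?q (fminus (f n) g)) <= ennreal ((1/4) ^ j)"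
    using est[OF that] nn_integral_eq_integral[OF int[OF that]] by (simp add: ipM_def power2_eq_square)
   hence "?q (fminus (f n) g) <= (1/4) ^ j" by simp
   moreover have "0 <= ?q (fminus (f n) g)" by (simp add: l2.nonneg l2.fminus_mem f gl2)
   ultimately show ?thesis using j by simp
  qed
  thus "\<exists>no. \<forall>n\<ge>no. norm (?q (fminus (f n) g) - 0) < e" by blast
 qed
 with gl2 show ?thesis by blast
qed

section \<open>Smooth cut-off functions of one variable\<close>

text \<open>The flat function \<open>exp (-1/t)\<close> with a polynomial factor in
  \<open>1/t\<close>. The factor makes the family closed under differentiation: the derivative
  belongs to the polynomial \<open>x^2 (p - p')\<close>.\<close>

definition hb :: "real poly => real => real" where
 "hb p t = (if t > 0 then poly p (1 / t) * exp (- (1 / t)) else 0)"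

lemma poly_exp_tendsto_0: "((%x::real. poly p x * exp (- x)) \<longlongrightarrow> 0) at_top"
proof -
 have "((%x. \<Sum>i\<le>degree p. coeff p i * (x ^ i / exp x)) \<longlongrightarrow> (\<Sum>i\<le>degree p. coeff p i * 0)) at_top"
  by (intro tendsto_sum tendsto_mult tendsto_const tendsto_power_div_exp_0)
 moreover have "(\<Sum>i\<le>degree p. coeff p i * (x ^ i / exp x)) = poly p x * exp (- x)" for x :: real
  unfolding poly_altdef sum_distrib_right exp_minus by (intro sum.cong refl) (simp add: field_simps)
 ultimately show ?thesis by simp
qed

lemma hb_has_derivative:
 "(hb p has_real_derivative hb ([:0, 0, 1:] * (p - pderiv p)) t) (at t)"
proof -
 consider "t > 0" | "t < 0" | "t = 0" by linarith
 thus ?thesis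
 proof cases
  case 1
  have "((%t. poly p (1 / t) * exp (- (1 / t))) has_real_derivative
    hb ([:0, 0, 1:] * (p - pderiv p)) t) (at t)" using 1 by (auto intro!: derivative_eq_intros simp: hb_def field_simps power2_eq_square)
  thus ?thesis by (rule has_field_derivative_transform_within_open[where S = "{0<..}"]) (use 1 in \<open>auto simp: hb_def\<close>)
 next
  case 2
  have "((%t. 0) has_real_derivative hb ([:0, 0, 1:] * (p - pderiv p)) t) (at t)" using 2 by (simp add: hb_def)
  thus ?thesis by (rule has_field_derivative_transform_within_open[where S = "{..<0}"]) (use 2 in \<open>auto simp: hb_def\<close>)
 next
  case 3
  have "((%h. hb p h / h) \<longlongrightarrow> 0) (at 0)"
  proof (rule filterlim_split_at_real)
   have "((%h. 0::real) \<longlongrightarrow> 0) (at_left 0)" by simp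
   thus "((%h. hb p h / h) \<longlongrightarrow> 0) (at_left 0)" by (rule Lim_transform_eventually) (auto simp: eventually_at_filter hb_def)
   \<comment> \<open>From the right the difference quotient at 0 is \<open>x p(x) exp (-x)\<close>
     at \<open>x = 1/h\<close>, so it tends to 0 by exponential decay.\<close>
   have "((%h. poly ([:0, 1:] * p) (inverse h) * exp (- inverse h)) \<longlongrightarrow> 0) (at_right 0)"
    by (rule filterlim_compose[OF poly_exp_tendsto_0 filterlim_inverse_at_top_right])
   thus "((%h. hb p h / h) \<longlongrightarrow> 0) (at_right 0)" by (rule Lim_transform_eventually) (auto simp: eventually_at_filter hb_def field_simps)
  qed
  thus ?thesis using 3 by (simp add: DERIV_def hb_def)
 qed
qed

text \<open>An algebra generated by rescaled copies of \<open>hb\<close> and closed under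
  \<open>deriv\<close>, so that smoothness of all orders becomes plain membership.\<close>

inductive_set CI :: "(real => real) set" where
 bump: "(%t. hb p (a * t + b)) \<in> CI"
| const: "(%t. c) \<in> CI"
| add: "f \<in> CI ==> g \<in> CI ==> (%t. f t + g t) \<in> CI"
| mult: "f \<in> CI ==> g \<in> CI ==> (%t. f t * g t) \<in> CI"

lemma CI_has_derivative: "f \<in> CI ==> \<exists>f'\<in>CI. \<forall>t. (f has_real_derivative f' t) (at t)"
proof (induction rule: CI.induct)
 case (bump p a b)
 have "((%t. hb p (a * t + b)) has_real_derivative hb ([:0, 0, 1:] * (p - pderiv p)) (a * t + b) * a) (at t)" for t
  by (rule DERIV_chain2[OF hb_has_derivative]) (auto intro!: derivative_eq_intros)
 moreover have "(%t. hb ([:0, 0, 1:] * (p - pderiv p)) (a * t + b) * a) \<in> CI" by (intro CI.intros)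
 ultimately show ?case by (intro bexI allI)
next
 case (const c)
 show ?case by (rule bexI[OF _ CI.const[of 0]]) simp
next
 case (add f g)
 then obtain f' g' where "f' \<in> CI" "g' \<in> CI" "!!t. (f has_real_derivative f' t) (at t)"
  "!!t. (g has_real_derivative g' t) (at t)" by blast
 thus ?case by (intro bexI[of _ "%t. f' t + g' t"] allI DERIV_add CI.intros)
next
 case (mult f g)
 then obtain f' g' where *: "f' \<in> CI" "g' \<in> CI" "!!t. (f has_real_derivative f' t) (at t)"
  "!!t. (g has_real_derivative g' t) (at t)" by blast
 show ?case by (rule bexI[of _ "%t. f' t * g t + g' t * f t"])
   (auto intro!: CI.add CI.mult mult.hyps * DERIV_mult)
qed

lemma CI_deriv: "f \<in> CI ==> deriv f \<in> CI"
 and CI_DERIV: "f \<in> CI ==> (f has_real_derivative deriv f t) (at t)"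
proof -
 assume "f \<in> CI"
 then obtain f' where f': "f' \<in> CI" "!!t. (f has_real_derivative f' t) (at t)" using CI_has_derivative by blast
 hence "deriv f = f'" by (auto simp: fun_eq_iff intro: DERIV_imp_deriv)
 with f' show "deriv f \<in> CI" "(f has_real_derivative deriv f t) (at t)" by auto
qed

lemma CI_deriv_iter: "f \<in> CI ==> (deriv ^^ n) f \<in> CI" by (induction n) (auto intro: CI_deriv)

lemma CI_continuous: "f \<in> CI ==> continuous_on S f" by (meson CI_DERIV DERIV_isCont continuous_at_imp_continuous_on)

text \<open>Supported in the interval from \<open>a\<close> to \<open>b\<close> for positive
  \<open>n\<close>. Scaling the argument by \<open>n\<close> instead of shrinking a transition layer
  makes the family increase with \<open>n\<close> to the indicator of the open interval, see
  \<open>chi_mono\<close> and \<open>chi_tendsto\<close>.\<close>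

definition chi :: "real => real => real => real => real" where
 "chi n a b t = hb 1 (n * t + (- n * a)) * hb 1 ((- n) * t + n * b)"

lemma chi_CI: "chi n a b \<in> CI" unfolding chi_def by (intro CI.intros)

lemma hb_1: "0 <= hb 1 t" "hb 1 t <= 1" "0 < t ==> hb 1 t = exp (- (1 / t))" "t <= 0 ==> hb 1 t = 0" by (auto simp: hb_def)

lemma chi_bounds: "0 <= chi n a b t" "chi n a b t <= 1" by (auto simp: chi_def hb_1 mult_le_one)

lemma chi_outside: "0 <= n ==> t \<notin> {a<..<b} ==> chi n a b t = 0"
proof -
 assume n: "0 <= n" and t: "t \<notin> {a<..<b}"
 then consider "t <= a" | "b <= t" by force
 thus ?thesis
 proof cases
  case 1
  hence "n * t + (- n * a) <= 0" using n by (simp add: mult_left_mono)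
  thus ?thesis by (simp add: chi_def hb_1 del: mult_minus_left)
 next
  case 2
  hence "(- n) * t + n * b <= 0" using n by (simp add: mult_left_mono)
  thus ?thesis by (simp add: chi_def hb_1 del: mult_minus_left)
 qed
qed

lemma chi_inside:
 assumes "0 < n" "t \<in> {a<..<b}"
 shows "chi n a b t = exp (- (1 / (n * (t - a)))) * exp (- (1 / (n * (b - t))))"
proof -
 have "n * t + (- n * a) = n * (t - a)" "(- n) * t + n * b = n * (b - t)" by (auto simp: algebra_simps)
 moreover have "0 < n * (t - a)" "0 < n * (b - t)" using assms by auto
 ultimately show ?thesis by (simp add: chi_def hb_1 del: mult_minus_left)
qed

lemma chi_mono: assumes "0 < n" "n <= m" shows "chi n a b t <= chi m a b t"
proof (cases "t \<in> {a<..<b}")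
 case True
 have "exp (- (1 / (n * s))) <= exp (- (1 / (m * s)))" if "0 < s" for s using assms that by (simp add: frac_le)
 thus ?thesis using True assms by (simp add: chi_inside mult_mono)
next
 case False thus ?thesis using assms by (simp add: chi_outside)
qed

lemma chi_tendsto: "(%n. chi (real (Suc n)) a b t) \<longlonglongrightarrow> indicator {a<..<b} t"
proof (cases "t \<in> {a<..<b}")
 case True
 have *: "(%n. exp (- (1 / (real (Suc n) * s)))) \<longlonglongrightarrow> exp (- 0)" for s :: real
 proof (intro tendsto_exp tendsto_minus)
  have "(%n. (1 / real (Suc n)) * (1 / s)) \<longlonglongrightarrow> 0 * (1 / s)" by (intro tendsto_mult tendsto_const LIMSEQ_Suc[OF lim_1_over_n])
  thus "(%n. 1 / (real (Suc n) * s)) \<longlonglongrightarrow> 0" by simp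
 qed
 have "(%n. exp (- (1 / (real (Suc n) * (t - a)))) * exp (- (1 / (real (Suc n) * (b - t)))))
   \<longlonglongrightarrow> exp (- 0) * exp (- 0)" by (intro tendsto_mult *)
 thus ?thesis using True by (simp add: chi_inside del: of_nat_Suc)
next
 case False thus ?thesis by (simp add: chi_outside)
qed

lemma chi_integral_pos:
 assumes "a < b" "0 < n" shows "0 < (LINT t|lborel. chi n a b t)"
  and "integrable lborel (chi n a b)"
proof -
 have c: "continuous_on UNIV (chi n a b)" by (rule CI_continuous[OF chi_CI])
 have i: "integrable lborel (%t. indicator {a..b} t *\<^sub>R chi n a b t)" by (rule borel_integrable_compact) (auto intro: CI_continuous[OF chi_CI])
 have e: "indicator {a..b} t *\<^sub>R chi n a b t = chi n a b t" for t
  using assms chi_outside[of n t a b] by (cases "t \<in> {a<..<b}") (auto simp: indicator_def)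
 show I: "integrable lborel (chi n a b)" using i unfolding e .
 have pos: "0 < chi n a b t" if "t \<in> {a<..<b}" for t using that assms by (simp add: chi_inside)
 have "0 <= (LINT t|lborel. chi n a b t)" by (simp add: chi_bounds)
 moreover have "(LINT t|lborel. chi n a b t) ~= 0"
 proof
  assume "(LINT t|lborel. chi n a b t) = 0"
  hence "AE t in lborel. chi n a b t = 0" using integral_nonneg_eq_0_iff_AE[OF I] by (simp add: chi_bounds)
  hence "AE t in lborel. t \<notin> {a<..<b}" by eventually_elim (use pos in force)
  hence "emeasure lborel {a<..<b} = 0" by (subst (asm) AE_iff_measurable[of "{a<..<b}"]) auto
  thus False using assms by simp
 qed
 ultimately show "0 < (LINT t|lborel. chi n a b t)" by linarith
qed

subsection \<open>Tensor products in the plane\<close>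

definition tens :: "(real => real) => (real => real) => fn" where
 "tens F G x = F (x $ 1) * G (x $ 2)"

text \<open>Coinduction: differentiability of all orders follows from a single closure property of a
  set of functions.\<close>

lemma smooth_coinduct:
 assumes "\<phi> \<in> S" and "!!f. f \<in> S ==> (\<forall>x. f differentiable (at x)) &
  (\<forall>i. (%x. frechet_derivative f (at x) (axis i 1)) \<in> S)"
 shows "smooth \<phi>"
proof -
 have "dpart is \<phi> \<in> S" for "is" by (induction "is") (use assms in auto)
 thus ?thesis using assms(2) by (simp add: smooth_def)
qed

lemma tens_has_derivative:
 assumes "F \<in> CI" "G \<in> CI"
 shows "(tens F G has_derivative (%h. F (x $ 1) * (deriv G (x $ 2) * h $ 2) + deriv F (x $ 1) * h $ 1 * G (x $ 2))) (at x)"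
proof -
 have c: "((%x::pt. x $ i) has_derivative (%h. h $ i)) (at x)" for i by (rule bounded_linear.has_derivative[OF bounded_linear_vec_nth has_derivative_ident])
 have "((%x. H (x $ i)) has_derivative (%h. deriv H (x $ i) * h $ i)) (at x)" if "H \<in> CI" for H i
  using has_derivative_compose[OF c[of i] CI_DERIV[OF that, unfolded has_field_derivative_def]] by simp
 thus ?thesis unfolding tens_def using assms by (intro has_derivative_mult)
qed

lemma frechet_tens:
 assumes "F \<in> CI" "G \<in> CI"
 shows "(%x. frechet_derivative (tens F G) (at x) (axis i 1)) =
  (if i = 1 then tens (deriv F) G else tens F (deriv G))"
proof
 fix x
 have "frechet_derivative (tens F G) (at x) =
   (%h. F (x $ 1) * (deriv G (x $ 2) * h $ 2) + deriv F (x $ 1) * h $ 1 * G (x $ 2))"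
  by (rule frechet_derivative_at[symmetric]) (rule tens_has_derivative[OF assms])
 thus "frechet_derivative (tens F G) (at x) (axis i 1) =
  (if i = 1 then tens (deriv F) G else tens F (deriv G)) x" using exhaust_2[of i] by (auto simp: tens_def axis_def)
qed

lemma dpart_tens:
 assumes "F \<in> CI" "G \<in> CI"
 shows "dpart is (tens F G) = tens ((deriv ^^ count_list is 1) F) ((deriv ^^ count_list is 2) G)"
proof (induction "is")
 case (Cons i "is")
 have "dpart (i # is) (tens F G) = (%x. frechet_derivative (tens ((deriv ^^ count_list is 1) F) ((deriv ^^ count_list is 2) G)) (at x) (axis i 1))"
  by (simp only: dpart.simps Cons.IH)
 also have "... = (if i = 1 then tens (deriv ((deriv ^^ count_list is 1) F)) ((deriv ^^ count_list is 2) G)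
   else tens ((deriv ^^ count_list is 1) F) (deriv ((deriv ^^ count_list is 2) G)))" by (intro frechet_tens CI_deriv_iter assms)
 finally show ?case using exhaust_2[of i] by auto
qed simp

lemma smooth_tens: assumes "F \<in> CI" "G \<in> CI" shows "smooth (tens F G)"
proof (rule smooth_coinduct[where S = "{tens F G | F G. F \<in> CI & G \<in> CI}"])
 show "tens F G \<in> {tens F G | F G. F \<in> CI & G \<in> CI}" using assms by blast
next
 fix f assume "f \<in> {tens F G | F G. F \<in> CI & G \<in> CI}"
 then obtain F G where f: "f = tens F G" "F \<in> CI" "G \<in> CI" by blast
 have "(%x. frechet_derivative f (at x) (axis i 1)) \<in> {tens F G | F G. F \<in> CI & G \<in> CI}" for i
  unfolding f(1) frechet_tens[OF f(2,3)] using CI_deriv f(2,3) by auto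
 moreover have "f differentiable (at x)" for x using tens_has_derivative[OF f(2,3)] f(1) unfolding differentiable_def by blast
 ultimately show "(\<forall>x. f differentiable (at x)) &
  (\<forall>i. (%x. frechet_derivative f (at x) (axis i 1)) \<in> {tens F G | F G. F \<in> CI & G \<in> CI})" by blast
qed

definition chi2 :: "real => pt => pt => fn" where
 "chi2 n a b = tens (chi n (a $ 1) (b $ 1)) (chi n (a $ 2) (b $ 2))"

lemma mem_box_2: "(x::pt) \<in> box a b \<longleftrightarrow> x $ 1 \<in> {a $ 1 <..< b $ 1} & x $ 2 \<in> {a $ 2 <..< b $ 2}"
 by (auto simp: mem_box_cart forall_2)

lemma chi2_outside: "0 <= n ==> x \<notin> box a b ==> chi2 n a b x = 0" unfolding chi2_def tens_def mem_box_2 using chi_outside[of n] by fastforce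

lemma chi2_bounds: "0 <= chi2 n a b x" "chi2 n a b x <= 1" by (auto simp: chi2_def tens_def chi_bounds mult_le_one)

section \<open>Smooth functions, test functions and integration by parts\<close>

lemma smooth_continuous: "smooth \<phi> ==> continuous_on S (dpart is \<phi>)"
 by (meson continuous_at_imp_continuous_on differentiable_imp_continuous_within smooth_def)

lemma continuous_measurable_lebesgue_on:
 "continuous_on UNIV (f :: 'a::euclidean_space => real) ==> f \<in> borel_measurable (lebesgue_on U)"
 by (simp add: borel_measurable_continuous_onI measurable_completion measurable_restrict_space1)

lemma dpart_append: "dpart (is @ js) \<phi> = dpart is (dpart js \<phi>)" by (induction "is") auto

lemma smooth_dpart: "smooth \<phi> ==> smooth (dpart js \<phi>)" unfolding smooth_def by (simp flip: dpart_append)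

lemma smooth_has_derivative:
 "smooth \<phi> ==> (dpart is \<phi> has_derivative frechet_derivative (dpart is \<phi>) (at x)) (at x)" by (simp add: smooth_def frechet_derivative_works)

lemma smooth_has_derivative0:
 "smooth \<phi> ==> (\<phi> has_derivative frechet_derivative \<phi> (at x)) (at x)" using smooth_has_derivative[of \<phi> "[]" x] unfolding dpart.simps(1) .

lemma dpart_lincomb:
 assumes "smooth v" "smooth w"
 shows "dpart is (lincomb c v d w) = lincomb c (dpart is v) d (dpart is w)"
proof (induction "is")
 case (Cons i "is")
 have "dpart (i # is) (lincomb c v d w) x = lincomb c (dpart (i # is) v) d (dpart (i # is) w) x" for x
 proof -
  have "((%x. c * dpart is v x + d * dpart is w x) has_derivative
   (%h. c * frechet_derivative (dpart is v) (at x) h + d * frechet_derivative (dpart is w) (at x) h)) (at x)"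
   using assms by (intro has_derivative_add has_derivative_mult_right smooth_has_derivative)
  hence "(lincomb c (dpart is v) d (dpart is w) has_derivative
   (%h. c * frechet_derivative (dpart is v) (at x) h + d * frechet_derivative (dpart is w) (at x) h)) (at x)" by (simp add: lincomb_def)
  note e = frechet_derivative_at[OF this, symmetric]
  show ?thesis unfolding dpart.simps Cons.IH e by simp
 qed
 thus ?case by (simp only: fun_eq_iff) blast
qed simp

lemma smooth_lincomb:
 assumes "smooth v" "smooth w" shows "smooth (lincomb c v d w)" unfolding smooth_def dpart_lincomb[OF assms]
proof (intro allI)
 fix "is" x
 have "((%x. c * dpart is v x + d * dpart is w x) has_derivative
   (%h. c * frechet_derivative (dpart is v) (at x) h + d * frechet_derivative (dpart is w) (at x) h)) (at x)"
  using assms by (intro has_derivative_add has_derivative_mult_right smooth_has_derivative)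
 thus "lincomb c (dpart is v) d (dpart is w) differentiable at x" unfolding differentiable_def lincomb_def by blast
qed

lemma dpart_support:
 assumes "x \<notin> closure {x. \<phi> x ~= 0}" shows "dpart is \<phi> x = 0" using assms
proof (induction "is" arbitrary: x)
 case Nil
 thus ?case using closure_subset[of "{x. \<phi> x ~= 0}"] by auto
next
 case (Cons i "is")
 have "(dpart is \<phi> has_derivative (%h. 0)) (at x)" by (rule has_derivative_transform_within_open[of "%_. 0" _ _ UNIV "- closure {x. \<phi> x ~= 0}"])
   (use Cons in auto)
 from frechet_derivative_at[OF this, symmetric] show ?case by simp
qed

lemma test_funD:
 assumes "\<phi> \<in> test_fun U"
 shows "smooth \<phi>" "compact (closure {x. \<phi> x ~= 0})" "closure {x. \<phi> x ~= 0} \<subseteq> U" using assms by (auto simp: test_fun_def)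

lemma test_funI:
 assumes "smooth \<phi>" "compact K" "K \<subseteq> U" "!!x. x \<notin> K ==> \<phi> x = 0"
 shows "\<phi> \<in> test_fun U"
proof -
 have "closure {x. \<phi> x ~= 0} \<subseteq> K" using assms by (intro closure_minimal compact_imp_closed) auto
 moreover hence "compact (closure {x. \<phi> x ~= 0})" by (meson assms(2) closed_closure compact_imp_bounded bounded_subset compact_eq_bounded_closed)
 ultimately show ?thesis using assms by (auto simp: test_fun_def)
qed

lemma test_fun_dpart: assumes "\<phi> \<in> test_fun U" shows "dpart is \<phi> \<in> test_fun U"
 by (rule test_funI[OF smooth_dpart[OF test_funD(1)[OF assms]] test_funD(2,3)[OF assms]])
  (rule dpart_support)

lemma test_fun_mono: "U \<subseteq> W ==> test_fun U \<subseteq> test_fun W" by (auto simp: test_fun_def)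

lemma test_fun_lincomb: assumes "\<phi> \<in> test_fun U" "\<psi> \<in> test_fun U" shows "lincomb c \<phi> d \<psi> \<in> test_fun U"
proof (rule test_funI)
 let ?K = "closure {x. \<phi> x ~= 0} \<union> closure {x. \<psi> x ~= 0}"
 show "compact ?K" "?K \<subseteq> U" using assms by (auto dest: test_funD)
 show "lincomb c \<phi> d \<psi> x = 0" if "x \<notin> ?K" for x using that dpart_support[of x \<phi> "[]"] dpart_support[of x \<psi> "[]"] by simp
 show "smooth (lincomb c \<phi> d \<psi>)" using assms by (intro smooth_lincomb test_funD)
qed

lemma zero_test_fun: "(%x. 0) \<in> test_fun U"
proof (rule test_funI[of _ "{}"])
 have "dpart is (%x. 0) = (%x. 0)" for "is" by (induction "is") (auto simp: frechet_derivative_const)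
 thus "smooth (%x. 0)" by (simp add: smooth_def)
qed auto

lemma continuous_compact_support_bounded:
 fixes f :: "pt => real"
 assumes "continuous_on UNIV f" "compact K" "!!x. x \<notin> K ==> f x = 0"
 obtains B where "0 <= B" "!!x. \<bar>f x\<bar> <= B"
proof -
 have "bounded (f ` K)" using assms by (intro compact_imp_bounded compact_continuous_image) (auto intro: continuous_on_subset)
 then obtain B where B: "!!x. x \<in> K ==> \<bar>f x\<bar> <= B" by (auto simp: bounded_iff)
 have "\<bar>f x\<bar> <= max B 0" for x using B[of x] assms(3)[of x] by (cases "x \<in> K") auto
 thus ?thesis using that[of "max B 0"] by auto
qed

lemma continuous_compact_support_integrable:
 fixes f :: "pt => real"
 assumes "continuous_on UNIV f" "compact K" "!!x. x \<notin> K ==> f x = 0"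
 shows "integrable lborel f"
proof -
 have "integrable lborel (%x. indicator K x *\<^sub>R f x)" using assms by (intro borel_integrable_compact) (auto intro: continuous_on_subset)
 moreover have "(%x. indicator K x *\<^sub>R f x) = f" using assms(3) by (auto simp: indicator_def fun_eq_iff)
 ultimately show ?thesis by simp
qed

lemma continuous_L2:
 fixes f :: fn
 assumes "continuous_on UNIV f" "bounded U" "U \<in> sets lebesgue" shows "f \<in> L2 U"
proof -
 have "integrable lborel (%x. indicator (closure U) x *\<^sub>R (f x)\<^sup>2)"
  using assms by (intro borel_integrable_compact) (auto intro!: continuous_intros intro: continuous_on_subset)
 hence "integrable lebesgue (%x. indicator (closure U) x *\<^sub>R (f x)\<^sup>2)" by (subst integrable_completion) auto
 hence "integrable lebesgue (%x. indicator U x *\<^sub>R (indicator (closure U) x *\<^sub>R (f x)\<^sup>2))" by (rule integrable_mult_indicator[OF assms(3)])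
 moreover have "indicator U x *\<^sub>R (indicator (closure U) x *\<^sub>R (f x)\<^sup>2) = indicator U x *\<^sub>R (f x)\<^sup>2" for x
  using closure_subset[of U] by (auto simp: indicator_def)
 ultimately have "integrable lebesgue (%x. indicator U x *\<^sub>R (f x)\<^sup>2)" by (simp only:)
 hence "integrable (lebesgue_on U) (%x. (f x)^2)" using assms by (subst integrable_restrict_space) auto
 thus ?thesis using assms(1) by (simp add: L2_def continuous_measurable_lebesgue_on)
qed

lemma continuous_compact_support_L2:
 fixes f :: fn
 assumes f: "continuous_on UNIV f" "compact K" "!!x. x \<notin> K ==> f x = 0" and "U \<in> sets lebesgue"
 shows "f \<in> L2 U"
proof -
 have "integrable lborel (%x. (f x)^2)" using f by (intro continuous_compact_support_integrable[where K = K]) (auto intro!: continuous_intros)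
 hence "integrable lebesgue (%x. (f x)^2)" by (subst integrable_completion) auto
 hence "integrable lebesgue (%x. indicator U x *\<^sub>R (f x)\<^sup>2)" using assms by (intro integrable_mult_indicator) auto
 hence "integrable (lebesgue_on U) (%x. (f x)^2)" using assms by (subst integrable_restrict_space) auto
 thus ?thesis using assms(1) by (simp add: L2_def continuous_measurable_lebesgue_on)
qed

lemma test_fun_L2: assumes "\<phi> \<in> test_fun U" "W \<in> sets lebesgue" shows "dpart is \<phi> \<in> L2 W"
 by (rule continuous_compact_support_L2[OF smooth_continuous[OF test_funD(1)[OF assms(1)]] test_funD(2)[OF assms(1)] dpart_support])
  (use assms in auto)

lemma smooth_L2: "smooth \<phi> ==> bounded U ==> U \<in> sets lebesgue ==> dpart is \<phi> \<in> L2 U" by (intro continuous_L2 smooth_continuous)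

text \<open>The difference quotients have integral zero by translation invariance, and converge boundedly.\<close>

lemma integral_directional_derivative_eq_0:
 fixes g :: "pt => real"
 assumes d: "!!x. (g has_derivative g' x) (at x)" and c: "continuous_on UNIV (%x. g' x e)"
  and K: "compact K" "!!x. x \<notin> K ==> g x = 0"
 shows "(LINT x|lborel. g' x e) = 0"
proof -
 obtain B where B: "!!x. x \<in> K ==> norm x <= B" using compact_imp_bounded[OF K(1)] by (auto simp: bounded_iff)
 have gc: "continuous_on UNIV g" by (intro continuous_at_imp_continuous_on ballI has_derivative_continuous[OF d])
 let ?D = "cball 0 (B + norm e) :: pt set"
 \<comment> \<open>Quotients are estimated on the ball of radius \<open>B + norm e\<close>; the
   intermediate point of the mean value theorem may lie another \<open>norm e\<close> further
   out.\<close>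
 have "bounded ((%x. g' x e) ` cball 0 (B + 2 * norm e))" by (intro compact_imp_bounded compact_continuous_image continuous_on_subset[OF c]) auto
 then obtain L where "\<forall>y\<in>(\<lambda>x. g' x e) ` cball 0 (B + 2 * norm e). norm y <= L" unfolding bounded_iff by blast
 hence L: "\<bar>g' x e\<bar> <= L" if "norm x <= B + 2 * norm e" for x using that by fastforce
 have gint: "integrable lborel g" by (rule continuous_compact_support_integrable[OF gc K])
 define k where "k n = 1 / real (Suc n)" for n
 have k: "0 < k n" "k n <= 1" for n by (auto simp: k_def)
 define q where "q n x = (g (x + k n *\<^sub>R e) - g x) / k n" for n x
 have shift: "integrable lborel (%x. g (x + y))" "(LINT x|lborel. g (x + y)) = (LINT x|lborel. g x)" for y
 proof -
  have gm: "g \<in> borel_measurable borel" using gc by (rule borel_measurable_continuous_onI)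
  have "integrable (distr lborel borel ((+) y)) g" using gint by (simp add: lborel_distr_plus)
  thus "integrable lborel (%x. g (x + y))" using gm by (subst (asm) integrable_distr_eq) (auto simp: add.commute)
  show "(LINT x|lborel. g (x + y)) = (LINT x|lborel. g x)" using integral_distr[of "(+) y" lborel borel g] gm by (simp add: lborel_distr_plus add.commute)
 qed
 have der: "((%t. g (x + t *\<^sub>R e)) has_real_derivative g' (x + t *\<^sub>R e) e) (at t)" for x t
 proof -
  have "((%t. x + t *\<^sub>R e) has_derivative (%t. t *\<^sub>R e)) (at t)" by (auto intro!: derivative_eq_intros)
  from has_derivative_compose[OF this d]
  have "((%t. g (x + t *\<^sub>R e)) has_derivative (%s. g' (x + t *\<^sub>R e) (s *\<^sub>R e))) (at t)" .
  moreover have "(%s. g' (x + t *\<^sub>R e) (s *\<^sub>R e)) = (*) (g' (x + t *\<^sub>R e) e)"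
   using linear_scale[OF bounded_linear.linear[OF has_derivative_bounded_linear[OF d]]] by (simp add: fun_eq_iff)
  ultimately show ?thesis by (simp add: has_field_derivative_def)
 qed
 have lim: "(%n. q n x) \<longlonglongrightarrow> g' x e" for x
 proof -
  have "((%h. (g (x + h *\<^sub>R e) - g x) / h) \<longlongrightarrow> g' x e) (at 0)" using der[of x 0] by (simp add: DERIV_def)
  moreover have "filterlim k (at 0) sequentially" unfolding filterlim_at k_def by (simp add: LIMSEQ_Suc[OF lim_1_over_n] del: of_nat_Suc)
  ultimately show ?thesis unfolding q_def by (rule filterlim_compose)
 qed
 have small: "norm (s *\<^sub>R e) <= norm e" if "0 < s" "s <= 1" for s using that by (simp add: mult_left_le_one_le)
 have bound: "\<bar>q n x\<bar> <= indicator ?D x * L" for n x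
 proof (cases "x \<in> ?D")
  case True
  have "\<exists>z. 0 < z & z < k n & g (x + k n *\<^sub>R e) - g (x + 0 *\<^sub>R e) = (k n - 0) * g' (x + z *\<^sub>R e) e"
   by (rule MVT2[OF k(1)]) (use der in auto)
  then obtain z where z: "0 < z" "z < k n" "q n x = g' (x + z *\<^sub>R e) e" using k(1)[of n] by (auto simp: q_def)
  have "norm (x + z *\<^sub>R e) <= B + 2 * norm e" using small[of z] z k(2)[of n] True norm_triangle_ineq[of x "z *\<^sub>R e"] by simp
  thus ?thesis using z(3) L True by simp
 next
  case False
  hence "x \<notin> K" using B[of x] norm_ge_zero[of e] by auto
  moreover have "x + k n *\<^sub>R e \<notin> K"
   using B[of "x + k n *\<^sub>R e"] norm_triangle_ineq4[of "x + k n *\<^sub>R e" "k n *\<^sub>R e"] small[OF k, of n] False by auto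
  ultimately show ?thesis using False K(2) by (simp add: q_def)
 qed
 have "(%n. LINT x|lborel. q n x) \<longlonglongrightarrow> (LINT x|lborel. g' x e)"
 proof (rule integral_dominated_convergence[where w = "%x. indicator ?D x * L"])
  show "(%x. g' x e) \<in> borel_measurable lborel" using c by (simp add: borel_measurable_continuous_onI)
  show "q n \<in> borel_measurable lborel" for n unfolding q_def using gint shift(1) by (intro borel_measurable_divide borel_measurable_diff) auto
  show "integrable lborel (%x. indicator ?D x * L)"
   by (intro Bochner_Integration.integrable_mult_left integrable_real_indicator) (use emeasure_lborel_cball_finite[of 0 "B + norm e"] in \<open>auto simp: less_top[symmetric]\<close>)
 qed (use lim bound in auto)
 moreover have "(LINT x|lborel. q n x) = 0" for n unfolding q_def using shift gint by simp
 ultimately show ?thesis by (simp add: LIMSEQ_const_iff)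
qed

lemma ip_eq_lborel:
 assumes "continuous_on UNIV v" "continuous_on UNIV w" "!!x. x \<notin> U ==> w x = 0" "U \<in> sets lebesgue"
 shows "ip U v w = (LINT x|lborel. v x * w x)"
proof -
 have "ip U v w = (LINT x|lebesgue. indicator U x * (v x * w x))" using assms(4) by (simp add: ip_def integral_restrict_space)
 also have "... = (LINT x|lebesgue. v x * w x)" by (rule Bochner_Integration.integral_cong[OF refl]) (use assms(3) in \<open>auto simp: indicator_def\<close>)
 also have "... = (LINT x|lborel. v x * w x)" using assms by (intro integral_completion) (auto intro!: borel_measurable_continuous_onI continuous_intros)
 finally show ?thesis .
qed

lemma test_fun_zero_outside: "\<phi> \<in> test_fun U ==> x \<notin> U ==> dpart is \<phi> x = 0" by (meson dpart_support subsetD test_funD(3))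

declare dpart.simps(2) [simp del]

text \<open>The product has compact support in \<open>U\<close>, so the integral of its derivative
  over the plane vanishes. No boundary of \<open>U\<close> enters.\<close>

lemma integration_by_parts:
 assumes v: "smooth v" and \<psi>: "\<psi> \<in> test_fun U" and U: "U \<in> sets lebesgue"
 shows "ip U v (dpart [i] \<psi>) = - ip U (dpart [i] v) \<psi>"
proof -
 obtain K where K: "compact K" "!!is x. x \<notin> K ==> dpart is \<psi> x = 0" using test_funD(2)[OF \<psi>] dpart_support by blast
 have s: "smooth \<psi>" by (rule test_funD(1)[OF \<psi>])
 have c: "continuous_on UNIV v" "continuous_on UNIV (dpart [i] v)" "continuous_on UNIV \<psi>" "continuous_on UNIV (dpart [i] \<psi>)"
  using smooth_continuous[OF v, of UNIV "[]"] smooth_continuous[OF v, of UNIV "[i]"]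
   smooth_continuous[OF s, of UNIV "[]"] smooth_continuous[OF s, of UNIV "[i]"] unfolding dpart.simps(1) by blast+
 have z: "\<psi> x = 0" "dpart [i] \<psi> x = 0" if "x \<notin> K" for x using K(2)[OF that, of "[]"] K(2)[OF that, of "[i]"] by auto
 have zU: "\<psi> x = 0" "dpart [i] \<psi> x = 0" if "x \<notin> U" for x
  using test_fun_zero_outside[OF \<psi> that, of "[]"] test_fun_zero_outside[OF \<psi> that, of "[i]"] by auto
 let ?g' = "%x h. v x * frechet_derivative \<psi> (at x) h + frechet_derivative v (at x) h * \<psi> x"
 have eq: "?g' x (axis i 1) = v x * dpart [i] \<psi> x + dpart [i] v x * \<psi> x" for x by (simp only: dpart.simps)
 have "(LINT x|lborel. ?g' x (axis i 1)) = 0"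
 proof (rule integral_directional_derivative_eq_0[where g = "%x. v x * \<psi> x" and g' = ?g' and e = "axis i 1" and K = K])
  show "((%x. v x * \<psi> x) has_derivative ?g' x) (at x)" for x by (rule has_derivative_mult[OF smooth_has_derivative0[OF v] smooth_has_derivative0[OF s]])
  show "continuous_on UNIV (%x. ?g' x (axis i 1))" unfolding eq by (intro continuous_intros c)
  show "compact K" by (rule K(1))
  show "v x * \<psi> x = 0" if "x \<notin> K" for x using z[OF that] by simp
 qed
 hence "(LINT x|lborel. v x * dpart [i] \<psi> x + dpart [i] v x * \<psi> x) = 0" unfolding eq .
 moreover have "integrable lborel (%x. v x * dpart [i] \<psi> x)"
  by (rule continuous_compact_support_integrable[OF continuous_on_mult[OF c(1,4)] K(1)]) (simp add: z)
 moreover have "integrable lborel (%x. dpart [i] v x * \<psi> x)"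
  by (rule continuous_compact_support_integrable[OF continuous_on_mult[OF c(2,3)] K(1)]) (simp add: z)
 moreover have "ip U v (dpart [i] \<psi>) = (LINT x|lborel. v x * dpart [i] \<psi> x)" by (rule ip_eq_lborel[OF c(1,4) zU(2) U])
 moreover have "ip U (dpart [i] v) \<psi> = (LINT x|lborel. dpart [i] v x * \<psi> x)" by (rule ip_eq_lborel[OF c(2,3) zU(1) U])
 ultimately show ?thesis by simp
qed

text \<open>The outermost derivative of the test function is moved first and becomes the innermost
  one on \<open>v\<close>; hence the reversal. In this form symmetry of mixed partial derivatives is
  not involved.\<close>

lemma smooth_weak_deriv:
 assumes v: "smooth v" and U: "bounded U" "open U"
 shows "weak_deriv U is v (dpart (rev is) v)"
proof -
 have Um: "U \<in> sets lebesgue" using U by (simp add: borel_open)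
 have "ip U w (dpart is \<phi>) = (- 1) ^ length is * ip U (dpart (rev is) w) \<phi>" if "smooth w" "\<phi> \<in> test_fun U" for w \<phi> using that(1)
 proof (induction "is" arbitrary: w)
  case (Cons i "is")
  have "ip U w (dpart (i # is) \<phi>) = ip U w (dpart [i] (dpart is \<phi>))" by (simp only: dpart.simps)
  also have "... = - ip U (dpart [i] w) (dpart is \<phi>)" by (rule integration_by_parts[OF Cons.prems test_fun_dpart[OF that(2)] Um])
  also have "... = - ((- 1) ^ length is * ip U (dpart (rev is) (dpart [i] w)) \<phi>)" by (subst Cons.IH[OF smooth_dpart[OF Cons.prems]]) simp
  moreover have "dpart (rev (i # is)) w = dpart (rev is) (dpart [i] w)" by (simp only: rev.simps dpart_append)
  ultimately show ?case by simp
 qed simp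
 thus ?thesis unfolding weak_deriv_def using v smooth_L2[OF v U(1) Um, of "[]"] smooth_L2[OF v U(1) Um, of "rev is"] by simp
qed

text \<open>Integrate the divergence of \<open>x\<^sub>i \<phi>\<^sup>2\<close>.\<close>

lemma Friedrichs_test_fun:
 assumes \<phi>: "\<phi> \<in> test_fun U" and U: "U \<in> sets lebesgue" and B: "!!x. x \<in> U ==> norm x <= B" and B0: "0 <= B"
 shows "L2norm U \<phi> <= 2 * B * L2norm U (dpart [i] \<phi>)"
proof -
 obtain K where K: "compact K" "!!is x. x \<notin> K ==> dpart is \<phi> x = 0" using test_funD(2)[OF \<phi>] dpart_support by blast
 have s: "smooth \<phi>" by (rule test_funD(1)[OF \<phi>])
 have c: "continuous_on UNIV \<phi>" "continuous_on UNIV (dpart [i] \<phi>)"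
  using smooth_continuous[OF s, of UNIV "[]"] smooth_continuous[OF s, of UNIV "[i]"] by auto
 have z: "\<phi> x = 0" "dpart [i] \<phi> x = 0" if "x \<notin> K" for x using K(2)[OF that, of "[]"] K(2)[OF that, of "[i]"] by auto
 have zU: "\<phi> x = 0" "dpart [i] \<phi> x = 0" if "x \<notin> U" for x
  using test_fun_zero_outside[OF \<phi> that, of "[]"] test_fun_zero_outside[OF \<phi> that, of "[i]"] by auto
 have cc: "continuous_on UNIV (%x::pt. x $ i)" by (intro continuous_intros)
 let ?w = "%x. x $ i * \<phi> x"
 have "(LINT x|lborel. (\<phi> x)^2 + 2 * (?w x * dpart [i] \<phi> x)) = 0"
 proof -
  let ?g' = "%x h. (x $ i) * (2 * \<phi> x * frechet_derivative \<phi> (at x) h) + h $ i * (\<phi> x)^2"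
  have "(LINT x|lborel. ?g' x (axis i 1)) = 0"
  proof (rule integral_directional_derivative_eq_0[where g = "%x. x $ i * (\<phi> x)^2" and g' = ?g' and e = "axis i 1" and K = K])
   fix x
   have "((%x::pt. x $ i) has_derivative (%h. h $ i)) (at x)" by (rule bounded_linear.has_derivative[OF bounded_linear_vec_nth has_derivative_ident])
   moreover have "((%x. (\<phi> x)^2) has_derivative (%h. 2 * \<phi> x * frechet_derivative \<phi> (at x) h)) (at x)"
    using has_derivative_power[OF smooth_has_derivative0[OF s, of x], of 2] by (simp add: mult_ac)
   ultimately show "((%x. x $ i * (\<phi> x)^2) has_derivative ?g' x) (at x)" by (rule has_derivative_mult)
  next
   show "continuous_on UNIV (%x. ?g' x (axis i 1))" using c cc unfolding dpart.simps by (intro continuous_intros)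
  qed (use z K(1) in auto)
  moreover have "?g' x (axis i 1) = (\<phi> x)^2 + 2 * (?w x * dpart [i] \<phi> x)" for x by (simp add: axis_def dpart.simps)
  ultimately show ?thesis by (simp only:)
 qed
 moreover have "(LINT x|lborel. (\<phi> x)^2 + 2 * (?w x * dpart [i] \<phi> x)) = (LINT x|lborel. (\<phi> x)^2) + (LINT x|lborel. 2 * (?w x * dpart [i] \<phi> x))"
  by (intro Bochner_Integration.integral_add continuous_compact_support_integrable[OF _ K(1)] continuous_intros c cc) (simp_all add: z)
 moreover have "ip U \<phi> \<phi> = (LINT x|lborel. (\<phi> x)^2)" unfolding power2_eq_square by (rule ip_eq_lborel[OF c(1) c(1) zU(1) U])
 moreover have "ip U ?w (dpart [i] \<phi>) = (LINT x|lborel. ?w x * dpart [i] \<phi> x)" by (rule ip_eq_lborel[OF continuous_on_mult[OF cc c(1)] c(2) zU(2) U])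
 ultimately have eq: "ip U \<phi> \<phi> = - 2 * ip U ?w (dpart [i] \<phi>)" by simp
 have wL2: "?w \<in> L2 U" by (rule continuous_compact_support_L2[OF continuous_on_mult[OF cc c(1)] K(1) _ U]) (simp add: z)
 have \<phi>L2: "\<phi> \<in> L2 U" "dpart [i] \<phi> \<in> L2 U" using test_fun_L2[OF \<phi> U, of "[]"] test_fun_L2[OF \<phi> U, of "[i]"] by auto
 have w: "ip U ?w ?w <= B^2 * ip U \<phi> \<phi>"
 proof -
  have "(LINT x|lebesgue_on U. ?w x * ?w x) <= (LINT x|lebesgue_on U. B^2 * (\<phi> x * \<phi> x))"
  proof (rule integral_mono)
   show "integrable (lebesgue_on U) (%x. ?w x * ?w x)" "integrable (lebesgue_on U) (%x. B^2 * (\<phi> x * \<phi> x))"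
    using l2_integrable_mult[of _ "lebesgue_on U"] wL2 \<phi>L2 unfolding L2_eq_l2 by auto
   fix x assume "x \<in> space (lebesgue_on U)"
   hence "x \<in> U" by simp
   hence "\<bar>x $ i\<bar> <= B" using B component_le_norm_cart[of x i] order_trans by blast
   hence "(x $ i)^2 <= B^2" by (simp add: abs_le_square_iff[symmetric])
   hence "(x $ i)^2 * (\<phi> x * \<phi> x) <= B^2 * (\<phi> x * \<phi> x)" by (intro mult_right_mono) auto
   thus "?w x * ?w x <= B^2 * (\<phi> x * \<phi> x)" by (simp add: power2_eq_square mult_ac)
  qed
  thus ?thesis by (simp add: ip_def)
 qed
 have wn: "L2norm U ?w <= B * L2norm U \<phi>" using real_sqrt_le_mono[OF w] B0 by (simp add: L2norm_def real_sqrt_mult)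
 have "(L2norm U \<phi>)^2 <= 2 * (L2norm U ?w * L2norm U (dpart [i] \<phi>))"
  using L2.Cauchy_Schwarz[OF wL2 \<phi>L2(2)] eq L2.nrm_sq[OF \<phi>L2(1)] unfolding L2norm_def by linarith
 also have "... <= 2 * ((B * L2norm U \<phi>) * L2norm U (dpart [i] \<phi>))" by (intro mult_left_mono mult_right_mono wn) auto
 finally have "L2norm U \<phi> * L2norm U \<phi> <= L2norm U \<phi> * (2 * B * L2norm U (dpart [i] \<phi>))" by (simp add: power2_eq_square mult_ac)
 thus ?thesis using B0 L2norm_nonneg[of U \<phi>] by (cases "L2norm U \<phi> = 0") (auto simp: mult_le_cancel_left_pos)
qed

section \<open>Weak derivatives and equality almost everywhere\<close>

lemma weak_derivD:
 assumes "weak_deriv U is v g"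
 shows "v \<in> L2 U" "g \<in> L2 U" "\<phi> \<in> test_fun U ==> ip U v (dpart is \<phi>) = (- 1) ^ length is * ip U g \<phi>"
 using assms by (auto simp: weak_deriv_def)

lemma open_lebesgue: "open U ==> U \<in> sets lebesgue" by (simp add: borel_open)

lemma weak_deriv_lincomb:
 assumes "weak_deriv U is v g" "weak_deriv U is w h" "open U"
 shows "weak_deriv U is (lincomb c v d w) (lincomb c g d h)"
proof -
 note v = weak_derivD[OF assms(1)] and w = weak_derivD[OF assms(2)]
 have "ip U (lincomb c v d w) (dpart is \<phi>) = (- 1) ^ length is * ip U (lincomb c g d h) \<phi>" if "\<phi> \<in> test_fun U" for \<phi>
 proof -
  have "dpart is \<phi> \<in> L2 U" "\<phi> \<in> L2 U"
   using test_fun_L2[OF that open_lebesgue[OF assms(3)], of "is"] test_fun_L2[OF that open_lebesgue[OF assms(3)], of "[]"] by auto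
  thus ?thesis using v w that by (simp add: L2.lin algebra_simps)
 qed
 thus ?thesis using v w by (simp add: weak_deriv_def L2.lincomb_mem)
qed

lemma aeq_iff_L2norm:
 assumes "v \<in> L2 U" "w \<in> L2 U" shows "aeq U v w \<longleftrightarrow> L2norm U (fminus v w) = 0"
 using L2norm_eq_0_iff[OF L2.fminus_mem[OF assms]] by (simp add: aeq_def)

lemma aeq_refl: "aeq U v v"
 and aeq_sym: "aeq U v w ==> aeq U w v" by (auto simp: aeq_def elim: eventually_mono)

lemma aeq_trans: "aeq U u v ==> aeq U v w ==> aeq U u w" unfolding aeq_def by (rule AE_mp, assumption) (auto elim!: eventually_mono)

lemma aeq_lincomb: "aeq U v v' ==> aeq U w w' ==> aeq U (lincomb c v d w) (lincomb c v' d w')"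
 unfolding aeq_def by (rule AE_mp, assumption) (auto elim!: eventually_mono)

text \<open>Preimages change by subsets of null sets only, and these are measurable by completeness.
  This makes all notions below independent of the chosen representative.\<close>

lemma (in complete_measure) borel_measurable_AE_cong:
 fixes f g :: "'a => real"
 assumes "f \<in> borel_measurable M" "AE x in M. f x = g x" shows "g \<in> borel_measurable M"
proof (rule measurableI)
 fix A :: "real set" assume A: "A \<in> sets borel"
 show "g -` A \<inter> space M \<in> sets M"
 proof (rule in_sets_AE)
  show "AE x in M. x \<in> f -` A \<inter> space M \<longleftrightarrow> x \<in> g -` A \<inter> space M" using assms(2) by eventually_elim auto
  show "f -` A \<inter> space M \<in> sets M" using assms(1) A by (rule measurable_sets)
 qed simp
qed simp

lemma aeq_measurable:
 assumes "aeq U v w" "v \<in> borel_measurable (lebesgue_on U)" "U \<in> sets lebesgue"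
 shows "w \<in> borel_measurable (lebesgue_on U)"
proof -
 have "(%x. indicator U x *\<^sub>R v x) \<in> borel_measurable lebesgue" using assms by (simp add: borel_measurable_restrict_space_iff)
 moreover have "AE x in lebesgue. indicator U x *\<^sub>R v x = indicator U x *\<^sub>R w x"
  using assms by (auto simp: aeq_def AE_restrict_space_iff indicator_def elim!: eventually_mono)
 ultimately have "(%x. indicator U x *\<^sub>R w x) \<in> borel_measurable lebesgue"
  by (rule complete_measure.borel_measurable_AE_cong[OF completion.complete_measure_axioms])
 thus ?thesis using assms by (simp add: borel_measurable_restrict_space_iff)
qed

lemma ip_cong:
 assumes "aeq U v v'" "aeq U w w'" "v \<in> borel_measurable (lebesgue_on U)" "w \<in> borel_measurable (lebesgue_on U)" "U \<in> sets lebesgue"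
 shows "ip U v w = ip U v' w'" unfolding ip_eq_ipM
 by (rule ipM_cong_AE) (use assms aeq_measurable[OF assms(1,3,5)] aeq_measurable[OF assms(2,4,5)] in \<open>auto simp: aeq_def\<close>)

lemma L2_cong:
 assumes "aeq U v w" "v \<in> L2 U" "U \<in> sets lebesgue" shows "w \<in> L2 U"
proof -
 have w: "w \<in> borel_measurable (lebesgue_on U)" using aeq_measurable[OF assms(1) _ assms(3)] assms(2) by (simp add: L2_def)
 have "AE x in lebesgue_on U. (v x)^2 = (w x)^2" using assms(1) unfolding aeq_def by eventually_elim simp
 hence "integrable (lebesgue_on U) (%x. (w x)^2)" using assms(2) w integrable_cong_AE[of "%x. (v x)^2" "lebesgue_on U" "%x. (w x)^2"] by (auto simp: L2_def)
 thus ?thesis using w by (simp add: L2_def)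
qed

lemma L2_borel: "v \<in> L2 U ==> v \<in> borel_measurable (lebesgue_on U)" by (simp add: L2_def)

lemma L2norm_cong:
 assumes "aeq U v w" "v \<in> L2 U" "U \<in> sets lebesgue" shows "L2norm U v = L2norm U w"
 unfolding L2norm_def using ip_cong[OF assms(1,1) L2_borel[OF assms(2)] L2_borel[OF assms(2)] assms(3)] by simp

section \<open>Mean value and Taylor estimates\<close>

lemma smooth_frechet_expand:
 assumes "smooth \<phi>" shows "frechet_derivative \<phi> (at p) h = (\<Sum>i\<in>UNIV. h $ i * dpart [i] \<phi> p)"
proof -
 have lin: "linear (frechet_derivative \<phi> (at p))" using smooth_has_derivative0[OF assms, of p] by (rule has_derivative_linear)
 have "h = (\<Sum>i\<in>UNIV. h $ i *\<^sub>R axis i 1)" by (simp add: vec_eq_iff sum_2 axis_def forall_2)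
 hence "frechet_derivative \<phi> (at p) h = frechet_derivative \<phi> (at p) (\<Sum>i\<in>UNIV. h $ i *\<^sub>R axis i 1)" by simp
 also have "... = (\<Sum>i\<in>UNIV. h $ i * frechet_derivative \<phi> (at p) (axis i 1))" by (simp add: linear_sum[OF lin] linear_scale[OF lin])
 finally show ?thesis by (simp add: dpart.simps)
qed

lemma smooth_line_has_derivative:
 assumes "smooth \<phi>"
 shows "((%t. \<phi> (p + t *\<^sub>R h)) has_real_derivative (\<Sum>i\<in>UNIV. h $ i * dpart [i] \<phi> (p + t *\<^sub>R h))) (at t within S)"
proof -
 have "((%t::real. p + t *\<^sub>R h) has_derivative (%t. t *\<^sub>R h)) (at t)" by (auto intro!: derivative_eq_intros)
 from has_derivative_compose[OF this smooth_has_derivative0[OF assms]]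
 have "((%t. \<phi> (p + t *\<^sub>R h)) has_derivative (%s. frechet_derivative \<phi> (at (p + t *\<^sub>R h)) (s *\<^sub>R h))) (at t)" .
 moreover have "(%s. frechet_derivative \<phi> (at (p + t *\<^sub>R h)) (s *\<^sub>R h)) = (*) (\<Sum>i\<in>UNIV. h $ i * dpart [i] \<phi> (p + t *\<^sub>R h))"
  by (rule ext) (simp add: smooth_frechet_expand[OF assms] sum_distrib_left mult_ac)
 ultimately show ?thesis unfolding has_field_derivative_def by (simp add: has_derivative_at_withinI)
qed

lemma smooth_mvt:
 assumes "smooth \<phi>" shows "\<exists>t. \<phi> (p + h) - \<phi> p = (\<Sum>i\<in>UNIV. h $ i * dpart [i] \<phi> (p + t *\<^sub>R h)) & 0 < t & t < 1"
proof -
 have "\<exists>t. 0 < t & t < 1 & \<phi> (p + 1 *\<^sub>R h) - \<phi> (p + 0 *\<^sub>R h) = (1 - 0) * (\<Sum>i\<in>UNIV. h $ i * dpart [i] \<phi> (p + t *\<^sub>R h))"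
  by (rule MVT2) (use smooth_line_has_derivative[OF assms] in auto)
 thus ?thesis by auto
qed

lemma test_fun_bounded:
 assumes "\<phi> \<in> test_fun U" obtains B where "0 <= B" "!!x. \<bar>dpart is \<phi> x\<bar> <= B"
 using continuous_compact_support_bounded[OF smooth_continuous[OF test_funD(1)[OF assms]] test_funD(2)[OF assms] dpart_support[of _ \<phi> "is"]] by blast

lemma test_fun_bounded_partials:
 assumes "\<phi> \<in> test_fun U" obtains B where "0 <= B" "!!i x. \<bar>dpart [i] \<phi> x\<bar> <= B"
proof -
 obtain B1 B2 where "0 <= B1" "!!x. \<bar>dpart [1] \<phi> x\<bar> <= B1" "0 <= B2" "!!x. \<bar>dpart [2] \<phi> x\<bar> <= B2"
  using test_fun_bounded[OF assms, of "[1]"] test_fun_bounded[OF assms, of "[2]"] by metis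
 hence "\<bar>dpart [i] \<phi> x\<bar> <= max B1 B2" for i x using exhaust_2[of i] by (auto simp: le_max_iff_disj)
 thus ?thesis using that[of "max B1 B2"] \<open>0 <= B1\<close> by auto
qed

lemma sum_2_abs_le: fixes h :: pt assumes "!!i. \<bar>c i\<bar> <= B" shows "\<bar>\<Sum>i\<in>UNIV. h $ i * c i\<bar> <= 2 * B * norm h"
proof -
 have "\<bar>h $ i * c i\<bar> <= norm h * B" for i unfolding abs_mult using assms by (intro mult_mono component_le_norm_cart) auto
 hence "\<bar>h $ 1 * c 1\<bar> + \<bar>h $ 2 * c 2\<bar> <= norm h * B + norm h * B" by (intro add_mono)
 with abs_triangle_ineq[of "h $ 1 * c 1" "h $ 2 * c 2"] show ?thesis by (simp add: sum_2 mult_ac)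
qed

lemma test_fun_Lipschitz:
 assumes "\<phi> \<in> test_fun U" obtains L where "0 <= L" "!!p h. \<bar>\<phi> (p + h) - \<phi> p\<bar> <= L * norm h"
proof -
 obtain B where B: "0 <= B" "!!i x. \<bar>dpart [i] \<phi> x\<bar> <= B" using test_fun_bounded_partials[OF assms] by metis
 have "\<bar>\<phi> (p + h) - \<phi> p\<bar> <= 2 * B * norm h" for p h using smooth_mvt[OF test_funD(1)[OF assms], of p h] sum_2_abs_le[OF B(2)] by auto
 thus ?thesis using that[of "2 * B"] B(1) by simp
qed

text \<open>The mean value theorem leaves the gradient at an intermediate point; its Lipschitz
  continuity yields the second power of the step.\<close>

lemma test_fun_Taylor:
 assumes "\<phi> \<in> test_fun U"
 obtains C where "0 <= C" "!!p h. \<bar>\<phi> (p + h) - \<phi> p - (\<Sum>i\<in>UNIV. h $ i * dpart [i] \<phi> p)\<bar> <= C * (norm h)^2"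
proof -
 obtain L1 L2 where L: "0 <= L1" "!!p h. \<bar>dpart [1] \<phi> (p + h) - dpart [1] \<phi> p\<bar> <= L1 * norm h"
  "0 <= L2" "!!p h. \<bar>dpart [2] \<phi> (p + h) - dpart [2] \<phi> p\<bar> <= L2 * norm h"
  using test_fun_Lipschitz[OF test_fun_dpart[OF assms, of "[1]"]] test_fun_Lipschitz[OF test_fun_dpart[OF assms, of "[2]"]] by metis
 have Li: "\<bar>dpart [i] \<phi> (p + h) - dpart [i] \<phi> p\<bar> <= max L1 L2 * norm h" for i p h
  using exhaust_2[of i] L(2)[of p h] L(4)[of p h] mult_right_mono[of L1 "max L1 L2" "norm h"] mult_right_mono[of L2 "max L1 L2" "norm h"] by fastforce
 have "\<bar>\<phi> (p + h) - \<phi> p - (\<Sum>i\<in>UNIV. h $ i * dpart [i] \<phi> p)\<bar> <= (2 * max L1 L2) * (norm h)^2" for p h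
 proof -
  obtain t where t: "\<phi> (p + h) - \<phi> p = (\<Sum>i\<in>UNIV. h $ i * dpart [i] \<phi> (p + t *\<^sub>R h))" "0 < t" "t < 1"
   using smooth_mvt[OF test_funD(1)[OF assms]] by blast
  have "\<phi> (p + h) - \<phi> p - (\<Sum>i\<in>UNIV. h $ i * dpart [i] \<phi> p) = (\<Sum>i\<in>UNIV. h $ i * (dpart [i] \<phi> (p + t *\<^sub>R h) - dpart [i] \<phi> p))"
   unfolding t(1) by (simp add: sum_subtractf right_diff_distrib)
  moreover have "\<bar>\<Sum>i\<in>UNIV. h $ i * (dpart [i] \<phi> (p + t *\<^sub>R h) - dpart [i] \<phi> p)\<bar> <= 2 * (max L1 L2 * norm h) * norm h"
  proof (rule sum_2_abs_le)
   fix i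
   have "\<bar>dpart [i] \<phi> (p + t *\<^sub>R h) - dpart [i] \<phi> p\<bar> <= max L1 L2 * norm (t *\<^sub>R h)" by (rule Li)
   also have "... <= max L1 L2 * norm h" using t L by (intro mult_left_mono) (auto simp: mult_left_le_one_le)
   finally show "\<bar>dpart [i] \<phi> (p + t *\<^sub>R h) - dpart [i] \<phi> p\<bar> <= max L1 L2 * norm h" .
  qed
  ultimately show ?thesis by (simp add: power2_eq_square mult_ac)
 qed
 thus ?thesis using that[of "2 * max L1 L2"] L by auto
qed

lemma L2_integrable: assumes "f \<in> L2 U" "U \<in> lmeasurable" shows "integrable (lebesgue_on U) f"
proof (rule Bochner_Integration.integrable_bound[of _ "%x. 1 + (f x)^2"])
 show "integrable (lebesgue_on U) (%x. 1 + (f x)^2)" using assms(1) finite_measure.integrable_const[OF finite_measure_lebesgue_on[OF assms(2)], of "1 :: real"]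
  by (intro Bochner_Integration.integrable_add) (simp_all add: L2_def)
 have "\<bar>y\<bar> <= \<bar>1 + y^2\<bar>" for y :: real using zero_le_power2[of "\<bar>y\<bar> - 1"] by (simp add: power2_eq_square algebra_simps)
 thus "AE x in lebesgue_on U. norm (f x) <= norm (1 + (f x)^2)" by simp
qed (use assms(1) in \<open>simp add: L2_def\<close>)

section \<open>Convolutions\<close>

text \<open>Convolution of \<open>f\<close>, cut off outside \<open>K\<close>, with the kernel
  \<open>k\<close>, evaluated at \<open>l x + b\<close> instead of \<open>x\<close>. The affine map
  will pull points away from the boundary of \<open>K\<close>.\<close>

definition cv :: "pt set => fn => real => pt => fn => fn" where
 "cv K f l b k x = ip K f (%y. k (l *\<^sub>R x + b - y))"

lemma bounded_open_lmeasurable: "bounded U ==> open U ==> (U :: pt set) \<in> lmeasurable" by (simp add: lmeasurable_open)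

lemma kernel_L2:
 assumes "continuous_on UNIV k" "bounded K" "open K" shows "(%y. k (p - y)) \<in> L2 K"
 by (intro continuous_L2 continuous_on_compose2[OF assms(1)] continuous_intros assms open_lebesgue) auto

text \<open>Differentiation under the integral: the quadratic Taylor remainder of the kernel is
  integrated against the absolute value of \<open>f\<close>. The chain rule contributes the factor
  \<open>l\<close>.\<close>

lemma cv_has_derivative:
 assumes f: "f \<in> L2 K" and K: "bounded K" "open K" and k: "k \<in> test_fun UNIV"
 shows "(cv K f l b k has_derivative (%h. \<Sum>i\<in>UNIV. h $ i * (l * cv K f l b (dpart [i] k) x))) (at x)"
proof -
 obtain C where C: "0 <= C" "!!p h. \<bar>k (p + h) - k p - (\<Sum>i\<in>UNIV. h $ i * dpart [i] k p)\<bar> <= C * (norm h)^2"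
  using test_fun_Taylor[OF k] by blast
 have fi: "integrable (lebesgue_on K) f" by (rule L2_integrable[OF f bounded_open_lmeasurable[OF K]])
 define A where "A = (LINT y|lebesgue_on K. \<bar>f y\<bar>)"
 have kc: "continuous_on UNIV (dpart is k)" for "is" by (rule smooth_continuous[OF test_funD(1)[OF k]])
 have kc0: "continuous_on UNIV k" using kc[of "[]"] by simp
 note ki = kernel_L2[OF _ K]
 show ?thesis
 proof (rule has_derivativeI_sandwich[where e = 1 and H = "%y. A * C * l^2 * norm (y - x)"])
  show "bounded_linear (%h. \<Sum>i\<in>UNIV. h $ i * (l * cv K f l b (dpart [i] k) x))"
   by (intro bounded_linear_sum bounded_linear_mult_left[THEN bounded_linear_compose] bounded_linear_vec_nth)
  show "((%y. A * C * l^2 * norm (y - x)) \<longlongrightarrow> 0) (at x)" by (auto intro!: tendsto_eq_intros)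
  fix z assume z: "z ~= x"
  let ?h = "z - x"
  let ?e = "%y. k (l *\<^sub>R z + b - y) - k (l *\<^sub>R x + b - y) - (\<Sum>i\<in>UNIV. (l *\<^sub>R ?h) $ i * dpart [i] k (l *\<^sub>R x + b - y))"
  have eL2: "?e \<in> L2 K" by (intro continuous_L2 continuous_intros continuous_on_compose2[OF kc] continuous_on_compose2[OF kc0] K open_lebesgue) auto
  have "cv K f l b k z - cv K f l b k x - (\<Sum>i\<in>UNIV. ?h $ i * (l * cv K f l b (dpart [i] k) x)) = ip K f ?e"
  proof -
   have i: "integrable (lebesgue_on K) (%y. f y * k (l *\<^sub>R z + b - y))" "integrable (lebesgue_on K) (%y. f y * k (l *\<^sub>R x + b - y))"
    "!!i. integrable (lebesgue_on K) (%y. f y * dpart [i] k (l *\<^sub>R x + b - y))"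
    using l2_integrable_mult[of f "lebesgue_on K"] f ki[OF kc0] ki[OF kc] unfolding L2_eq_l2 by auto
   have "ip K f ?e = (LINT y|lebesgue_on K. (f y * k (l *\<^sub>R z + b - y) - f y * k (l *\<^sub>R x + b - y)) -
     (\<Sum>i\<in>UNIV. (l * ?h $ i) * (f y * dpart [i] k (l *\<^sub>R x + b - y))))"
    unfolding ip_def by (intro Bochner_Integration.integral_cong refl) (simp add: right_diff_distrib sum_distrib_left mult_ac)
   also have "... = cv K f l b k z - cv K f l b k x - (\<Sum>i\<in>UNIV. (l * ?h $ i) * cv K f l b (dpart [i] k) x)" unfolding cv_def ip_def using i by simp
   finally show ?thesis by (simp add: mult_ac)
  qed
  moreover have "\<bar>ip K f ?e\<bar> <= A * (C * (l^2 * (norm ?h)^2))"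
  proof -
   have "\<bar>ip K f ?e\<bar> <= (LINT y|lebesgue_on K. \<bar>f y * ?e y\<bar>)" unfolding ip_def by (rule integral_abs_bound)
   also have "... <= (LINT y|lebesgue_on K. \<bar>f y\<bar> * (C * (l^2 * (norm ?h)^2)))"
   proof (rule integral_mono)
    show "integrable (lebesgue_on K) (%y. \<bar>f y * ?e y\<bar>)" using l2_integrable_mult[of f "lebesgue_on K" ?e] f eL2 unfolding L2_eq_l2 by simp
    show "integrable (lebesgue_on K) (%y. \<bar>f y\<bar> * (C * (l^2 * (norm ?h)^2)))" using fi by simp
    fix y
    have "l *\<^sub>R z + b - y = (l *\<^sub>R x + b - y) + l *\<^sub>R ?h" by (simp add: algebra_simps)
    with C(2)[of "l *\<^sub>R x + b - y" "l *\<^sub>R ?h"] have "\<bar>?e y\<bar> <= C * (norm (l *\<^sub>R ?h))^2" by (simp only:)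
    thus "\<bar>f y * ?e y\<bar> <= \<bar>f y\<bar> * (C * (l^2 * (norm ?h)^2))" unfolding abs_mult by (intro mult_left_mono) (auto simp: power_mult_distrib)
   qed
   finally show ?thesis by (simp add: A_def)
  qed
  ultimately have "norm (cv K f l b k z - cv K f l b k x - (\<Sum>i\<in>UNIV. ?h $ i * (l * cv K f l b (dpart [i] k) x))) <= (A * C * l^2 * norm ?h) * norm ?h"
   by (simp add: power2_eq_square mult_ac)
  thus "norm (cv K f l b k z - cv K f l b k x - (\<Sum>i\<in>UNIV. ?h $ i * (l * cv K f l b (dpart [i] k) x))) / norm ?h <= A * C * l^2 * norm ?h"
   using z by (simp add: divide_le_eq)
 qed simp
qed

lemma dpart_cv:
 assumes f: "f \<in> L2 K" and K: "bounded K" "open K" and k: "k \<in> test_fun UNIV"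
 shows "dpart is (cv K f l b k) = (%x. l ^ length is * cv K f l b (dpart is k) x)"
proof (induction "is")
 case (Cons i "is")
 show ?case
 proof
  fix x
  have "((%x. l ^ length is * cv K f l b (dpart is k) x) has_derivative
   (%h. l ^ length is * (\<Sum>j\<in>UNIV. h $ j * (l * cv K f l b (dpart [j] (dpart is k)) x)))) (at x)"
   by (intro has_derivative_mult_right cv_has_derivative[OF f K test_fun_dpart[OF k]])
  from frechet_derivative_at[OF this, symmetric]
  have "dpart (i # is) (cv K f l b k) x = l ^ length is * (\<Sum>j\<in>UNIV. axis i 1 $ j * (l * cv K f l b (dpart [j] (dpart is k)) x))"
   by (simp only: dpart.simps Cons.IH)
  also have "(\<Sum>j\<in>UNIV. axis i 1 $ j * (l * cv K f l b (dpart [j] (dpart is k)) x)) = l * cv K f l b (dpart [i] (dpart is k)) x"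
   using exhaust_2[of i] by (auto simp: sum_2 axis_def)
  also have "dpart [i] (dpart is k) = dpart (i # is) k" by (simp only: dpart.simps)
  finally show "dpart (i # is) (cv K f l b k) x = l ^ length (i # is) * cv K f l b (dpart (i # is) k) x" by simp
 qed
qed simp

lemma smooth_cv:
 assumes f: "f \<in> L2 K" and K: "bounded K" "open K" and k: "k \<in> test_fun UNIV" shows "smooth (cv K f l b k)" unfolding smooth_def dpart_cv[OF assms]
proof (intro allI)
 fix "is" x
 have "((%x. l ^ length is * cv K f l b (dpart is k) x) has_derivative
   (%h. l ^ length is * (\<Sum>j\<in>UNIV. h $ j * (l * cv K f l b (dpart [j] (dpart is k)) x)))) (at x)"
  by (intro has_derivative_mult_right cv_has_derivative[OF f K test_fun_dpart[OF k]])
 thus "(%x. l ^ length is * cv K f l b (dpart is k) x) differentiable at x" unfolding differentiable_def by blast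
qed

lemma dpart_reflect:
 assumes "smooth k" shows "dpart is (%y. k (p - y)) = (%y. (- 1) ^ length is * dpart is k (p - y))"
  and "smooth (%y. k (p - y))"
proof -
 have d: "((%y. (- 1) ^ n * dpart is k (p - y)) has_derivative (%h. (- 1) ^ n * frechet_derivative (dpart is k) (at (p - y)) (- h))) (at y)" for n "is" y
  by (intro has_derivative_mult_right has_derivative_compose[OF _ smooth_has_derivative[OF assms]])
   (auto intro!: derivative_eq_intros)
 show *: "dpart is (%y. k (p - y)) = (%y. (- 1) ^ length is * dpart is k (p - y))" for "is"
 proof (induction "is")
  case (Cons i "is")
  show ?case
  proof
   fix y
   have lin: "linear (frechet_derivative (dpart is k) (at (p - y)))" by (rule has_derivative_linear[OF smooth_has_derivative[OF assms]])
   have "dpart (i # is) (%y. k (p - y)) y = (- 1) ^ length is * frechet_derivative (dpart is k) (at (p - y)) (- axis i 1)"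
    using frechet_derivative_at[OF d[of "length is" "is" y], symmetric] by (simp only: dpart.simps Cons.IH)
   thus "dpart (i # is) (%y. k (p - y)) y = (- 1) ^ length (i # is) * dpart (i # is) k (p - y)" by (simp add: linear_neg[OF lin] dpart.simps)
  qed
 qed simp
 show "smooth (%y. k (p - y))" unfolding smooth_def * using d unfolding differentiable_def by blast
qed

subsection \<open>A dilated mollifier\<close>

definition mk :: "real => fn" where
 "mk \<epsilon> = (let F = chi 1 (- \<epsilon>) \<epsilon> in tens (%t. (1 / (LINT x|lborel. tens F F x)) * F t) F)"

text \<open>The support is a square of half-width \<epsilon>; comparison with the sum norm gives the
  Euclidean radius \<open>2 \<epsilon>\<close>. Partial derivatives of a tensor product depend only
  on how often each direction occurs, and this yields the invariance under \<open>rev\<close>, which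
  undoes the reversal of \<open>smooth_weak_deriv\<close>.\<close>

lemma mk_props:
 assumes "0 < \<epsilon>"
 shows "mk \<epsilon> \<in> test_fun UNIV" "!!x. 0 <= mk \<epsilon> x" "(LINT x|lborel. mk \<epsilon> x) = 1" "!!x. 2 * \<epsilon> <= norm x ==> mk \<epsilon> x = 0"
  "dpart (rev is) (mk \<epsilon>) = dpart is (mk \<epsilon>)" "continuous_on UNIV (mk \<epsilon>)" "integrable lborel (mk \<epsilon>)"
proof -
 let ?F = "chi 1 (- \<epsilon>) \<epsilon>"
 define m where "m = (LINT x|lborel. tens ?F ?F x)"
 have mk: "mk \<epsilon> = tens (%t. (1 / m) * ?F t) ?F" by (simp add: mk_def m_def Let_def)
 have mk': "mk \<epsilon> x = (1 / m) * tens ?F ?F x" for x by (simp add: mk tens_def)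
 have c2: "tens ?F ?F = chi2 1 (\<chi> i. - \<epsilon>) (\<chi> i. \<epsilon>)" by (simp add: chi2_def)
 have ci: "(%t. (1 / m) * ?F t) \<in> CI" "?F \<in> CI" by (rule CI.mult[OF CI.const chi_CI], rule chi_CI)
 have sm: "smooth (mk \<epsilon>)" unfolding mk by (rule smooth_tens[OF ci])
 show cm: "continuous_on UNIV (mk \<epsilon>)" using smooth_continuous[OF sm, of UNIV "[]"] by simp
 have supp: "tens ?F ?F x = 0" if "x \<notin> box (\<chi> i. - \<epsilon>) (\<chi> i. \<epsilon>)" for x unfolding c2 by (rule chi2_outside[OF _ that]) simp
 have supp': "mk \<epsilon> x = 0" if "x \<notin> cbox (\<chi> i. - \<epsilon>) (\<chi> i. \<epsilon>)" for x
  using supp[of x] that box_subset_cbox[of "\<chi> i. - \<epsilon>" "\<chi> i. \<epsilon>"] by (auto simp: mk')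
 show "mk \<epsilon> \<in> test_fun UNIV" by (rule test_funI[OF sm compact_cbox _ supp']) auto
 show "integrable lborel (mk \<epsilon>)" by (rule continuous_compact_support_integrable[OF cm compact_cbox supp'])
 have tc: "continuous_on UNIV (tens ?F ?F)" using smooth_continuous[OF smooth_tens[OF ci(2) ci(2)], of UNIV "[]"] by simp
 have ti: "integrable lborel (tens ?F ?F)"
  by (rule continuous_compact_support_integrable[OF tc compact_cbox[of "\<chi> i. - \<epsilon>" "\<chi> i. \<epsilon>"]])
   (use supp box_subset_cbox[of "\<chi> i. - \<epsilon>" "\<chi> i. \<epsilon>"] in blast)
 have nn: "0 <= tens ?F ?F x" for x by (simp add: c2 chi2_bounds)
 have "m ~= 0"
 proof
  assume "m = 0"
  hence "AE x in lborel. tens ?F ?F x = 0" using integral_nonneg_eq_0_iff_AE[OF ti] nn by (simp add: m_def)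
  moreover have "tens ?F ?F x ~= 0" if "x \<in> box (\<chi> i. - \<epsilon>) (\<chi> i. \<epsilon>)" for x
   using that unfolding mem_box_2 tens_def by (simp add: chi_inside)
  ultimately have "AE x in lborel. x \<notin> box (\<chi> i. - \<epsilon>) (\<chi> i. \<epsilon> :: real ^ 2)" by (auto elim!: eventually_mono)
  hence "AE x in lebesgue. x \<notin> box (\<chi> i. - \<epsilon>) (\<chi> i. \<epsilon> :: real ^ 2)" by (rule AE_completion)
  hence "negligible (box (\<chi> i. - \<epsilon>) (\<chi> i. \<epsilon> :: real ^ 2))"
   unfolding negligible_iff_null_sets by (intro completion.null_sets_iff_AE[THEN iffD2]) simp
  moreover have "0 \<in> box (\<chi> i. - \<epsilon>) (\<chi> i. \<epsilon> :: real ^ 2)" using assms by (simp add: mem_box_2)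
  ultimately show False using open_not_negligible[OF open_box] by blast
 qed
 moreover have "0 <= m" unfolding m_def using nn by simp
 ultimately have m: "0 < m" by simp
 show "0 <= mk \<epsilon> x" for x using m nn by (simp add: mk')
 show "(LINT x|lborel. mk \<epsilon> x) = 1" unfolding mk' using m by (simp add: m_def)
 show "mk \<epsilon> x = 0" if "2 * \<epsilon> <= norm x" for x
 proof -
  have "norm x <= \<bar>x $ 1\<bar> + \<bar>x $ 2\<bar>" using norm_le_l1_cart[of x] by (simp add: sum_2)
  hence "x \<notin> box (\<chi> i. - \<epsilon>) (\<chi> i. \<epsilon>)" using that by (auto simp: mem_box_2)
  thus ?thesis using supp by (simp add: mk')
 qed
 have "count_list (rev is) i = count_list is i" for i by (induction "is") auto
 thus "dpart (rev is) (mk \<epsilon>) = dpart is (mk \<epsilon>)" unfolding mk dpart_tens[OF ci] by simp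
qed

lemma integral_reflect_shift:
 fixes k :: fn assumes "k \<in> borel_measurable borel"
 shows "(\<integral>\<^sup>+y. ennreal (k (p - y)) \<partial>lborel) = (\<integral>\<^sup>+y. ennreal (k y) \<partial>lborel)"
  and "0 < l ==> (\<integral>\<^sup>+x. ennreal (k (p + l *\<^sub>R x)) \<partial>lborel) = ennreal (1 / l^2) * (\<integral>\<^sup>+y. ennreal (k y) \<partial>lborel)"
proof -
 have m: "(%x. ennreal (k x)) \<in> borel_measurable borel" using assms by measurable
 have *: "(\<integral>\<^sup>+y. ennreal (k y) \<partial>lborel) = ennreal (c^2) * (\<integral>\<^sup>+x. ennreal (k (p + c *\<^sub>R x)) \<partial>lborel)" if "c ~= 0" for c
 proof -
  have "(\<integral>\<^sup>+y. ennreal (k y) \<partial>lborel) = (\<integral>\<^sup>+y. ennreal (k y) \<partial>density (distr lborel borel (%x. p + c *\<^sub>R x)) (%_. \<bar>c\<bar>^DIM(pt)))"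
   using lborel_affine[OF that, of p] by simp
  also have "... = (\<integral>\<^sup>+x. ennreal (\<bar>c\<bar>^DIM(pt)) * ennreal (k (p + c *\<^sub>R x)) \<partial>lborel)"
   using m by (subst nn_integral_density) (auto simp: nn_integral_distr)
  also have "... = ennreal (c^2) * (\<integral>\<^sup>+x. ennreal (k (p + c *\<^sub>R x)) \<partial>lborel)" using m by (subst nn_integral_cmult) auto
  finally show ?thesis .
 qed
 show "(\<integral>\<^sup>+y. ennreal (k (p - y)) \<partial>lborel) = (\<integral>\<^sup>+y. ennreal (k y) \<partial>lborel)" using *[of "-1"] by simp
 assume l: "0 < l"
 have "ennreal (1 / l^2) * (\<integral>\<^sup>+y. ennreal (k y) \<partial>lborel) = ennreal (1 / l^2) * ennreal (l^2) * (\<integral>\<^sup>+x. ennreal (k (p + l *\<^sub>R x)) \<partial>lborel)"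
  using *[of l] l by (simp add: mult.assoc)
 also have "ennreal (1 / l^2) * ennreal (l^2) = 1" using l by (simp flip: ennreal_mult)
 finally show "(\<integral>\<^sup>+x. ennreal (k (p + l *\<^sub>R x)) \<partial>lborel) = ennreal (1 / l^2) * (\<integral>\<^sup>+y. ennreal (k y) \<partial>lborel)" by simp
qed

section \<open>Density of continuous functions\<close>

lemma L2_truncation:
 assumes "g \<in> L2 K" "K \<in> sets lebesgue" "0 < e"
 shows "\<exists>M>0. (%x. max (- M) (min M (g x))) \<in> L2 K & L2norm K (fminus g (%x. max (- M) (min M (g x)))) < e"
proof -
 define t where "t n x = max (- real (Suc n)) (min (real (Suc n)) (g x))" for n x
 have gm: "g \<in> borel_measurable (lebesgue_on K)" and gi: "integrable (lebesgue_on K) (%x. (g x)^2)" using assms(1) by (auto simp: L2_def)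
 have tm: "t n \<in> borel_measurable (lebesgue_on K)" for n unfolding t_def using gm by measurable
 have tb: "(t n x)^2 <= (g x)^2" "(g x - t n x)^2 <= (g x)^2" for n x by (auto simp: t_def abs_le_square_iff[symmetric] max_def min_def abs_if)
 have tL2: "t n \<in> L2 K" for n unfolding L2_def using tm by (auto intro!: Bochner_Integration.integrable_bound[OF gi] simp: tb)
 have "(%n. LINT x|lebesgue_on K. (g x - t n x)^2) \<longlonglongrightarrow> (LINT x|lebesgue_on K. 0)"
 proof (rule integral_dominated_convergence[where w = "%x. (g x)^2"])
  show "AE x in lebesgue_on K. (%n. (g x - t n x)^2) \<longlonglongrightarrow> 0"
  proof (rule AE_I2)
   fix x
   obtain N where N: "\<bar>g x\<bar> < real N" using reals_Archimedean2 by blast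
   have "(g x - t n x)^2 = 0" if "N <= n" for n
   proof -
    have "\<bar>g x\<bar> < real (Suc n)" using N that by linarith
    hence "t n x = g x" by (auto simp: t_def)
    thus ?thesis by simp
   qed
   thus "(%n. (g x - t n x)^2) \<longlonglongrightarrow> 0" by (intro tendsto_eventually) (auto simp: eventually_sequentially)
  qed
  show "(%x. (g x - t n x)^2) \<in> borel_measurable (lebesgue_on K)" for n using gm tm[of n] by measurable
  show "AE x in lebesgue_on K. norm ((g x - t n x)^2) <= (g x)^2" for n by (rule AE_I2) (simp add: tb(2))
  show "integrable (lebesgue_on K) (%x. (g x)^2)" by (rule gi)
 qed simp
 hence "(%n. (L2norm K (fminus g (t n)))^2) \<longlonglongrightarrow> 0" by (simp add: L2norm_sq)
 then obtain n where "(L2norm K (fminus g (t n)))^2 < e^2" using assms(3) LIMSEQ_D[of _ 0 "e^2"] by fastforce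
 hence "L2norm K (fminus g (t n)) < e" by (rule power2_less_imp_less) (use assms(3) in simp)
 thus ?thesis using tL2[of n] unfolding t_def by (intro exI[of _ "real (Suc n)"]) auto
qed

text \<open>A measurable function is an almost everywhere limit of continuous ones. Truncating both
  the function and its approximants at the same height supplies the bound needed for dominated
  convergence.\<close>

lemma L2_continuous_dense:
 assumes g: "g \<in> L2 K" and K: "K \<in> lmeasurable" "bounded K" and e: "0 < e"
 shows "\<exists>h. continuous_on UNIV h & h \<in> L2 K & L2norm K (fminus g h) < e"
proof -
 have Km: "K \<in> sets lebesgue" using K by (simp add: fmeasurableD)
 obtain M where M: "0 < M" "(%x. max (- M) (min M (g x))) \<in> L2 K" "L2norm K (fminus g (%x. max (- M) (min M (g x)))) < e / 2"
  using L2_truncation[OF g Km, of "e / 2"] e by auto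
 define f where "f = (%x. max (- M) (min M (g x)))"
 have fm: "f \<in> borel_measurable (lebesgue_on K)" and fL2: "f \<in> L2 K" using M(2) by (auto simp: f_def L2_def)
 have fb: "- M <= f x" "f x <= M" for x using M(1) by (auto simp: f_def)
 have "f measurable_on K" using fm Km by (simp add: measurable_on_iff_borel_measurable)
 then obtain N F where NF: "negligible N" "!!n. continuous_on UNIV (F n)" "!!x. x \<notin> N ==> (%n. F n x) \<longlonglongrightarrow> (if x \<in> K then f x else 0)"
  unfolding measurable_on_def by blast
 define G where "G n x = max (- M) (min M (F n x))" for n and x :: pt
 have Gc: "continuous_on UNIV (G n)" for n unfolding G_def by (intro continuous_intros NF)
 have GL2: "G n \<in> L2 K" for n by (rule continuous_L2[OF Gc K(2) Km])
 have "(%n. LINT x|lebesgue_on K. (f x - G n x)^2) \<longlonglongrightarrow> (LINT x|lebesgue_on K. 0)"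
 proof (rule integral_dominated_convergence[where w = "%x. (2 * M)^2"])
  show "integrable (lebesgue_on K) (%x. (2 * M)^2)" using finite_measure.integrable_const[OF finite_measure_lebesgue_on[OF K(1)]] by blast
  have "AE x in lebesgue. x \<notin> N" using NF(1) unfolding negligible_iff_null_sets by (rule AE_not_in)
  hence "AE x in lebesgue. x \<in> K --> (%n. (f x - G n x)^2) \<longlonglongrightarrow> 0"
  proof eventually_elim
   case (elim x)
   show ?case
   proof
    assume "x \<in> K"
    hence "(%n. F n x) \<longlonglongrightarrow> f x" using NF(3)[OF elim] by simp
    hence "(%n. (f x - G n x)^2) \<longlonglongrightarrow> (f x - max (- M) (min M (f x)))\<^sup>2" unfolding G_def by (intro tendsto_intros)
    thus "(%n. (f x - G n x)^2) \<longlonglongrightarrow> 0" using fb[of x] by simp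
   qed
  qed
  thus "AE x in lebesgue_on K. (%n. (f x - G n x)^2) \<longlonglongrightarrow> 0" using Km by (simp add: AE_restrict_space_iff)
  have "\<bar>f x - G n x\<bar> <= 2 * M" for n x using fb[of x] M(1) by (auto simp: G_def)
  from power_mono[OF this abs_ge_zero, of _ _ 2]
  show "AE x in lebesgue_on K. norm ((f x - G n x)^2) <= (2 * M)^2" for n by (intro AE_I2) simp
  show "(%x. (f x - G n x)^2) \<in> borel_measurable (lebesgue_on K)" for n using fm continuous_measurable_lebesgue_on[OF Gc[of n], of K] by measurable
 qed simp
 hence "(%n. (L2norm K (fminus f (G n)))^2) \<longlonglongrightarrow> 0" by (simp add: L2norm_sq)
 then obtain n where "(L2norm K (fminus f (G n)))^2 < (e / 2)^2" using e LIMSEQ_D[of _ 0 "(e / 2)^2"] by fastforce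
 hence "L2norm K (fminus f (G n)) < e / 2" by (rule power2_less_imp_less) (use e in simp)
 hence "L2norm K (fminus g (G n)) < e" using L2.nrm_triangle[OF g fL2 GL2[of n]] M(3) unfolding L2norm_def[symmetric] f_def[symmetric] by linarith
 thus ?thesis using Gc GL2 by blast
qed

section \<open>Mollification on bounded convex sets\<close>

text \<open>The set is first shrunk towards the centre \<open>c\<close> of an inscribed ball. By
  convexity a shrunk point keeps distance \<open>(1 - lam n) r\<close> from the boundary, and the
  kernel radius is half of that. So the kernel at every point of \<open>K\<close> is a test function
  on \<open>K\<close>, and no extension of \<open>f\<close> across the boundary is needed.\<close>

locale convex_mollifier =
 fixes K :: "pt set" and c :: pt and r :: real
 assumes K: "open K" "bounded K" "convex K" and r: "0 < r" "ball c r \<subseteq> K"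
begin

text \<open>The offset 2 keeps the dilation factor at least 1/2 from \<open>n = 0\<close> on; this
  bounds the Jacobian in \<open>mol_bound\<close>.\<close>

definition lam :: "nat => real" where "lam n = 1 - 1 / (real n + 2)"
definition eps :: "nat => real" where "eps n = r / (4 * (real n + 2))"
definition shr :: "nat => pt => pt" where "shr n x = lam n *\<^sub>R x + (1 - lam n) *\<^sub>R c"
definition mol :: "nat => fn => fn" where "mol n f = cv K f (lam n) ((1 - lam n) *\<^sub>R c) (mk (eps n))"

lemma lam: "1 / 2 <= lam n" "lam n < 1" "0 < lam n"
proof -
 have "1 / (real n + 2) <= 1 / 2" by (rule divide_left_mono) auto
 thus "1 / 2 <= lam n" "0 < lam n" unfolding lam_def by linarith+
 show "lam n < 1" by (simp add: lam_def)
qed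

lemma eps: "0 < eps n" "2 * eps n = (1 - lam n) * (r / 2)" using r by (auto simp: eps_def lam_def field_simps)

lemma lam_tendsto: "lam \<longlonglongrightarrow> 1"
proof -
 have "(%n. 1 - 1 / real (n + 2)) \<longlonglongrightarrow> 1 - 0" by (intro tendsto_diff tendsto_const LIMSEQ_ignore_initial_segment[OF lim_1_over_n])
 thus ?thesis by (simp add: lam_def[abs_def] add.commute)
qed

lemma Km: "K \<in> sets lebesgue" "K \<in> lmeasurable" using K by (auto simp: open_lebesgue lmeasurable_open)

lemma mol_eq: "mol n f x = (LINT y|lebesgue_on K. f y * mk (eps n) (shr n x - y))" by (simp add: mol_def cv_def ip_def shr_def)

text \<open>A point close to the shrunk \<open>x\<close> is the same convex combination of
  \<open>x\<close> with another point \<open>z\<close> of the inscribed ball in place of its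
  centre.\<close>

lemma shr_mem: assumes "x \<in> K" "norm (shr n x - y) <= 2 * eps n" shows "y \<in> K"
proof -
 have l: "0 < 1 - lam n" using lam by simp
 define z where "z = c + (1 / (1 - lam n)) *\<^sub>R (y - shr n x)"
 have "norm (z - c) = norm (shr n x - y) / (1 - lam n)" using l by (simp add: z_def norm_minus_commute)
 also have "... <= r / 2" using assms(2) eps(2) l by (simp add: pos_divide_le_eq mult.commute)
 finally have "z \<in> K" using r by (auto simp: dist_norm norm_minus_commute)
 hence "lam n *\<^sub>R x + (1 - lam n) *\<^sub>R z \<in> K" using K(3) assms(1) lam[of n] by (intro convexD) auto
 moreover have "lam n *\<^sub>R x + (1 - lam n) *\<^sub>R z = y" using l by (simp add: z_def shr_def scaleR_add_right)
 ultimately show ?thesis by simp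
qed

lemma kernel_test_fun: assumes "x \<in> K" shows "(%y. mk (eps n) (shr n x - y)) \<in> test_fun K"
proof (rule test_funI[where K = "cball (shr n x) (2 * eps n)"])
 show "smooth (%y. mk (eps n) (shr n x - y))" by (rule dpart_reflect(2)[OF test_funD(1)[OF mk_props(1)[OF eps(1)]]])
 show "cball (shr n x) (2 * eps n) \<subseteq> K" using shr_mem[OF assms] by (auto simp: dist_norm)
 show "mk (eps n) (shr n x - y) = 0" if "y \<notin> cball (shr n x) (2 * eps n)" for y using that by (intro mk_props(4)[OF eps(1)]) (simp add: dist_norm)
qed simp

lemma mk_borel: "mk (eps n) \<in> borel_measurable borel" using mk_props(6)[OF eps(1)] by (rule borel_measurable_continuous_onI)

lemma nn_integral_mk: "(\<integral>\<^sup>+y. ennreal (mk (eps n) y) \<partial>lborel) = 1"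
 using nn_integral_eq_integral[OF mk_props(7)[OF eps(1)[of n]]] mk_props(2,3)[OF eps(1)] by simp

lemma kernel_continuous: "continuous_on UNIV (%y. mk (eps n) (p - y))"
 by (rule continuous_on_compose2[OF mk_props(6)[OF eps(1)]]) (auto intro!: continuous_intros)

lemma kernel_integral: assumes "x \<in> K" shows "(LINT y|lebesgue_on K. mk (eps n) (shr n x - y)) = 1"
proof -
 have "(LINT y|lebesgue_on K. mk (eps n) (shr n x - y)) = ip K (%_. 1) (%y. mk (eps n) (shr n x - y))" by (simp add: ip_def)
 also have "... = (LINT y|lborel. 1 * mk (eps n) (shr n x - y))"
  using test_fun_zero_outside[OF kernel_test_fun[OF assms, of n], of _ "[]"] kernel_continuous Km by (intro ip_eq_lborel) auto
 also have "... = enn2real (\<integral>\<^sup>+y. ennreal (mk (eps n) (shr n x - y)) \<partial>lborel)"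
  using mk_props(2)[OF eps(1)] kernel_continuous by (subst integral_eq_nn_integral) (auto intro!: borel_measurable_continuous_onI)
 also have "... = 1" unfolding integral_reflect_shift(1)[OF mk_borel] nn_integral_mk by simp
 finally show ?thesis .
qed

lemma kernel_L2': "(%y. mk (eps n) (p - y)) \<in> L2 K" by (rule kernel_L2[OF mk_props(6)[OF eps(1)] K(2,1)])

lemma mol_smooth: "f \<in> L2 K ==> smooth (mol n f)" unfolding mol_def by (rule smooth_cv[OF _ K(2,1) mk_props(1)[OF eps(1)]])

lemma mol_L2: "f \<in> L2 K ==> mol n f \<in> L2 K" using smooth_L2[OF mol_smooth[of f n] K(2) Km(1), of "[]"] by simp

lemma mol_diff: assumes "f \<in> L2 K" "g \<in> L2 K" shows "mol n (fminus f g) = fminus (mol n f) (mol n g)"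
 using L2.diff_left[OF assms kernel_L2'] by (simp add: fun_eq_iff mol_eq ip_def)

lemma kernel_bounded: obtains B where "0 <= B" "!!z. mk (eps n) z <= B"
proof -
 obtain B where "0 <= B" "!!z. \<bar>dpart [] (mk (eps n)) z\<bar> <= B" using test_fun_bounded[OF mk_props(1)[OF eps(1)]] by blast
 thus ?thesis using that[of B] by (auto simp: abs_le_iff)
qed

text \<open>Jensen's inequality: the kernel is a probability density, and the variance of
  \<open>f\<close> under it is nonnegative.\<close>

lemma mol_square_le:
 assumes f: "f \<in> L2 K" and x: "x \<in> K"
 shows "(mol n f x)^2 <= (LINT y|lebesgue_on K. (f y)^2 * mk (eps n) (shr n x - y))"
  and "integrable (lebesgue_on K) (%y. (f y)^2 * mk (eps n) (shr n x - y))"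
proof -
 let ?k = "%y. mk (eps n) (shr n x - y)" and ?a = "mol n f x" and ?M = "lebesgue_on K"
 obtain B where B: "0 <= B" "!!z. mk (eps n) z <= B" using kernel_bounded by blast
 have km: "?k \<in> borel_measurable ?M" using kernel_continuous by (rule continuous_measurable_lebesgue_on)
 have i2: "integrable ?M (%y. B * (f y)^2)" using f by (simp add: L2_def)
 show i: "integrable ?M (%y. (f y)^2 * ?k y)"
 proof (rule Bochner_Integration.integrable_bound[OF i2])
  show "(%y. (f y)^2 * ?k y) \<in> borel_measurable ?M" using L2_borel[OF f] km by (intro borel_measurable_times borel_measurable_power)
  have "(f y)^2 * ?k y <= (f y)^2 * B" for y by (intro mult_left_mono B) simp
  thus "AE y in ?M. norm ((f y)^2 * ?k y) <= norm (B * (f y)^2)" using B(1) mk_props(2)[OF eps(1)] by (intro AE_I2) (simp add: abs_mult mult.commute)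
 qed
 have i1: "integrable ?M (%y. f y * ?k y)" using l2_integrable_mult[of f ?M ?k] f kernel_L2' by (simp add: L2_eq_l2)
 have i0: "integrable ?M ?k" by (rule L2_integrable[OF kernel_L2' Km(2)])
 have "0 <= (LINT y|?M. (f y - ?a)^2 * ?k y)" using mk_props(2)[OF eps(1)] by simp
 also have "(LINT y|?M. (f y - ?a)^2 * ?k y) = (LINT y|?M. (f y)^2 * ?k y - 2 * ?a * (f y * ?k y) + ?a^2 * ?k y)"
  by (intro Bochner_Integration.integral_cong refl) (simp add: power2_eq_square algebra_simps)
 also have "... = (LINT y|?M. (f y)^2 * ?k y) - 2 * ?a * (LINT y|?M. f y * ?k y) + ?a^2 * (LINT y|?M. ?k y)" using i i1 i0 by simp
 also have "... = (LINT y|?M. (f y)^2 * ?k y) - ?a\<^sup>2" unfolding kernel_integral[OF x] mol_eq[symmetric] by (simp add: power2_eq_square)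
 finally show "?a^2 <= (LINT y|?M. (f y)^2 * ?k y)" by simp
qed

text \<open>Jensen's inequality and Tonelli's theorem. Integrating the kernel over the evaluation
  point costs the inverse Jacobian \<open>1 / lam^2\<close>, at most 4, hence the factor 2.\<close>

lemma mol_bound: assumes f: "f \<in> L2 K" shows "L2norm K (mol n f) <= 2 * L2norm K f"
proof -
 let ?M = "lebesgue_on K" and ?k = "%x y. mk (eps n) (shr n x - y)"
 interpret finite_measure ?M by (rule finite_measure_lebesgue_on[OF Km(2)])
 interpret pair_sigma_finite ?M ?M ..
 have fm[measurable]: "f \<in> borel_measurable ?M" using f by (simp add: L2_def)
 have id[measurable]: "(%x. x) \<in> borel_measurable ?M" by (intro measurable_restrict_space1 measurable_completion) simp
 have k[measurable]: "mk (eps n) \<in> borel_measurable borel" by (rule mk_borel)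
 have pm: "(%(x, y). ennreal ((f y)^2 * ?k x y)) \<in> borel_measurable (?M \<Otimes>\<^sub>M ?M)" unfolding split_beta shr_def
  using measurable_compose[OF measurable_fst id] measurable_compose[OF measurable_snd id]
  by (intro measurable_compose[OF _ measurable_ennreal] borel_measurable_times borel_measurable_power
    measurable_compose[OF _ k] borel_measurable_diff borel_measurable_add borel_measurable_scaleR borel_measurable_const
    measurable_compose[OF measurable_snd fm]) auto
 have "(\<integral>\<^sup>+x. ennreal ((mol n f x)^2) \<partial>?M) <= (\<integral>\<^sup>+x. \<integral>\<^sup>+y. ennreal ((f y)^2 * ?k x y) \<partial>?M \<partial>?M)"
 proof (rule nn_integral_mono)
  fix x assume "x \<in> space ?M"
  hence x: "x \<in> K" by simp
  have "ennreal ((mol n f x)^2) <= ennreal (LINT y|?M. (f y)^2 * ?k x y)" by (intro ennreal_leI mol_square_le(1)[OF f x])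
  also have "... = (\<integral>\<^sup>+y. ennreal ((f y)^2 * ?k x y) \<partial>?M)"
   using mk_props(2)[OF eps(1)] by (intro nn_integral_eq_integral[symmetric] mol_square_le(2)[OF f x]) auto
  finally show "ennreal ((mol n f x)^2) <= (\<integral>\<^sup>+y. ennreal ((f y)^2 * ?k x y) \<partial>?M)" .
 qed
 also have "... = (\<integral>\<^sup>+y. \<integral>\<^sup>+x. ennreal ((f y)^2 * ?k x y) \<partial>?M \<partial>?M)" using Fubini[OF pm] by simp
 also have "... <= (\<integral>\<^sup>+y. ennreal 4 * ennreal ((f y)^2) \<partial>?M)"
 proof (rule nn_integral_mono)
  fix y
  have "(\<integral>\<^sup>+x. ennreal ((f y)^2 * ?k x y) \<partial>?M) = (\<integral>\<^sup>+x. ennreal ((f y)^2) * ennreal (?k x y) \<partial>?M)"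
   using mk_props(2)[OF eps(1)] by (simp add: ennreal_mult)
  also have "... = (\<integral>\<^sup>+x. ennreal ((f y)^2) * ennreal (?k x y) * indicator K x \<partial>lebesgue)"
   using Km by (subst nn_integral_restrict_space) auto
  also have "... <= (\<integral>\<^sup>+x. ennreal ((f y)^2) * ennreal (?k x y) \<partial>lebesgue)" by (intro nn_integral_mono) (auto simp: indicator_def)
  also have "... = (\<integral>\<^sup>+x. ennreal ((f y)^2) * ennreal (mk (eps n) (((1 - lam n) *\<^sub>R c - y) + lam n *\<^sub>R x)) \<partial>lborel)"
   unfolding shr_def by (subst nn_integral_completion) (simp add: algebra_simps)
  also have "... = ennreal ((f y)^2) * (ennreal (1 / (lam n)^2))"
   using integral_reflect_shift(2)[OF mk_borel lam(3), of n "(1 - lam n) *\<^sub>R c - y" n] nn_integral_mk by (subst nn_integral_cmult) auto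
  also have "... <= ennreal ((f y)^2) * ennreal 4"
  proof (intro mult_left_mono ennreal_leI)
   have "(1 / 2)^2 <= (lam n)^2" using lam[of n] by (intro power_mono) auto
   thus "1 / (lam n)^2 <= 4" using lam(3)[of n] by (simp add: field_simps power2_eq_square)
  qed simp
  finally show "(\<integral>\<^sup>+x. ennreal ((f y)^2 * ?k x y) \<partial>?M) <= ennreal 4 * ennreal ((f y)^2)" by (simp add: mult.commute)
 qed
 also have "... = ennreal (4 * (L2norm K f)^2)"
  using f nn_integral_eq_integral[of ?M "%y. (f y)^2"] by (subst nn_integral_cmult) (auto simp: L2_def L2norm_sq ennreal_mult)
 also have "(\<integral>\<^sup>+x. ennreal ((mol n f x)^2) \<partial>?M) = ennreal ((L2norm K (mol n f))^2)"
  using mol_L2[OF f, of n] by (subst nn_integral_eq_integral) (auto simp: L2_def L2norm_sq)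
 finally have "(L2norm K (mol n f))^2 <= (2 * L2norm K f)^2" by (simp add: power_mult_distrib)
 thus ?thesis by (rule power2_le_imp_le) simp
qed

lemma mol_continuous_tendsto:
 assumes h: "continuous_on UNIV h" "h \<in> L2 K" and e: "0 < e"
 shows "\<exists>N. \<forall>n\<ge>N. \<forall>x\<in>K. \<bar>mol n h x - h x\<bar> <= e"
proof -
 obtain D where D: "0 < D" "!!x. x \<in> K ==> norm (x - c) <= D"
 proof -
  obtain D where "!!x. x \<in> K ==> norm x <= D" using K(2) by (auto simp: bounded_iff)
  hence "norm (x - c) <= \<bar>D\<bar> + norm c + 1" if "x \<in> K" for x using that norm_triangle_ineq4[of x c] by fastforce
  moreover have "0 < \<bar>D\<bar> + norm c + 1" by (intro add_nonneg_pos add_nonneg_nonneg) auto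
  ultimately show ?thesis using that by blast
 qed
 have "uniformly_continuous_on (closure K) h" using K(2) by (intro compact_uniformly_continuous continuous_on_subset[OF h(1)]) auto
 then obtain d where d: "0 < d" "!!x y. x \<in> closure K ==> y \<in> closure K ==> dist y x < d ==> dist (h y) (h x) < e"
  unfolding uniformly_continuous_on_def using e by metis
 have "(%n. (1 - lam n) * (D + r)) \<longlonglongrightarrow> (1 - 1) * (D + r)" by (intro tendsto_intros lam_tendsto)
 hence "\<forall>\<^sub>F n in sequentially. (1 - lam n) * (D + r) < d" using d(1) by (auto dest: order_tendstoD(2))
 then obtain N where N: "!!n. N <= n ==> (1 - lam n) * (D + r) < d" by (auto simp: eventually_sequentially)
 have "\<bar>mol n h x - h x\<bar> <= e" if n: "N <= n" and x: "x \<in> K" for n x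
 proof -
  let ?k = "%y. mk (eps n) (shr n x - y)" and ?M = "lebesgue_on K"
  have i1: "integrable ?M (%y. h y * ?k y)" using l2_integrable_mult[of h ?M ?k] h kernel_L2' by (simp add: L2_eq_l2)
  have i0: "integrable ?M ?k" by (rule L2_integrable[OF kernel_L2' Km(2)])
  have "mol n h x - h x = (LINT y|?M. h y * ?k y) - h x * (LINT y|?M. ?k y)" by (simp add: mol_eq kernel_integral[OF x])
  also have "... = (LINT y|?M. (h y - h x) * ?k y)" using i1 i0 by (simp add: left_diff_distrib)
  finally have "\<bar>mol n h x - h x\<bar> <= (LINT y|?M. \<bar>(h y - h x) * ?k y\<bar>)" using integral_abs_bound by metis
  also have "... <= (LINT y|?M. e * ?k y)"
  proof (rule integral_mono)
   have "integrable ?M (%y. (h y - h x) * ?k y)" using i1 i0 by (simp add: left_diff_distrib)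
   thus "integrable ?M (%y. \<bar>(h y - h x) * ?k y\<bar>)" by simp
   show "integrable ?M (%y. e * ?k y)" using i0 by simp
   fix y assume "y \<in> space ?M"
   hence y: "y \<in> K" by simp
   show "\<bar>(h y - h x) * ?k y\<bar> <= e * ?k y"
   proof (cases "2 * eps n <= norm (shr n x - y)")
    case True thus ?thesis using mk_props(4)[OF eps(1)] by simp
   next
    case False
    have "y - x = - (shr n x - y) - (1 - lam n) *\<^sub>R (x - c)" by (simp add: shr_def algebra_simps)
    hence n1: "norm (y - x) <= norm (shr n x - y) + norm ((1 - lam n) *\<^sub>R (x - c))"
     using norm_triangle_ineq4[of "- (shr n x - y)" "(1 - lam n) *\<^sub>R (x - c)"] by (simp only: norm_minus_cancel)
    have n2: "norm ((1 - lam n) *\<^sub>R (x - c)) <= (1 - lam n) * D" using D(2)[OF x] lam(2)[of n] by (simp add: mult_left_mono)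
    have n3: "norm (shr n x - y) <= (1 - lam n) * r"
    proof -
     have "(1 - lam n) * (r / 2) <= (1 - lam n) * r" using lam(2)[of n] r by (intro mult_left_mono) auto
     thus ?thesis using False eps(2)[of n] by linarith
    qed
    have "norm (y - x) < d" using n1 n2 n3 N[OF n] unfolding distrib_left by linarith
    hence "\<bar>h y - h x\<bar> < e" using d(2)[of x y] x y closure_subset[of K] by (auto simp: dist_norm)
    thus ?thesis unfolding abs_mult using mk_props(2)[OF eps(1)[of n]] by (intro mult_mono) auto
   qed
  qed
  also have "... = e" using kernel_integral[OF x] by simp
  finally show ?thesis .
 qed
 thus ?thesis by blast
qed

lemma mol_tendsto: assumes g: "g \<in> L2 K" shows "(%n. L2norm K (fminus (mol n g) g)) \<longlonglongrightarrow> 0"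
proof (rule LIMSEQ_I)
 fix e :: real assume e: "0 < e"
 \<comment> \<open>The distance from \<open>g\<close> to \<open>h\<close> counts once by itself and
   twice after mollification, together less than half of \<open>e\<close>. The choice of
   \<open>d\<close> lets the uniform error contribute at most a quarter; the added 1 excludes a
   division by zero.\<close>
 obtain h where h: "continuous_on UNIV h" "h \<in> L2 K" "L2norm K (fminus g h) < e / 6" using L2_continuous_dense[OF g Km(2) K(2), of "e / 6"] e by auto
 define V where "V = measure lebesgue K"
 define d where "d = e / (4 * (sqrt V + 1))"
 have V0: "0 <= V" by (simp add: V_def)
 have d0: "0 < d" using e V0 by (simp add: d_def add_nonneg_pos)
 obtain N where N: "!!n x. N <= n ==> x \<in> K ==> \<bar>mol n h x - h x\<bar> <= d" using mol_continuous_tendsto[OF h(1,2) d0] by blast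
 have "norm (L2norm K (fminus (mol n g) g) - 0) < e" if n: "N <= n" for n
 proof -
  note mg = mol_L2[OF g, of n] and mh = mol_L2[OF h(2), of n]
  have t1: "L2norm K (fminus (mol n g) g) <= L2norm K (fminus (mol n g) (mol n h)) + (L2norm K (fminus (mol n h) h) + L2norm K (fminus h g))"
   using L2.nrm_triangle[OF mg mh g] L2.nrm_triangle[OF mh h(2) g] unfolding L2norm_def[symmetric] by linarith
  have t2: "L2norm K (fminus (mol n g) (mol n h)) <= 2 * L2norm K (fminus g h)" using mol_bound[OF L2.fminus_mem[OF g h(2)], of n] mol_diff[OF g h(2)] by simp
  have t3: "L2norm K (fminus h g) = L2norm K (fminus g h)" unfolding L2norm_def by (rule L2.nrm_commute[OF h(2) g])
  have t4: "L2norm K (fminus (mol n h) h) <= e / 4"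
  proof -
   have "(L2norm K (fminus (mol n h) h))^2 <= (LINT x|lebesgue_on K. d^2)" unfolding L2norm_sq
   proof (rule integral_mono)
    show "integrable (lebesgue_on K) (%x. (fminus (mol n h) h x)^2)" using L2.fminus_mem[OF mh h(2)] unfolding L2_def by blast
    show "integrable (lebesgue_on K) (%x. d^2)" using finite_measure.integrable_const[OF finite_measure_lebesgue_on[OF Km(2)]] by blast
    fix x assume "x \<in> space (lebesgue_on K)"
    hence "\<bar>mol n h x - h x\<bar> <= d" using N[OF n] by simp
    thus "(fminus (mol n h) h x)^2 <= d^2" using d0 by (simp add: abs_le_square_iff[symmetric])
   qed
   also have "... = V * d^2" using Km(1) by (simp add: V_def measure_restrict_space)
   finally have "L2norm K (fminus (mol n h) h) <= sqrt (V * d^2)" by (rule real_le_rsqrt)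
   also have "... = sqrt V * d" using d0 by (simp add: real_sqrt_mult)
   also have "... <= (sqrt V + 1) * d" using d0 by simp
   also have "... = e / 4"
   proof -
    have "s * (e / (4 * s)) = e / 4" if "s ~= 0" for s :: real using that by simp
    moreover have "sqrt V + 1 ~= 0" using real_sqrt_ge_zero[OF V0] by linarith
    ultimately show ?thesis unfolding d_def by blast
   qed
   finally show ?thesis .
  qed
  have "L2norm K (fminus (mol n g) g) < e" using t1 t2 t3 t4 h(3) e by linarith
  thus ?thesis by simp
 qed
 thus "\<exists>no. \<forall>n\<ge>no. norm (L2norm K (fminus (mol n g) g) - 0) < e" by blast
qed

end

subsection \<open>The fundamental lemma\<close>

lemma L2_subset:
 assumes WU: "W \<subseteq> U" and Um: "U \<in> sets lebesgue" "W \<in> sets lebesgue" and f: "f \<in> L2 U" shows "f \<in> L2 W"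
proof -
 have "integrable lebesgue (%x. indicator U x *\<^sub>R (f x)\<^sup>2)" "(%x. indicator U x *\<^sub>R f x) \<in> borel_measurable lebesgue"
  using f Um by (auto simp: L2_def integrable_restrict_space borel_measurable_restrict_space_iff)
 hence "integrable lebesgue (%x. indicator W x *\<^sub>R (indicator U x *\<^sub>R (f x)\<^sup>2))"
  and "(%x. indicator W x *\<^sub>R (indicator U x *\<^sub>R f x)) \<in> borel_measurable lebesgue"
  using integrable_mult_indicator[OF Um(2)] borel_measurable_scaleR[OF borel_measurable_indicator[OF Um(2)]] by blast+
 moreover have "indicator W x *\<^sub>R (indicator U x *\<^sub>R y) = indicator W x *\<^sub>R y" for x and y :: real using WU by (auto simp: indicator_def)
 ultimately have "integrable lebesgue (%x. indicator W x *\<^sub>R (f x)\<^sup>2)"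
  and "(%x. indicator W x *\<^sub>R f x) \<in> borel_measurable lebesgue" by (simp_all only:)
 thus ?thesis using Um by (simp add: L2_def integrable_restrict_space borel_measurable_restrict_space_iff)
qed

lemma ip_subset:
 assumes "W \<subseteq> U" "U \<in> sets lebesgue" "W \<in> sets lebesgue" "!!x. x \<notin> W ==> \<psi> x = 0" shows "ip W f \<psi> = ip U f \<psi>"
proof -
 have "(LINT x|lebesgue. indicator W x *\<^sub>R (f x * \<psi> x)) = (LINT x|lebesgue. indicator U x *\<^sub>R (f x * \<psi> x))"
  by (rule Bochner_Integration.integral_cong[OF refl]) (use assms in \<open>auto simp: indicator_def\<close>)
 thus ?thesis using assms(2,3) by (simp add: ip_def integral_restrict_space)
qed

text \<open>On a ball inside \<open>U\<close> the mollifications of \<open>g\<close> are pairings of \<open>g\<close> with test functions.\<close>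

lemma fundamental_lemma:
 assumes U: "open U" and g: "g \<in> L2 U" and z: "!!\<phi>. \<phi> \<in> test_fun U ==> ip U g \<phi> = 0"
 shows "aeq U g (%x. 0)"
proof -
 let ?F = "{ball p r | p r. 0 < r & ball p r \<subseteq> U}"
 have ball: "AE x in lebesgue. x \<in> K --> g x = 0" if KF: "K \<in> ?F" for K
 proof -
  obtain p r where K: "K = ball p r" "0 < r" "ball p r \<subseteq> U" using KF by blast
  interpret C: convex_mollifier K p r by unfold_locales (use K in auto)
  note s = K(3)[folded K(1)] open_lebesgue[OF U] C.Km(1)
  have gK: "g \<in> L2 K" by (rule L2_subset[OF s g])
  have "C.mol n g x = 0" if x: "x \<in> K" for n x
   using z[OF subsetD[OF test_fun_mono[OF s(1)] C.kernel_test_fun[OF x]], of n] ip_subset[OF s test_fun_zero_outside[OF C.kernel_test_fun[OF x], of _ "[]" n], where f = g]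
   by (simp add: C.mol_eq ip_def)
  hence "aeq K (fminus (C.mol n g) g) (fminus (%x. 0) g)" for n unfolding aeq_def by (intro AE_I2) simp
  from L2norm_cong[OF this L2.fminus_mem[OF C.mol_L2[OF gK] gK] s(3)] C.mol_tendsto[OF gK]
  have "L2norm K (fminus (%x. 0) g) = 0" by (simp add: LIMSEQ_const_iff)
  hence "aeq K g (%x. 0)" by (rule aeq_sym[OF aeq_iff_L2norm[OF L2.zero_mem[OF gK] gK, THEN iffD2]])
  thus ?thesis using s(3) by (simp add: aeq_def AE_restrict_space_iff)
 qed
 have "!!S. S \<in> ?F ==> open S" by auto
 \<comment> \<open>By Lindelof's theorem countably many balls suffice, so the exceptional null sets
   can be united.\<close>
 then obtain D where D: "D \<subseteq> ?F" "countable D" "\<Union> D = \<Union> ?F" by (rule Lindelof)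
 have FU: "\<Union> ?F = U"
 proof
  show "U \<subseteq> \<Union> ?F"
  proof
   fix x assume "x \<in> U"
   then obtain r where "0 < r" "ball x r \<subseteq> U" using U openE by blast
   thus "x \<in> \<Union> ?F" by (intro UnionI[of "ball x r"]) auto
  qed
 qed auto
 have "AE x in lebesgue. \<forall>K\<in>D. x \<in> K --> g x = 0" using ball D(1) by (subst AE_ball_countable[OF D(2)]) blast
 hence "AE x in lebesgue. x \<in> \<Union> D --> g x = 0" by eventually_elim blast
 hence "AE x in lebesgue. x \<in> U --> g x = 0" unfolding D(3) FU .
 thus ?thesis using open_lebesgue[OF U] by (simp add: aeq_def AE_restrict_space_iff)
qed

lemma weak_deriv_unique:
 assumes "weak_deriv U is v g" "weak_deriv U is v h" "open U" shows "aeq U g h"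
proof -
 have "weak_deriv U is (lincomb 1 v (-1) v) (lincomb 1 g (-1) h)" by (rule weak_deriv_lincomb[OF assms])
 hence d: "weak_deriv U is (%x. 0) (fminus g h)" by (simp add: fminus_eq_lincomb lincomb_def)
 have "ip U (fminus g h) \<phi> = 0" if "\<phi> \<in> test_fun U" for \<phi> using weak_derivD(3)[OF d that] by (simp add: ip_def)
 from fundamental_lemma[OF assms(3) weak_derivD(2)[OF d] this] show ?thesis by (simp add: aeq_def)
qed

lemma weak_deriv_cong:
 assumes "aeq U v w" "aeq U g h" "weak_deriv U is v g" "open U" shows "weak_deriv U is w h"
proof -
 have U: "U \<in> sets lebesgue" using assms(4) by (rule open_lebesgue)
 note d = weak_derivD[OF assms(3)]
 have "ip U w (dpart is \<phi>) = (- 1) ^ length is * ip U h \<phi>" if "\<phi> \<in> test_fun U" for \<phi>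
 proof -
  have *: "dpart is \<phi> \<in> L2 U" "\<phi> \<in> L2 U" using test_fun_L2[OF that U, of "is"] test_fun_L2[OF that U, of "[]"] by auto
  have "ip U v (dpart is \<phi>) = ip U w (dpart is \<phi>)" by (rule ip_cong[OF assms(1) aeq_refl L2_borel[OF d(1)] L2_borel[OF *(1)] U])
  moreover have "ip U g \<phi> = ip U h \<phi>" by (rule ip_cong[OF assms(2) aeq_refl L2_borel[OF d(2)] L2_borel[OF *(2)] U])
  ultimately show ?thesis using d(3)[OF that] by simp
 qed
 thus ?thesis using L2_cong[OF assms(1) d(1) U] L2_cong[OF assms(2) d(2) U] by (simp add: weak_deriv_def)
qed

text \<open>Equality everywhere, although the arguments agree only almost everywhere: both sides
  choose from the same predicate.\<close>

lemma wd_cong: assumes "aeq U v w" "open U" shows "wd U is v = wd U is w"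
proof -
 have "weak_deriv U is v = weak_deriv U is w"
  using weak_deriv_cong[OF assms(1) aeq_refl _ assms(2)] weak_deriv_cong[OF aeq_sym[OF assms(1)] aeq_refl _ assms(2)] by (intro ext iffI) auto
 thus ?thesis by (simp add: wd_def)
qed

lemma wd_weak_deriv: "weak_deriv U is v g ==> weak_deriv U is v (wd U is v)" unfolding wd_def by (rule someI[of "weak_deriv U is v"])

lemma wd_aeq: "weak_deriv U is v g ==> open U ==> aeq U (wd U is v) g" using weak_deriv_unique wd_weak_deriv by blast

lemma weak_deriv_restrict:
 assumes "weak_deriv U is v g" "W \<subseteq> U" "open U" "open W" shows "weak_deriv W is v g"
proof -
 have Um: "U \<in> sets lebesgue" "W \<in> sets lebesgue" using assms open_lebesgue by auto
 note d = weak_derivD[OF assms(1)]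
 have "ip W v (dpart is \<phi>) = (- 1) ^ length is * ip W g \<phi>" if p: "\<phi> \<in> test_fun W" for \<phi>
 proof -
  have "\<phi> \<in> test_fun U" using p test_fun_mono[OF assms(2)] by blast
  thus ?thesis using d(3) ip_subset[OF assms(2) Um test_fun_zero_outside[OF p], where f = v] ip_subset[OF assms(2) Um test_fun_zero_outside[OF p, of _ "[]"], where f = g] by simp
 qed
 thus ?thesis using d L2_subset[OF assms(2) Um] by (simp add: weak_deriv_def)
qed

subsection \<open>Sobolev spaces\<close>

lemma finite_length_lists: "finite {is :: 2 list. length is <= m}" "finite {is :: 2 list. length is = m}"
 using finite_lists_length_le[of "UNIV :: 2 set" m] finite_lists_length_eq[of "UNIV :: 2 set" m] by auto

lemma sqrt_le_of_quasi_triangle: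
 fixes x y z :: real
 assumes "0 <= x" "0 <= y" and q: "!!e. 0 < e ==> z <= (1 + e) * x + (1 + 1 / e) * y"
 shows "sqrt z <= sqrt x + sqrt y"
proof (rule field_le_epsilon)
 fix e :: real assume e: "0 < e"
 define s t where "s = sqrt x + e / 2" and "t = sqrt y + e / 2"
 have st: "0 < s" "0 < t" using assms e by (auto simp: s_def t_def intro: add_nonneg_pos)
 have xy: "x <= s^2" "y <= t^2" using power_mono[of "sqrt x" s 2] power_mono[of "sqrt y" t 2] assms e by (auto simp: s_def t_def)
 \<comment> \<open>The ratio of the roots is the optimal parameter. Half of the slack was added to
   each root to keep the ratio defined when one of them is zero.\<close>
 have "z <= (1 + t / s) * x + (1 + 1 / (t / s)) * y" using q[of "t / s"] st by simp
 also have "... <= (1 + t / s) * s^2 + (1 + 1 / (t / s)) * t^2" using xy st by (intro add_mono mult_left_mono) (auto intro: add_nonneg_nonneg)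
 also have "... = (s + t)^2" using st by (simp add: power2_eq_square algebra_simps)
 finally have "sqrt z <= s + t" using st by (intro real_le_lsqrt) auto
 thus "sqrt z <= sqrt x + sqrt y + e" by (simp add: s_def t_def)
qed

lemma quasi_triangle_square:
 fixes a b e :: real assumes "0 < e" shows "(a + b)^2 <= (1 + e) * a^2 + (1 + 1 / e) * b^2"
proof -
 have "0 <= (e * a - b)^2 / e" using assms by simp
 also have "... = e * a^2 - 2 * a * b + b^2 / e" using assms by (simp add: field_simps power2_eq_square)
 finally show ?thesis by (simp add: power2_sum algebra_simps)
qed

lemma gagliardo_measurable:
 assumes "U \<in> lmeasurable" "g \<in> borel_measurable (lebesgue_on U)"
 shows "(%(y, x). ennreal ((g x - g y)^2 / norm (x - y) powr p)) \<in> borel_measurable (lebesgue_on U \<Otimes>\<^sub>M lebesgue_on U)"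
proof -
 have [measurable]: "g \<in> borel_measurable (lebesgue_on U)" by (rule assms)
 have id: "(%x. x) \<in> borel_measurable (lebesgue_on U)" by (intro measurable_restrict_space1 measurable_completion) simp
 have [measurable]: "fst \<in> borel_measurable (lebesgue_on U \<Otimes>\<^sub>M lebesgue_on U)" "snd \<in> borel_measurable (lebesgue_on U \<Otimes>\<^sub>M lebesgue_on U)"
  using measurable_compose[OF measurable_fst id] measurable_compose[OF measurable_snd id] by auto
 show ?thesis unfolding split_beta by measurable
qed

lemma gagliardo_inner_measurable:
 assumes "U \<in> lmeasurable" "g \<in> borel_measurable (lebesgue_on U)"
 shows "(%y. \<integral>\<^sup>+ x. ennreal ((g x - g y)^2 / norm (x - y) powr p) \<partial>lebesgue_on U) \<in> borel_measurable (lebesgue_on U)"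
  and "y \<in> space (lebesgue_on U) ==> (%x. ennreal ((g x - g y)^2 / norm (x - y) powr p)) \<in> borel_measurable (lebesgue_on U)"
proof -
 interpret finite_measure "lebesgue_on U" by (rule finite_measure_lebesgue_on[OF assms(1)])
 show "(%y. \<integral>\<^sup>+ x. ennreal ((g x - g y)^2 / norm (x - y) powr p) \<partial>lebesgue_on U) \<in> borel_measurable (lebesgue_on U)"
  by (rule borel_measurable_nn_integral[OF gagliardo_measurable[OF assms]])
 show "(%x. ennreal ((g x - g y)^2 / norm (x - y) powr p)) \<in> borel_measurable (lebesgue_on U)" if "y \<in> space (lebesgue_on U)"
  using measurable_Pair2[OF gagliardo_measurable[OF assms] that] by simp
qed

lemma gagliardo_cong:
 assumes "aeq U g h" shows "gagliardo \<sigma> U g = gagliardo \<sigma> U h" unfolding gagliardo_def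
proof (rule nn_integral_cong_AE)
 show "AE y in lebesgue_on U. (\<integral>\<^sup>+ x. ennreal ((g x - g y)^2 / norm (x - y) powr (2 + 2 * \<sigma>)) \<partial>lebesgue_on U) =
  (\<integral>\<^sup>+ x. ennreal ((h x - h y)^2 / norm (x - y) powr (2 + 2 * \<sigma>)) \<partial>lebesgue_on U)" using assms unfolding aeq_def
 proof eventually_elim
  case (elim y)
  show ?case by (rule nn_integral_cong_AE) (use assms elim in \<open>auto simp: aeq_def elim!: eventually_mono\<close>)
 qed
qed

lemma gagliardo_lincomb:
 assumes U: "U \<in> lmeasurable" and g: "g \<in> borel_measurable (lebesgue_on U)" and h: "h \<in> borel_measurable (lebesgue_on U)" and e: "0 < e"
 shows "gagliardo \<sigma> U (lincomb c g d h)
  <= ennreal ((1 + e) * c^2) * gagliardo \<sigma> U g + ennreal ((1 + 1 / e) * d^2) * gagliardo \<sigma> U h"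
proof -
 let ?M = "lebesgue_on U" and ?p = "2 + 2 * \<sigma>"
 let ?k = "%g y x. ennreal ((g x - g y)^2 / norm (x - y) powr ?p)"
 have pt: "?k (lincomb c g d h) y x <= ennreal ((1 + e) * c^2) * ?k g y x + ennreal ((1 + 1 / e) * d^2) * ?k h y x" for x y
 proof -
  have "(lincomb c g d h x - lincomb c g d h y)^2 = (c * (g x - g y) + d * (h x - h y))^2" by (simp add: algebra_simps)
  also have "... <= (1 + e) * (c * (g x - g y))^2 + (1 + 1 / e) * (d * (h x - h y))^2" by (rule quasi_triangle_square[OF e])
  finally have "(lincomb c g d h x - lincomb c g d h y)^2 / norm (x - y) powr ?p
   <= ((1 + e) * (c * (g x - g y))^2 + (1 + 1 / e) * (d * (h x - h y))^2) / norm (x - y) powr ?p" by (rule divide_right_mono) simp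
  also have "... = ((1 + e) * c^2) * ((g x - g y)^2 / norm (x - y) powr ?p) + ((1 + 1 / e) * d^2) * ((h x - h y)^2 / norm (x - y) powr ?p)"
   by (simp add: power_mult_distrib add_divide_distrib)
  finally have "?k (lincomb c g d h) y x <= ennreal (((1 + e) * c^2) * ((g x - g y)^2 / norm (x - y) powr ?p) + ((1 + 1 / e) * d^2) * ((h x - h y)^2 / norm (x - y) powr ?p))"
   by (rule ennreal_leI)
  also have "... = ennreal ((1 + e) * c^2) * ?k g y x + ennreal ((1 + 1 / e) * d^2) * ?k h y x" using e by (subst ennreal_plus) (auto simp flip: ennreal_mult)
  finally show ?thesis .
 qed
 have "gagliardo \<sigma> U (lincomb c g d h)
   <= (\<integral>\<^sup>+ y. \<integral>\<^sup>+ x. ennreal ((1 + e) * c^2) * ?k g y x + ennreal ((1 + 1 / e) * d^2) * ?k h y x \<partial>?M \<partial>?M)"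
  unfolding gagliardo_def by (intro nn_integral_mono pt)
 also have "... = (\<integral>\<^sup>+ y. ennreal ((1 + e) * c^2) * (\<integral>\<^sup>+ x. ?k g y x \<partial>?M) + ennreal ((1 + 1 / e) * d^2) * (\<integral>\<^sup>+ x. ?k h y x \<partial>?M) \<partial>?M)"
  by (rule nn_integral_cong, subst nn_integral_add)
   (use gagliardo_inner_measurable(2)[OF U g, of _ ?p] gagliardo_inner_measurable(2)[OF U h, of _ ?p] in \<open>auto simp: nn_integral_cmult\<close>)
 also have "... = ennreal ((1 + e) * c^2) * gagliardo \<sigma> U g + ennreal ((1 + 1 / e) * d^2) * gagliardo \<sigma> U h" unfolding gagliardo_def
  using gagliardo_inner_measurable(1)[OF U g, of ?p] gagliardo_inner_measurable(1)[OF U h, of ?p] by (subst nn_integral_add) (auto simp: nn_integral_cmult)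
 finally show ?thesis .
qed

text \<open>Lower semicontinuity, by Fatou's lemma in each of the two variables.\<close>

lemma gagliardo_le_of_AE_limit:
 assumes U: "U \<in> lmeasurable" and g: "!!k. g k \<in> borel_measurable (lebesgue_on U)"
  and lim: "AE x in lebesgue_on U. (%k::nat. g k x) \<longlonglongrightarrow> h x"
  and B: "!!k. K <= k ==> gagliardo \<sigma> U (g k) <= B"
 shows "gagliardo \<sigma> U h <= B"
proof -
 let ?M = "lebesgue_on U" and ?p = "2 + 2 * \<sigma>"
 let ?k = "%g y x. ennreal ((g x - g y)^2 / norm (x - y) powr ?p)"
 have "gagliardo \<sigma> U h = (\<integral>\<^sup>+ y. \<integral>\<^sup>+ x. liminf (%k. ?k (g k) y x) \<partial>?M \<partial>?M)" unfolding gagliardo_def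
 proof (rule nn_integral_cong_AE)
  show "AE y in ?M. (\<integral>\<^sup>+ x. ?k h y x \<partial>?M) = (\<integral>\<^sup>+ x. liminf (%k. ?k (g k) y x) \<partial>?M)" using lim
  proof eventually_elim
   case (elim y)
   show ?case
   proof (rule nn_integral_cong_AE)
    show "AE x in ?M. ?k h y x = liminf (%k. ?k (g k) y x)" using lim
    proof eventually_elim
     case (elim x)
     have "(%k. ?k (g k) y x) \<longlonglongrightarrow> ?k h y x"
     proof (cases "x = y")
      case False
      show ?thesis
       by (intro tendsto_ennrealI tendsto_divide tendsto_const tendsto_power tendsto_diff elim \<open>(%k. g k y) \<longlonglongrightarrow> h y\<close>)
        (use False in simp)
     qed simp
     from lim_imp_Liminf[OF trivial_limit_sequentially this] show ?case by (rule sym)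
    qed
   qed
  qed
 qed
 also have "... <= (\<integral>\<^sup>+ y. liminf (%k. \<integral>\<^sup>+ x. ?k (g k) y x \<partial>?M) \<partial>?M)"
  by (intro nn_integral_mono nn_integral_liminf gagliardo_inner_measurable(2)[OF U g])
 also have "... <= liminf (%k. gagliardo \<sigma> U (g k))" unfolding gagliardo_def by (intro nn_integral_liminf gagliardo_inner_measurable(1)[OF U g])
 also have "... <= B" by (rule Liminf_le) (use B in \<open>auto simp: eventually_sequentially\<close>)
 finally show ?thesis .
qed

lemma gagliardo_scale_zero: "gagliardo \<sigma> U (%x. 0) = 0" by (simp add: gagliardo_def)

lemma HsD:
 assumes "v \<in> Hs s U" "length is <= nat \<lfloor>s\<rfloor>"
 shows "weak_deriv U is v (wd U is v)" "wd U is v \<in> L2 U" "v \<in> L2 U"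
proof -
 obtain g where "weak_deriv U is v g" using assms unfolding Hs_def by blast
 thus *: "weak_deriv U is v (wd U is v)" by (rule wd_weak_deriv)
 thus "wd U is v \<in> L2 U" "v \<in> L2 U" by (auto dest: weak_derivD)
qed

lemma Hs_L2: "v \<in> Hs s U ==> v \<in> L2 U" using HsD(3)[of v s U "[]"] by simp

lemma Hs_gagliardo: "v \<in> Hs s U ==> frac s ~= 0 ==> length is = nat \<lfloor>s\<rfloor> ==> gagliardo (frac s) U (wd U is v) < \<infinity>"
 by (simp add: Hs_def)

lemma wd_lincomb:
 assumes "v \<in> Hs s U" "w \<in> Hs s U" "length is <= nat \<lfloor>s\<rfloor>" "open U"
 shows "aeq U (wd U is (lincomb c v d w)) (lincomb c (wd U is v) d (wd U is w))"
 by (rule wd_aeq[OF weak_deriv_lincomb[OF HsD(1)[OF assms(1,3)] HsD(1)[OF assms(2,3)] assms(4)] assms(4)])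

lemma Hs_lincomb:
 assumes U: "open U" "bounded U" and v: "v \<in> Hs s U" and w: "w \<in> Hs s U"
 shows "lincomb c v d w \<in> Hs s U"
proof -
 have Um: "U \<in> lmeasurable" using U by (simp add: lmeasurable_open)
 have "gagliardo (frac s) U (wd U is (lincomb c v d w)) < \<infinity>" if "frac s ~= 0" "length is = nat \<lfloor>s\<rfloor>" for "is"
 proof -
  have l: "length is <= nat \<lfloor>s\<rfloor>" using that by simp
  have "gagliardo (frac s) U (wd U is (lincomb c v d w)) = gagliardo (frac s) U (lincomb c (wd U is v) d (wd U is w))"
   by (rule gagliardo_cong[OF wd_lincomb[OF v w l U(1)]])
  also have "... <= ennreal ((1 + 1) * c^2) * gagliardo (frac s) U (wd U is v) + ennreal ((1 + 1 / 1) * d^2) * gagliardo (frac s) U (wd U is w)"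
   by (rule gagliardo_lincomb[OF Um]) (use HsD(2)[OF v l] HsD(2)[OF w l] in \<open>auto simp: L2_def\<close>)
  also have "... < \<infinity>" using Hs_gagliardo[OF v that] Hs_gagliardo[OF w that] by (simp add: ennreal_mult_less_top)
  finally show ?thesis .
 qed
 moreover have "\<exists>g. weak_deriv U is (lincomb c v d w) g" if "length is <= nat \<lfloor>s\<rfloor>" for "is"
  using weak_deriv_lincomb[OF HsD(1)[OF v that] HsD(1)[OF w that] U(1)] by blast
 ultimately show ?thesis by (simp add: Hs_def)
qed

lemma Hs_cong:
 assumes "aeq U v w" "v \<in> Hs s U" "open U" shows "w \<in> Hs s U" "Hs_norm s U w = Hs_norm s U v"
proof -
 have "wd U is w = wd U is v" for "is" using wd_cong[OF assms(1,3)] by simp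
 moreover have "\<exists>g. weak_deriv U is w g" if "length is <= nat \<lfloor>s\<rfloor>" for "is"
  using weak_deriv_cong[OF assms(1) aeq_refl HsD(1)[OF assms(2) that] assms(3)] by blast
 ultimately show "w \<in> Hs s U" "Hs_norm s U w = Hs_norm s U v" using assms(2) by (auto simp: Hs_def Hs_norm_def)
qed

lemma frac_bounds: "0 <= frac s" "0 < 1 - frac s" using frac_ge_0[of s] frac_lt_1[of s] by auto

lemma Hs_norm_nonneg [simp]: "0 <= Hs_norm s U v"
proof -
 have "0 <= (1 - frac s) * (\<Sum>is | length is = nat \<lfloor>s\<rfloor>. enn2real (gagliardo (frac s) U (wd U is v)))"
  using frac_bounds[of s] by (intro mult_nonneg_nonneg sum_nonneg) auto
 thus ?thesis unfolding Hs_norm_def by (auto intro!: add_nonneg_nonneg sum_nonneg)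
qed

lemma Hs_norm_sq: "(Hs_norm s U v)^2 = (\<Sum>is | length is <= nat \<lfloor>s\<rfloor>. (L2norm U (wd U is v))^2) +
  (if frac s = 0 then 0 else (1 - frac s) *
    (\<Sum>is | length is = nat \<lfloor>s\<rfloor>. enn2real (gagliardo (frac s) U (wd U is v))))"
proof -
 have "0 <= (1 - frac s) * (\<Sum>is | length is = nat \<lfloor>s\<rfloor>. enn2real (gagliardo (frac s) U (wd U is v)))"
  using frac_bounds[of s] by (intro mult_nonneg_nonneg sum_nonneg) auto
 thus ?thesis unfolding Hs_norm_def by (subst real_sqrt_pow2) (auto intro!: add_nonneg_nonneg sum_nonneg)
qed

lemma L2norm_wd_le_Hs_norm:
 assumes "length is <= nat \<lfloor>s\<rfloor>" shows "L2norm U (wd U is v) <= Hs_norm s U v"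
proof (rule power2_le_imp_le)
 have "(L2norm U (wd U is v))^2 <= (\<Sum>is | length is <= nat \<lfloor>s\<rfloor>. (L2norm U (wd U is v))^2)"
  using assms by (intro member_le_sum) (auto simp: finite_length_lists)
 moreover have "0 <= (1 - frac s) * (\<Sum>is | length is = nat \<lfloor>s\<rfloor>. enn2real (gagliardo (frac s) U (wd U is v)))"
  using frac_bounds[of s] by (intro mult_nonneg_nonneg sum_nonneg) auto
 ultimately show "(L2norm U (wd U is v))^2 <= (Hs_norm s U v)^2" unfolding Hs_norm_sq by (auto intro: add_increasing2)
qed simp

lemma enn2real_gagliardo_le_Hs_norm:
 assumes "frac s ~= 0" "length is = nat \<lfloor>s\<rfloor>"
 shows "(1 - frac s) * enn2real (gagliardo (frac s) U (wd U is v)) <= (Hs_norm s U v)^2"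
proof -
 have "enn2real (gagliardo (frac s) U (wd U is v)) <= (\<Sum>is | length is = nat \<lfloor>s\<rfloor>. enn2real (gagliardo (frac s) U (wd U is v)))"
  using assms by (intro member_le_sum) (auto simp: finite_length_lists)
 hence "(1 - frac s) * enn2real (gagliardo (frac s) U (wd U is v)) <= (1 - frac s) * (\<Sum>is | length is = nat \<lfloor>s\<rfloor>. enn2real (gagliardo (frac s) U (wd U is v)))"
  using frac_bounds[of s] by (intro mult_left_mono) auto
 moreover have "0 <= (\<Sum>is | length is <= nat \<lfloor>s\<rfloor>. (L2norm U (wd U is v))^2)" by (intro sum_nonneg) auto
 ultimately show ?thesis unfolding Hs_norm_sq using assms by simp
qed

text \<open>The weighted inequality holds with the same weights for the \<open>L\<^sup>2\<close>
  terms and for the Gagliardo terms, so it passes to the whole square of the norm.\<close>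

lemma Hs_norm_lincomb:
 assumes U: "open U" "bounded U" and v: "v \<in> Hs s U" and w: "w \<in> Hs s U"
 shows "Hs_norm s U (lincomb c v d w) <= \<bar>c\<bar> * Hs_norm s U v + \<bar>d\<bar> * Hs_norm s U w"
proof -
 let ?m = "nat \<lfloor>s\<rfloor>" and ?G = "%is v. gagliardo (frac s) U (wd U is v)"
 have Um: "U \<in> lmeasurable" "U \<in> sets lebesgue" using U by (auto simp: lmeasurable_open open_lebesgue)
 let ?u = "lincomb c v d w"
 have "(Hs_norm s U ?u)^2 <= (1 + e) * (\<bar>c\<bar> * Hs_norm s U v)^2 + (1 + 1 / e) * (\<bar>d\<bar> * Hs_norm s U w)^2" if e: "0 < e" for e
 proof -
  let ?A = "(1 + e) * c^2" and ?B = "(1 + 1 / e) * d^2"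
  have AB: "0 <= ?A" "0 <= ?B" using e by auto
  have l: "(L2norm U (wd U is ?u))^2 <= ?A * (L2norm U (wd U is v))^2 + ?B * (L2norm U (wd U is w))^2"
   if "length is <= ?m" for "is"
  proof -
   have "L2norm U (wd U is ?u) = L2norm U (lincomb c (wd U is v) d (wd U is w))"
    by (rule L2norm_cong[OF wd_lincomb[OF v w that U(1)] HsD(2)[OF Hs_lincomb[OF U v w] that] Um(2)])
   also have "... <= \<bar>c\<bar> * L2norm U (wd U is v) + \<bar>d\<bar> * L2norm U (wd U is w)"
    unfolding L2norm_def by (rule L2.nrm_lincomb[OF HsD(2)[OF v that] HsD(2)[OF w that]])
   finally have "(L2norm U (wd U is ?u))^2 <= (\<bar>c\<bar> * L2norm U (wd U is v) + \<bar>d\<bar> * L2norm U (wd U is w))^2" by (rule power_mono) simp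
   also have "... <= (1 + e) * (\<bar>c\<bar> * L2norm U (wd U is v))^2 + (1 + 1 / e) * (\<bar>d\<bar> * L2norm U (wd U is w))^2"
    by (rule quasi_triangle_square[OF e])
   finally show ?thesis by (simp add: power_mult_distrib mult.assoc)
  qed
  have g: "enn2real (?G is ?u) <= ?A * enn2real (?G is v) + ?B * enn2real (?G is w)"
   if fl: "frac s ~= 0" "length is = ?m" for "is"
  proof -
   have l: "length is <= ?m" using that by simp
   obtain x y where xy: "0 <= x" "0 <= y" "?G is v = ennreal x" "?G is w = ennreal y"
    using Hs_gagliardo[OF v fl] Hs_gagliardo[OF w fl] by (cases "?G is v"; cases "?G is w") auto
   have "?G is ?u = gagliardo (frac s) U (lincomb c (wd U is v) d (wd U is w))" by (rule gagliardo_cong[OF wd_lincomb[OF v w l U(1)]])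
   also have "... <= ennreal ?A * ?G is v + ennreal ?B * ?G is w"
    by (rule gagliardo_lincomb[OF Um(1) _ _ e]) (use HsD(2)[OF v l] HsD(2)[OF w l] in \<open>auto simp: L2_def\<close>)
   also have "... = ennreal (?A * x + ?B * y)" unfolding xy using xy(1,2) AB by (subst ennreal_plus) (auto simp: ennreal_mult)
   finally have "enn2real (?G is ?u) <= enn2real (ennreal (?A * x + ?B * y))" by (rule enn2real_mono) simp
   also have "... = ?A * x + ?B * y" using mult_nonneg_nonneg[OF AB(1) xy(1)] mult_nonneg_nonneg[OF AB(2) xy(2)] by (intro enn2real_ennreal add_nonneg_nonneg)
   finally show ?thesis using xy by simp
  qed
  have "(\<Sum>is | length is <= ?m. (L2norm U (wd U is ?u))^2) <=
    ?A * (\<Sum>is | length is <= ?m. (L2norm U (wd U is v))^2) + ?B * (\<Sum>is | length is <= ?m. (L2norm U (wd U is w))^2)"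
   unfolding sum_distrib_left sum.distrib[symmetric] by (rule sum_mono) (use l in simp)
  moreover have "(if frac s = 0 then 0 else (1 - frac s) * (\<Sum>is | length is = ?m. enn2real (?G is ?u))) <=
    ?A * (if frac s = 0 then 0 else (1 - frac s) * (\<Sum>is | length is = ?m. enn2real (?G is v))) +
    ?B * (if frac s = 0 then 0 else (1 - frac s) * (\<Sum>is | length is = ?m. enn2real (?G is w)))"
  proof (cases "frac s = 0")
   case False
   have "(\<Sum>is | length is = ?m. enn2real (?G is ?u)) <=
    ?A * (\<Sum>is | length is = ?m. enn2real (?G is v)) + ?B * (\<Sum>is | length is = ?m. enn2real (?G is w))"
    unfolding sum_distrib_left sum.distrib[symmetric] by (rule sum_mono) (use g[OF False] in simp)
   from mult_left_mono[OF this, of "1 - frac s"] show ?thesis using frac_bounds[of s] False by (simp add: distrib_left mult_ac)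
  qed simp
  ultimately have "(Hs_norm s U ?u)^2 <= ?A * (Hs_norm s U v)^2 + ?B * (Hs_norm s U w)^2" unfolding Hs_norm_sq by (simp add: distrib_left)
  thus ?thesis by (simp add: power_mult_distrib mult.assoc)
 qed
 from sqrt_le_of_quasi_triangle[OF _ _ this] show ?thesis by simp
qed

lemma Hs_fminus: "open U ==> bounded U ==> v \<in> Hs s U ==> w \<in> Hs s U ==> fminus v w \<in> Hs s U" by (simp add: fminus_eq_lincomb Hs_lincomb)

lemma wd_Nil_aeq: assumes "v \<in> L2 U" "open U" shows "aeq U (wd U [] v) v" using assms by (intro wd_aeq) (simp_all add: weak_deriv_def)

lemma L2norm_le_Hs_norm: assumes "v \<in> L2 U" "open U" shows "L2norm U v <= Hs_norm s U v"
proof -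
 have "L2norm U v = L2norm U (wd U [] v)" by (rule L2norm_cong[OF aeq_sym[OF wd_Nil_aeq[OF assms]] assms(1) open_lebesgue[OF assms(2)]])
 thus ?thesis using L2norm_wd_le_Hs_norm[of "[]" s U v] by simp
qed

lemma Hs_mono: assumes "v \<in> Hs s U" "2 <= s" shows "v \<in> Hs 2 U"
proof -
 have "2 <= nat \<lfloor>s\<rfloor>" using assms(2) by linarith
 thus ?thesis using assms(1) by (auto simp: Hs_def)
qed

lemma Hs2_norm_le: assumes "2 <= s" shows "Hs_norm 2 U v <= Hs_norm s U v"
proof (rule power2_le_imp_le)
 have m: "2 <= nat \<lfloor>s\<rfloor>" using assms by linarith
 have "(\<Sum>is | length is <= 2. (L2norm U (wd U is v))^2) <= (\<Sum>is | length is <= nat \<lfloor>s\<rfloor>. (L2norm U (wd U is v))^2)"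
  using m by (intro sum_mono2) (auto simp: finite_length_lists)
 moreover have "0 <= (1 - frac s) * (\<Sum>is | length is = nat \<lfloor>s\<rfloor>. enn2real (gagliardo (frac s) U (wd U is v)))"
  using frac_bounds[of s] by (intro mult_nonneg_nonneg sum_nonneg) auto
 ultimately show "(Hs_norm 2 U v)^2 <= (Hs_norm s U v)^2" unfolding Hs_norm_sq by (auto intro: add_increasing2)
qed simp

lemma weak_deriv_limit:
 assumes U: "open U" and w: "!!n::nat. weak_deriv U is (v n) (g n)" and v: "v' \<in> L2 U" and g: "g' \<in> L2 U"
  and lv: "(%n. L2norm U (fminus (v n) v')) \<longlonglongrightarrow> 0" and lg: "(%n. L2norm U (fminus (g n) g')) \<longlonglongrightarrow> 0"
 shows "weak_deriv U is v' g'"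
proof -
 have Um: "U \<in> sets lebesgue" using U by (rule open_lebesgue)
 have lim: "(%n. ip U (f n) \<phi>) \<longlonglongrightarrow> ip U f' \<phi>"
  if "!!n. f n \<in> L2 U" "f' \<in> L2 U" "\<phi> \<in> L2 U" "(%n. L2norm U (fminus (f n) f')) \<longlonglongrightarrow> 0" for f f' \<phi>
 proof (rule Lim_null[THEN iffD2], rule Lim_null_comparison)
  show "\<forall>\<^sub>F n in sequentially. norm (ip U (f n) \<phi> - ip U f' \<phi>) <= L2norm U (fminus (f n) f') * L2norm U \<phi>"
   using L2.Cauchy_Schwarz[OF L2.fminus_mem[OF that(1,2)] that(3)] that by (simp add: L2.diff_left L2norm_def)
  show "(%n. L2norm U (fminus (f n) f') * L2norm U \<phi>) \<longlonglongrightarrow> 0" using tendsto_mult_right[OF that(4), of "L2norm U \<phi>"] by simp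
 qed
 have "ip U v' (dpart is \<phi>) = (- 1) ^ length is * ip U g' \<phi>" if p: "\<phi> \<in> test_fun U" for \<phi>
 proof (rule LIMSEQ_unique)
  have t: "dpart is \<phi> \<in> L2 U" "\<phi> \<in> L2 U" using test_fun_L2[OF p Um, of "is"] test_fun_L2[OF p Um, of "[]"] by auto
  show "(%n. ip U (v n) (dpart is \<phi>)) \<longlonglongrightarrow> ip U v' (dpart is \<phi>)" by (rule lim[OF weak_derivD(1)[OF w] v t(1) lv])
  have "(%n. (- 1) ^ length is * ip U (g n) \<phi>) \<longlonglongrightarrow> (- 1) ^ length is * ip U g' \<phi>"
   by (intro tendsto_mult tendsto_const lim[OF weak_derivD(2)[OF w] g t(2) lg])
  thus "(%n. ip U (v n) (dpart is \<phi>)) \<longlonglongrightarrow> (- 1) ^ length is * ip U g' \<phi>" using weak_derivD(3)[OF w p] by simp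
 qed
 thus ?thesis using v g by (simp add: weak_deriv_def)
qed

text \<open>The limit is already known in \<open>L\<^sup>2\<close>. Its derivatives come from
  completeness of \<open>L\<^sup>2\<close> and are identified by testing. The fractional part is
  passed to the limit by semicontinuity along an almost everywhere convergent subsequence, with the
  first index kept fixed.\<close>

lemma Hs_complete:
 assumes U: "open U" "bounded U" and w: "!!n::nat. w n \<in> Hs s U" and w': "w' \<in> L2 U"
  and lim: "(%n. L2norm U (fminus (w n) w')) \<longlonglongrightarrow> 0"
  and Cau: "!!e. 0 < e ==> \<exists>N. \<forall>m\<ge>N. \<forall>n\<ge>N. Hs_norm s U (fminus (w m) (w n)) < e"
 shows "w' \<in> Hs s U" and "(%n. Hs_norm s U (fminus (w n) w')) \<longlonglongrightarrow> 0"
proof -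
 let ?m = "nat \<lfloor>s\<rfloor>" and ?G = "%is v. gagliardo (frac s) U (wd U is v)"
 have Um: "U \<in> lmeasurable" "U \<in> sets lebesgue" using U by (auto simp: lmeasurable_open open_lebesgue)
 have wm: "fminus (w m) (w n) \<in> Hs s U" for m n by (rule Hs_fminus[OF U w w])
 have wdm: "aeq U (wd U is (fminus (w m) (w n))) (fminus (wd U is (w m)) (wd U is (w n)))" if "length is <= ?m" for m n "is"
  using wd_lincomb[OF w w that U(1), of 1 m "-1" n] by (simp add: fminus_eq_lincomb)
 have ex: "\<exists>g\<in>L2 U. (%n. L2norm U (fminus (wd U is (w n)) g)) \<longlonglongrightarrow> 0" if l: "length is <= ?m" for "is"
 proof -
  let ?f = "%n. wd U is (w n)"
  have "\<exists>g\<in>l2 (lebesgue_on U). (%n. ipM (lebesgue_on U) (fminus (?f n) g) (fminus (?f n) g)) \<longlonglongrightarrow> 0"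
  proof (rule l2_complete)
   show "?f n \<in> l2 (lebesgue_on U)" for n using HsD(2)[OF w l] by (simp add: L2_eq_l2)
   fix e :: real assume "0 < e"
   then obtain N where N: "!!m n. N <= m ==> N <= n ==> Hs_norm s U (fminus (w m) (w n)) < sqrt e" using Cau[of "sqrt e"] by auto
   have "ip U (fminus (?f m) (?f n)) (fminus (?f m) (?f n)) < e" if "N <= m" "N <= n" for m n
   proof -
    have "L2norm U (fminus (?f m) (?f n)) = L2norm U (wd U is (fminus (w m) (w n)))" by (rule L2norm_cong[OF wdm[OF l] HsD(2)[OF wm l] Um(2), symmetric])
    also have "... <= Hs_norm s U (fminus (w m) (w n))" by (rule L2norm_wd_le_Hs_norm[OF l])
    also have "... < sqrt e" by (rule N[OF that])
    finally show ?thesis by (simp add: L2norm_def)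
   qed
   thus "\<exists>N. \<forall>m\<ge>N. \<forall>n\<ge>N. ipM (lebesgue_on U) (fminus (?f m) (?f n)) (fminus (?f m) (?f n)) < e" unfolding ip_eq_ipM by blast
  qed
  then obtain g where g: "g \<in> L2 U" "(%n. ip U (fminus (?f n) g) (fminus (?f n) g)) \<longlonglongrightarrow> 0" by (auto simp: L2_eq_l2 ip_eq_ipM)
  from tendsto_real_sqrt[OF g(2)] g(1) show ?thesis by (auto simp: L2norm_def)
 qed
 have der: "\<exists>g. weak_deriv U is w' g & (%n. L2norm U (fminus (wd U is (w n)) g)) \<longlonglongrightarrow> 0" if l: "length is <= ?m" for "is"
  using ex[OF l] weak_deriv_limit[OF U(1) HsD(1)[OF w l] w' _ lim] by blast
 have derw: "weak_deriv U is w' (wd U is w')" if "length is <= ?m" for "is" using der[OF that] wd_weak_deriv by blast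
 have L2lim: "(%n. L2norm U (fminus (wd U is (w n)) (wd U is w'))) \<longlonglongrightarrow> 0" if l: "length is <= ?m" for "is"
 proof -
  obtain g where g: "weak_deriv U is w' g" "(%n. L2norm U (fminus (wd U is (w n)) g)) \<longlonglongrightarrow> 0" using der[OF l] by blast
  have "aeq U (fminus (wd U is (w n)) g) (fminus (wd U is (w n)) (wd U is w'))" for n
   unfolding fminus_eq_lincomb by (intro aeq_lincomb aeq_refl aeq_sym[OF wd_aeq[OF g(1) U(1)]])
  from L2norm_cong[OF this _ Um(2)] have "L2norm U (fminus (wd U is (w n)) g) = L2norm U (fminus (wd U is (w n)) (wd U is w'))" for n
   using HsD(2)[OF w l] weak_derivD(2)[OF g(1)] by (simp add: L2.fminus_mem)
  with g(2) show ?thesis by simp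
 qed
 have wdm': "aeq U (wd U is (fminus (w m) w')) (fminus (wd U is (w m)) (wd U is w'))" if "length is <= ?m" for m "is"
  using wd_aeq[OF weak_deriv_lincomb[OF HsD(1)[OF w that] derw[OF that] U(1)] U(1), of 1 m "-1"] by (simp add: fminus_eq_lincomb)
 have gag: "\<exists>N. \<forall>n\<ge>N. ?G is (fminus (w n) w') <= ennreal e"
  if e: "0 < e" and f: "frac s ~= 0" and l: "length is = ?m" for e "is"
 proof -
  have l': "length is <= ?m" using l by simp
  have "(L2norm U (fminus (wd U is (w n)) (wd U is w')))^2 = ipM (lebesgue_on U) (fminus (wd U is (w n)) (wd U is w')) (fminus (wd U is (w n)) (wd U is w'))" for n
   unfolding L2norm_def ip_eq_ipM[symmetric] by (rule L2.nrm_sq[OF L2.fminus_mem[OF HsD(2)[OF w l'] weak_derivD(2)[OF derw[OF l']]]])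
  with tendsto_power[OF L2lim[OF l'], of 2]
  have "(%n. ipM (lebesgue_on U) (fminus (wd U is (w n)) (wd U is w')) (fminus (wd U is (w n)) (wd U is w'))) \<longlonglongrightarrow> 0" by simp
  from l2_tendsto_AE_subseq[OF _ _ this] obtain r where r: "strict_mono r"
   "AE x in lebesgue_on U. (%k. wd U is (w (r k)) x) \<longlonglongrightarrow> wd U is w' x"
   using HsD(2)[OF w l'] weak_derivD(2)[OF derw[OF l']] unfolding L2_eq_l2 by blast
  \<comment> \<open>This threshold compensates the weight \<open>1 - frac s\<close> with which the
    seminorm enters the norm.\<close>
  have "0 < sqrt ((1 - frac s) * e)" using e frac_bounds[of s] by simp
  then obtain N where N: "!!m n. N <= m ==> N <= n ==> Hs_norm s U (fminus (w m) (w n)) < sqrt ((1 - frac s) * e)" using Cau by meson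
  have "?G is (fminus (w n) w') <= ennreal e" if n: "N <= n" for n
  proof -
   have "gagliardo (frac s) U (fminus (wd U is (w n)) (wd U is w')) <= ennreal e"
   proof (rule gagliardo_le_of_AE_limit[OF Um(1), where g = "%k. fminus (wd U is (w n)) (wd U is (w (r k)))" and K = N])
    show "fminus (wd U is (w n)) (wd U is (w (r k))) \<in> borel_measurable (lebesgue_on U)" for k
     using L2.fminus_mem[OF HsD(2)[OF w l'] HsD(2)[OF w l']] by (rule L2_borel)
    show "AE x in lebesgue_on U. (%k. fminus (wd U is (w n)) (wd U is (w (r k))) x) \<longlonglongrightarrow> fminus (wd U is (w n)) (wd U is w') x"
     using r(2) by eventually_elim (simp add: tendsto_intros)
    fix k assume "N <= k"
    hence k: "N <= r k" using seq_suble[OF r(1), of k] by linarith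
    have "(1 - frac s) * enn2real (?G is (fminus (w n) (w (r k)))) <= (Hs_norm s U (fminus (w n) (w (r k))))^2" by (rule enn2real_gagliardo_le_Hs_norm[OF f l])
    also have "... <= (sqrt ((1 - frac s) * e))^2" using N[OF n k] by (intro power_mono) auto
    also have "... = (1 - frac s) * e" using e frac_bounds[of s] by simp
    finally have *: "enn2real (?G is (fminus (w n) (w (r k)))) <= e" using frac_bounds[of s] mult_le_cancel_left_pos by blast
    have "?G is (fminus (w n) (w (r k))) = ennreal (enn2real (?G is (fminus (w n) (w (r k)))))" using Hs_gagliardo[OF wm f l] by simp
    also have "... <= ennreal e" using * by (rule ennreal_leI)
    finally show "gagliardo (frac s) U (fminus (wd U is (w n)) (wd U is (w (r k)))) <= ennreal e" using gagliardo_cong[OF wdm[OF l']] by simp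
   qed
   thus ?thesis using gagliardo_cong[OF wdm'[OF l']] by simp
  qed
  thus ?thesis by blast
 qed
 have "fminus (w 0) w' \<in> L2 U" using L2.fminus_mem[OF Hs_L2[OF w] w'] .
 show w'Hs: "w' \<in> Hs s U"
 proof -
  have "?G is w' < \<infinity>" if f: "frac s ~= 0" and l: "length is = ?m" for "is"
  proof -
   have l': "length is <= ?m" using l by simp
   obtain n where n: "?G is (fminus (w n) w') <= ennreal 1" using gag[OF zero_less_one f l] by blast
   have "aeq U (wd U is w') (lincomb 1 (wd U is (w n)) (-1) (wd U is (fminus (w n) w')))" using wdm'[OF l', of n] unfolding aeq_def by eventually_elim simp
   hence "?G is w' = gagliardo (frac s) U (lincomb 1 (wd U is (w n)) (-1) (wd U is (fminus (w n) w')))" by (rule gagliardo_cong)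
   also have "... <= ennreal ((1 + 1) * 1^2) * ?G is (w n) + ennreal ((1 + 1 / 1) * (-1)^2) * ?G is (fminus (w n) w')"
   proof (rule gagliardo_lincomb[OF Um(1)])
    show "wd U is (w n) \<in> borel_measurable (lebesgue_on U)" using HsD(2)[OF w l'] by (rule L2_borel)
    show "wd U is (fminus (w n) w') \<in> borel_measurable (lebesgue_on U)"
     using aeq_measurable[OF aeq_sym[OF wdm'[OF l', of n]] L2_borel[OF L2.fminus_mem[OF HsD(2)[OF w l'] weak_derivD(2)[OF derw[OF l']]]] Um(2)] .
   qed simp
   also have "... < \<infinity>" using Hs_gagliardo[OF w f l, of n] le_less_trans[OF n ennreal_less_top] by (simp add: ennreal_mult_less_top)
   finally show ?thesis .
  qed
  thus ?thesis using derw by (auto simp: Hs_def)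
 qed
 have t1: "(%n. (L2norm U (wd U is (fminus (w n) w')))^2) \<longlonglongrightarrow> 0" if l: "length is <= ?m" for "is"
 proof -
  have "L2norm U (wd U is (fminus (w n) w')) = L2norm U (fminus (wd U is (w n)) (wd U is w'))" for n
   by (rule L2norm_cong[OF wdm'[OF l] HsD(2)[OF Hs_fminus[OF U w w'Hs] l] Um(2)])
  thus ?thesis using tendsto_power[OF L2lim[OF l], of 2] by simp
 qed
 have t2: "(%n. enn2real (?G is (fminus (w n) w'))) \<longlonglongrightarrow> 0" if f: "frac s ~= 0" and l: "length is = ?m" for "is"
 proof (rule LIMSEQ_I)
  fix e :: real assume e: "0 < e"
  obtain N where N: "!!n. N <= n ==> ?G is (fminus (w n) w') <= ennreal (e / 2)" using gag[of "e / 2", OF _ f l] e by auto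
  have "norm (enn2real (?G is (fminus (w n) w')) - 0) < e" if "N <= n" for n using enn2real_mono[OF N[OF that]] e by simp
  thus "\<exists>no. \<forall>n\<ge>no. norm (enn2real (?G is (fminus (w n) w')) - 0) < e" by blast
 qed
 have "(%n. (\<Sum>is | length is <= ?m. (L2norm U (wd U is (fminus (w n) w')))^2)) \<longlonglongrightarrow> (\<Sum>is::2 list | length is <= ?m. 0)"
  by (intro tendsto_sum t1) simp
 moreover have "(%n. if frac s = 0 then 0 else (1 - frac s) *
    (\<Sum>is | length is = ?m. enn2real (?G is (fminus (w n) w')))) \<longlonglongrightarrow> 0"
 proof (cases "frac s = 0")
  case False
  have "(%n. (1 - frac s) * (\<Sum>is | length is = ?m. enn2real (?G is (fminus (w n) w')))) \<longlonglongrightarrow> (1 - frac s) * (\<Sum>is::2 list | length is = ?m. 0)"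
   by (intro tendsto_mult tendsto_const tendsto_sum t2[OF False]) simp
  thus ?thesis using False by simp
 qed simp
 ultimately have "(%n. (Hs_norm s U (fminus (w n) w'))^2) \<longlonglongrightarrow> 0 + 0" unfolding Hs_norm_sq by (intro tendsto_add) simp_all
 hence "(%n. sqrt ((Hs_norm s U (fminus (w n) w'))^2)) \<longlonglongrightarrow> sqrt 0" by (intro tendsto_real_sqrt) simp
 thus "(%n. Hs_norm s U (fminus (w n) w')) \<longlonglongrightarrow> 0" by simp
qed

section \<open>Density of smooth functions in Sobolev spaces\<close>

context convex_mollifier
begin

text \<open>The kernel at \<open>x\<close> is a test function on \<open>K\<close>, so the weak
  derivative may be moved onto it. The signs from reflecting the kernel and from the weak derivative
  cancel, and the dilation leaves one factor \<open>lam n\<close> per derivative.\<close>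

lemma dpart_mol:
 assumes w: "weak_deriv K is v g" and x: "x \<in> K"
 shows "dpart (rev is) (mol n v) x = lam n ^ length is * mol n g x"
proof -
 note vL2 = weak_derivD(1)[OF w]
 let ?\<psi> = "%y. mk (eps n) (shr n x - y)"
 have sm: "smooth (mk (eps n))" by (rule test_funD(1)[OF mk_props(1)[OF eps(1)]])
 have "dpart (rev is) (mol n v) x = lam n ^ length is * ip K v (%y. dpart is (mk (eps n)) (shr n x - y))"
  unfolding mol_def dpart_cv[OF vL2 K(2,1) mk_props(1)[OF eps(1)]] mk_props(5)[OF eps(1)] by (simp add: cv_def shr_def)
 also have "ip K v (%y. dpart is (mk (eps n)) (shr n x - y)) = (- 1) ^ length is * ip K v (dpart is ?\<psi>)"
 proof -
  have "ip K v (dpart is ?\<psi>) = (LINT y|lebesgue_on K. (- 1) ^ length is * (v y * dpart is (mk (eps n)) (shr n x - y)))"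
   unfolding dpart_reflect(1)[OF sm] ip_def by (simp only: mult.left_commute)
  also have "... = (- 1) ^ length is * ip K v (%y. dpart is (mk (eps n)) (shr n x - y))" by (simp add: ip_def)
  finally show ?thesis by (simp add: mult.assoc[symmetric] power_mult_distrib[symmetric])
 qed
 also have "... = ip K g ?\<psi>" unfolding weak_derivD(3)[OF w kernel_test_fun[OF x]] by (simp add: mult.assoc[symmetric] power_mult_distrib[symmetric])
 also have "ip K g ?\<psi> = mol n g x" by (simp add: mol_eq ip_def)
 finally show ?thesis .
qed

text \<open>Derivatives of the mollification are mollified derivatives up to a power of
  \<open>lam n\<close>, and that power tends to 1.\<close>

lemma smooth_dense:
 assumes v: "v \<in> Hs (real m) K"
 shows "(%n. Hs_norm (real m) K (fminus (mol n v) v)) \<longlonglongrightarrow> 0"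
proof -
 have vL2: "v \<in> L2 K" by (rule Hs_L2[OF v])
 have lim: "(%n. (L2norm K (wd K is (fminus (mol n v) v)))^2) \<longlonglongrightarrow> 0" if l: "length is <= m" for "is"
 proof -
  define g where "g = wd K is v"
  have w: "weak_deriv K is v g" "g \<in> L2 K" unfolding g_def using HsD(1,2)[OF v] l by auto
  have "weak_deriv K is (fminus (mol n v) v) (fminus (dpart (rev is) (mol n v)) g)" for n
   unfolding fminus_eq_lincomb by (rule weak_deriv_lincomb[OF smooth_weak_deriv[OF mol_smooth[OF vL2] K(2,1)] w(1) K(1)])
  from wd_aeq[OF this K(1)] have "aeq K (wd K is (fminus (mol n v) v)) (fminus (dpart (rev is) (mol n v)) g)" for n .
  moreover have "aeq K (fminus (dpart (rev is) (mol n v)) g) (lincomb (lam n ^ length is) (mol n g) (-1) g)" for n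
   unfolding aeq_def by (rule AE_I2) (simp add: dpart_mol[OF w(1)])
  ultimately have ae: "aeq K (lincomb (lam n ^ length is) (mol n g) (-1) g) (wd K is (fminus (mol n v) v))" for n using aeq_trans aeq_sym by blast
  have L: "lincomb (lam n ^ length is) (mol n g) (-1) g \<in> L2 K" for n by (intro L2.lincomb_mem mol_L2 w(2))
  have "L2norm K (wd K is (fminus (mol n v) v)) <= L2norm K (fminus (mol n g) g) + (1 - lam n ^ length is) * L2norm K g" for n
  proof -
   have p: "0 <= lam n ^ length is" "lam n ^ length is <= 1" using lam[of n] power_le_one[of "lam n"] by auto
   have eq: "lincomb (lam n ^ length is) (mol n g) (-1) g = lincomb (lam n ^ length is) (fminus (mol n g) g) (lam n ^ length is - 1) g"
    by (simp add: fun_eq_iff algebra_simps)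
   have "L2norm K (wd K is (fminus (mol n v) v)) = L2norm K (lincomb (lam n ^ length is) (mol n g) (-1) g)" by (rule L2norm_cong[OF ae L Km(1), symmetric])
   also have "... <= \<bar>lam n ^ length is\<bar> * L2norm K (fminus (mol n g) g) + \<bar>lam n ^ length is - 1\<bar> * L2norm K g"
    unfolding eq L2norm_def by (intro L2.nrm_lincomb L2.fminus_mem mol_L2 w(2))
   also have "... <= L2norm K (fminus (mol n g) g) + (1 - lam n ^ length is) * L2norm K g" using p by (intro add_mono) (auto simp: mult_left_le_one_le)
   finally show ?thesis .
  qed
  hence ev: "\<forall>\<^sub>F n in sequentially. norm (L2norm K (wd K is (fminus (mol n v) v))) <= L2norm K (fminus (mol n g) g) + (1 - lam n ^ length is) * L2norm K g"
   by (intro always_eventually allI) simp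
  have "(%n. L2norm K (fminus (mol n g) g) + (1 - lam n ^ length is) * L2norm K g) \<longlonglongrightarrow> 0 + (1 - 1 ^ length is) * L2norm K g"
   by (intro tendsto_intros mol_tendsto w(2) lam_tendsto)
  hence "(%n. L2norm K (fminus (mol n g) g) + (1 - lam n ^ length is) * L2norm K g) \<longlonglongrightarrow> 0" by simp
  with ev have "(%n. L2norm K (wd K is (fminus (mol n v) v))) \<longlonglongrightarrow> 0" by (rule Lim_null_comparison)
  from tendsto_power[OF this, of 2] show ?thesis by simp
 qed
 have "(%n. \<Sum>is | length is <= m. (L2norm K (wd K is (fminus (mol n v) v)))^2) \<longlonglongrightarrow> (\<Sum>is::2 list | length is <= m. 0)"
  by (intro tendsto_sum lim) simp
 hence "(%n. sqrt (\<Sum>is | length is <= m. (L2norm K (wd K is (fminus (mol n v) v)))^2)) \<longlonglongrightarrow> sqrt 0" by (intro tendsto_real_sqrt) simp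
 thus ?thesis by (simp add: Hs_norm_def)
qed

end

subsection \<open>Trace inequalities on triangles\<close>

text \<open>Determinant with columns \<open>b\<close> and \<open>c\<close>: the signed area of the
  parallelogram they span.\<close>

definition cross2 :: "pt => pt => real" where
 "cross2 b c = b $ 1 * c $ 2 - b $ 2 * c $ 1"

definition vec2 :: "real \<times> real => pt" where
 "vec2 p = (\<chi> i. if i = 1 then fst p else snd p)"

lemma vec2_nth [simp]: "vec2 p $ 1 = fst p" "vec2 p $ 2 = snd p" by (auto simp: vec2_def)

lemma vec2_borel: "vec2 \<in> borel_measurable borel"
proof (rule borel_measurable_continuous_onI)
 have "continuous_on UNIV (%p::real \<times> real. if i = 1 then fst p else snd p)" for i :: 2 by (cases "i = 1") (auto intro: continuous_intros)
 thus "continuous_on UNIV vec2" unfolding vec2_def by (intro continuous_on_vec_lambda)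
qed

text \<open>Transfers the product measure on pairs to the plane of vectors, so that Fubini's theorem
  can be used in oblique coordinates.\<close>

lemma lborel_vector: "distr lborel borel vec2 = (lborel :: pt measure)"
proof (rule sym, rule lborel_eqI)
 fix l u :: pt assume lu: "!!b. b \<in> Basis ==> l \<bullet> b <= u \<bullet> b"
 have le: "l $ i <= u $ i" for i using lu[of "axis i 1"] by (simp add: inner_axis)
 have m: "vec2 \<in> borel_measurable (lborel :: (real \<times> real) measure)" using vec2_borel by simp
 have "emeasure (distr lborel borel vec2) (box l u)
   = emeasure lborel (vec2 -` box l u)" using m by (subst emeasure_distr) auto
 also have "vec2 -` box l u = box (l $ 1, l $ 2) (u $ 1, u $ 2)"
 proof -
  have "vec2 -` box l u = {p. fst p \<in> {l $ 1<..<u $ 1} & snd p \<in> {l $ 2<..<u $ 2}}" by (auto simp: mem_box_2)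
  thus ?thesis by (auto simp: box_def Basis_prod_def)
 qed
 also have "emeasure lborel ... = ennreal ((u $ 1 - l $ 1) * (u $ 2 - l $ 2))"
  using le by (subst emeasure_lborel_box) (auto simp: Basis_prod_def prod.union_disjoint)
 also have "(u $ 1 - l $ 1) * (u $ 2 - l $ 2) = (\<Prod>b\<in>Basis. (u - l) \<bullet> b)"
  using prod.reindex[of "%i::2. axis i (1::real)" UNIV "%b. (u - l) \<bullet> b"] by (simp add: Basis_vec_def UNIV_2 inner_axis axis_eq_axis inj_on_def)
 finally show "emeasure (distr lborel borel vec2) (box l u) = ennreal (\<Prod>b\<in>Basis. (u - l) \<bullet> b)" .
qed simp

lemma lborel_linear:
 assumes "cross2 b c ~= 0"
 shows "lborel = density (distr lborel borel (%x::pt. x $ 1 *\<^sub>R b + x $ 2 *\<^sub>R c)) (%_. ennreal \<bar>cross2 b c\<bar>)"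
proof (rule lborel_eqI)
 let ?T = "%x::pt. x $ 1 *\<^sub>R b + x $ 2 *\<^sub>R c"
 have lin: "linear ?T" by (rule linearI) (simp_all add: algebra_simps)
 have det: "det (matrix ?T) = cross2 b c" by (simp add: det_2 matrix_def cross2_def axis_def)
 hence inv: "bij ?T" using assms det_nz_iff_inj[OF lin] linear_injective_imp_surjective[OF lin] by (simp add: bij_def)
 have m: "?T \<in> borel_measurable borel" using lin by (intro borel_measurable_continuous_onI linear_continuous_on) (simp add: linear_conv_bounded_linear)
 fix l u :: pt assume lu: "!!b. b \<in> Basis ==> l \<bullet> b <= u \<bullet> b"
 let ?S = "?T -` box l u"
 obtain G where G: "linear G" "!!x. G (?T x) = x" "!!x. ?T (G x) = x" using linear_injective_isomorphism[OF lin] inv by (auto simp: bij_def)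
 have "G ` box l u \<in> lmeasurable" by (intro measurable_linear_image G) auto
 moreover have "?S = G ` box l u"
 proof (intro set_eqI iffI)
  fix x assume "x \<in> ?S"
  thus "x \<in> G ` box l u" using imageI[of "?T x" "box l u" G] unfolding G(2) by simp
 next
  fix x assume "x \<in> G ` box l u"
  then obtain y where y: "x = G y" "y \<in> box l u" by blast
  show "x \<in> ?S" using y(2) G(3)[of y] unfolding y(1) vimage_def mem_Collect_eq by simp
 qed
 ultimately have S: "?S \<in> lmeasurable" by simp
 have Sb: "?S \<in> sets borel" using measurable_sets[OF m, of "box l u"] by simp
 have "measure lebesgue (box l u) = \<bar>cross2 b c\<bar> * measure lebesgue ?S"
  using measure_linear_image[OF lin S] det inv by (simp add: surj_image_vimage_eq bij_is_surj)
 hence "ennreal (measure lborel (box l u)) = ennreal \<bar>cross2 b c\<bar> * ennreal (measure lebesgue ?S)" by (simp add: ennreal_mult measure_completion)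
 also have "ennreal (measure lebesgue ?S) = emeasure lborel ?S" using emeasure_eq_measure2[OF S] Sb by simp
 finally have "emeasure (density (distr lborel borel ?T) (%_. ennreal \<bar>cross2 b c\<bar>)) (box l u) = ennreal (measure lborel (box l u))"
  using m by (simp add: emeasure_density nn_integral_cmult emeasure_distr)
 also have "measure lborel (box l u) = (\<Prod>b\<in>Basis. (u - l) \<bullet> b)" using lu by (simp add: measure_lborel_box_eq)
 finally show "emeasure (density (distr lborel borel ?T) (%_. ennreal \<bar>cross2 b c\<bar>)) (box l u) = ennreal (\<Prod>b\<in>Basis. (u - l) \<bullet> b)" .
qed simp

lemma nn_integral_parallelogram:
 fixes F :: "pt => ennreal"
 assumes F: "F \<in> borel_measurable borel" and d: "cross2 b c ~= 0"
 shows "(\<integral>\<^sup>+x. F x \<partial>lborel) = ennreal \<bar>cross2 b c\<bar> * (\<integral>\<^sup>+s. \<integral>\<^sup>+t. F (z + s *\<^sub>R b + t *\<^sub>R c) \<partial>lborel \<partial>lborel)"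
proof -
 let ?T = "%x::pt. x $ 1 *\<^sub>R b + x $ 2 *\<^sub>R c"
 have Tm[measurable]: "?T \<in> borel_measurable borel" by (intro borel_measurable_continuous_onI) (intro continuous_intros)
 have [measurable]: "F \<in> borel_measurable borel" by (rule F)
 have vm: "vec2 \<in> borel_measurable (lborel :: (real \<times> real) measure)" using vec2_borel by simp
 have "(\<integral>\<^sup>+x. F x \<partial>lborel) = (\<integral>\<^sup>+x. F x \<partial>distr lborel borel ((+) z))" by (simp add: lborel_distr_plus)
 also have "... = (\<integral>\<^sup>+x. F (z + x) \<partial>lborel)" by (subst nn_integral_distr) auto
 also have "... = (\<integral>\<^sup>+x. F (z + x) \<partial>density (distr lborel borel ?T) (%_. ennreal \<bar>cross2 b c\<bar>))"
  using lborel_linear[OF d] by simp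
 also have "... = ennreal \<bar>cross2 b c\<bar> * (\<integral>\<^sup>+x. F (z + ?T x) \<partial>lborel)"
  by (simp add: nn_integral_density nn_integral_distr nn_integral_cmult)
 also have "(\<integral>\<^sup>+x. F (z + ?T x) \<partial>lborel) = (\<integral>\<^sup>+x. F (z + ?T x) \<partial>distr lborel borel vec2)"
  unfolding lborel_vector ..
 also have "... = (\<integral>\<^sup>+p. F (z + fst p *\<^sub>R b + snd p *\<^sub>R c) \<partial>(lborel :: (real \<times> real) measure))"
  using vm by (subst nn_integral_distr) (auto simp: split_beta add.assoc)
 also have "... = (\<integral>\<^sup>+p. F (z + fst p *\<^sub>R b + snd p *\<^sub>R c) \<partial>(lborel \<Otimes>\<^sub>M lborel))" by (simp add: lborel_prod)
 also have "... = (\<integral>\<^sup>+s. \<integral>\<^sup>+t. F (z + s *\<^sub>R b + t *\<^sub>R c) \<partial>lborel \<partial>lborel)"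
  by (subst lborel.nn_integral_fst[symmetric]) auto
 finally show ?thesis .
qed

text \<open>Integrate the derivative of \<open>(1 - t) F\<^sup>2\<close>.\<close>

lemma endpoint_square_le:
 fixes F :: "real => real"
 assumes d: "!!t. (F has_real_derivative F' t) (at t)" and c: "continuous_on UNIV F'"
 shows "ennreal ((F 0)^2) <= (\<integral>\<^sup>+t. ennreal (2 * (F t)^2 + (F' t)^2) * indicator {0..1} t \<partial>lborel)"
proof -
 have Fc: "continuous_on UNIV F" using d DERIV_isCont continuous_at_imp_continuous_on by blast
 have iF: "isCont F t" "isCont F' t" for t using Fc c by (auto simp: continuous_on_eq_continuous_at)
 let ?g' = "%t. 2 * (1 - t) * F t * F' t - (F t)\<^sup>2"
 have "(LINT t|lborel. ?g' t * indicator {0..1} t) = (1 - 1) * (F 1)^2 - (1 - 0) * (F 0)^2"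
  by (rule integral_FTC_Icc_real) (auto intro!: derivative_eq_intros d continuous_intros iF)
 hence "(F 0)^2 = (LINT t|lborel. - (?g' t * indicator {0..1} t))" by simp
 also have "... <= (LINT t|lborel. (2 * (F t)^2 + (F' t)^2) * indicator {0..1} t)"
 proof (rule integral_mono)
  show "integrable lborel (%t. - (?g' t * indicator {0..1} t))"
   by (intro Bochner_Integration.integrable_minus borel_integrable_atLeastAtMost) (auto intro!: continuous_intros iF)
  show "integrable lborel (%t. (2 * (F t)^2 + (F' t)^2) * indicator {0..1} t)" by (intro borel_integrable_atLeastAtMost) (auto intro!: continuous_intros iF)
  fix t
  have "- (2 * (1 - t) * F t * F' t) <= (F t)^2 + (F' t)^2" if "0 <= t" "t <= 1"
  proof -
   have "0 <= (F t + (1 - t) * F' t)^2" by simp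
   hence "- (2 * (1 - t) * F t * F' t) <= (F t)^2 + (1 - t)^2 * (F' t)^2" by (simp add: power2_eq_square algebra_simps)
   also have "(1 - t)^2 * (F' t)^2 <= 1 * (F' t)^2" using that by (intro mult_right_mono) (auto simp: power_le_one)
   finally show ?thesis by simp
  qed
  thus "- (?g' t * indicator {0..1} t) <= (2 * (F t)^2 + (F' t)^2) * indicator {0..1} t" by (auto simp: indicator_def)
 qed
 finally have "ennreal ((F 0)^2) <= ennreal (LINT t|lborel. (2 * (F t)^2 + (F' t)^2) * indicator {0..1} t)" by (rule ennreal_leI)
 also have "... = (\<integral>\<^sup>+t. ennreal ((2 * (F t)^2 + (F' t)^2) * indicator {0..1} t) \<partial>lborel)"
  by (intro nn_integral_eq_integral[symmetric] borel_integrable_atLeastAtMost) (auto intro!: continuous_intros iF)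
 also have "... = (\<integral>\<^sup>+t. ennreal (2 * (F t)^2 + (F' t)^2) * indicator {0..1} t \<partial>lborel)"
  by (intro nn_integral_cong) (auto simp: indicator_def)
 finally show ?thesis .
qed

definition ddir :: "pt => fn => fn" where
 "ddir c \<phi> x = (\<Sum>i\<in>UNIV. c $ i * dpart [i] \<phi> x)"

lemma ddir_sq_le: "(ddir c \<phi> x)^2 <= 2 * (norm c)^2 * ((dpart [1] \<phi> x)^2 + (dpart [2] \<phi> x)^2)"
proof -
 have c: "(c $ i)^2 <= (norm c)^2" for i using component_le_norm_cart[of c i] by (simp add: abs_le_square_iff[symmetric])
 have "(ddir c \<phi> x)^2 <= 2 * ((c $ 1 * dpart [1] \<phi> x)^2 + (c $ 2 * dpart [2] \<phi> x)^2)"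
  using quasi_triangle_square[of 1 "c $ 1 * dpart [1] \<phi> x" "c $ 2 * dpart [2] \<phi> x"] by (simp add: ddir_def sum_2)
 also have "... <= 2 * ((norm c)^2 * (dpart [1] \<phi> x)^2 + (norm c)^2 * (dpart [2] \<phi> x)^2)"
  unfolding power_mult_distrib by (intro mult_left_mono add_mono mult_right_mono c) auto
 finally show ?thesis by (simp add: algebra_simps)
qed

lemma ddir_continuous: "smooth \<phi> ==> continuous_on S (ddir c \<phi>)" unfolding ddir_def by (intro continuous_intros smooth_continuous)

text \<open>A nondegenerate parallelogram with corner \<open>z\<close> that fits into the closure of
  \<open>K\<close>. One-dimensional estimates along its sides replace a reference triangle with
  affine maps.\<close>

definition good_par :: "pt set => pt => pt => pt => bool" where
 "good_par K z b c \<longleftrightarrow> cross2 b c ~= 0 & (\<forall>s\<in>{0..1}. \<forall>t\<in>{0..1}. z + s *\<^sub>R b + t *\<^sub>R c \<in> closure K)"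

text \<open>The denominator is the Jacobian of the oblique coordinates; the numerator combines the
  weight 2 of the function in \<open>endpoint_square_le\<close> with the bound
  \<open>ddir_sq_le\<close> for the derivative along \<open>c\<close>.\<close>

definition par_const :: "pt => pt => real" where
 "par_const b c = (2 + 2 * (norm c)^2) / \<bar>cross2 b c\<bar>"

lemma par_const_nonneg: "0 <= par_const b c" by (simp add: par_const_def)

lemma Hs_norm_1_smooth:
 assumes "smooth \<phi>" "open K" "bounded K"
 shows "(Hs_norm 1 K \<phi>)^2 = (L2norm K \<phi>)^2 + ((L2norm K (dpart [1] \<phi>))^2 + (L2norm K (dpart [2] \<phi>))^2)"
proof -
 have *: "L2norm K (wd K is \<phi>) = L2norm K (dpart (rev is) \<phi>)" for "is" using smooth_weak_deriv[OF assms(1,3,2), of "is"] wd_weak_deriv weak_derivD(2)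
  by (intro L2norm_cong wd_aeq assms(2) open_lebesgue) blast+
 have "{is :: 2 list. length is <= 1} = {[], [1], [2]}"
 proof -
  have "is \<in> {[], [1], [2]}" if "length is <= 1" for "is" :: "2 list" using that exhaust_2 by (cases "is") (auto simp: length_Suc_conv)
  thus ?thesis by auto
 qed
 thus ?thesis unfolding Hs_norm_sq by (simp add: *)
qed

text \<open>From every point of the side \<open>b\<close> the endpoint estimate is applied in
  direction \<open>c\<close>; integrating along the side produces an integral over the
  parallelogram.\<close>

lemma trace_segment:
 assumes \<phi>: "smooth \<phi>" and K: "open K" "bounded K" "convex K" and P: "good_par K z b c"
 shows "(\<integral>\<^sup>+s. ennreal ((\<phi> (z + s *\<^sub>R b))^2) * indicator {0..1} s \<partial>lborel) <= ennreal (par_const b c * (Hs_norm 1 K \<phi>)^2)"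
proof -
 define H where "H x = 2 * (\<phi> x)^2 + (ddir c \<phi> x)^2" for x
 have \<phi>c: "continuous_on S \<phi>" for S using smooth_continuous[OF \<phi>, of S "[]"] by simp
 have Hc: "continuous_on UNIV H" unfolding H_def by (intro continuous_intros \<phi>c ddir_continuous[OF \<phi>])
 let ?I = "indicator (closure K) :: pt => ennreal"
 let ?F = "%x. ennreal (H x) * ?I x"
 have Fm: "?F \<in> borel_measurable borel" using borel_measurable_continuous_onI[OF Hc] by (intro borel_measurable_times_ennreal) auto
 have "(\<integral>\<^sup>+s. ennreal ((\<phi> (z + s *\<^sub>R b))^2) * indicator {0..1} s \<partial>lborel) <= (\<integral>\<^sup>+s. \<integral>\<^sup>+t. ?F (z + s *\<^sub>R b + t *\<^sub>R c) \<partial>lborel \<partial>lborel)"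
 proof (rule nn_integral_mono)
  fix s :: real
  show "ennreal ((\<phi> (z + s *\<^sub>R b))^2) * indicator {0..1} s <= (\<integral>\<^sup>+t. ?F (z + s *\<^sub>R b + t *\<^sub>R c) \<partial>lborel)"
  proof (cases "s \<in> {0..1}")
   case True
   let ?G = "%t. \<phi> (z + s *\<^sub>R b + t *\<^sub>R c)"
   have "ennreal ((?G 0)^2) <= (\<integral>\<^sup>+t. ennreal (2 * (?G t)^2 + (ddir c \<phi> (z + s *\<^sub>R b + t *\<^sub>R c))^2) * indicator {0..1} t \<partial>lborel)"
   proof (rule endpoint_square_le)
    show "(?G has_real_derivative ddir c \<phi> (z + s *\<^sub>R b + t *\<^sub>R c)) (at t)" for t
     unfolding ddir_def by (rule smooth_line_has_derivative[OF \<phi>])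
    show "continuous_on UNIV (%t. ddir c \<phi> (z + s *\<^sub>R b + t *\<^sub>R c))"
     by (intro continuous_on_compose2[OF ddir_continuous[OF \<phi>, of UNIV]] continuous_intros) auto
   qed
   also have "... <= (\<integral>\<^sup>+t. ?F (z + s *\<^sub>R b + t *\<^sub>R c) \<partial>lborel)"
    using P True by (intro nn_integral_mono) (auto simp: indicator_def good_par_def H_def)
   finally show ?thesis using True by simp
  qed simp
 qed
 also have "... = ennreal (1 / \<bar>cross2 b c\<bar>) * (\<integral>\<^sup>+x. ?F x \<partial>lborel)" using P nn_integral_parallelogram[OF Fm, of b c z]
  by (simp add: good_par_def mult.assoc[symmetric] flip: ennreal_mult)
 also have "(\<integral>\<^sup>+x. ?F x \<partial>lborel) = (\<integral>\<^sup>+x. ennreal (H x) \<partial>lebesgue_on K)"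
 proof -
  have neg: "AE x in lebesgue. x \<notin> frontier K" using negligible_convex_frontier[OF K(3)] unfolding negligible_iff_null_sets by (rule AE_not_in)
  have "(\<integral>\<^sup>+x. ?F x \<partial>lborel) = (\<integral>\<^sup>+x. ?F x \<partial>lebesgue)" using Fm by (simp add: nn_integral_completion)
  also have "... = (\<integral>\<^sup>+x. ennreal (H x) * indicator K x \<partial>lebesgue)"
   using neg by (intro nn_integral_cong_AE) (auto simp: indicator_def frontier_def interior_open[OF K(1)] closure_subset[THEN subsetD] elim!: eventually_mono)
  also have "... = (\<integral>\<^sup>+x. ennreal (H x) \<partial>lebesgue_on K)" using open_lebesgue[OF K(1)] by (simp add: nn_integral_restrict_space)
  finally show ?thesis .
 qed
 also have "... <= ennreal ((2 + 2 * (norm c)^2) * (Hs_norm 1 K \<phi>)^2)"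
 proof -
  have m: "\<phi> \<in> L2 K" "dpart [1] \<phi> \<in> L2 K" "dpart [2] \<phi> \<in> L2 K"
   using smooth_L2[OF \<phi> K(2) open_lebesgue[OF K(1)]] dpart.simps(1) by metis+
  have i: "integrable (lebesgue_on K) (%x. (\<phi> x)^2 + ((dpart [1] \<phi> x)^2 + (dpart [2] \<phi> x)^2))" using m by (auto simp: L2_def)
  have "(\<integral>\<^sup>+x. ennreal (H x) \<partial>lebesgue_on K) <= (\<integral>\<^sup>+x. ennreal ((2 + 2 * (norm c)^2) * ((\<phi> x)^2 + ((dpart [1] \<phi> x)^2 + (dpart [2] \<phi> x)^2))) \<partial>lebesgue_on K)"
  proof (intro nn_integral_mono ennreal_leI)
   fix x
   have "H x <= 2 * (\<phi> x)^2 + 2 * (norm c)^2 * ((dpart [1] \<phi> x)^2 + (dpart [2] \<phi> x)^2)" unfolding H_def using ddir_sq_le[of c \<phi> x] by simp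
   also have "... <= (2 + 2 * (norm c)^2) * ((\<phi> x)^2 + ((dpart [1] \<phi> x)^2 + (dpart [2] \<phi> x)^2))" unfolding distrib_left distrib_right by simp
   finally show "H x <= (2 + 2 * (norm c)^2) * ((\<phi> x)^2 + ((dpart [1] \<phi> x)^2 + (dpart [2] \<phi> x)^2))" .
  qed
  also have "... = ennreal (LINT x|lebesgue_on K. (2 + 2 * (norm c)^2) * ((\<phi> x)^2 + ((dpart [1] \<phi> x)^2 + (dpart [2] \<phi> x)^2)))"
   using i by (intro nn_integral_eq_integral) auto
  also have "(LINT x|lebesgue_on K. (2 + 2 * (norm c)^2) * ((\<phi> x)^2 + ((dpart [1] \<phi> x)^2 + (dpart [2] \<phi> x)^2))) = (2 + 2 * (norm c)^2) * (Hs_norm 1 K \<phi>)^2"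
   unfolding Hs_norm_1_smooth[OF \<phi> K(1,2)] L2norm_sq using m by (simp add: L2_def)
  finally show ?thesis .
 qed
 finally show ?thesis by (simp add: par_const_def mult_left_mono ennreal_mult[symmetric] flip: ennreal_mult) 
qed

text \<open>The first-order norm has three terms, each of which occurs in the second-order norm;
  hence the factor 3.\<close>

lemma Hs_norm_1_dpart_le:
 assumes \<phi>: "smooth \<phi>" and K: "open K" "bounded K"
 shows "(Hs_norm 1 K (dpart [i] \<phi>))^2 <= 3 * (Hs_norm 2 K \<phi>)^2" and "(Hs_norm 1 K \<phi>)^2 <= 3 * (Hs_norm 2 K \<phi>)^2"
proof -
 have *: "(L2norm K (dpart is \<phi>))^2 <= (Hs_norm 2 K \<phi>)^2" if "length is <= 2" for "is"
 proof -
  have w: "weak_deriv K (rev is) \<phi> (dpart is \<phi>)" using smooth_weak_deriv[OF \<phi> K(2,1), of "rev is"] by simp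
  have "L2norm K (dpart is \<phi>) = L2norm K (wd K (rev is) \<phi>)"
   by (rule L2norm_cong[OF aeq_sym[OF wd_aeq[OF w K(1)]] weak_derivD(2)[OF w] open_lebesgue[OF K(1)]])
  also have "... <= Hs_norm 2 K \<phi>" by (rule L2norm_wd_le_Hs_norm) (use that in simp)
  finally show ?thesis by (rule power_mono) simp
 qed
 have e: "dpart [j] (dpart [i] \<phi>) = dpart [j, i] \<phi>" for i j by (simp add: dpart.simps)
 show "(Hs_norm 1 K (dpart [i] \<phi>))^2 <= 3 * (Hs_norm 2 K \<phi>)^2" unfolding Hs_norm_1_smooth[OF smooth_dpart[OF \<phi>] K] e 
  using *[of "[i]", OF _] *[of "[1, i]", OF _] *[of "[2, i]", OF _] by (simp only: list.size) linarith
 show "(Hs_norm 1 K \<phi>)^2 <= 3 * (Hs_norm 2 K \<phi>)^2"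
  
  unfolding Hs_norm_1_smooth[OF \<phi> K] using *[of "[]"] *[of "[1]"] *[of "[2]"] by (simp only: list.size dpart.simps(1)) linarith
qed

text \<open>The endpoint estimate along \<open>b\<close> bounds the point value by traces of the
  function and of its gradient on that side, and each trace costs one more derivative by
  \<open>trace_segment\<close>. The function has weight 2 and each of the two partial derivatives
  weight \<open>2 (norm b)^2\<close>; multiplied by 3 from \<open>Hs_norm_1_dpart_le\<close> this
  gives the constant.\<close>

lemma sup_bound:
 assumes \<phi>: "smooth \<phi>" and K: "open K" "bounded K" "convex K" and P: "good_par K z b c"
 shows "\<bar>\<phi> z\<bar> <= sqrt (par_const b c * (6 + 12 * (norm b)^2)) * Hs_norm 2 K \<phi>"
proof -
 let ?J = "%\<psi>. \<integral>\<^sup>+s. ennreal ((\<psi> (z + s *\<^sub>R b))^2) * indicator {0..1} s \<partial>lborel"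
 let ?C = "par_const b c" and ?N = "(Hs_norm 2 K \<phi>)^2" and ?B = "(norm b)^2"
 have \<phi>c: "continuous_on UNIV (%s. dpart is \<phi> (z + s *\<^sub>R b))" for "is"
  by (intro continuous_on_compose2[OF smooth_continuous[OF \<phi>, of UNIV]] continuous_intros) auto
 have jm: "(%s. ennreal ((dpart is \<phi> (z + s *\<^sub>R b))^2) * indicator {0..1} s) \<in> borel_measurable lborel" for "is"
  using borel_measurable_continuous_onI[OF \<phi>c[of "is"]] by measurable
 have le: "?J \<psi> <= ennreal (?C * (3 * ?N))" if "smooth \<psi>" "(Hs_norm 1 K \<psi>)^2 <= 3 * ?N" for \<psi>
 proof -
  have "?J \<psi> <= ennreal (?C * (Hs_norm 1 K \<psi>)^2)" by (rule trace_segment[OF that(1) K P])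
  also have "... <= ennreal (?C * (3 * ?N))" by (intro ennreal_leI mult_left_mono that par_const_nonneg)
  finally show ?thesis .
 qed
 have "ennreal ((\<phi> (z + 0 *\<^sub>R b))^2) <= (\<integral>\<^sup>+s. ennreal (2 * (\<phi> (z + s *\<^sub>R b))^2 + (ddir b \<phi> (z + s *\<^sub>R b))^2) * indicator {0..1} s \<partial>lborel)"
 proof (rule endpoint_square_le)
  show "((%s. \<phi> (z + s *\<^sub>R b)) has_real_derivative ddir b \<phi> (z + s *\<^sub>R b)) (at s)" for s
   unfolding ddir_def by (rule smooth_line_has_derivative[OF \<phi>])
  show "continuous_on UNIV (%s. ddir b \<phi> (z + s *\<^sub>R b))" unfolding ddir_def by (intro continuous_intros \<phi>c)
 qed
 also have "... <= (\<integral>\<^sup>+s. ennreal 2 * (ennreal ((dpart [] \<phi> (z + s *\<^sub>R b))^2) * indicator {0..1} s) + ennreal (2 * ?B) *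
   (ennreal ((dpart [1] \<phi> (z + s *\<^sub>R b))^2) * indicator {0..1} s + ennreal ((dpart [2] \<phi> (z + s *\<^sub>R b))^2) * indicator {0..1} s) \<partial>lborel)"
 proof (rule nn_integral_mono)
  fix s :: real
  let ?x = "z + s *\<^sub>R b"
  have "ennreal (2 * (\<phi> ?x)^2 + (ddir b \<phi> ?x)^2) <= ennreal (2 * (\<phi> ?x)^2 + 2 * ?B * ((dpart [1] \<phi> ?x)^2 + (dpart [2] \<phi> ?x)^2))"
   using ddir_sq_le[of b \<phi> ?x] by (intro ennreal_leI) simp
  also have "... = ennreal 2 * ennreal ((\<phi> ?x)^2) + ennreal (2 * ?B) * (ennreal ((dpart [1] \<phi> ?x)^2) + ennreal ((dpart [2] \<phi> ?x)^2))"
   by (simp add: ennreal_plus ennreal_mult del: ennreal_numeral)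
  finally show "ennreal (2 * (\<phi> ?x)^2 + (ddir b \<phi> ?x)^2) * indicator {0..1} s <= ennreal 2 * (ennreal ((dpart [] \<phi> ?x)^2) * indicator {0..1} s) + ennreal (2 * ?B) *
   (ennreal ((dpart [1] \<phi> ?x)^2) * indicator {0..1} s + ennreal ((dpart [2] \<phi> ?x)^2) * indicator {0..1} s)" by (auto simp: indicator_def)
 qed
 also have "... = ennreal 2 * ?J (dpart [] \<phi>) + ennreal (2 * ?B) * (?J (dpart [1] \<phi>) + ?J (dpart [2] \<phi>))"
  using jm[of "[]"] jm[of "[1]"] jm[of "[2]"] by (subst nn_integral_add; (subst nn_integral_cmult)?; (subst nn_integral_add)?; simp add: nn_integral_cmult nn_integral_add)
 also have "... <= ennreal 2 * ennreal (?C * (3 * ?N)) + ennreal (2 * ?B) * (ennreal (?C * (3 * ?N)) + ennreal (?C * (3 * ?N)))"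
  using Hs_norm_1_dpart_le[OF \<phi> K(1,2)] \<phi> by (intro add_mono mult_left_mono le smooth_dpart) auto
 also have "... = ennreal (?C * (6 + 12 * ?B) * ?N)"
  using par_const_nonneg[of b c] by (simp add: ennreal_mult[symmetric] ennreal_plus[symmetric] algebra_simps del: ennreal_plus ennreal_numeral)
 finally have "(\<phi> z)^2 <= ?C * (6 + 12 * ?B) * ?N" using par_const_nonneg[of b c] by simp
 hence "sqrt ((\<phi> z)^2) <= sqrt (?C * (6 + 12 * ?B) * ?N)" by (rule real_sqrt_le_mono)
 thus ?thesis by (simp add: real_sqrt_mult)
qed

lemma cross2_zero: assumes "cross2 b c = 0" "b ~= 0" shows "\<exists>m. c = m *\<^sub>R b"
proof (cases "b $ 1 = 0")
 case False
 hence "c = (c $ 1 / b $ 1) *\<^sub>R b" using assms by (simp add: vec_eq_iff forall_2 cross2_def field_simps)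
 thus ?thesis by blast
next
 case True
 hence b2: "b $ 2 ~= 0" using assms(2) by (auto simp: vec_eq_iff forall_2)
 hence "c $ 1 = 0" using assms True by (simp add: cross2_def)
 hence "c = (c $ 2 / b $ 2) *\<^sub>R b" using True b2 by (simp add: vec_eq_iff forall_2)
 thus ?thesis by blast
qed

section \<open>Sobolev embedding and point values on a triangle\<close>

locale triangle =
 fixes k :: "pt set"
 assumes card3: "card k = 3" and indep: "\<not> affine_dependent k"
begin

abbreviation "K \<equiv> tri k"

lemma K_props: "open K" "bounded K" "convex K" "K ~= {}" "closure K = convex hull k" "compact (convex hull k)"
proof -
 have fin: "finite k" using card3 by (intro card_ge_0_finite) simp
 show "open K" "convex K" by (auto simp: tri_def convex_interior)
 show "compact (convex hull k)" using fin by (rule finite_imp_compact_convex_hull)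
 thus "bounded K" unfolding tri_def by (meson bounded_subset compact_imp_bounded interior_subset)
 show ne: "K ~= {}" unfolding tri_def using card3 indep by (subst interior_convex_hull_eq_empty) auto
 show "closure K = convex hull k"
  using convex_closure_interior[OF convex_convex_hull, of k] ne \<open>compact (convex hull k)\<close> by (simp add: tri_def compact_imp_closed)
qed

lemma K_leb: "K \<in> sets lebesgue" by (rule open_lebesgue[OF K_props(1)])

lemma mollifier_ex: "\<exists>c r. convex_mollifier K c r"
proof -
 obtain c where "c \<in> K" using K_props(4) by blast
 then obtain r where "0 < r" "ball c r \<subseteq> K" using K_props(1) by (meson open_contains_ball)
 thus ?thesis using K_props unfolding convex_mollifier_def by blast
qed

lemma vertex_cross:
 assumes "k = {p, q, w}" shows "cross2 (q - p) (w - p) ~= 0"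
proof
 assume z: "cross2 (q - p) (w - p) = 0"
 have d: "p ~= q" "p ~= w" "q ~= w" using card3 assms by (auto simp: card_insert_if split: if_splits)
 let ?b = "q - p" and ?c = "w - p"
 have "\<exists>m. ?c = m *\<^sub>R ?b" using cross2_zero[OF z] d(1) by simp
 hence "collinear {0, ?b, ?c}" unfolding collinear_lemma by blast
 hence "collinear {q, p, w}" using collinear_3[of q p w] by simp
 hence "affine_dependent {q, p, w}" using d by (simp add: collinear_3_eq_affine_dependent)
 thus False using indep assms by (simp add: insert_commute)
qed

lemma hull_combination:
 assumes "k = {p, q, w}" "0 <= u" "0 <= v" "0 <= x" "u + v + x = 1" shows "u *\<^sub>R p + v *\<^sub>R q + x *\<^sub>R w \<in> convex hull k"
 unfolding assms(1) convex_hull_3 using assms by blast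

text \<open>Some barycentric coordinate of \<open>z\<close> is at least 1/3. Moving away from the
  corresponding vertex by up to a sixth of each adjacent side keeps it nonnegative, so a
  parallelogram of fixed shape fits at every point. The three constants belong to the three
  vertices.\<close>

lemma sup_bound_ex: "\<exists>C\<ge>0. \<forall>\<phi>. smooth \<phi> --> (\<forall>z\<in>convex hull k. \<bar>\<phi> z\<bar> <= C * Hs_norm 2 K \<phi>)"
proof -
 obtain p q w where k: "k = {p, q, w}" using card3 by (auto simp: card_Suc_eq numeral_3_eq_3)
 define B where "B p q w = sqrt (par_const ((1/6) *\<^sub>R (q - p)) ((1/6) *\<^sub>R (w - p)) * (6 + 12 * (norm ((1/6) *\<^sub>R (q - p)))^2))" for p q w :: pt
 have B0: "0 <= B p q w" for p q w unfolding B_def using par_const_nonneg by simp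
 have *: "\<bar>\<phi> z\<bar> <= B p q w * Hs_norm 2 K \<phi>"
  if k: "k = {p, q, w}" and \<phi>: "smooth \<phi>" and u: "1 / 3 <= u" "0 <= v" "0 <= x" "u + v + x = 1" and z: "z = u *\<^sub>R p + v *\<^sub>R q + x *\<^sub>R w" for p q w \<phi> u v x z
  unfolding B_def
 proof (rule sup_bound[OF \<phi> K_props(1-3)])
  have "cross2 ((1/6) *\<^sub>R (q - p)) ((1/6) *\<^sub>R (w - p)) = (1/36) * cross2 (q - p) (w - p)" by (simp add: cross2_def algebra_simps)
  moreover have "z + s *\<^sub>R ((1/6) *\<^sub>R (q - p)) + t *\<^sub>R ((1/6) *\<^sub>R (w - p)) \<in> convex hull k" if "s \<in> {0..1}" "t \<in> {0..1}" for s t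
  proof -
   have "z + s *\<^sub>R ((1/6) *\<^sub>R (q - p)) + t *\<^sub>R ((1/6) *\<^sub>R (w - p)) = (u - s/6 - t/6) *\<^sub>R p + (v + s/6) *\<^sub>R q + (x + t/6) *\<^sub>R w"
    by (simp add: z vec_eq_iff algebra_simps)
   thus ?thesis using hull_combination[OF k, of "u - s/6 - t/6" "v + s/6" "x + t/6"] that u by simp
  qed
  ultimately show "good_par K z ((1/6) *\<^sub>R (q - p)) ((1/6) *\<^sub>R (w - p))" using vertex_cross[OF k] by (simp add: good_par_def K_props(5))
 qed
 have "\<bar>\<phi> z\<bar> <= (B p q w + B q w p + B w p q) * Hs_norm 2 K \<phi>" if \<phi>: "smooth \<phi>" and z: "z \<in> convex hull k" for \<phi> z
 proof -
  obtain u v x where uvx: "0 <= u" "0 <= v" "0 <= x" "u + v + x = 1" "z = u *\<^sub>R p + v *\<^sub>R q + x *\<^sub>R w"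
   using z unfolding k convex_hull_3 by blast
  have "1/3 <= u \<or> 1/3 <= v \<or> 1/3 <= x" using uvx by linarith
  hence "\<bar>\<phi> z\<bar> <= B p q w * Hs_norm 2 K \<phi> \<or> \<bar>\<phi> z\<bar> <= B q w p * Hs_norm 2 K \<phi> \<or> \<bar>\<phi> z\<bar> <= B w p q * Hs_norm 2 K \<phi>"
   using *[of p q w \<phi> u v x z] *[of q w p \<phi> v x u z] *[of w p q \<phi> x u v z] k uvx \<phi> by (auto simp: insert_commute add_ac)
  moreover have "0 <= B p q w * Hs_norm 2 K \<phi>" "0 <= B q w p * Hs_norm 2 K \<phi>" "0 <= B w p q * Hs_norm 2 K \<phi>" using B0 by simp_all
  ultimately show ?thesis unfolding distrib_right by linarith
 qed
 thus ?thesis using B0 by (intro exI[of _ "B p q w + B q w p + B w p q"]) simp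
qed

lemma smooth_Hs: "smooth \<phi> ==> \<phi> \<in> Hs (real m) K" using smooth_weak_deriv[OF _ K_props(2,1)] by (auto simp: Hs_def)

lemma smooth_approx:
 assumes "v \<in> Hs (real m) K" obtains \<phi> where "!!n::nat. smooth (\<phi> n)" "(%n. Hs_norm (real m) K (fminus (\<phi> n) v)) \<longlonglongrightarrow> 0"
proof -
 obtain c r where "convex_mollifier K c r" using mollifier_ex by blast
 then interpret convex_mollifier K c r .
 show ?thesis using that[of "%n. mol n v"] mol_smooth[OF Hs_L2[OF assms]] smooth_dense[OF assms] by blast
qed

lemma Hs_norm_Cauchy:
 assumes v: "v \<in> Hs s K" and \<phi>: "!!n::nat. \<phi> n \<in> Hs s K" and lim: "(%n. Hs_norm s K (fminus (\<phi> n) v)) \<longlonglongrightarrow> 0" and e: "0 < e"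
 shows "\<exists>N. \<forall>m\<ge>N. \<forall>n\<ge>N. Hs_norm s K (fminus (\<phi> m) (\<phi> n)) < e"
proof -
 obtain N where N: "!!n. N <= n ==> Hs_norm s K (fminus (\<phi> n) v) < e / 2" using LIMSEQ_D[OF lim, of "e / 2"] e by auto
 have "Hs_norm s K (fminus (\<phi> m) (\<phi> n)) < e" if "N <= m" "N <= n" for m n
 proof -
  have "fminus (\<phi> m) (\<phi> n) = lincomb 1 (fminus (\<phi> m) v) (-1) (fminus (\<phi> n) v)" by (simp add: fun_eq_iff)
  hence "Hs_norm s K (fminus (\<phi> m) (\<phi> n)) <= Hs_norm s K (fminus (\<phi> m) v) + Hs_norm s K (fminus (\<phi> n) v)"
   using Hs_norm_lincomb[OF K_props(1,2) Hs_fminus[OF K_props(1,2) \<phi>[of m] v] Hs_fminus[OF K_props(1,2) \<phi>[of n] v], of 1 "-1"] by simp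
  thus ?thesis using N[OF that(1)] N[OF that(2)] by linarith
 qed
 thus ?thesis by blast
qed

text \<open>By the supremum bound, smooth approximations in \<open>H\<^sup>2\<close> are uniformly
  Cauchy on the closed triangle. An almost everywhere convergent subsequence identifies the uniform
  limit with \<open>v\<close>.\<close>

lemma Sobolev_embedding:
 assumes v: "v \<in> Hs 2 K" shows "\<exists>w. continuous_on (convex hull k) w & aeq K w v"
proof -
 obtain \<phi> where \<phi>: "!!n::nat. smooth (\<phi> n)" "(%n. Hs_norm 2 K (fminus (\<phi> n) v)) \<longlonglongrightarrow> 0"
  using smooth_approx[of v 2] v by auto
 have \<phi>H: "\<phi> n \<in> Hs 2 K" for n using smooth_Hs[OF \<phi>(1), of n 2] by simp
 obtain C where C: "0 <= C" "!!\<psi> z. smooth \<psi> ==> z \<in> convex hull k ==> \<bar>\<psi> z\<bar> <= C * Hs_norm 2 K \<psi>" using sup_bound_ex by blast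
 have "uniformly_Cauchy_on (convex hull k) \<phi>" unfolding uniformly_Cauchy_on_def
 proof (intro allI impI)
  fix e :: real assume e: "0 < e"
  hence "0 < e / (C + 1)" using C(1) by simp
  from Hs_norm_Cauchy[OF v \<phi>H \<phi>(2) this]
  obtain N where N: "!!m n. N <= m ==> N <= n ==> Hs_norm 2 K (fminus (\<phi> m) (\<phi> n)) < e / (C + 1)" by blast
  have "dist (\<phi> m x) (\<phi> n x) < e" if "x \<in> convex hull k" "N <= m" "N <= n" for x m n
  proof -
   have "\<bar>fminus (\<phi> m) (\<phi> n) x\<bar> <= C * Hs_norm 2 K (fminus (\<phi> m) (\<phi> n))"
    unfolding fminus_eq_lincomb using that \<phi>(1) by (intro C(2) smooth_lincomb)
   also have "... <= (C + 1) * Hs_norm 2 K (fminus (\<phi> m) (\<phi> n))" by (intro mult_right_mono) auto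
   also have "... < e" using N[OF that(2,3)] C(1) by (simp add: pos_less_divide_eq mult.commute)
   finally show ?thesis by (simp add: dist_real_def)
  qed
  thus "\<exists>M. \<forall>x\<in>convex hull k. \<forall>m\<ge>M. \<forall>n\<ge>M. dist (\<phi> m x) (\<phi> n x) < e" by blast
 qed
 then obtain w where w: "uniform_limit (convex hull k) \<phi> w sequentially" using uniformly_convergent_eq_Cauchy uniformly_convergent_on_def by metis
 have wc: "continuous_on (convex hull k) w"
 proof (rule uniform_limit_theorem[OF _ w])
  show "\<forall>\<^sub>F n in sequentially. continuous_on (convex hull k) (\<phi> n)"
   using smooth_continuous[OF \<phi>(1), of _ "[]"] by (intro always_eventually allI) simp
 qed simp
 have \<phi>L2: "\<phi> n \<in> L2 K" for n by (rule Hs_L2[OF \<phi>H])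
 have L: "(%n. ipM (lebesgue_on K) (fminus (\<phi> n) v) (fminus (\<phi> n) v)) \<longlonglongrightarrow> 0"
 proof -
  have "(%n. L2norm K (fminus (\<phi> n) v)) \<longlonglongrightarrow> 0" by (rule Lim_null_comparison[OF _ \<phi>(2)])
    (use L2norm_le_Hs_norm[OF L2.fminus_mem[OF \<phi>L2 Hs_L2[OF v]] K_props(1)] in \<open>auto intro!: always_eventually\<close>)
  moreover have "(L2norm K (fminus (\<phi> n) v))^2 = ipM (lebesgue_on K) (fminus (\<phi> n) v) (fminus (\<phi> n) v)" for n
   unfolding L2norm_sq ipM_def by (simp add: power2_eq_square)
  ultimately show ?thesis using tendsto_power[of "%n. L2norm K (fminus (\<phi> n) v)" 0 sequentially 2] by simp
 qed
 obtain r where r: "strict_mono r" "AE x in lebesgue_on K. (%n. \<phi> (r n) x) \<longlonglongrightarrow> v x"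
  using l2_tendsto_AE_subseq[OF _ _ L] \<phi>L2 Hs_L2[OF v] unfolding L2_eq_l2 by blast
 have "AE x in lebesgue_on K. x \<in> K" using AE_space[of "lebesgue_on K"] by simp
 with r(2) have "AE x in lebesgue_on K. w x = v x"
 proof eventually_elim
  case (elim x)
  have "x \<in> convex hull k" using elim(2) interior_subset by (auto simp: tri_def)
  hence "(%n. \<phi> n x) \<longlonglongrightarrow> w x" by (rule tendsto_uniform_limitI[OF w])
  hence "(%n. \<phi> (r n) x) \<longlonglongrightarrow> w x" using LIMSEQ_subseq_LIMSEQ[OF _ r(1)] by (simp add: o_def)
  thus ?case using elim(1) LIMSEQ_unique by blast
 qed
 thus ?thesis using wc by (auto simp: aeq_def)
qed

text \<open>The set where two continuous functions differ in the interior is open, hence not null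
  unless empty. This makes the definite description in \<open>trace_at\<close> meaningful.\<close>

lemma continuous_rep_unique:
 assumes "continuous_on (convex hull k) w" "continuous_on (convex hull k) w'" "aeq K w w'" "z \<in> convex hull k"
 shows "w z = w' z"
proof -
 let ?f = "%x. w x - w' x"
 have fc: "continuous_on (convex hull k) ?f" by (intro continuous_intros assms)
 have sub: "K \<subseteq> convex hull k" by (simp add: tri_def interior_subset)
 have "?f x = 0" if "x \<in> K" for x
 proof (rule ccontr)
  assume nz: "?f x ~= 0"
  have "open (K \<inter> ?f -` (- {0}))" using continuous_open_preimage[OF continuous_on_subset[OF fc sub] K_props(1), of "- {0}"] by (simp add: open_Compl)
  moreover have "negligible (K \<inter> ?f -` (- {0}))"
  proof -
   have "AE y in lebesgue. y \<notin> K \<inter> ?f -` (- {0})" using assms(3) K_leb by (auto simp: aeq_def AE_restrict_space_iff elim!: eventually_mono)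
   thus ?thesis unfolding negligible_iff_null_sets by (intro completion.null_sets_iff_AE[THEN iffD2]) simp
  qed
  moreover have "x \<in> K \<inter> ?f -` (- {0})" using that nz by simp
  ultimately show False using open_not_negligible by blast
 qed
 hence "?f z = 0" by (intro continuous_constant_on_closure[of K ?f 0 z]) (use fc assms(4) K_props(5) in auto)
 thus ?thesis by simp
qed

lemma trace_at_eq:
 assumes "continuous_on (convex hull k) w" "aeq K w v" "z \<in> convex hull k" shows "trace_at k v z = w z" unfolding trace_at_def
proof (rule the_equality)
 show "\<exists>w'. continuous_on (convex hull k) w' & aeq K w' v & w' z = w z" using assms by blast
 show "c = w z" if "\<exists>w'. continuous_on (convex hull k) w' & aeq K w' v & w' z = c" for c
  using that continuous_rep_unique[OF _ assms(1) _ assms(3)] aeq_trans aeq_sym[OF assms(2)] by blast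
qed

lemma trace_at_lincomb:
 assumes "v \<in> Hs 2 K" "u \<in> Hs 2 K" "z \<in> convex hull k"
 shows "trace_at k (lincomb c v d u) z = c * trace_at k v z + d * trace_at k u z"
proof -
 obtain w w' where w: "continuous_on (convex hull k) w" "aeq K w v" "continuous_on (convex hull k) w'" "aeq K w' u" using Sobolev_embedding assms(1,2) by blast
 have "continuous_on (convex hull k) (lincomb c w d w')" unfolding lincomb_def by (intro continuous_intros w)
 from trace_at_eq[OF this aeq_lincomb[OF w(2,4)] assms(3)] show ?thesis using trace_at_eq[OF w(1,2) assms(3)] trace_at_eq[OF w(3,4) assms(3)] by simp
qed

lemma wd_Hs1: assumes "v \<in> Hs 2 K" shows "wd K [i] v \<in> Hs 1 K"
proof -
 have g: "weak_deriv K [i] v (wd K [i] v)" using HsD(1)[OF assms, of "[i]"] by simp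
 have "weak_deriv K [j] (wd K [i] v) (wd K [i, j] v)" for j
 proof -
  have w: "weak_deriv K [i, j] v (wd K [i, j] v)" using HsD(1)[OF assms, of "[i, j]"] by simp
  have "ip K (wd K [i] v) (dpart [j] \<phi>) = - ip K (wd K [i, j] v) \<phi>" if p: "\<phi> \<in> test_fun K" for \<phi>
  proof -
   have "dpart [i] (dpart [j] \<phi>) = dpart [i, j] \<phi>" by (simp add: dpart.simps)
   thus ?thesis using weak_derivD(3)[OF g test_fun_dpart[OF p, of "[j]"]] weak_derivD(3)[OF w p] by simp
  qed
  thus ?thesis using weak_derivD(2)[OF g] weak_derivD(2)[OF w] by (simp add: weak_deriv_def)
 qed
 moreover have "weak_deriv K [] (wd K [i] v) (wd K [i] v)" using weak_derivD(2)[OF g] by (simp add: weak_deriv_def)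
 ultimately have "\<exists>h. weak_deriv K is (wd K [i] v) h" if "length is <= 1" for "is" using that by (cases "is") (auto simp: length_Suc_conv)
 thus ?thesis by (simp add: Hs_def)
qed

end

subsection \<open>Edge traces\<close>

lemma edge_measure_obtain:
 assumes "card e = 2"
 obtains a b where "e = {a, b}" "a ~= b" "edge_measure e = density (distr (restrict_space lborel {0..1}) borel (%s. (1 - s) *\<^sub>R a + s *\<^sub>R b)) (%_. ennreal (edge_length e))"
proof -
 have ex: "\<exists>p. case p of (a, b) => e = {a, b}" using assms by (auto simp: card_2_iff)
 define p where "p = (SOME (a, b). e = {a, b})"
 have p: "e = {fst p, snd p}" using someI_ex[OF ex, folded p_def] by (cases p) simp
 hence "fst p ~= snd p" using assms by auto
 moreover have "edge_measure e = density (distr (restrict_space lborel {0..1}) borel (%s. (1 - s) *\<^sub>R fst p + s *\<^sub>R snd p)) (%_. ennreal (edge_length e))"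
  unfolding edge_measure_def p_def[symmetric] by (simp add: split_beta)
 ultimately show ?thesis using that[of "fst p" "snd p"] p by blast
qed

lemma edge_measure_nn_integral:
 assumes m: "edge_measure e = density (distr (restrict_space lborel {0..1}) borel (%s. (1 - s) *\<^sub>R a + s *\<^sub>R b)) (%_. ennreal (edge_length e))"
  and F: "F \<in> borel_measurable borel"
 shows "(\<integral>\<^sup>+x. F x \<partial>edge_measure e) = ennreal (edge_length e) * (\<integral>\<^sup>+s. F ((1 - s) *\<^sub>R a + s *\<^sub>R b) * indicator {0..1} s \<partial>lborel)"
proof -
 have g: "(%s. (1 - s) *\<^sub>R a + s *\<^sub>R b) \<in> borel_measurable borel" by (intro borel_measurable_continuous_onI continuous_intros)
 have "(\<integral>\<^sup>+x. F x \<partial>edge_measure e) = ennreal (edge_length e) * (\<integral>\<^sup>+s. F ((1 - s) *\<^sub>R a + s *\<^sub>R b) \<partial>restrict_space lborel {0..1})"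
  unfolding m using F g by (subst nn_integral_density, simp, simp, subst nn_integral_cmult, simp, subst nn_integral_distr)
   (auto intro: measurable_restrict_space1)
 also have "(\<integral>\<^sup>+s. F ((1 - s) *\<^sub>R a + s *\<^sub>R b) \<partial>restrict_space lborel {0..1}) = (\<integral>\<^sup>+s. F ((1 - s) *\<^sub>R a + s *\<^sub>R b) * indicator {0..1} s \<partial>lborel)"
  by (subst nn_integral_restrict_space) auto
 finally show ?thesis .
qed

lemma edge_measure_props: assumes "card e = 2" shows "finite_measure (edge_measure e)" "sets (edge_measure e) = sets borel"
proof -
 obtain a b where m: "edge_measure e = density (distr (restrict_space lborel {0..1}) borel (%s. (1 - s) *\<^sub>R a + s *\<^sub>R b)) (%_. ennreal (edge_length e))"
  using edge_measure_obtain[OF assms] by blast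
 show s: "sets (edge_measure e) = sets borel" by (simp add: m)
 have "emeasure (edge_measure e) (space (edge_measure e)) = (\<integral>\<^sup>+x. 1 \<partial>edge_measure e)" by simp
 also have "... = ennreal (edge_length e)" unfolding edge_measure_nn_integral[OF m borel_measurable_const] by simp
 finally show "finite_measure (edge_measure e)" by (intro finite_measureI) simp
qed

text \<open>A parallelogram with the whole edge as a side does not fit into the triangle. The edge
  is therefore halved, and each half is the side of a half-size parallelogram based at its own
  endpoint; the second half is traversed backwards.\<close>

lemma (in triangle) edge_trace_bound:
 assumes e: "e \<subseteq> k" "card e = 2"
 shows "\<exists>C\<ge>0. \<forall>\<phi>. smooth \<phi> --> (\<integral>\<^sup>+x. ennreal ((\<phi> x)^2) \<partial>edge_measure e) <= ennreal (C * (Hs_norm 1 K \<phi>)^2)"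
proof -
 obtain a b where ab: "e = {a, b}" "a ~= b" and m: "edge_measure e = density (distr (restrict_space lborel {0..1}) borel (%s. (1 - s) *\<^sub>R a + s *\<^sub>R b)) (%_. ennreal (edge_length e))"
  using edge_measure_obtain[OF e(2)] by blast
 have "card (k - e) = 1" using e card3 by (subst card_Diff_subset) (auto intro: card_ge_0_finite)
 then obtain w where "k - e = {w}" by (auto simp: card_1_singleton_iff)
 hence k: "k = {a, b, w}" "k = {b, a, w}" using e ab by auto
 have par: "good_par K p ((1/2) *\<^sub>R (q - p)) ((1/2) *\<^sub>R (w - p))" if k: "k = {p, q, w}" for p q
 proof -
  have "cross2 ((1/2) *\<^sub>R (q - p)) ((1/2) *\<^sub>R (w - p)) = (1/4) * cross2 (q - p) (w - p)" by (simp add: cross2_def algebra_simps)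
  moreover have "p + s *\<^sub>R ((1/2) *\<^sub>R (q - p)) + t *\<^sub>R ((1/2) *\<^sub>R (w - p)) \<in> convex hull k" if "s \<in> {0..1}" "t \<in> {0..1}" for s t
  proof -
   have "p + s *\<^sub>R ((1/2) *\<^sub>R (q - p)) + t *\<^sub>R ((1/2) *\<^sub>R (w - p)) = (1 - s/2 - t/2) *\<^sub>R p + (s/2) *\<^sub>R q + (t/2) *\<^sub>R w"
    by (simp add: vec_eq_iff algebra_simps)
   thus ?thesis using hull_combination[OF k, of "1 - s/2 - t/2" "s/2" "t/2"] that by simp
  qed
  ultimately show ?thesis using vertex_cross[OF k] by (simp add: good_par_def K_props(5))
 qed
 define Ca Cb where "Ca = par_const ((1/2) *\<^sub>R (b - a)) ((1/2) *\<^sub>R (w - a))" and "Cb = par_const ((1/2) *\<^sub>R (a - b)) ((1/2) *\<^sub>R (w - b))"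
 have C0: "0 <= Ca" "0 <= Cb" by (auto simp: Ca_def Cb_def par_const_nonneg)
 have l0: "0 <= edge_length e" unfolding edge_length_def ab(1) by (intro diameter_ge_0) auto
 have "(\<integral>\<^sup>+x. ennreal ((\<phi> x)^2) \<partial>edge_measure e) <= ennreal ((edge_length e * (Ca + Cb)) * (Hs_norm 1 K \<phi>)^2)" if \<phi>: "smooth \<phi>" for \<phi>
 proof -
  have \<phi>c: "continuous_on UNIV \<phi>" using smooth_continuous[OF \<phi>, of UNIV "[]"] by simp
  define f where "f s = ennreal ((\<phi> ((1 - s) *\<^sub>R a + s *\<^sub>R b))^2)" for s
  have fm[measurable]: "f \<in> borel_measurable borel"
   unfolding f_def by (intro measurable_compose[OF _ measurable_ennreal] borel_measurable_continuous_onI continuous_intros continuous_on_compose2[OF \<phi>c]) auto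
  have half: "(\<integral>\<^sup>+s. f (t + c * s) * indicator {0..1} s \<partial>lborel) <= ennreal (par_const ((1/2) *\<^sub>R (q - p)) ((1/2) *\<^sub>R (w - p)) * (Hs_norm 1 K \<phi>)^2)"
   if "k = {p, q, w}" "!!s. (1 - (t + c * s)) *\<^sub>R a + (t + c * s) *\<^sub>R b = p + s *\<^sub>R ((1/2) *\<^sub>R (q - p))" for p q t c
   unfolding f_def that(2) by (rule trace_segment[OF \<phi> K_props(1-3) par[OF that(1)]])
  have "(\<integral>\<^sup>+s. f s * indicator {0..1} s \<partial>lborel) <= (\<integral>\<^sup>+s. f s * indicator {0..1/2} s + f s * indicator {1/2..1} s \<partial>lborel)"
   by (intro nn_integral_mono) (auto simp: indicator_def)
  also have "... = (\<integral>\<^sup>+s. f s * indicator {0..1/2} s \<partial>lborel) + (\<integral>\<^sup>+s. f s * indicator {1/2..1} s \<partial>lborel)"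
   by (intro nn_integral_add) measurable
  also have "(\<integral>\<^sup>+s. f s * indicator {0..1/2} s \<partial>lborel) = ennreal (1/2) * (\<integral>\<^sup>+s. f (0 + (1/2) * s) * indicator {0..1} s \<partial>lborel)"
   by (subst nn_integral_real_affine[where c = "1/2" and t = 0]) (auto intro!: arg_cong2[where f = "(*)"] nn_integral_cong simp: indicator_def)
  also have "(\<integral>\<^sup>+s. f s * indicator {1/2..1} s \<partial>lborel) = ennreal (1/2) * (\<integral>\<^sup>+s. f (1 + (-1/2) * s) * indicator {0..1} s \<partial>lborel)"
   by (subst nn_integral_real_affine[where c = "-1/2" and t = 1]) (auto intro!: arg_cong2[where f = "(*)"] nn_integral_cong simp: indicator_def)
  also have "ennreal (1/2) * (\<integral>\<^sup>+s. f (0 + (1/2) * s) * indicator {0..1} s \<partial>lborel) + ennreal (1/2) * (\<integral>\<^sup>+s. f (1 + (-1/2) * s) * indicator {0..1} s \<partial>lborel)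
    <= 1 * ennreal (Ca * (Hs_norm 1 K \<phi>)^2) + 1 * ennreal (Cb * (Hs_norm 1 K \<phi>)^2)"
   unfolding Ca_def Cb_def by (intro add_mono mult_mono half k) (auto simp: vec_eq_iff algebra_simps ennreal_le_1[of "1/2", simplified])
  also have "... = ennreal ((Ca + Cb) * (Hs_norm 1 K \<phi>)^2)" using C0 by (simp add: distrib_right)
  finally have "ennreal (edge_length e) * (\<integral>\<^sup>+s. f s * indicator {0..1} s \<partial>lborel) <= ennreal (edge_length e) * ennreal ((Ca + Cb) * (Hs_norm 1 K \<phi>)^2)"
   by (intro mult_left_mono) auto
  moreover have "(\<integral>\<^sup>+x. ennreal ((\<phi> x)^2) \<partial>edge_measure e) = ennreal (edge_length e) * (\<integral>\<^sup>+s. f s * indicator {0..1} s \<partial>lborel)"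
   unfolding f_def using borel_measurable_continuous_onI[OF \<phi>c] by (intro edge_measure_nn_integral[OF m]) measurable
  ultimately show ?thesis using l0 C0 by (simp add: ennreal_mult[symmetric] mult.assoc)
 qed
 thus ?thesis using l0 C0 by (intro exI[of _ "edge_length e * (Ca + Cb)"]) simp
qed

context triangle begin

lemma smooth_edge_l2:
 assumes e: "e \<subseteq> k" "card e = 2" and \<phi>: "smooth \<phi>" shows "\<phi> \<in> l2 (edge_measure e)"
proof -
 have "(\<integral>\<^sup>+x. ennreal ((\<phi> x)^2) \<partial>edge_measure e) < \<infinity>"
  using edge_trace_bound[OF e] \<phi> le_less_trans[OF _ ennreal_less_top] by (metis infinity_ennreal_def)
 moreover have "\<phi> \<in> borel_measurable (edge_measure e)" using borel_measurable_continuous_onI[of \<phi>] smooth_continuous[OF \<phi>, of UNIV "[]"]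
  by (simp add: measurable_cong_sets[OF edge_measure_props(2)[OF e(2)] refl])
 ultimately show ?thesis by (auto simp: l2_def intro!: integrableI_bounded)
qed

lemma edge_trace_bound':
 assumes e: "e \<subseteq> k" "card e = 2"
 obtains C where "0 <= C" "!!\<phi>. smooth \<phi> ==> ipM (edge_measure e) \<phi> \<phi> <= C * (Hs_norm 1 K \<phi>)^2"
proof -
 obtain C where C: "0 <= C" "!!\<phi>. smooth \<phi> ==> (\<integral>\<^sup>+x. ennreal ((\<phi> x)^2) \<partial>edge_measure e) <= ennreal (C * (Hs_norm 1 K \<phi>)^2)"
  using edge_trace_bound[OF e] by blast
 have "ipM (edge_measure e) \<phi> \<phi> <= C * (Hs_norm 1 K \<phi>)^2" if "smooth \<phi>" for \<phi>
 proof -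
  have "ennreal (ipM (edge_measure e) \<phi> \<phi>) = (\<integral>\<^sup>+x. ennreal ((\<phi> x)^2) \<partial>edge_measure e)"
   unfolding ipM_def power2_eq_square[symmetric] by (rule nn_integral_eq_integral[symmetric]) (use l2_integrable_sq[OF smooth_edge_l2[OF e that]] in auto)
  hence "ennreal (ipM (edge_measure e) \<phi> \<phi>) <= ennreal (C * (Hs_norm 1 K \<phi>)^2)" using C(2)[OF that] by simp
  thus ?thesis using C(1) by simp
 qed
 thus ?thesis using that C(1) by blast
qed

lemma is_edge_traceI:
 assumes "\<tau> \<in> l2 (edge_measure e)" "card e = 2" "!!j. smooth (\<phi> j)"
  "(%j::nat. Hs_norm 1 K (fminus (\<phi> j) g)) \<longlonglongrightarrow> 0" "(%j. ipM (edge_measure e) (fminus (\<phi> j) \<tau>) (fminus (\<phi> j) \<tau>)) \<longlonglongrightarrow> 0"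
 shows "is_edge_trace k e g \<tau>" using assms measurable_cong_sets[OF edge_measure_props(2)[OF assms(2)] refl, of "borel :: real measure"]
 unfolding is_edge_trace_def l2_def ipM_def power2_eq_square fminus_apply by blast

lemma is_edge_traceD:
 assumes "is_edge_trace k e g \<tau>" "card e = 2"
 shows "\<tau> \<in> l2 (edge_measure e)" "\<exists>\<phi>. (\<forall>j. smooth (\<phi> j)) & (%j::nat. Hs_norm 1 K (fminus (\<phi> j) g)) \<longlonglongrightarrow> 0 &
  (%j. ipM (edge_measure e) (fminus (\<phi> j) \<tau>) (fminus (\<phi> j) \<tau>)) \<longlonglongrightarrow> 0"
 using assms measurable_cong_sets[OF edge_measure_props(2)[OF assms(2)] refl, of "borel :: real measure"]
 unfolding is_edge_trace_def l2_def ipM_def power2_eq_square fminus_apply by blast+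

text \<open>The trace bound makes the restrictions of smooth approximations a Cauchy sequence in the
  complete space on the edge.\<close>

lemma edge_trace_exists:
 assumes e: "e \<subseteq> k" "card e = 2" and g: "g \<in> Hs 1 K" shows "is_edge_trace k e g (edge_trace k e g)"
proof -
 obtain \<phi> where \<phi>: "!!n::nat. smooth (\<phi> n)" "(%n. Hs_norm 1 K (fminus (\<phi> n) g)) \<longlonglongrightarrow> 0"
  using smooth_approx[of g 1] g by auto
 have \<phi>H: "\<phi> n \<in> Hs 1 K" for n using smooth_Hs[OF \<phi>(1), of n 1] by simp
 obtain C where C: "0 <= C" "!!\<phi>. smooth \<phi> ==> ipM (edge_measure e) \<phi> \<phi> <= C * (Hs_norm 1 K \<phi>)^2" using edge_trace_bound'[OF e] by blast
 have "\<exists>\<tau>\<in>l2 (edge_measure e). (%n. ipM (edge_measure e) (fminus (\<phi> n) \<tau>) (fminus (\<phi> n) \<tau>)) \<longlonglongrightarrow> 0"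
 proof (rule l2_complete)
  show "\<phi> n \<in> l2 (edge_measure e)" for n by (rule smooth_edge_l2[OF e \<phi>(1)])
  fix d :: real assume d: "0 < d"
  hence "0 < sqrt (d / (C + 1))" using C(1) by simp
  from Hs_norm_Cauchy[OF g \<phi>H \<phi>(2) this]
  obtain N where N: "!!m n. N <= m ==> N <= n ==> Hs_norm 1 K (fminus (\<phi> m) (\<phi> n)) < sqrt (d / (C + 1))" by blast
  have "ipM (edge_measure e) (fminus (\<phi> m) (\<phi> n)) (fminus (\<phi> m) (\<phi> n)) < d" if "N <= m" "N <= n" for m n
  proof -
   have "ipM (edge_measure e) (fminus (\<phi> m) (\<phi> n)) (fminus (\<phi> m) (\<phi> n)) <= C * (Hs_norm 1 K (fminus (\<phi> m) (\<phi> n)))^2"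
    unfolding fminus_eq_lincomb by (intro C(2) smooth_lincomb \<phi>(1))
   also have "... <= (C + 1) * (Hs_norm 1 K (fminus (\<phi> m) (\<phi> n)))^2" by (intro mult_right_mono) auto
   also have "... < d"
   proof -
    have "(Hs_norm 1 K (fminus (\<phi> m) (\<phi> n)))^2 < (sqrt (d / (C + 1)))^2" using N[OF that] by (intro power_strict_mono) auto
    also have "... = d / (C + 1)" using d C(1) by simp
    finally show ?thesis using C(1) by (simp add: pos_less_divide_eq mult.commute)
   qed
   finally show ?thesis .
  qed
  thus "\<exists>N. \<forall>m\<ge>N. \<forall>n\<ge>N. ipM (edge_measure e) (fminus (\<phi> m) (\<phi> n)) (fminus (\<phi> m) (\<phi> n)) < d" by blast
 qed
 then obtain \<tau> where "is_edge_trace k e g \<tau>" using is_edge_traceI[OF _ e(2) \<phi>] by blast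
 thus ?thesis unfolding edge_trace_def by (rule someI[of "is_edge_trace k e g"])
qed

lemma is_edge_trace_lincomb:
 assumes e: "e \<subseteq> k" "card e = 2" and v: "is_edge_trace k e v \<tau>" "v \<in> Hs 1 K" and w: "is_edge_trace k e w \<sigma>" "w \<in> Hs 1 K"
 shows "is_edge_trace k e (lincomb c v d w) (lincomb c \<tau> d \<sigma>)"
proof -
 let ?n = "%f. sqrt (ipM (edge_measure e) f f)"
 obtain \<phi> \<psi> where \<phi>: "!!j. smooth (\<phi> j)" "(%j::nat. Hs_norm 1 K (fminus (\<phi> j) v)) \<longlonglongrightarrow> 0"
  "(%j. ipM (edge_measure e) (fminus (\<phi> j) \<tau>) (fminus (\<phi> j) \<tau>)) \<longlonglongrightarrow> 0"
  and \<psi>: "!!j. smooth (\<psi> j)" "(%j::nat. Hs_norm 1 K (fminus (\<psi> j) w)) \<longlonglongrightarrow> 0"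
  "(%j. ipM (edge_measure e) (fminus (\<psi> j) \<sigma>) (fminus (\<psi> j) \<sigma>)) \<longlonglongrightarrow> 0"
  using is_edge_traceD(2)[OF v(1) e(2)] is_edge_traceD(2)[OF w(1) e(2)] by blast
 note t = is_edge_traceD(1)[OF v(1) e(2)] is_edge_traceD(1)[OF w(1) e(2)]
 have H: "\<phi> j \<in> Hs 1 K" "\<psi> j \<in> Hs 1 K" for j using smooth_Hs[OF \<phi>(1), of j 1] smooth_Hs[OF \<psi>(1), of j 1] by auto
 have eq: "fminus (lincomb c p d q) (lincomb c p' d q') = lincomb c (fminus p p') d (fminus q q')" for p p' q q' by (simp add: fun_eq_iff algebra_simps)
 have lin: "(%j. \<bar>c\<bar> * x j + \<bar>d\<bar> * y j) \<longlonglongrightarrow> 0" if "x \<longlonglongrightarrow> 0" "y \<longlonglongrightarrow> 0" for x y :: "nat => real"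
  using tendsto_add[OF tendsto_mult_right_zero[OF that(1)] tendsto_mult_right_zero[OF that(2)]] by simp
 show ?thesis
 proof (rule is_edge_traceI[where \<phi> = "%j. lincomb c (\<phi> j) d (\<psi> j)"])
  show "lincomb c \<tau> d \<sigma> \<in> l2 (edge_measure e)" by (rule l2_lincomb[OF t])
  show "smooth (lincomb c (\<phi> j) d (\<psi> j))" for j by (rule smooth_lincomb[OF \<phi>(1) \<psi>(1)])
  show "(%j. Hs_norm 1 K (fminus (lincomb c (\<phi> j) d (\<psi> j)) (lincomb c v d w))) \<longlonglongrightarrow> 0" unfolding eq
   by (rule Lim_null_comparison[OF _ lin[OF \<phi>(2) \<psi>(2)]])
    (use Hs_norm_lincomb[OF K_props(1,2) Hs_fminus[OF K_props(1,2) H(1) v(2)] Hs_fminus[OF K_props(1,2) H(2) w(2)]] in \<open>auto intro!: always_eventually\<close>)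
  have "(%j. ?n (lincomb c (fminus (\<phi> j) \<tau>) d (fminus (\<psi> j) \<sigma>))) \<longlonglongrightarrow> 0"
  proof (rule Lim_null_comparison)
   show "(%j. \<bar>c\<bar> * ?n (fminus (\<phi> j) \<tau>) + \<bar>d\<bar> * ?n (fminus (\<psi> j) \<sigma>)) \<longlonglongrightarrow> 0"
    using lin[OF tendsto_real_sqrt[OF \<phi>(3), simplified] tendsto_real_sqrt[OF \<psi>(3), simplified]] .
   show "\<forall>\<^sub>F j in sequentially. norm (?n (lincomb c (fminus (\<phi> j) \<tau>) d (fminus (\<psi> j) \<sigma>))) <= \<bar>c\<bar> * ?n (fminus (\<phi> j) \<tau>) + \<bar>d\<bar> * ?n (fminus (\<psi> j) \<sigma>)"
    using l2.nrm_lincomb[OF l2.fminus_mem[OF smooth_edge_l2[OF e \<phi>(1)] t(1)] l2.fminus_mem[OF smooth_edge_l2[OF e \<psi>(1)] t(2)]]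
     l2.nonneg[OF l2_lincomb[OF l2.fminus_mem[OF smooth_edge_l2[OF e \<phi>(1)] t(1)] l2.fminus_mem[OF smooth_edge_l2[OF e \<psi>(1)] t(2)]]]
    by (intro always_eventually allI) simp
  qed
  from tendsto_power[OF this, of 2]
  show "(%j. ipM (edge_measure e) (fminus (lincomb c (\<phi> j) d (\<psi> j)) (lincomb c \<tau> d \<sigma>)) (fminus (lincomb c (\<phi> j) d (\<psi> j)) (lincomb c \<tau> d \<sigma>))) \<longlonglongrightarrow> 0"
   unfolding eq using l2.nrm_sq[OF l2_lincomb[OF l2.fminus_mem[OF smooth_edge_l2[OF e \<phi>(1)] t(1)] l2.fminus_mem[OF smooth_edge_l2[OF e \<psi>(1)] t(2)]]] by simp
 qed (rule e(2))
qed

text \<open>By linearity the difference of two traces of \<open>v\<close> is a trace of zero, and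
  the trace bound forces it to vanish. Without this the chosen traces could not be combined
  linearly.\<close>

lemma is_edge_trace_unique:
 assumes e: "e \<subseteq> k" "card e = 2" and t: "is_edge_trace k e v \<tau>" "is_edge_trace k e v \<sigma>" and v: "v \<in> Hs 1 K"
 shows "AE x in edge_measure e. \<tau> x = \<sigma> x"
proof -
 have "is_edge_trace k e (lincomb 1 v (-1) v) (lincomb 1 \<tau> (-1) \<sigma>)" by (rule is_edge_trace_lincomb[OF e t(1) v t(2) v])
 moreover have "lincomb 1 v (-1) v = (%x. 0)" by (simp add: fun_eq_iff)
 ultimately have z: "is_edge_trace k e (%x. 0) (fminus \<tau> \<sigma>)" by (simp add: fminus_eq_lincomb)
 obtain \<phi> where \<phi>: "!!j. smooth (\<phi> j)" "(%j::nat. Hs_norm 1 K (fminus (\<phi> j) (%x. 0))) \<longlonglongrightarrow> 0"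
  "(%j. ipM (edge_measure e) (fminus (\<phi> j) (fminus \<tau> \<sigma>)) (fminus (\<phi> j) (fminus \<tau> \<sigma>))) \<longlonglongrightarrow> 0"
  using is_edge_traceD(2)[OF z e(2)] by blast
 note zl = is_edge_traceD(1)[OF z e(2)]
 let ?n = "%f. sqrt (ipM (edge_measure e) f f)"
 obtain C where C: "0 <= C" "!!\<phi>. smooth \<phi> ==> ipM (edge_measure e) \<phi> \<phi> <= C * (Hs_norm 1 K \<phi>)^2" using edge_trace_bound'[OF e] by blast
 have "?n (fminus \<tau> \<sigma>) <= sqrt C * Hs_norm 1 K (fminus (\<phi> j) (%x. 0)) + ?n (fminus (\<phi> j) (fminus \<tau> \<sigma>))" for j
 proof -
  have "?n (fminus \<tau> \<sigma>) <= ?n (\<phi> j) + ?n (fminus (fminus \<tau> \<sigma>) (\<phi> j))" by (rule l2.nrm_le_add[OF zl smooth_edge_l2[OF e \<phi>(1)]])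
  moreover have "?n (fminus (fminus \<tau> \<sigma>) (\<phi> j)) = ?n (fminus (\<phi> j) (fminus \<tau> \<sigma>))" by (rule l2.nrm_commute[OF zl smooth_edge_l2[OF e \<phi>(1)]])
  moreover have "?n (\<phi> j) <= sqrt (C * (Hs_norm 1 K (\<phi> j))^2)" by (intro real_sqrt_le_mono C(2) \<phi>(1))
  moreover have "fminus (\<phi> j) (%x. 0) = \<phi> j" by (simp add: fun_eq_iff)
  ultimately show ?thesis by (simp add: real_sqrt_mult)
 qed
 moreover have "(%j. sqrt C * Hs_norm 1 K (fminus (\<phi> j) (%x. 0)) + ?n (fminus (\<phi> j) (fminus \<tau> \<sigma>))) \<longlonglongrightarrow> sqrt C * 0 + sqrt 0"
  by (intro tendsto_intros \<phi>(2,3))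
 ultimately have "?n (fminus \<tau> \<sigma>) <= sqrt C * 0 + sqrt 0" by (intro LIMSEQ_le_const) auto
 hence "ipM (edge_measure e) (fminus \<tau> \<sigma>) (fminus \<tau> \<sigma>) = 0" using l2.nonneg[OF zl] by simp
 hence "AE x in edge_measure e. fminus \<tau> \<sigma> x = 0" using l2_nrm_eq_0_iff[OF zl] by simp
 thus ?thesis by eventually_elim simp
qed

lemma edge_trace_cong:
 assumes "aeq K g h" "g \<in> Hs 1 K" shows "edge_trace k e g = edge_trace k e h"
proof -
 have "Hs_norm 1 K (fminus \<phi> g) = Hs_norm 1 K (fminus \<phi> h)" if "smooth \<phi>" for \<phi>
 proof -
  have "aeq K (fminus \<phi> g) (fminus \<phi> h)" unfolding fminus_eq_lincomb by (intro aeq_lincomb aeq_refl assms)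
  from Hs_cong(2)[OF this Hs_fminus[OF K_props(1,2) smooth_Hs[OF that, of 1, simplified] assms(2)] K_props(1)] show ?thesis by simp
 qed
 hence "is_edge_trace k e g = is_edge_trace k e h" unfolding is_edge_trace_def by (intro ext) (simp cong: conj_cong)
 thus ?thesis by (simp add: edge_trace_def)
qed

definition ntr :: "pt set => fn => real" where
 "ntr e v = (LINT x|edge_measure e. normal_trace k e v x)"

lemma normal_trace_integrable:
 assumes e: "e \<subseteq> k" "card e = 2" and v: "v \<in> Hs 2 K" shows "integrable (edge_measure e) (normal_trace k e v)"
proof -
 interpret finite_measure "edge_measure e" by (rule edge_measure_props(1)[OF e(2)])
 have "integrable (edge_measure e) (edge_trace k e (wd K [i] v))" for i by (rule square_integrable_imp_integrable)
   (use is_edge_traceD(1)[OF edge_trace_exists[OF e wd_Hs1[OF v]] e(2)] in \<open>auto simp: l2_def\<close>)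
 thus ?thesis unfolding normal_trace_def by auto
qed

lemma ntr_lincomb:
 assumes e: "e \<subseteq> k" "card e = 2" and v: "v \<in> Hs 2 K" and w: "w \<in> Hs 2 K"
 shows "ntr e (lincomb c v d w) = c * ntr e v + d * ntr e w"
proof -
 have i: "AE x in edge_measure e. edge_trace k e (wd K [i] (lincomb c v d w)) x = c * edge_trace k e (wd K [i] v) x + d * edge_trace k e (wd K [i] w) x" for i
 proof -
  have l: "length [i] <= nat \<lfloor>2::real\<rfloor>" by simp
  have "edge_trace k e (wd K [i] (lincomb c v d w)) = edge_trace k e (lincomb c (wd K [i] v) d (wd K [i] w))"
   by (rule edge_trace_cong[OF wd_lincomb[OF v w l K_props(1)] wd_Hs1[OF Hs_lincomb[OF K_props(1,2) v w]]])
  moreover have "AE x in edge_measure e. edge_trace k e (lincomb c (wd K [i] v) d (wd K [i] w)) x = lincomb c (edge_trace k e (wd K [i] v)) d (edge_trace k e (wd K [i] w)) x"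
   by (rule is_edge_trace_unique[OF e edge_trace_exists[OF e]
     is_edge_trace_lincomb[OF e edge_trace_exists[OF e wd_Hs1[OF v]] wd_Hs1[OF v] edge_trace_exists[OF e wd_Hs1[OF w]] wd_Hs1[OF w]]])
    (rule Hs_lincomb[OF K_props(1,2) wd_Hs1[OF v] wd_Hs1[OF w]])+
  ultimately show ?thesis by simp
 qed
 have "AE x in edge_measure e. normal_trace k e (lincomb c v d w) x = c * normal_trace k e v x + d * normal_trace k e w x"
  using i[of 1] i[of 2] by eventually_elim (simp add: normal_trace_def sum_2 algebra_simps)
 hence "ntr e (lincomb c v d w) = (LINT x|edge_measure e. c * normal_trace k e v x + d * normal_trace k e w x)"
  unfolding ntr_def using normal_trace_integrable[OF e] v w Hs_lincomb[OF K_props(1,2) v w, of c d] by (intro integral_cong_AE) auto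
 also have "... = c * ntr e v + d * ntr e w" unfolding ntr_def using normal_trace_integrable[OF e] v w by simp
 finally show ?thesis .
qed

end

subsection \<open>The mesh-dependent norm\<close>

lemma wd2_mem: "v \<in> Hs 2 U ==> wd U [i, j] v \<in> L2 U" by (rule HsD(2)) auto

lemma hess_form_eq:
 assumes "w \<in> Hs 2 U" "v \<in> Hs 2 U"
 shows "hess_form U w v = (\<Sum>i\<in>UNIV. \<Sum>j\<in>UNIV. ip U (wd U [i, j] w) (wd U [i, j] v))"
proof -
 have "integrable (lebesgue_on U) (%x. wd U [i, j] w x * wd U [i, j] v x)" for i j
  using l2_integrable_mult wd2_mem[OF assms(1)] wd2_mem[OF assms(2)] unfolding L2_eq_l2 by blast
 thus ?thesis by (simp add: hess_form_def ip_def)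
qed

lemma hess_form_self: "v \<in> Hs 2 U ==> hess_form U v v = (\<Sum>i\<in>UNIV. \<Sum>j\<in>UNIV. (L2norm U (wd U [i, j] v))^2)"
 by (simp add: hess_form_eq L2norm_def L2.nonneg wd2_mem)

lemma hess_form_lincomb:
 assumes U: "open U" "bounded U" and "u \<in> Hs 2 U" "v \<in> Hs 2 U" "w \<in> Hs 2 U"
 shows "hess_form U (lincomb c u d v) w = c * hess_form U u w + d * hess_form U v w"
proof -
 have "ip U (wd U [i, j] (lincomb c u d v)) (wd U [i, j] w) = c * ip U (wd U [i, j] u) (wd U [i, j] w) + d * ip U (wd U [i, j] v) (wd U [i, j] w)" for i j
 proof -
  have "ip U (wd U [i, j] (lincomb c u d v)) (wd U [i, j] w) = ip U (lincomb c (wd U [i, j] u) d (wd U [i, j] v)) (wd U [i, j] w)"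
   by (rule ip_cong[OF wd_lincomb[OF assms(3,4) _ U(1)] aeq_refl L2_borel[OF wd2_mem[OF Hs_lincomb[OF U assms(3,4)]]] L2_borel[OF wd2_mem[OF assms(5)]] open_lebesgue[OF U(1)]]) simp
  thus ?thesis using wd2_mem[OF assms(3)] wd2_mem[OF assms(4)] wd2_mem[OF assms(5)] by (simp add: L2.lin)
 qed
 thus ?thesis using assms Hs_lincomb[OF U assms(3,4)] by (simp add: hess_form_eq sum.distrib sum_distrib_left)
qed

lemma hess_form_cong: "aeq U u v ==> open U ==> hess_form U u w = hess_form U v w" by (simp add: hess_form_def wd_cong)

lemma hess_form_quasi:
 assumes U: "open U" "bounded U" and v: "v \<in> Hs 2 U" and w: "w \<in> Hs 2 U" and e: "0 < e"
 shows "hess_form U (lincomb c v d w) (lincomb c v d w) <= (1 + e) * c^2 * hess_form U v v + (1 + 1 / e) * d^2 * hess_form U w w"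
proof -
 have "(L2norm U (wd U [i, j] (lincomb c v d w)))^2 <= (1 + e) * c^2 * (L2norm U (wd U [i, j] v))^2 + (1 + 1 / e) * d^2 * (L2norm U (wd U [i, j] w))^2" for i j
 proof -
  have "L2norm U (wd U [i, j] (lincomb c v d w)) = L2norm U (lincomb c (wd U [i, j] v) d (wd U [i, j] w))"
   by (rule L2norm_cong[OF wd_lincomb[OF v w _ U(1)] wd2_mem[OF Hs_lincomb[OF U v w]] open_lebesgue[OF U(1)]]) simp
  also have "... <= \<bar>c\<bar> * L2norm U (wd U [i, j] v) + \<bar>d\<bar> * L2norm U (wd U [i, j] w)"
   unfolding L2norm_def by (rule L2.nrm_lincomb[OF wd2_mem[OF v] wd2_mem[OF w]])
  finally have "(L2norm U (wd U [i, j] (lincomb c v d w)))^2 <= (\<bar>c\<bar> * L2norm U (wd U [i, j] v) + \<bar>d\<bar> * L2norm U (wd U [i, j] w))^2" by (rule power_mono) simp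
  also have "... <= (1 + e) * (\<bar>c\<bar> * L2norm U (wd U [i, j] v))^2 + (1 + 1 / e) * (\<bar>d\<bar> * L2norm U (wd U [i, j] w))^2" by (rule quasi_triangle_square[OF e])
  finally show ?thesis by (simp add: power_mult_distrib mult.assoc)
 qed
 hence "hess_form U (lincomb c v d w) (lincomb c v d w) <= (\<Sum>i\<in>UNIV. \<Sum>j\<in>UNIV. (1 + e) * c^2 * (L2norm U (wd U [i, j] v))^2 + (1 + 1 / e) * d^2 * (L2norm U (wd U [i, j] w))^2)"
  unfolding hess_form_self[OF Hs_lincomb[OF U v w]] by (intro sum_mono)
 thus ?thesis unfolding hess_form_self[OF v] hess_form_self[OF w] by (simp add: sum.distrib sum_distrib_left)
qed

lemma square_quasi: fixes c :: real assumes "0 < e" shows "(c * a + d * b)^2 <= (1 + e) * c^2 * a^2 + (1 + 1 / e) * d^2 * b^2"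
 using quasi_triangle_square[OF assms, of "c * a" "d * b"] by (simp add: power_mult_distrib mult.assoc)

locale mesh =
 fixes \<Omega> :: "pt set" and \<T> :: mesh
 assumes conf: "conforming_triangulation \<Omega> \<T>" and poly: "polygonal_lipschitz_domain \<Omega>"
begin

lemma tri_locale: "k \<in> \<T> ==> triangle k" using conf by (auto simp: conforming_triangulation_def triangle_def)

lemma fin: "finite \<T>" using conf by (simp add: conforming_triangulation_def)

lemma Omega: "open \<Omega>" "bounded \<Omega>" "\<Omega> ~= {}" "\<Omega> \<in> sets lebesgue" "\<Omega> \<in> lmeasurable"
 using poly by (auto simp: polygonal_lipschitz_domain_def open_lebesgue lmeasurable_open)

lemma pwHs_tri: "v \<in> pwHs 2 \<T> ==> k \<in> \<T> ==> v \<in> Hs 2 (tri k)" by (simp add: pwHs_def)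

lemma pwHs_lincomb: "v \<in> pwHs 2 \<T> ==> w \<in> pwHs 2 \<T> ==> lincomb c v d w \<in> pwHs 2 \<T>"
 using triangle.K_props(1,2)[OF tri_locale] by (auto simp: pwHs_def intro!: Hs_lincomb)

lemma edge_facts: assumes "e \<in> edges \<T>" "k \<in> elements_of \<T> e" shows "k \<in> \<T>" "e \<subseteq> k" "card e = 2" "e \<subseteq> convex hull k"
 using assms by (auto simp: edges_def elements_of_def intro: hull_inc)

lemma jump_at_lincomb:
 assumes "v \<in> pwHs 2 \<T>" "w \<in> pwHs 2 \<T>" "e \<in> edges \<T>" "z \<in> e"
 shows "jump_at \<T> e (lincomb c v d w) z = c * jump_at \<T> e v z + d * jump_at \<T> e w z"
proof -
 have "trace_at k (lincomb c v d w) z = c * trace_at k v z + d * trace_at k w z" if "k \<in> elements_of \<T> e" for k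
  using edge_facts[OF assms(3) that] assms by (intro triangle.trace_at_lincomb[OF tri_locale] pwHs_tri) auto
 thus ?thesis unfolding jump_at_def by (simp add: sum.distrib[symmetric] sum_distrib_left algebra_simps cong: sum.cong)
qed

lemma jump_normal_lincomb:
 assumes v: "v \<in> pwHs 2 \<T>" and w: "w \<in> pwHs 2 \<T>" and e: "e \<in> edges \<T>"
 shows "(LINT x|edge_measure e. jump_normal \<T> e (lincomb c v d w) x) = c * (LINT x|edge_measure e. jump_normal \<T> e v x) + d * (LINT x|edge_measure e. jump_normal \<T> e w x)"
proof -
 have *: "(LINT x|edge_measure e. jump_normal \<T> e u x) = (\<Sum>k\<in>elements_of \<T> e. side k e * triangle.ntr k e u)" if u: "u \<in> pwHs 2 \<T>" for u
 proof -
  have "integrable (edge_measure e) (normal_trace k e u)" if "k \<in> elements_of \<T> e" for k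
   using edge_facts[OF e that] u by (intro triangle.normal_trace_integrable[OF tri_locale] pwHs_tri) auto
  thus ?thesis unfolding jump_normal_def by (subst Bochner_Integration.integral_sum) (auto simp: triangle.ntr_def[OF tri_locale[OF edge_facts(1)[OF e]]])
 qed
 have "triangle.ntr k e (lincomb c v d w) = c * triangle.ntr k e v + d * triangle.ntr k e w" if "k \<in> elements_of \<T> e" for k
  using edge_facts[OF e that] v w by (intro triangle.ntr_lincomb[OF tri_locale] pwHs_tri) auto
 thus ?thesis unfolding *[OF v] *[OF w] *[OF pwHs_lincomb[OF v w]] by (simp add: sum.distrib[symmetric] sum_distrib_left algebra_simps cong: sum.cong)
qed

lemma hess_nonneg: "0 <= hess_form U v v" unfolding hess_form_def by (intro integral_nonneg_AE AE_I2 sum_nonneg) simp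

lemma hnorm_sq: "(hnorm \<T> v)^2 = (\<Sum>k\<in>\<T>. hess_form (tri k) v v) +
  (\<Sum>e\<in>edges \<T>. \<Sum>z\<in>e. \<bar>jump_at \<T> e v z\<bar>\<^sup>2 / (edge_length e)^2) +
  (\<Sum>e\<in>edges \<T>. \<bar>(1 / edge_length e) * (LINT x|edge_measure e. jump_normal \<T> e v x)\<bar>\<^sup>2)"
 unfolding hnorm_def by (intro real_sqrt_pow2 add_nonneg_nonneg sum_nonneg hess_nonneg) auto

lemma hnorm_nonneg [simp]: "0 <= hnorm \<T> v" unfolding hnorm_def by (intro real_sqrt_ge_zero add_nonneg_nonneg sum_nonneg hess_nonneg) auto

text \<open>Each summand is a squared seminorm, the jump terms being squares of linear functionals
  by the embedding and trace results. The inequalities with common weights are added term by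
  term.\<close>

lemma hnorm_lincomb:
 assumes v: "v \<in> pwHs 2 \<T>" and w: "w \<in> pwHs 2 \<T>"
 shows "hnorm \<T> (lincomb c v d w) <= \<bar>c\<bar> * hnorm \<T> v + \<bar>d\<bar> * hnorm \<T> w"
proof -
 let ?u = "lincomb c v d w"
 have "(hnorm \<T> ?u)^2 <= (1 + e) * (\<bar>c\<bar> * hnorm \<T> v)^2 + (1 + 1 / e) * (\<bar>d\<bar> * hnorm \<T> w)^2" if e: "0 < e" for e
 proof -
  let ?A = "(1 + e) * c^2" and ?B = "(1 + 1 / e) * d^2"
  have 1: "(\<Sum>k\<in>\<T>. hess_form (tri k) ?u ?u) <= ?A * (\<Sum>k\<in>\<T>. hess_form (tri k) v v) + ?B * (\<Sum>k\<in>\<T>. hess_form (tri k) w w)"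
   unfolding sum_distrib_left sum.distrib[symmetric] by (intro sum_mono hess_form_quasi triangle.K_props(1,2)[OF tri_locale] pwHs_tri v w e)
  have 2: "(\<Sum>f\<in>edges \<T>. \<Sum>z\<in>f. \<bar>jump_at \<T> f ?u z\<bar>\<^sup>2 / (edge_length f)^2) <=
    ?A * (\<Sum>f\<in>edges \<T>. \<Sum>z\<in>f. \<bar>jump_at \<T> f v z\<bar>\<^sup>2 / (edge_length f)^2) + ?B * (\<Sum>f\<in>edges \<T>. \<Sum>z\<in>f. \<bar>jump_at \<T> f w z\<bar>\<^sup>2 / (edge_length f)^2)"
   unfolding sum_distrib_left sum.distrib[symmetric]
  proof (intro sum_mono)
   fix f z assume fz: "f \<in> edges \<T>" "z \<in> f"
   have "(jump_at \<T> f ?u z)^2 <= ?A * (jump_at \<T> f v z)^2 + ?B * (jump_at \<T> f w z)^2" unfolding jump_at_lincomb[OF v w fz] by (rule square_quasi[OF e])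
   from divide_right_mono[OF this, of "(edge_length f)^2"]
   show "\<bar>jump_at \<T> f ?u z\<bar>\<^sup>2 / (edge_length f)^2 <= ?A * (\<bar>jump_at \<T> f v z\<bar>\<^sup>2 / (edge_length f)^2) + ?B * (\<bar>jump_at \<T> f w z\<bar>\<^sup>2 / (edge_length f)^2)"
    by (simp add: add_divide_distrib)
  qed
  have 3: "(\<Sum>f\<in>edges \<T>. \<bar>(1 / edge_length f) * (LINT x|edge_measure f. jump_normal \<T> f ?u x)\<bar>\<^sup>2) <=
    ?A * (\<Sum>f\<in>edges \<T>. \<bar>(1 / edge_length f) * (LINT x|edge_measure f. jump_normal \<T> f v x)\<bar>\<^sup>2) + ?B * (\<Sum>f\<in>edges \<T>. \<bar>(1 / edge_length f) * (LINT x|edge_measure f. jump_normal \<T> f w x)\<bar>\<^sup>2)"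
   unfolding sum_distrib_left sum.distrib[symmetric] power2_abs
  proof (intro sum_mono)
   fix f assume f: "f \<in> edges \<T>"
   show "((1 / edge_length f) * (LINT x|edge_measure f. jump_normal \<T> f ?u x))^2 <=
    ?A * ((1 / edge_length f) * (LINT x|edge_measure f. jump_normal \<T> f v x))^2 + ?B * ((1 / edge_length f) * (LINT x|edge_measure f. jump_normal \<T> f w x))^2"
    unfolding jump_normal_lincomb[OF v w f] distrib_left mult.left_commute[of "1 / edge_length f"] by (rule square_quasi[OF e])
  qed
  have "(hnorm \<T> ?u)^2 <= ?A * (hnorm \<T> v)^2 + ?B * (hnorm \<T> w)^2" unfolding hnorm_sq distrib_left using 1 2 3 by linarith
  thus ?thesis by (simp add: power_mult_distrib mult.assoc)
 qed
 from sqrt_le_of_quasi_triangle[OF _ _ this] show ?thesis by simp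
qed

lemma hnorm_minus: assumes "v \<in> pwHs 2 \<T>" shows "hnorm \<T> (fminus (%x. 0) v) <= hnorm \<T> v"
proof -
 have "fminus (%x. 0) v = lincomb (-1) v 0 v" by (simp add: fun_eq_iff)
 thus ?thesis using hnorm_lincomb[OF assms assms, of "-1" 0] by simp
qed

lemma hnorm_triangle:
 assumes "u \<in> pwHs 2 \<T>" "v \<in> pwHs 2 \<T>" "w \<in> pwHs 2 \<T>"
 shows "hnorm \<T> (fminus u w) <= hnorm \<T> (fminus u v) + hnorm \<T> (fminus v w)"
proof -
 have "fminus u w = lincomb 1 (fminus u v) 1 (fminus v w)" by (simp add: fun_eq_iff)
 thus ?thesis using hnorm_lincomb[of "fminus u v" "fminus v w" 1 1] assms by (simp add: fminus_eq_lincomb pwHs_lincomb)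
qed

text \<open>A null function \<open>v\<close> agrees almost everywhere with \<open>2 v\<close>, so
  both have the same derivatives, traces and norm, since these depend on the class only. Homogeneity
  then bounds the norm of \<open>v\<close> by half of itself.\<close>

lemma hnorm_aeq_0:
 assumes v: "v \<in> pwHs 2 \<T>" and z: "!!k. k \<in> \<T> ==> aeq (tri k) v (%x. 0)" shows "hnorm \<T> v = 0"
proof -
 have v2: "aeq (tri k) v (lincomb 2 v 0 v)" if "k \<in> \<T>" for k using z[OF that] unfolding aeq_def by eventually_elim simp
 have wd: "wd (tri k) is (lincomb 2 v 0 v) = wd (tri k) is v" if "k \<in> \<T>" for k "is"
  using wd_cong[OF v2[OF that] triangle.K_props(1)[OF tri_locale[OF that]]] by simp
 have tr: "trace_at k (lincomb 2 v 0 v) z = trace_at k v z" if "k \<in> \<T>" for k z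
 proof -
  have "aeq (tri k) w (lincomb 2 v 0 v) \<longleftrightarrow> aeq (tri k) w v" for w using v2[OF that] aeq_trans aeq_sym by blast
  thus ?thesis by (simp add: trace_at_def)
 qed
 have el: "k \<in> \<T>" if "k \<in> elements_of \<T> e" for k e using that by (simp add: elements_of_def)
 have "hnorm \<T> (lincomb 2 v 0 v) = hnorm \<T> v" unfolding hnorm_def hess_form_def jump_at_def jump_normal_def normal_trace_def
  using wd tr el by (simp cong: sum.cong)
 moreover have "hnorm \<T> (lincomb (1/2) (lincomb 2 v 0 v) 0 v) <= \<bar>1/2\<bar> * hnorm \<T> (lincomb 2 v 0 v) + \<bar>0\<bar> * hnorm \<T> v"
  by (intro hnorm_lincomb pwHs_lincomb v)
 moreover have "lincomb (1/2) (lincomb 2 v 0 v) 0 v = v" by (simp add: fun_eq_iff)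
 ultimately have "hnorm \<T> v <= 1/2 * hnorm \<T> v" by simp
 thus ?thesis using hnorm_nonneg[of v] by linarith
qed

subsection \<open>Geometry of the mesh\<close>

text \<open>Excludes slits and isolated boundary points: the domain lies locally above a Lipschitz
  graph, so some points near a boundary point are outside the closure. Needed to place the open
  triangles inside the domain.\<close>

lemma interior_closure_Omega: "interior (closure \<Omega>) = \<Omega>"
proof
 show "\<Omega> \<subseteq> interior (closure \<Omega>)" using Omega(1) by (simp add: closure_subset interior_maximal)
 show "interior (closure \<Omega>) \<subseteq> \<Omega>"
 proof
  fix p assume p: "p \<in> interior (closure \<Omega>)"
  show "p \<in> \<Omega>"
  proof (rule ccontr)
   assume np: "p \<notin> \<Omega>"
   have "p \<in> closure \<Omega>" using p interior_subset by blast
   hence "p \<in> frontier \<Omega>" using np Omega(1) by (simp add: frontier_def interior_open)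
   then obtain a b r L \<phi> where ab: "norm a = 1" "norm b = 1" "a \<bullet> b = 0" "0 < r" "L-lipschitz_on (UNIV :: real set) \<phi>"
    and gr: "!!x. x \<in> ball p r ==> x \<in> \<Omega> \<longleftrightarrow> \<phi> ((x - p) \<bullet> a) < (x - p) \<bullet> b"
    using poly unfolding polygonal_lipschitz_domain_def lipschitz_boundary_def by blast
   have \<phi>0: "0 <= \<phi> 0" using gr[of p] ab(4) np by simp
   obtain d where d: "0 < d" "ball p d \<subseteq> closure \<Omega>" using p by (auto simp: mem_interior)
   define s where "s = min d r / 2"
   have s: "0 < s" "s < d" "s < r" using d ab(4) by (auto simp: s_def)
   \<comment> \<open>Strictly below the graph, yet inside the ball around \<open>p\<close> that is
     supposed to lie in the closure.\<close>
   let ?q = "p - s *\<^sub>R b"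
   have \<phi>c: "continuous_on UNIV \<phi>" by (rule lipschitz_on_continuous_on[OF ab(5)])
   let ?W = "{x. (x - p) \<bullet> b < \<phi> ((x - p) \<bullet> a)} \<inter> ball p r"
   have "open ?W" by (intro open_Int open_Collect_less continuous_intros continuous_on_compose2[OF \<phi>c]) auto
   moreover have "?W \<inter> \<Omega> = {}" using gr by fastforce
   ultimately have "?W \<inter> closure \<Omega> = {}" using open_Int_closure_eq_empty by blast
   moreover have "?q \<in> ?W" using ab(2-4) s \<phi>0 norm_eq_1[of b] inner_commute[of a b] by (simp add: dist_norm)
   moreover have "?q \<in> ball p d" using ab(2) s by (simp add: dist_norm)
   ultimately show False using d(2) by blast
  qed
 qed
qed

lemma tri_subset: assumes "k \<in> \<T>" shows "tri k \<subseteq> \<Omega>"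
proof -
 have "convex hull k \<subseteq> closure \<Omega>" using conf assms unfolding conforming_triangulation_def by blast
 hence "tri k \<subseteq> interior (closure \<Omega>)" unfolding tri_def by (rule interior_mono)
 thus ?thesis by (simp add: interior_closure_Omega)
qed

text \<open>Two different triangles meet in the hull of at most two common vertices, which has empty
  interior and is null; boundaries of convex sets are null as well.\<close>

lemma indicator_sum: "AE x in lebesgue. indicat_real \<Omega> x = (\<Sum>k\<in>\<T>. indicator (tri k) x)"
proof -
 have ae1: "AE x in lebesgue. x \<notin> frontier (convex hull k)" for k :: "pt set"
  using negligible_convex_frontier[OF convex_convex_hull, of k] unfolding negligible_iff_null_sets by (rule AE_not_in)
 have ae2: "AE x in lebesgue. k ~= k' --> x \<notin> convex hull (k \<inter> k')" if "k \<in> \<T>" "k' \<in> \<T>" for k k'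
 proof (cases "k = k'")
  case False
  have c: "card k = 3" "card k' = 3" using triangle.card3[OF tri_locale] that by auto
  hence f: "finite k" "finite k'" by (auto intro: card_ge_0_finite)
  have "k \<inter> k' ~= k" using False c f by (metis card_subset_eq inf.cobounded2)
  hence "card (k \<inter> k') < 3" using psubset_card_mono[OF f(1), of "k \<inter> k'"] c by auto
  hence "interior (convex hull (k \<inter> k')) = {}" using f by (intro empty_interior_convex_hull) auto
  hence "negligible (convex hull (k \<inter> k'))" by (simp add: negligible_convex_interior)
  thus ?thesis unfolding negligible_iff_null_sets by (auto dest: AE_not_in elim: eventually_mono)
 qed simp
 have "AE x in lebesgue. \<forall>k\<in>\<T>. x \<notin> frontier (convex hull k)" using fin ae1 by (simp add: AE_ball_countable countable_finite)
 moreover have "AE x in lebesgue. \<forall>k\<in>\<T>. \<forall>k'\<in>\<T>. k ~= k' --> x \<notin> convex hull (k \<inter> k')"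
  using fin ae2 by (simp add: AE_ball_countable countable_finite)
 ultimately show ?thesis
 proof eventually_elim
  case (elim x)
  show ?case
  proof (cases "x \<in> \<Omega>")
   case False
   hence "x \<notin> tri k" if "k \<in> \<T>" for k using tri_subset[OF that] by blast
   thus ?thesis using False by simp
  next
   case True
   hence "x \<in> closure \<Omega>" using closure_subset by blast
   then obtain k where k: "k \<in> \<T>" "x \<in> convex hull k" using conf unfolding conforming_triangulation_def by blast
   have xk: "x \<in> tri k" using elim(1) k closure_subset[of "convex hull k"] unfolding frontier_def tri_def by blast
   have "x \<notin> tri k'" if "k' \<in> \<T>" "k' ~= k" for k'
   proof
    assume "x \<in> tri k'"
    hence "x \<in> convex hull k'" unfolding tri_def using interior_subset by blast
    hence "x \<in> convex hull (k \<inter> k')" using k that(1) conf unfolding conforming_triangulation_def by blast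
    thus False using elim(2) k that by blast
   qed
   hence "(\<Sum>k'\<in>\<T>. indicat_real (tri k') x) = (\<Sum>k'\<in>\<T>. if k' = k then 1 else 0)" using xk by (intro sum.cong) auto
   thus ?thesis using True k fin by simp
  qed
 qed
qed

lemma L2_Omega: assumes v: "!!k. k \<in> \<T> ==> v \<in> L2 (tri k)"
 shows "v \<in> L2 \<Omega>" and "(L2norm \<Omega> v)^2 = (\<Sum>k\<in>\<T>. (L2norm (tri k) v)^2)"
proof -
 note tl = triangle.K_leb[OF tri_locale]
 have ae: "AE x in lebesgue. (\<Sum>k\<in>\<T>. indicator (tri k) x *\<^sub>R f x) = indicator \<Omega> x *\<^sub>R f x" for f :: fn
  using indicator_sum by eventually_elim (simp add: sum_distrib_right)
 have m: "(%x. indicator (tri k) x *\<^sub>R v x) \<in> borel_measurable lebesgue" "integrable lebesgue (%x. indicator (tri k) x *\<^sub>R (v x)\<^sup>2)" if "k \<in> \<T>" for k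
  using v[OF that] tl[OF that] by (auto simp: L2_def borel_measurable_restrict_space_iff integrable_restrict_space)
 have "(%x. \<Sum>k\<in>\<T>. indicator (tri k) x *\<^sub>R v x) \<in> borel_measurable lebesgue" using m(1) by (intro borel_measurable_sum)
 from complete_measure.borel_measurable_AE_cong[OF completion.complete_measure_axioms this ae]
 have "(%x. indicator \<Omega> x *\<^sub>R v x) \<in> borel_measurable lebesgue" .
 hence vm: "v \<in> borel_measurable (lebesgue_on \<Omega>)" using Omega(4) by (simp add: borel_measurable_restrict_space_iff)
 have i: "integrable lebesgue (%x. \<Sum>k\<in>\<T>. indicator (tri k) x *\<^sub>R (v x)\<^sup>2)" using m(2) by (intro Bochner_Integration.integrable_sum)
 have sm: "(%x. indicator \<Omega> x *\<^sub>R (v x)\<^sup>2) \<in> borel_measurable lebesgue"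
  using complete_measure.borel_measurable_AE_cong[OF completion.complete_measure_axioms borel_measurable_integrable[OF i] ae] .
 have "integrable lebesgue (%x. indicator \<Omega> x *\<^sub>R (v x)\<^sup>2)" using integrable_cong_AE[OF borel_measurable_integrable[OF i] sm ae] i by simp
 thus "v \<in> L2 \<Omega>" using vm Omega(4) by (simp add: L2_def integrable_restrict_space)
 have "(L2norm \<Omega> v)^2 = (LINT x|lebesgue. indicator \<Omega> x *\<^sub>R (v x)\<^sup>2)" unfolding L2norm_sq using Omega(4) by (simp add: integral_restrict_space)
 also have "... = (LINT x|lebesgue. (\<Sum>k\<in>\<T>. indicator (tri k) x *\<^sub>R (v x)\<^sup>2))"
  by (rule integral_cong_AE[OF sm borel_measurable_integrable[OF i]]) (use ae[of "%x. (v x)^2"] in \<open>auto elim!: eventually_mono\<close>)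
 also have "... = (\<Sum>k\<in>\<T>. (LINT x|lebesgue. indicator (tri k) x *\<^sub>R (v x)\<^sup>2))" using m(2) by (intro Bochner_Integration.integral_sum)
 also have "... = (\<Sum>k\<in>\<T>. (L2norm (tri k) v)^2)" unfolding L2norm_sq using tl by (intro sum.cong) (auto simp: integral_restrict_space)
 finally show "(L2norm \<Omega> v)^2 = (\<Sum>k\<in>\<T>. (L2norm (tri k) v)^2)" .
qed

lemma pwHs_L2: "v \<in> pwHs 2 \<T> ==> v \<in> L2 \<Omega>" by (rule L2_Omega(1)) (rule Hs_L2[OF pwHs_tri])

lemma Hs_restrict: assumes v: "v \<in> Hs 2 \<Omega>" and k: "k \<in> \<T>"
 shows "v \<in> Hs 2 (tri k)" "length is <= 2 ==> aeq (tri k) (wd (tri k) is v) (wd \<Omega> is v)"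
proof -
 have *: "weak_deriv (tri k) is v (wd \<Omega> is v)" if "length is <= 2" for "is"
  using HsD(1)[OF v, of "is"] that by (intro weak_deriv_restrict[OF _ tri_subset[OF k] Omega(1) triangle.K_props(1)[OF tri_locale[OF k]]]) auto
 thus "v \<in> Hs 2 (tri k)" by (auto simp: Hs_def)
 show "length is <= 2 ==> aeq (tri k) (wd (tri k) is v) (wd \<Omega> is v)" using wd_aeq[OF * triangle.K_props(1)[OF tri_locale[OF k]]] .
qed

lemma Hs_pwHs: "v \<in> Hs 2 \<Omega> ==> v \<in> pwHs 2 \<T>" by (simp add: pwHs_def Hs_restrict(1))

end

subsection \<open>Weak derivatives of scalar functions of time\<close>

abbreviation lebT :: "real => real measure" where
 "lebT T \<equiv> lebesgue_on {0<..<T}"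

text \<open>Half-open intervals make the integral additive over adjacent intervals without
  exceptional points.\<close>

definition tint :: "real => (real => real) => real => real => real" where
 "tint T g a b = (LINT t|lebT T. indicator {a<..b} t * g t)"

lemma bounded_mult_integrable:
 assumes "integrable (lebT T) (f :: real => real)" "h \<in> borel_measurable borel" "!!t. \<bar>h t\<bar> <= (B::real)"
 shows "integrable (lebT T) (%t. h t * f t)"
proof (rule Bochner_Integration.integrable_bound[where f = "%t. B * f t"])
 have "h \<in> borel_measurable (lebT T)" using assms(2) by (intro measurable_restrict_space1 measurable_completion) simp
 thus "(%t. h t * f t) \<in> borel_measurable (lebT T)" using assms(1) by (intro borel_measurable_times) auto
 have "0 <= B" using order_trans[OF abs_ge_zero assms(3)] .
 thus "AE t in lebT T. norm (h t * f t) <= norm (B * f t)" by (intro AE_I2) (simp add: abs_mult mult_right_mono assms(3))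
qed (use assms(1) in simp)

lemma tint_integrable: "integrable (lebT T) g ==> integrable (lebT T) (%t. indicator {a<..b} t * g t)"
 for g :: "real => real" by (rule bounded_mult_integrable[where B = 1]) (auto simp: indicator_def)

lemma tint_add:
 assumes "integrable (lebT T) g" "a <= b" "b <= c" shows "tint T g a c = tint T g a b + tint T g b c"
proof -
 have "indicator {a<..c} t * g t = indicator {a<..b} t * g t + indicator {b<..c} t * g t" for t using assms by (auto simp: indicator_def)
 thus ?thesis unfolding tint_def using tint_integrable[OF assms(1)] by simp
qed

lemma tint_mono:
 assumes "integrable (lebT T) f" "integrable (lebT T) g" "AE t in lebT T. f t <= g t"
 shows "tint T f a b <= tint T g a b" unfolding tint_def by (rule integral_mono_AE[OF tint_integrable[OF assms(1)] tint_integrable[OF assms(2)]])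
  (use assms(3) in \<open>eventually_elim, auto simp: indicator_def\<close>)

lemma tint_const: assumes "0 <= a" "a <= b" "b <= T" shows "tint T (%_. c) a b = (b - a) * c"
proof -
 have "tint T (%_. c) a b = (LINT t|lebesgue. indicator ({0<..<T} \<inter> {a<..b}) t * c)"
  unfolding tint_def by (subst integral_restrict_space) (auto simp: indicator_inter_arith mult_ac intro!: Bochner_Integration.integral_cong)
 also have "... = measure lebesgue ({0<..<T} \<inter> {a<..b}) * c" by simp
 also have "measure lebesgue ({0<..<T} \<inter> {a<..b}) = b - a"
 proof -
  have "{0<..<T} \<inter> {a<..b} = (if b < T then {a<..b} else {a<..<b})" using assms by auto
  thus ?thesis using assms by simp
 qed
 finally show ?thesis .
qed

lemma const_integrable_time: "integrable (lebT T) (%_::real. c::real)"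
 using finite_measure.integrable_const[OF finite_measure_lebesgue_on[of "{0<..<T}"]] by simp

lemma tint_continuous:
 assumes g: "continuous_on {0..T} g" and ab: "0 <= a" "a <= b" "b <= T"
 shows "tint T g a b = integral {a..b} g" and "integrable (lebT T) g"
proof -
 have "set_integrable lborel {0..T} g" by (rule borel_integrable_atLeastAtMost'[OF g])
 hence "integrable lebesgue (%t. indicator {0..T} t *\<^sub>R g t)" unfolding set_integrable_def by (subst integrable_completion) auto
 hence "integrable lebesgue (%t. indicator {0<..<T} t *\<^sub>R (indicator {0..T} t *\<^sub>R g t))" by (rule integrable_mult_indicator[rotated]) simp
 moreover have "indicator {0<..<T} t *\<^sub>R (indicator {0..T} t *\<^sub>R g t) = indicator {0<..<T} t *\<^sub>R g t" for t by (auto simp: indicator_def)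
 ultimately have "integrable lebesgue (%t. indicator {0<..<T} t *\<^sub>R g t)" by (simp only:)
 thus "integrable (lebT T) g" by (simp add: integrable_restrict_space)
 have si: "set_integrable lborel {a..b} g" using ab by (intro borel_integrable_atLeastAtMost' continuous_on_subset[OF g]) auto
 have "tint T g a b = (LINT t|lebesgue. indicator {0<..<T} t * (indicator {a<..b} t * g t))" unfolding tint_def by (subst integral_restrict_space) auto
 also have "... = (LINT t|lebesgue. indicator {a..b} t * g t)"
 proof (rule integral_cong_AE)
  have *: "(%t. indicator {a..b} t * g t) \<in> borel_measurable lborel" using si unfolding set_integrable_def by auto
  show m: "(%t. indicator {a..b} t * g t) \<in> borel_measurable lebesgue" using measurable_completion[OF *] .
  have eq: "indicator {0<..<T} t * (indicator {a<..b} t * g t) = indicator ({0<..<T} \<inter> {a<..b}) t * (indicator {a..b} t * g t)" for t by (auto simp: indicator_def)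
  show "(%t. indicator {0<..<T} t * (indicator {a<..b} t * g t)) \<in> borel_measurable lebesgue"
   unfolding eq by (rule borel_measurable_times[OF borel_measurable_indicator m]) simp
  have "AE t in lebesgue. t \<notin> {a, T}" by (rule AE_not_in) (simp add: negligible_iff_null_sets[symmetric])
  thus "AE t in lebesgue. indicator {0<..<T} t * (indicator {a<..b} t * g t) = indicator {a..b} t * g t"
   by eventually_elim (use ab in \<open>auto simp: indicator_def\<close>)
 qed
 also have "... = (LINT t|lborel. indicator {a..b} t * g t)" using si unfolding set_integrable_def by (intro integral_completion) auto
 also have "... = integral {a..b} g" using set_borel_integral_eq_integral(2)[OF si] by (simp add: set_lebesgue_integral_def)
 finally show "tint T g a b = integral {a..b} g" .
qed

text \<open>For \<open>a < b\<close>, the ramp from 0 at \<open>a\<close> to 1 at \<open>b\<close>: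
  the antiderivative of the indicator of the interval divided by its length.\<close>

definition cl :: "real => real => real => real" where
 "cl a b t = max 0 (min 1 ((t - a) / (b - a)))"

text \<open>Smooth counterpart of \<open>cl\<close>. It is not compactly supported, but the
  difference of two of them is, and serves as a test function in time.\<close>

definition stp :: "real => real => real => real => real" where
 "stp n a b t = (LINT s|lborel. indicator {..t} s * chi n a b s) / (LINT s|lborel. chi n a b s)"

lemma stp_props:
 assumes ab: "a < b" and n: "0 < n"
 shows "(stp n a b has_real_derivative chi n a b t / (LINT s|lborel. chi n a b s)) (at t)"
  "t <= a ==> stp n a b t = 0" "b <= t ==> stp n a b t = 1" "0 <= stp n a b t" "stp n a b t <= 1"
proof -
 let ?f = "chi n a b" and ?m = "LINT s|lborel. chi n a b s"
 note m = chi_integral_pos[OF ab n]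
 have out: "?f s = 0" if "s \<notin> {a<..<b}" for s using chi_outside[OF less_imp_le[OF n] that] .
 have eq: "(LINT s|lborel. indicator {..t} s * ?f s) = integral {a - 1..t} ?f" for t
 proof -
  have "(LINT s|lborel. indicator {..t} s * ?f s) = (LINT s|lborel. indicator {a - 1..t} s *\<^sub>R ?f s)"
   by (intro Bochner_Integration.integral_cong refl) (use out in \<open>auto simp: indicator_def\<close>)
  also have "... = integral {a - 1..t} ?f"
   using set_borel_integral_eq_integral(2)[OF borel_integrable_atLeastAtMost'[OF CI_continuous[OF chi_CI]], of "a - 1" t n a b] by (simp add: set_lebesgue_integral_def)
  finally show ?thesis .
 qed
 show z: "stp n a b t = 0" if "t <= a" for t
 proof -
  have "indicator {..t} s * ?f s = 0" for s using out[of s] that by (auto simp: indicator_def)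
  thus ?thesis unfolding stp_def by (simp only: Bochner_Integration.integral_zero div_0)
 qed
 show "stp n a b t = 1" if "b <= t" for t
 proof -
  have "(LINT s|lborel. indicator {..t} s * ?f s) = ?m"
   by (intro Bochner_Integration.integral_cong refl) (use out that in \<open>auto simp: indicator_def\<close>)
  thus ?thesis using m(1) by (simp add: stp_def)
 qed
 have "0 <= (LINT s|lborel. indicator {..t} s * ?f s)" "(LINT s|lborel. indicator {..t} s * ?f s) <= ?m" for t
 proof -
  show "0 <= (LINT s|lborel. indicator {..t} s * ?f s)" by (intro integral_nonneg_AE AE_I2) (simp add: chi_bounds)
  show "(LINT s|lborel. indicator {..t} s * ?f s) <= ?m"
   using integrable_mult_indicator[OF _ m(2), of "{..t}"] m(2) by (intro integral_mono) (auto simp: indicator_def chi_bounds)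
 qed
 thus "0 <= stp n a b t" "stp n a b t <= 1" using m(1) by (auto simp: stp_def)
 show "(stp n a b has_real_derivative ?f t / ?m) (at t)"
 proof (cases "t < a")
  case True
  have "((%t. 0) has_real_derivative ?f t / ?m) (at t)" using True out[of t] by simp
  thus ?thesis by (rule has_field_derivative_transform_within_open[where S = "{..<a}"]) (use True z in auto)
 next
  case False
  have "((%u. integral {a - 1..u} ?f) has_real_derivative ?f t) (at t within {a - 1..t + 1})"
   using False by (intro integral_has_real_derivative CI_continuous[OF chi_CI]) auto
  hence "((%u. integral {a - 1..u} ?f) has_real_derivative ?f t) (at t)" using False at_within_Icc_at[of "a - 1" t "t + 1"] by simp
  from DERIV_cdivide[OF this, of ?m] show ?thesis by (simp add: stp_def[abs_def] eq)
 qed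
qed

lemma stp_tendsto:
 assumes ab: "a < b"
 shows "(%n. stp (real (Suc n)) a b t) \<longlonglongrightarrow> cl a b t" and "(%n. LINT s|lborel. chi (real (Suc n)) a b s) \<longlonglongrightarrow> b - a"
proof -
 have lim: "(%n. LINT s|lborel. indicator A s * chi (real (Suc n)) a b s) \<longlonglongrightarrow> (LINT s|lborel. indicator A s * indicator {a<..<b} s)" if A: "A \<in> sets borel" for A
 proof (rule integral_dominated_convergence[where w = "indicator {a<..<b}"])
  show "AE s in lborel. (%n. indicator A s * chi (real (Suc n)) a b s) \<longlonglongrightarrow> indicator A s * indicator {a<..<b} s"
   by (intro AE_I2 tendsto_mult tendsto_const chi_tendsto)
  show "AE s in lborel. norm (indicator A s * chi (real (Suc n)) a b s) <= indicator {a<..<b} s" for n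
   using chi_outside[of "real (Suc n)" _ a b] by (intro AE_I2) (auto simp: indicator_def chi_bounds)
  show "(%s. indicator A s * chi (real (Suc n)) a b s) \<in> borel_measurable lborel" for n
   using A borel_measurable_continuous_onI[OF CI_continuous[OF chi_CI]] by (intro borel_measurable_times) auto
  show "integrable lborel (indicat_real {a<..<b})" by (intro integrable_real_indicator) (use ab in auto)
 qed (use A in simp)
 show m: "(%n. LINT s|lborel. chi (real (Suc n)) a b s) \<longlonglongrightarrow> b - a" using lim[of UNIV] ab by simp
 have "(LINT s|lborel. indicator {..t} s * indicator {a<..<b} s) = cl a b t * (b - a)"
 proof -
  have "(LINT s|lborel. indicator {..t} s * indicator {a<..<b} s) = measure lborel ({..t} \<inter> {a<..<b})" by (simp add: indicator_inter_arith[symmetric])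
  also have "... = cl a b t * (b - a)"
  proof -
   consider "t <= a" | "b <= t" | "a < t" "t < b" by linarith
   thus ?thesis
   proof cases
    case 1 hence "{..t} \<inter> {a<..<b} = {}" by auto
    thus ?thesis using 1 ab by (simp add: cl_def divide_le_0_iff)
   next
    case 2 hence "{..t} \<inter> {a<..<b} = {a<..<b}" by auto
    thus ?thesis using 2 ab by (simp add: cl_def le_divide_eq)
   next
    case 3 hence "{..t} \<inter> {a<..<b} = {a<..t}" by auto
    thus ?thesis using 3 ab by (simp add: cl_def min_def max_def divide_le_0_iff)
   qed
  qed
  finally show ?thesis .
 qed
 with tendsto_divide[OF lim[of "{..t}"] m] ab show "(%n. stp (real (Suc n)) a b t) \<longlonglongrightarrow> cl a b t" by (simp add: stp_def)
qed

text \<open>Scalar form of \<open>weak_time_deriv\<close>: pairing with a fixed spatial function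
  reduces statements on functions of time to this setting.\<close>

locale weak_1D =
 fixes T :: real and g k :: "real => real"
 assumes gi: "integrable (lebT T) g" and ki: "integrable (lebT T) k"
  and wk: "!!\<phi>. \<phi> \<in> time_test_fun T ==> (LINT t|lebT T. deriv \<phi> t * g t) = - (LINT t|lebT T. \<phi> t * k t)"
begin

lemma cl_borel: "cl a b \<in> borel_measurable borel" unfolding cl_def by measurable

lemma cl_bound: "\<bar>cl a b t\<bar> <= 1" by (auto simp: cl_def)

text \<open>The test function is a smoothed ramp over one interval minus a smoothed ramp over
  another. Its derivative is a difference of smoothed means, so the definition of the weak
  derivative compares the means of \<open>g\<close> over the two intervals.\<close>

lemma mean_difference:
 assumes a: "0 < a" "a < b" "b < T" and a0: "0 < a0" "a0 < b0" "b0 < T"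
 shows "tint T g a b / (b - a) - tint T g a0 b0 / (b0 - a0) = (LINT t|lebT T. (cl a0 b0 t - cl a b t) * k t)"
proof -
 let ?M = "lebT T"
 define N where "N n = real (Suc n)" for n
 have N: "0 < N n" "0 < N 0" "N 0 <= N n" for n by (auto simp: N_def)
 define I where "I n a b = (LINT s|lborel. chi n a b s)" for n a b
 define \<phi> where "\<phi> n t = stp (N n) a b t - stp (N n) a0 b0 t" for n t
 define \<psi> where "\<psi> n t = chi (N n) a b t / I (N n) a b - chi (N n) a0 b0 t / I (N n) a0 b0" for n t
 have der: "(\<phi> n has_real_derivative \<psi> n t) (at t)" for n t
  unfolding \<phi>_def \<psi>_def I_def using stp_props(1)[OF a(2) N(1)] stp_props(1)[OF a0(2) N(1)] by (intro DERIV_diff)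
 have dphi: "deriv (\<phi> n) = \<psi> n" for n using der by (auto simp: fun_eq_iff intro: DERIV_imp_deriv)
 have \<psi>CI: "\<psi> n \<in> CI" for n
 proof -
  have "(%t. chi (N n) a b t * (1 / I (N n) a b) + chi (N n) a0 b0 t * (- 1 / I (N n) a0 b0)) \<in> CI" by (intro CI.add CI.mult CI.const chi_CI)
  thus ?thesis by (simp add: \<psi>_def[abs_def])
 qed
 have test: "\<phi> n \<in> time_test_fun T" for n
 proof -
  have "(deriv ^^ j) (\<phi> n) differentiable (at t)" for j t
  proof (cases j)
   case 0 thus ?thesis using der[of n t] by (auto intro: differentiableI[OF has_field_derivative_imp_has_derivative])
  next
   case (Suc i)
   hence "(deriv ^^ j) (\<phi> n) = (deriv ^^ i) (\<psi> n)" by (simp add: funpow_swap1 dphi)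
   thus ?thesis using CI_DERIV[OF CI_deriv_iter[OF \<psi>CI], of i n t] by (auto intro: differentiableI[OF has_field_derivative_imp_has_derivative])
  qed
  moreover have "closure {t. \<phi> n t ~= 0} \<subseteq> {min a a0..max b b0}"
  proof (rule closure_minimal)
   have "\<phi> n t = 0" if "t < min a a0 \<or> max b b0 < t" for t
    using that stp_props(2,3)[OF a(2) N(1)[of n], of t] stp_props(2,3)[OF a0(2) N(1)[of n], of t] by (auto simp: \<phi>_def)
   thus "{t. \<phi> n t ~= 0} \<subseteq> {min a a0..max b b0}" by (auto simp: not_less[symmetric])
  qed simp
  moreover have "{min a a0..max b b0} \<subseteq> {0<..<T}" using a a0 by auto
  ultimately show ?thesis unfolding time_test_fun_def by blast
 qed
 have lim1: "(%n. LINT t|?M. \<psi> n t * g t) \<longlonglongrightarrow> (LINT t|?M. (indicator {a<..b} t / (b - a) - indicator {a0<..b0} t / (b0 - a0)) * g t)"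
 proof (rule integral_dominated_convergence[where w = "%t. (1 / I (N 0) a b + 1 / I (N 0) a0 b0) * norm (g t)"])
  \<comment> \<open>Because \<open>chi\<close> increases with its parameter, the normalising
    integrals are smallest for \<open>n = 0\<close>, which gives a bound uniform in
    \<open>n\<close>.\<close>
  have Ipos: "0 < I (N 0) a b" "I (N 0) a b <= I (N n) a b" if "a < b" for n a b
  proof -
   show "0 < I (N 0) a b" unfolding I_def using chi_integral_pos(1)[OF that N(1)] .
   show "I (N 0) a b <= I (N n) a b" unfolding I_def using that N by (intro integral_mono chi_integral_pos chi_mono) auto
  qed
  have pb: "0 <= chi (N n) a b t / I (N n) a b" "chi (N n) a b t / I (N n) a b <= 1 / I (N 0) a b" if "a < b" for n a b t
   using Ipos(1)[OF that] Ipos(2)[OF that, of n] chi_bounds[of "N n" a b t] by (auto intro!: frac_le divide_nonneg_nonneg)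
  have "\<bar>\<psi> n t\<bar> <= 1 / I (N 0) a b + 1 / I (N 0) a0 b0" for n t unfolding \<psi>_def using pb[OF a(2), of n t] pb[OF a0(2), of n t] by linarith
  note mult_right_mono[OF this abs_ge_zero]
  thus "AE t in ?M. norm (\<psi> n t * g t) <= (1 / I (N 0) a b + 1 / I (N 0) a0 b0) * norm (g t)" for n by (intro AE_I2) (simp add: abs_mult)
  have "AE t in lebesgue. t \<notin> {b, b0}" by (rule AE_not_in) (simp add: negligible_iff_null_sets[symmetric])
  hence "AE t in lebesgue. t \<in> {0<..<T} --> t \<notin> {b, b0}" by eventually_elim simp
  hence "AE t in ?M. t \<notin> {b, b0}" using AE_restrict_space_iff[of "{0<..<T}" lebesgue "%t. t \<notin> {b, b0}"] by simp
  thus "AE t in ?M. (%n. \<psi> n t * g t) \<longlonglongrightarrow> (indicator {a<..b} t / (b - a) - indicator {a0<..b0} t / (b0 - a0)) * g t"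
  proof eventually_elim
   case (elim t)
   hence "indicat_real {a<..b} t = indicator {a<..<b} t" "indicat_real {a0<..b0} t = indicator {a0<..<b0} t" by (auto simp: indicator_def)
   thus ?case unfolding \<psi>_def I_def N_def using a a0 by (simp only:) (intro tendsto_intros chi_tendsto stp_tendsto, auto)
  qed
  show "(%t. \<psi> n t * g t) \<in> borel_measurable ?M" for n
   using gi continuous_measurable_lebesgue_on[OF CI_continuous[OF \<psi>CI]] by (intro borel_measurable_times) auto
  show "(%t. (indicator {a<..b} t / (b - a) - indicator {a0<..b0} t / (b0 - a0)) * g t) \<in> borel_measurable ?M"
   using gi a a0 by (intro borel_measurable_times borel_measurable_diff borel_measurable_divide borel_measurable_indicator) (auto simp: sets_restrict_space_iff intro: sets.Int)
 qed (use gi in simp)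
 have eqI: "(LINT t|?M. (indicator {a<..b} t / (b - a) - indicator {a0<..b0} t / (b0 - a0)) * g t) = tint T g a b / (b - a) - tint T g a0 b0 / (b0 - a0)"
  unfolding tint_def using tint_integrable[OF gi] by (simp add: left_diff_distrib)
 have lim2: "(%n. LINT t|?M. \<phi> n t * k t) \<longlonglongrightarrow> (LINT t|?M. (cl a b t - cl a0 b0 t) * k t)"
 proof (rule integral_dominated_convergence[where w = "%t. 2 * norm (k t)"])
  have "\<bar>\<phi> n t\<bar> <= 2" for n t
   using stp_props(4,5)[OF a(2) N(1)[of n], of t] stp_props(4,5)[OF a0(2) N(1)[of n], of t] unfolding \<phi>_def by linarith
  from mult_right_mono[OF this abs_ge_zero]
  show "AE t in ?M. norm (\<phi> n t * k t) <= 2 * norm (k t)" for n by (intro AE_I2) (simp add: abs_mult)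
  show "AE t in ?M. (%n. \<phi> n t * k t) \<longlonglongrightarrow> (cl a b t - cl a0 b0 t) * k t"
   unfolding \<phi>_def N_def using a a0 by (intro AE_I2 tendsto_intros stp_tendsto) auto
  have "continuous_on UNIV (\<phi> n)" for n using der DERIV_isCont continuous_at_imp_continuous_on by blast
  thus "(%t. \<phi> n t * k t) \<in> borel_measurable ?M" for n using ki continuous_measurable_lebesgue_on by (intro borel_measurable_times) auto
  have "(%t. cl a b t - cl a0 b0 t) \<in> borel_measurable ?M"
   using cl_borel by (intro measurable_restrict_space1 measurable_completion borel_measurable_diff) auto
  thus "(%t. (cl a b t - cl a0 b0 t) * k t) \<in> borel_measurable ?M" using ki by (intro borel_measurable_times) auto
 qed (use ki in simp)
 have "(LINT t|?M. \<psi> n t * g t) = - (LINT t|?M. \<phi> n t * k t)" for n using wk[OF test[of n]] by (simp add: dphi)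
 with lim1 have "(%n. - (LINT t|?M. \<phi> n t * k t)) \<longlonglongrightarrow> tint T g a b / (b - a) - tint T g a0 b0 / (b0 - a0)" unfolding eqI by simp
 from LIMSEQ_unique[OF this tendsto_minus[OF lim2]]
 have "tint T g a b / (b - a) - tint T g a0 b0 / (b0 - a0) = - (LINT t|?M. (cl a b t - cl a0 b0 t) * k t)" .
 also have "... = (LINT t|?M. (cl a0 b0 t - cl a b t) * k t)" by (subst Bochner_Integration.integral_minus[symmetric]) (simp add: algebra_simps)
 finally show ?thesis .
qed

text \<open>Difference quotients of \<open>p\<close> are means of \<open>g\<close>. By
  \<open>mean_difference\<close> they equal a mean over a fixed interval plus an integral of
  \<open>k\<close> against ramps, and the ramps collapse to the indicator of the points beyond
  \<open>x\<close>. So \<open>p\<close> is differentiable at every interior time although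
  \<open>g\<close> is given only almost everywhere.\<close>

lemma antiderivative_C1:
 assumes T: "0 < T" and p: "!!a b. 0 <= a ==> a <= b ==> b <= T ==> p b - p a = tint T g a b"
 shows "\<exists>G. (\<forall>t\<in>{0<..<T}. (p has_real_derivative G t) (at t)) & (\<forall>s t. s <= t --> G t - G s = tint T k s t)"
proof -
 let ?M = "lebT T"
 \<comment> \<open>Any fixed interior interval would do; it anchors the constant of
   integration.\<close>
 define a0 b0 where "a0 = T / 3" and "b0 = T / 2"
 have a0: "0 < a0" "a0 < b0" "b0 < T" using T by (auto simp: a0_def b0_def)
 define G where "G x = tint T g a0 b0 / (b0 - a0) + (LINT t|?M. (cl a0 b0 t - indicator {x<..} t) * k t)" for x
 have ii: "integrable ?M (%t. (cl a0 b0 t - indicator {x<..} t) * k t)" for x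
 proof (rule bounded_mult_integrable[OF ki, where B = 2])
  show "(%t. cl a0 b0 t - indicator {x<..} t) \<in> borel_measurable borel" using cl_borel by (intro borel_measurable_diff) auto
  show "\<bar>cl a0 b0 t - indicator {x<..} t\<bar> <= 2" for t using cl_bound[of a0 b0 t] by (cases "t \<in> {x<..}") auto
 qed
 have "(p has_real_derivative G x) (at x)" if x: "x \<in> {0<..<T}" for x unfolding DERIV_def
 proof (subst tendsto_at_iff_sequentially, intro allI impI)
  fix h :: "nat => real" assume h: "\<forall>i. h i \<in> UNIV - {0}" "h \<longlonglongrightarrow> 0"
  define a b where "a n = min x (x + h n)" and "b n = max x (x + h n)" for n
  have lim: "a \<longlonglongrightarrow> x" "b \<longlonglongrightarrow> x" unfolding a_def b_def using h(2) by (auto intro!: tendsto_eq_intros)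
  have ab: "a n < b n" for n using h(1)[rule_format, of n] by (auto simp: a_def b_def)
  have "\<forall>\<^sub>F n in sequentially. 0 < a n & b n < T"
   using order_tendstoD(1)[OF lim(1), of 0] order_tendstoD(2)[OF lim(2), of T] x by (auto intro: eventually_conj)
  hence ev: "\<forall>\<^sub>F n in sequentially. tint T g a0 b0 / (b0 - a0) + (LINT t|?M. (cl a0 b0 t - cl (a n) (b n) t) * k t) = (p (x + h n) - p x) / h n"
  proof eventually_elim
   case (elim n)
   have "(p (x + h n) - p x) / h n = (p (b n) - p (a n)) / (b n - a n)"
    unfolding a_def b_def min_def max_def using h(1)[rule_format, of n] by (auto simp: field_simps)
   also have "... = tint T g (a n) (b n) / (b n - a n)" using p[of "a n" "b n"] elim ab[of n] by simp
   finally show ?case using mean_difference[of "a n" "b n" a0 b0] elim ab[of n] a0 by simp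
  qed
  have "(%n. LINT t|?M. (cl a0 b0 t - cl (a n) (b n) t) * k t) \<longlonglongrightarrow> (LINT t|?M. (cl a0 b0 t - indicator {x<..} t) * k t)"
  proof (rule integral_dominated_convergence[where w = "%t. 2 * norm (k t)"])
   have "\<bar>cl a0 b0 t - cl (a n) (b n) t\<bar> <= 2" for n t using cl_bound[of a0 b0 t] cl_bound[of "a n" "b n" t] by linarith
   from mult_right_mono[OF this abs_ge_zero]
   show "AE t in ?M. norm ((cl a0 b0 t - cl (a n) (b n) t) * k t) <= 2 * norm (k t)" for n by (intro AE_I2) (simp add: abs_mult)
   have "AE t in lebesgue. t \<notin> {x}" by (rule AE_not_in) (simp add: negligible_iff_null_sets[symmetric])
   hence "AE t in ?M. t \<notin> {x}" by (auto simp: AE_restrict_space_iff elim!: eventually_mono)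
   thus "AE t in ?M. (%n. (cl a0 b0 t - cl (a n) (b n) t) * k t) \<longlonglongrightarrow> (cl a0 b0 t - indicator {x<..} t) * k t"
   proof eventually_elim
    case (elim t)
    have "(%n. cl (a n) (b n) t) \<longlonglongrightarrow> indicator {x<..} t"
    proof (cases "t < x")
     case True
     have "\<forall>\<^sub>F n in sequentially. cl (a n) (b n) t = 0" using order_tendstoD(1)[OF lim(1) True]
     proof eventually_elim
      case (elim n)
      hence "(t - a n) / (b n - a n) <= 0" using ab[of n] by (simp add: divide_le_0_iff)
      thus ?case by (simp add: cl_def)
     qed
     thus ?thesis using True by (simp add: tendsto_eventually)
    next
     case False
     hence "x < t" using elim by auto
     have "\<forall>\<^sub>F n in sequentially. cl (a n) (b n) t = 1" using order_tendstoD(2)[OF lim(2) \<open>x < t\<close>]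
     proof eventually_elim
      case (elim n)
      hence "1 <= (t - a n) / (b n - a n)" using ab[of n] by (simp add: le_divide_eq)
      thus ?case by (simp add: cl_def)
     qed
     thus ?thesis using \<open>x < t\<close> by (simp add: tendsto_eventually)
    qed
    thus ?case by (intro tendsto_intros)
   qed
   have "(%t. cl a0 b0 t - cl (a n) (b n) t) \<in> borel_measurable ?M" for n
    using cl_borel by (intro measurable_restrict_space1 measurable_completion borel_measurable_diff) auto
   thus "(%t. (cl a0 b0 t - cl (a n) (b n) t) * k t) \<in> borel_measurable ?M" for n using ki by (intro borel_measurable_times) auto
   show "(%t. (cl a0 b0 t - indicator {x<..} t) * k t) \<in> borel_measurable ?M" using ii by auto
  qed (use ki in simp)
  from tendsto_add[OF tendsto_const[of "tint T g a0 b0 / (b0 - a0)"] this]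
  have "(%n. tint T g a0 b0 / (b0 - a0) + (LINT t|?M. (cl a0 b0 t - cl (a n) (b n) t) * k t)) \<longlonglongrightarrow> G x" by (simp add: G_def)
  from Lim_transform_eventually[OF this ev] show "((%h. (p (x + h) - p x) / h) \<circ> h) \<longlonglongrightarrow> G x" by (simp add: o_def)
 qed
 moreover have "G t - G s = tint T k s t" if "s <= t" for s t
 proof -
  have "G t - G s = (LINT r|?M. (cl a0 b0 r - indicator {t<..} r) * k r - (cl a0 b0 r - indicator {s<..} r) * k r)" unfolding G_def using ii by simp
  also have "... = tint T k s t" unfolding tint_def using that by (intro Bochner_Integration.integral_cong refl) (auto simp: indicator_def algebra_simps)
  finally show ?thesis .
 qed
 ultimately show ?thesis by blast
qed

end

subsection \<open>Strongly measurable functions of time\<close>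

lemma AE_time_iff: "(AE t in lebT T. P t) \<longleftrightarrow> (AE t in lebesgue. t \<in> {0<..<(T::real)} --> P t)" by (rule AE_restrict_space_iff) simp

lemma time_measurable_iff: "f \<in> borel_measurable (lebT T) \<longleftrightarrow> (%t. indicator {0<..<(T::real)} t *\<^sub>R (f t :: real)) \<in> borel_measurable lebesgue"
 by (rule borel_measurable_restrict_space_iff) simp

lemma time_measurable_AE_limit:
 assumes f: "!!n::nat. f n \<in> borel_measurable (lebesgue_on {0<..<T::real})" and lim: "AE t in lebT T. (%n. f n t) \<longlonglongrightarrow> (g t :: real)"
 shows "g \<in> borel_measurable (lebT T)"
proof -
 define L where "L t = lim (%n. indicator {0<..<T} t *\<^sub>R f n t)" for t
 have "L \<in> borel_measurable lebesgue" unfolding L_def by (rule borel_measurable_lim_metric[OF f[unfolded time_measurable_iff]])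
 moreover have "AE t in lebesgue. L t = indicator {0<..<T} t *\<^sub>R g t" using lim[unfolded AE_time_iff]
 proof eventually_elim
  case (elim t)
  have "(%n. indicator {0<..<T} t *\<^sub>R f n t) \<longlonglongrightarrow> indicator {0<..<T} t *\<^sub>R g t"
   using elim by (cases "t \<in> {0<..<T}") (auto simp: indicator_def)
  thus ?case unfolding L_def by (rule limI)
 qed
 ultimately have "(%t. indicator {0<..<T} t *\<^sub>R g t) \<in> borel_measurable lebesgue"
  by (rule complete_measure.borel_measurable_AE_cong[OF completion.complete_measure_axioms])
 thus ?thesis by (simp only: time_measurable_iff)
qed

lemma simple_level_measurable:
 assumes "simple_in_time T X S" "simple_in_time T X S'"
 shows "{t \<in> {0<..<T}. P (S t) (S' t)} \<in> sets lebesgue"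
proof -
 let ?I = "{0<..<T}"
 have "{t \<in> ?I. P (S t) (S' t)} = (\<Union>y\<in>S ` ?I. \<Union>y'\<in>S' ` ?I. if P y y' then {t \<in> ?I. S t = y} \<inter> {t \<in> ?I. S' t = y'} else {})"
  by (auto split: if_splits)
 moreover have "... \<in> sets lebesgue" using assms unfolding simple_in_time_def by (intro sets.finite_UN) auto
 ultimately show ?thesis by simp
qed

lemma simple_measurable:
 assumes "simple_in_time T X S" shows "(%t. F (S t) :: real) \<in> borel_measurable (lebT T)"
proof (rule measurableI)
 fix A :: "real set"
 have "(%t. F (S t)) -` A \<inter> space (lebT T) = {t \<in> {0<..<T}. F (S t) \<in> A}" by auto
 thus "(%t. F (S t)) -` A \<inter> space (lebT T) \<in> sets (lebT T)"
  using simple_level_measurable[OF assms assms, of "%y _. F y \<in> A"] by (auto simp: sets_restrict_space_iff)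
qed simp

lemma simple_combine:
 assumes "simple_in_time T X S" "simple_in_time T X S'" "!!y y'. y \<in> X ==> y' \<in> X ==> h y y' \<in> X"
 shows "simple_in_time T X (%t. h (S t) (S' t))"
proof -
 have "(%t. h (S t) (S' t)) ` {0<..<T} \<subseteq> (%(y, y'). h y y') ` (S ` {0<..<T} \<times> S' ` {0<..<T})" by auto
 moreover have "finite (S ` {0<..<T} \<times> S' ` {0<..<T})" using assms unfolding simple_in_time_def by blast
 ultimately have "finite ((%t. h (S t) (S' t)) ` {0<..<T})" by (meson finite_imageI finite_subset)
 thus ?thesis using assms simple_level_measurable[OF assms(1,2), of "%y y'. h y y' = w" for w] unfolding simple_in_time_def by blast
qed

lemma simple_const: "w \<in> X ==> simple_in_time T X (%t. w)" by (auto simp: simple_in_time_def intro: finite_subset[of _ "{w}"])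

lemma simple_integral:
 assumes S: "simple_in_time T X S"
 shows "tint T (%t. F (S t)) a b = (\<Sum>y\<in>S ` {0<..<T}. tint T (%t. indicator {y} (S t)) a b * F y)"
  and "integrable (lebT T) (%t. F (S t) :: real)"
proof -
 have f: "finite (S ` {0<..<T})" using S by (simp add: simple_in_time_def)
 have i1: "integrable (lebT T) (%t. indicat_real {y} (S t))" for y
  by (rule Bochner_Integration.integrable_bound[OF const_integrable_time[of T 1] simple_measurable[OF S]]) (auto simp: indicator_def)
 have eq: "F (S t) = (\<Sum>y\<in>S ` {0<..<T}. indicator {y} (S t) * F y)" if "t \<in> {0<..<T}" for t
 proof -
  have "(\<Sum>y\<in>S ` {0<..<T}. indicator {y} (S t) * F y) = (\<Sum>y\<in>S ` {0<..<T}. if y = S t then F y else 0)"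
   by (intro sum.cong refl) (auto simp: indicator_def)
  thus ?thesis using that f by simp
 qed
 have "integrable (lebT T) (%t. \<Sum>y\<in>S ` {0<..<T}. indicator {y} (S t) * F y)" using i1 by simp
 thus "integrable (lebT T) (%t. F (S t))" using eq by (subst Bochner_Integration.integrable_cong) auto
 have "tint T (%t. F (S t)) a b = (LINT t|lebT T. (\<Sum>y\<in>S ` {0<..<T}. (indicator {a<..b} t * indicator {y} (S t)) * F y))"
  unfolding tint_def by (intro Bochner_Integration.integral_cong refl) (use eq in \<open>simp add: sum_distrib_left mult.assoc\<close>)
 also have "... = (\<Sum>y\<in>S ` {0<..<T}. tint T (%t. indicator {y} (S t)) a b * F y)"
  unfolding tint_def using tint_integrable[OF i1] by (subst Bochner_Integration.integral_sum) auto
 finally show "tint T (%t. F (S t)) a b = (\<Sum>y\<in>S ` {0<..<T}. tint T (%t. indicator {y} (S t)) a b * F y)" .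
qed

text \<open>\<open>N\<close> is constrained on \<open>X\<close> only, where it is a seminorm.
  Instances are the Sobolev norms, the \<open>L\<^sup>2\<close> norm and its restriction to the
  discrete space.\<close>

locale seminormed_fn =
 fixes X :: "fn set" and N :: "fn => real"
 assumes zero: "(%x. 0) \<in> X" and lc: "v \<in> X ==> w \<in> X ==> lincomb c v d w \<in> X"
  and tri: "v \<in> X ==> w \<in> X ==> N (lincomb c v d w) <= \<bar>c\<bar> * N v + \<bar>d\<bar> * N w" and nn: "v \<in> X ==> 0 <= N v"
begin

lemma fm: "v \<in> X ==> w \<in> X ==> fminus v w \<in> X" by (simp add: fminus_eq_lincomb lc)

lemma commute: "v \<in> X ==> w \<in> X ==> N (fminus v w) <= N (fminus w v)"
proof -
 assume "v \<in> X" "w \<in> X"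
 moreover have "fminus v w = lincomb (-1) (fminus w v) 0 (fminus w v)" by (simp add: fun_eq_iff)
 ultimately show ?thesis using tri[OF fm fm, of w v w v "-1" 0] by simp
qed

lemma le_add: "v \<in> X ==> w \<in> X ==> N v <= N w + N (fminus v w)"
proof -
 assume "v \<in> X" "w \<in> X"
 moreover have "v = lincomb 1 w 1 (fminus v w)" by (simp add: fun_eq_iff)
 ultimately show ?thesis using tri[OF _ fm, of w v w 1 1] by simp
qed

lemma diff: "v \<in> X ==> w \<in> X ==> \<bar>N v - N w\<bar> <= N (fminus v w)" using le_add[of v w] le_add[of w v] commute[of w v] by linarith

lemma strongly_measurable_functional:
 assumes g: "strongly_measurable T X N g" and F: "!!u v. u \<in> X ==> v \<in> X ==> \<bar>F u - F v\<bar> <= C * N (fminus u v)"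
 shows "(%t. F (g t)) \<in> borel_measurable (lebT T)"
proof -
 obtain S where S: "!!k. simple_in_time T X (S k)" "AE t in lebT T. (%k::nat. N (fminus (g t) (S k t))) \<longlonglongrightarrow> 0"
  and gX: "AE t in lebT T. g t \<in> X" using g by (auto simp: strongly_measurable_def)
 show ?thesis
 proof (rule time_measurable_AE_limit)
  show "(%t. F (S n t)) \<in> borel_measurable (lebT T)" for n by (rule simple_measurable[OF S(1)])
  have "AE t in lebT T. t \<in> {0<..<T}" using AE_space[of "lebT T"] by simp
  with S(2) gX show "AE t in lebT T. (%n. F (S n t)) \<longlonglongrightarrow> F (g t)"
  proof eventually_elim
   case (elim t)
   have SX: "S n t \<in> X" for n using S(1)[of n] elim(3) by (auto simp: simple_in_time_def)
   have "\<bar>F (S n t) - F (g t)\<bar> <= C * N (fminus (g t) (S n t))" for n using F[OF elim(2) SX[of n]] by (simp add: abs_minus_commute)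
   hence "(%n. F (S n t) - F (g t)) \<longlonglongrightarrow> 0"
    by (intro Lim_null_comparison[OF _ tendsto_mult_right_zero[OF elim(1), of C]]) (auto intro!: always_eventually)
   thus ?case by (simp add: LIM_zero_iff)
  qed
 qed
qed

lemma strongly_measurable_diff_simple:
 assumes "strongly_measurable T X N g" "simple_in_time T X S"
 shows "strongly_measurable T X N (%t. fminus (g t) (S t))"
proof -
 obtain S' where S': "!!k. simple_in_time T X (S' k)" "AE t in lebT T. (%k::nat. N (fminus (g t) (S' k t))) \<longlonglongrightarrow> 0"
  and gX: "AE t in lebT T. g t \<in> X" using assms(1) by (auto simp: strongly_measurable_def)
 have "fminus (fminus u w) (fminus v w) = fminus u v" for u v w by (simp add: fun_eq_iff)
 moreover have "simple_in_time T X (%t. fminus (S' k t) (S t))" for k by (rule simple_combine[OF S'(1) assms(2) fm])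
 moreover have "AE t in lebT T. t \<in> {0<..<T}" using AE_space[of "lebT T"] by simp
 hence "AE t in lebT T. fminus (g t) (S t) \<in> X" using gX
 proof eventually_elim
  case (elim t)
  hence "S t \<in> X" using assms(2) by (auto simp: simple_in_time_def)
  thus ?case using elim by (intro fm)
 qed
 ultimately show ?thesis unfolding strongly_measurable_def using S'(2) by (intro conjI exI[of _ "%k t. fminus (S' k t) (S t)"]) auto
qed

lemma strongly_measurable_norm: "strongly_measurable T X N g ==> (%t. N (g t)) \<in> borel_measurable (lebT T)"
 by (rule strongly_measurable_functional[where C = 1]) (use diff in auto)

lemma norm_sum:
 assumes "finite Y" "Y \<subseteq> X" "!!y. 0 <= c y"
 shows "(%x. \<Sum>y\<in>Y. c y * y x) \<in> X & N (%x. \<Sum>y\<in>Y. c y * y x) <= (\<Sum>y\<in>Y. c y * N y)" using assms(1,2)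
proof (induction Y)
 case empty
 have "(%x. 0) = lincomb 0 (%x. 0) 0 (%x. 0)" by (simp add: fun_eq_iff)
 thus ?case using zero tri[OF zero zero, of 0 0] by simp
next
 case (insert z Y)
 let ?s = "%x. \<Sum>y\<in>Y. c y * y x"
 have "(%x. \<Sum>y\<in>insert z Y. c y * y x) = lincomb (c z) z 1 ?s" using insert by (simp add: fun_eq_iff)
 thus ?case using insert lc[of z ?s "c z" 1] tri[of z ?s "c z" 1] assms(3)[of z] by (auto intro: order_trans)
qed

end

lemma ip_sum:
 assumes "finite Y" "Y \<subseteq> L2 U" "z \<in> L2 U"
 shows "(%x. \<Sum>y\<in>Y. c y * y x) \<in> L2 U & ip U (%x. \<Sum>y\<in>Y. c y * y x) z = (\<Sum>y\<in>Y. c y * ip U y z)" using assms(1,2)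
proof (induction Y)
 case empty
 thus ?case using L2.zero_mem[OF assms(3)] by (simp add: ip_def)
next
 case (insert y Y)
 let ?s = "%x. \<Sum>y\<in>Y. c y * y x"
 have "(%x. \<Sum>y\<in>insert y Y. c y * y x) = lincomb (c y) y 1 ?s" using insert by (simp add: fun_eq_iff)
 thus ?case using insert L2.lincomb_mem[of y U ?s "c y" 1] L2.lin[of y U ?s z "c y" 1] assms(3) by simp
qed

lemma zero_L2: "(%x. 0) \<in> L2 U" by (simp add: L2_def)

lemma zero_Hs: "open U ==> (%x. 0) \<in> Hs s U"
proof -
 assume U: "open U"
 have "weak_deriv U is (%x. 0) (%x. 0)" for "is" by (simp add: weak_deriv_def zero_L2 ip_def)
 moreover have "gagliardo (frac s) U (wd U is (%x. 0)) = 0" for "is" using gagliardo_cong[OF wd_aeq[OF calculation U]] by (simp add: gagliardo_scale_zero)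
 ultimately show ?thesis by (auto simp: Hs_def)
qed

lemma seminormed_Hs: "open U ==> bounded U ==> seminormed_fn (Hs s U) (Hs_norm s U)" by unfold_locales (auto simp: zero_Hs Hs_lincomb Hs_norm_lincomb)

lemma seminormed_L2: "seminormed_fn (L2 U) (L2norm U)" by unfold_locales (auto simp: zero_L2 L2.lincomb_mem L2norm_def L2.nrm_lincomb L2.nonneg)

text \<open>The truncated approximating simple functions are dominated, so their integrals form a Cauchy sequence.\<close>

lemma Bochner_integral_Hs:
 assumes U: "open U" "bounded U" and g: "strongly_measurable T (Hs s U) (Hs_norm s U) g"
  and M: "AE t in lebT T. Hs_norm s U (g t) <= M"
  and w: "w \<in> L2 U" and eq: "!!z. z \<in> L2 U ==> ip U w z = tint T (%t. ip U (g t) z) a b"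
 shows "w \<in> Hs s U" and "Hs_norm s U w <= tint T (%t. Hs_norm s U (g t)) a b"
  and "integrable (lebT T) (%t. Hs_norm s U (g t))"
proof -
 interpret H: seminormed_fn "Hs s U" "Hs_norm s U" by (rule seminormed_Hs[OF U])
 let ?I = "lebT T" and ?N = "Hs_norm s U"
 obtain S0 where S0: "!!k. simple_in_time T (Hs s U) (S0 k)" "AE t in ?I. (%k::nat. ?N (fminus (g t) (S0 k t))) \<longlonglongrightarrow> 0"
  and gX: "AE t in ?I. g t \<in> Hs s U" using g by (auto simp: strongly_measurable_def)
 have tI: "AE t in ?I. t \<in> {0<..<T}" using AE_space[of ?I] by simp
 \<comment> \<open>Since the limit has norm at most \<open>M\<close>, the threshold with slack 1
   leaves all late approximants unchanged at almost every time, while all values obey one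
   bound.\<close>
 define S where "S k t = (if ?N (S0 k t) <= \<bar>M\<bar> + 1 then S0 k t else (%x. 0))" for k t
 have S: "simple_in_time T (Hs s U) (S k)" for k
  unfolding S_def using simple_combine[OF S0(1) S0(1), where h = "%y _. if ?N y <= \<bar>M\<bar> + 1 then y else (%x. 0)"] H.zero by simp
 have N0: "?N (%x. 0) <= 0" using H.norm_sum[of "{}" "%_. 0"] by simp
 have SB: "?N (S k t) <= \<bar>M\<bar> + 1" for k t using N0 by (auto simp: S_def)
 have SX: "S k t \<in> Hs s U" if "t \<in> {0<..<T}" for k t using S[of k] that by (auto simp: simple_in_time_def)
 have conv: "AE t in ?I. (%k. ?N (fminus (g t) (S k t))) \<longlonglongrightarrow> 0" using S0(2) gX M tI
 proof eventually_elim
  case (elim t)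
  have "\<forall>\<^sub>F k in sequentially. ?N (fminus (g t) (S0 k t)) < 1" using order_tendstoD(2)[OF elim(1), of 1] by simp
  hence "\<forall>\<^sub>F k in sequentially. ?N (fminus (g t) (S0 k t)) = ?N (fminus (g t) (S k t))"
  proof eventually_elim
   case (elim k)
   have "S0 k t \<in> Hs s U" using S0(1)[of k] \<open>t \<in> {0<..<T}\<close> by (auto simp: simple_in_time_def)
   hence "?N (S0 k t) <= \<bar>M\<bar> + 1" using H.diff[OF \<open>g t \<in> Hs s U\<close>, of "S0 k t"] elim \<open>?N (g t) <= M\<close> by linarith
   thus ?case by (simp add: S_def)
  qed
  from Lim_transform_eventually[OF elim(1) this] show ?case .
 qed
 have bnd: "AE t in ?I. ?N (fminus (g t) (S k t)) <= 2 * \<bar>M\<bar> + 1" for k using gX M tI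
 proof eventually_elim
  case (elim t)
  have "?N (fminus (g t) (S k t)) <= ?N (g t) + ?N (S k t)" unfolding fminus_eq_lincomb using H.tri[OF elim(1) SX[OF elim(3)], of 1 "-1"] by simp
  thus ?case using elim(2) SB[of k t] by linarith
 qed
 have gint: "integrable ?I (%t. ?N (g t))"
  by (rule Bochner_Integration.integrable_bound[OF const_integrable_time[of T "\<bar>M\<bar>"] H.strongly_measurable_norm[OF g]])
   (use M in \<open>eventually_elim, auto\<close>)
 thus "integrable ?I (%t. ?N (g t))" .
 have dm: "strongly_measurable T (Hs s U) ?N (%t. fminus (g t) (S k t))" for k by (rule H.strongly_measurable_diff_simple[OF g S])
 have dint: "integrable ?I (%t. ?N (fminus (g t) (S k t)))" for k
  by (rule Bochner_Integration.integrable_bound[OF const_integrable_time[of T "2 * \<bar>M\<bar> + 1"] H.strongly_measurable_norm[OF dm]])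
   (use bnd[of k] in \<open>eventually_elim, auto\<close>)
 define d where "d k = tint T (%t. ?N (fminus (g t) (S k t))) a b" for k
 have d0: "d \<longlonglongrightarrow> 0"
 proof -
  have "(%k. LINT t|?I. indicator {a<..b} t * ?N (fminus (g t) (S k t))) \<longlonglongrightarrow> (LINT t|?I. indicator {a<..b} t * 0)"
  proof (rule integral_dominated_convergence[where w = "%t. 2 * \<bar>M\<bar> + 1"])
   show "AE t in ?I. (%k. indicator {a<..b} t * ?N (fminus (g t) (S k t))) \<longlonglongrightarrow> indicator {a<..b} t * 0"
    using conv by eventually_elim (auto intro!: tendsto_mult_right_zero)
   show "AE t in ?I. norm (indicator {a<..b} t * ?N (fminus (g t) (S k t))) <= 2 * \<bar>M\<bar> + 1" for k
    using bnd[of k] by eventually_elim (auto simp: indicator_def)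
  qed (use tint_integrable[OF dint] const_integrable_time in auto)
  thus ?thesis by (simp add: d_def[abs_def] tint_def)
 qed
 define W where "W k = (%x. \<Sum>y\<in>S k ` {0<..<T}. tint T (%t. indicator {y} (S k t)) a b * y x)" for k
 have c0: "0 <= tint T (%t. indicator {y} (S' t)) a b" for y and S' :: "real => fn" unfolding tint_def by (intro integral_nonneg_AE AE_I2) auto
 have fin: "finite (S k ` {0<..<T})" "S k ` {0<..<T} \<subseteq> Hs s U" for k using S[of k] by (auto simp: simple_in_time_def)
 have Wx: "W k x = tint T (%t. S k t x) a b" for k x unfolding W_def using simple_integral(1)[OF S, where F = "%y. y x"] by simp
 have WH: "W k \<in> Hs s U" for k unfolding W_def by (rule H.norm_sum[OF fin c0, THEN conjunct1])
 have WL: "W k \<in> L2 U" for k by (rule Hs_L2[OF WH])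
 \<comment> \<open>The difference of two such integrals is the integral of a simple function again,
   so its norm is bounded by the integral of the norm.\<close>
 have Wdiff: "?N (fminus (W m) (W n)) <= d m + d n" for m n
 proof -
  let ?D = "%t. fminus (S m t) (S n t)"
  have D: "simple_in_time T (Hs s U) ?D" by (rule simple_combine[OF S S H.fm])
  have "fminus (W m) (W n) = (%x. \<Sum>y\<in>?D ` {0<..<T}. tint T (%t. indicator {y} (?D t)) a b * y x)"
  proof
   fix x
   have "fminus (W m) (W n) x = tint T (%t. ?D t x) a b" unfolding fminus_apply Wx tint_def
    using tint_integrable[OF simple_integral(2)[OF S, where F = "%y. y x"]] by (simp add: right_diff_distrib)
   also have "... = (\<Sum>y\<in>?D ` {0<..<T}. tint T (%t. indicator {y} (?D t)) a b * y x)" using simple_integral(1)[OF D, where F = "%y. y x"] .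
   finally show "fminus (W m) (W n) x = (\<Sum>y\<in>?D ` {0<..<T}. tint T (%t. indicator {y} (?D t)) a b * y x)" .
  qed
  moreover have "finite (?D ` {0<..<T})" "?D ` {0<..<T} \<subseteq> Hs s U" using D by (auto simp: simple_in_time_def)
  ultimately have "?N (fminus (W m) (W n)) <= (\<Sum>y\<in>?D ` {0<..<T}. tint T (%t. indicator {y} (?D t)) a b * ?N y)" using H.norm_sum[OF _ _ c0] by simp
  also have "... = tint T (%t. ?N (?D t)) a b" using simple_integral(1)[OF D, where F = ?N] by simp
  also have "... <= tint T (%t. ?N (fminus (g t) (S m t)) + ?N (fminus (g t) (S n t))) a b"
  proof (rule tint_mono[OF simple_integral(2)[OF D]])
   show "integrable ?I (%t. ?N (fminus (g t) (S m t)) + ?N (fminus (g t) (S n t)))" using dint by simp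
   show "AE t in ?I. ?N (?D t) <= ?N (fminus (g t) (S m t)) + ?N (fminus (g t) (S n t))" using gX tI
   proof eventually_elim
    case (elim t)
    have "?D t = lincomb (-1) (fminus (g t) (S m t)) 1 (fminus (g t) (S n t))" by (simp add: fun_eq_iff)
    thus ?case using H.tri[OF H.fm[OF elim(1) SX[OF elim(2)]] H.fm[OF elim(1) SX[OF elim(2)]], of "-1" m 1 n] by simp
   qed
  qed
  also have "... = d m + d n" unfolding d_def tint_def using tint_integrable[OF dint] by (simp add: distrib_left)
  finally show ?thesis .
 qed
 have ipint: "integrable ?I (%t. ip U (g t) z)" if z: "z \<in> L2 U" for z
 proof (rule Bochner_Integration.integrable_bound[of _ "%t. L2norm U z * ?N (g t)"])
  have F: "\<bar>ip U u z - ip U v z\<bar> <= L2norm U z * ?N (fminus u v)" if "u \<in> Hs s U" "v \<in> Hs s U" for u v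
  proof -
   note uv = Hs_L2[OF that(1)] Hs_L2[OF that(2)]
   have "\<bar>ip U u z - ip U v z\<bar> <= L2norm U (fminus u v) * L2norm U z"
    using L2.Cauchy_Schwarz[OF L2.fminus_mem[OF uv] z] uv z by (simp add: L2.diff_left L2norm_def)
   also have "... <= ?N (fminus u v) * L2norm U z" by (intro mult_right_mono L2norm_le_Hs_norm L2.fminus_mem uv U) simp
   finally show ?thesis by (simp add: mult.commute)
  qed
  show "(%t. ip U (g t) z) \<in> borel_measurable ?I" by (rule H.strongly_measurable_functional[OF g F])
  show "AE t in ?I. norm (ip U (g t) z) <= norm (L2norm U z * ?N (g t))" using gX
  proof eventually_elim
   case (elim t)
   have "\<bar>ip U (g t) z\<bar> <= L2norm U (g t) * L2norm U z" using L2.Cauchy_Schwarz[OF Hs_L2[OF elim] z] by (simp add: L2norm_def)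
   also have "... <= ?N (g t) * L2norm U z" by (intro mult_right_mono L2norm_le_Hs_norm Hs_L2[OF elim] U) simp
   finally show ?case by (simp add: mult.commute)
  qed
 qed (use gint in simp)
 \<comment> \<open>The weak characterisation of \<open>w\<close> is tested with the error
   \<open>W k - w\<close> itself, which turns it into convergence in norm.\<close>
 have WL2: "L2norm U (fminus (W k) w) <= d k" for k
 proof -
  let ?z = "fminus (W k) w"
  have zL: "?z \<in> L2 U" by (rule L2.fminus_mem[OF WL w])
  have "ip U (W k) ?z = tint T (%t. ip U (S k t) ?z) a b" unfolding simple_integral(1)[OF S, where F = "%y. ip U y ?z"]
   by (subst (1) W_def, rule ip_sum[OF fin(1) _ zL, THEN conjunct2]) (use fin(2) Hs_L2 in blast)
  hence "ip U ?z ?z = tint T (%t. ip U (S k t) ?z) a b - tint T (%t. ip U (g t) ?z) a b" using L2.diff_left[OF WL w zL] eq[OF zL] by simp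
  also have "... = tint T (%t. ip U (S k t) ?z - ip U (g t) ?z) a b"
   unfolding tint_def using tint_integrable[OF ipint[OF zL]] tint_integrable[OF simple_integral(2)[OF S, where F = "%y. ip U y ?z"]] by (simp add: right_diff_distrib)
  also have "... <= tint T (%t. L2norm U ?z * ?N (fminus (g t) (S k t))) a b"
  proof (rule tint_mono)
   show "integrable ?I (%t. ip U (S k t) ?z - ip U (g t) ?z)" using ipint[OF zL] simple_integral(2)[OF S, where F = "%y. ip U y ?z"] by simp
   show "AE t in ?I. ip U (S k t) ?z - ip U (g t) ?z <= L2norm U ?z * ?N (fminus (g t) (S k t))" using gX tI
   proof eventually_elim
    case (elim t)
    note gs = Hs_L2[OF elim(1)] Hs_L2[OF SX[OF elim(2), of k]]
    have "ip U (S k t) ?z - ip U (g t) ?z <= L2norm U (fminus (g t) (S k t)) * L2norm U ?z"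
     using L2.Cauchy_Schwarz[OF L2.fminus_mem[OF gs] zL] L2.diff_left[OF gs zL] by (simp add: L2norm_def)
    also have "... <= ?N (fminus (g t) (S k t)) * L2norm U ?z" by (intro mult_right_mono L2norm_le_Hs_norm L2.fminus_mem gs U) simp
    finally show ?case by (simp add: mult.commute)
   qed
  qed (use dint in simp)
  also have "... = L2norm U ?z * d k" unfolding d_def tint_def by (simp add: mult.left_commute[of _ "L2norm U ?z"])
  finally have "L2norm U ?z * L2norm U ?z <= L2norm U ?z * d k" using L2.nonneg[OF zL] by (simp add: L2norm_def)
  moreover have "0 <= d k" unfolding d_def tint_def by (intro integral_nonneg_AE AE_I2) simp
  ultimately show ?thesis using L2norm_nonneg[of U ?z] by (cases "L2norm U ?z = 0") (auto simp: mult_le_cancel_left_pos)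
 qed
 have Llim: "(%k. L2norm U (fminus (W k) w)) \<longlonglongrightarrow> 0"
  by (rule Lim_null_comparison[OF _ d0]) (use WL2 in \<open>auto intro!: always_eventually\<close>)
 have Cau: "\<exists>K. \<forall>m\<ge>K. \<forall>n\<ge>K. ?N (fminus (W m) (W n)) < e" if e: "0 < e" for e
 proof -
  obtain K where K: "!!n. K <= n ==> d n < e / 2" using order_tendstoD(2)[OF d0 half_gt_zero[OF e]] unfolding eventually_sequentially by blast
  have "?N (fminus (W m) (W n)) < e" if "K <= m" "K <= n" for m n using Wdiff[of m n] K[OF that(1)] K[OF that(2)] by linarith
  thus ?thesis by blast
 qed
 show wH: "w \<in> Hs s U" by (rule Hs_complete(1)[OF U WH w Llim Cau])
 have Nlim: "(%k. ?N (fminus (W k) w)) \<longlonglongrightarrow> 0" by (rule Hs_complete(2)[OF U WH w Llim Cau])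
 have "?N w <= tint T (%t. ?N (g t)) a b + d k + ?N (fminus (W k) w)" for k
 proof -
  have "?N w <= ?N (W k) + ?N (fminus (W k) w)" using H.diff[OF wH WH[of k]] H.commute[OF wH WH[of k]] by linarith
  moreover have "?N (W k) <= tint T (%t. ?N (S k t)) a b"
   unfolding simple_integral(1)[OF S, where F = ?N] unfolding W_def by (rule H.norm_sum[OF fin c0, THEN conjunct2])
  moreover have "tint T (%t. ?N (S k t)) a b <= tint T (%t. ?N (g t) + ?N (fminus (g t) (S k t))) a b"
  proof (rule tint_mono[OF simple_integral(2)[OF S]])
   show "integrable ?I (%t. ?N (g t) + ?N (fminus (g t) (S k t)))" using gint dint by simp
   show "AE t in ?I. ?N (S k t) <= ?N (g t) + ?N (fminus (g t) (S k t))" using gX tI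
   proof eventually_elim
    case (elim t)
    thus ?case using H.diff[OF elim(1) SX[OF elim(2), of k]] by linarith
   qed
  qed
  moreover have "tint T (%t. ?N (g t) + ?N (fminus (g t) (S k t))) a b = tint T (%t. ?N (g t)) a b + d k"
   unfolding d_def tint_def using tint_integrable[OF dint] tint_integrable[OF gint] by (simp add: distrib_left)
  ultimately show ?thesis by linarith
 qed
 moreover have "(%k. tint T (%t. ?N (g t)) a b + d k + ?N (fminus (W k) w)) \<longlonglongrightarrow> tint T (%t. ?N (g t)) a b + 0 + 0"
  by (intro tendsto_intros d0 Nlim)
 ultimately have "?N w <= tint T (%t. ?N (g t)) a b + 0 + 0" by (intro LIMSEQ_le_const) auto
 thus "?N w <= tint T (%t. ?N (g t)) a b" by simp
qed

lemma tint_continuous_upper: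
 assumes k: "integrable (lebT T) k" shows "continuous_on UNIV (tint T k a)"
proof (rule continuous_on_sequentiallyI)
 fix u :: "nat => real" and x assume u: "u \<longlonglongrightarrow> x"
 let ?M = "lebT T"
 show "(%n. tint T k a (u n)) \<longlonglongrightarrow> tint T k a x" unfolding tint_def
 proof (rule integral_dominated_convergence[where w = "%t. norm (k t)"])
  have "AE t in lebesgue. t \<notin> {x}" by (rule AE_not_in) (simp add: negligible_iff_null_sets[symmetric])
  hence "AE t in ?M. t \<notin> {x}" by (auto simp: AE_restrict_space_iff elim!: eventually_mono)
  thus "AE t in ?M. (%n. indicator {a<..u n} t * k t) \<longlonglongrightarrow> indicator {a<..x} t * k t"
  proof eventually_elim
   case (elim t)
   have "\<forall>\<^sub>F n in sequentially. indicat_real {a<..u n} t = indicator {a<..x} t"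
   proof (cases "t < x")
    case True
    show ?thesis using order_tendstoD(1)[OF u True] by eventually_elim (use True in \<open>auto simp: indicator_def\<close>)
   next
    case False
    hence "x < t" using elim by auto
    show ?thesis using order_tendstoD(2)[OF u \<open>x < t\<close>] by eventually_elim (use \<open>x < t\<close> in \<open>auto simp: indicator_def\<close>)
   qed
   thus ?case by (intro tendsto_mult tendsto_const tendsto_eventually)
  qed
  show "AE t in ?M. norm (indicator {a<..u n} t * k t) <= norm (k t)" for n by (intro AE_I2) (auto simp: indicator_def)
  show "(%t. indicator {a<..u n} t * k t) \<in> borel_measurable ?M" for n using tint_integrable[OF k] by auto
  show "(%t. indicator {a<..x} t * k t) \<in> borel_measurable ?M" using tint_integrable[OF k] by auto
 qed (use k in simp)
qed

text \<open>At the endpoints the derivative is obtained from the mean value theorem and the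
  continuity of \<open>G\<close>, which extends to the closed interval by its increment
  formula.\<close>

lemma (in weak_1D) antiderivative_C1_closed:
 assumes T: "0 < T" and p: "!!a b. 0 <= a ==> a <= b ==> b <= T ==> p b - p a = tint T g a b"
 shows "\<exists>G. (\<forall>t\<in>{0..T}. (p has_real_derivative G t) (at t within {0..T})) & (\<forall>s t. s <= t --> G t - G s = tint T k s t)"
proof -
 obtain G where G: "!!t. t \<in> {0<..<T} ==> (p has_real_derivative G t) (at t)" "!!s t. s <= t ==> G t - G s = tint T k s t"
  using antiderivative_C1[OF T p] by blast
 have pc: "continuous_on {0..T} p"
 proof (rule continuous_on_eq)
  show "continuous_on {0..T} (%t. p 0 + tint T g 0 t)" by (intro continuous_intros continuous_on_subset[OF tint_continuous_upper[OF gi]]) simp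
  show "p 0 + tint T g 0 t = p t" if "t \<in> {0..T}" for t using p[of 0 t] that by simp
 qed
 have Gc: "continuous_on {0..T} G"
 proof (rule continuous_on_eq)
  show "continuous_on {0..T} (%t. G 0 + tint T k 0 t)" by (intro continuous_intros continuous_on_subset[OF tint_continuous_upper[OF ki]]) simp
  show "G 0 + tint T k 0 t = G t" if "t \<in> {0..T}" for t using G(2)[of 0 t] that by simp
 qed
 have mv: "\<exists>\<xi>. \<bar>\<xi> - t\<bar> <= \<bar>x - t\<bar> & \<xi> \<in> {0..T} & (p x - p t) / (x - t) = G \<xi>" if "t \<in> {0..T}" "x \<in> {0..T}" "x ~= t" for x t
 proof -
  define a b where "a = min x t" and "b = max x t"
  have ab: "a < b" "{a..b} \<subseteq> {0..T}" using that by (auto simp: a_def b_def)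
  have "(p has_derivative (%h. G y * h)) (at y)" if "a < y" "y < b" for y using G(1)[of y] that ab(2) by (auto simp: has_field_derivative_def)
  from mvt[OF ab(1) continuous_on_subset[OF pc ab(2)] this] obtain \<xi> where "a < \<xi>" "\<xi> < b" "p b - p a = G \<xi> * (b - a)" by blast
  then obtain \<xi> where \<xi>: "a < \<xi>" "\<xi> < b" "p b - p a = (b - a) * G \<xi>" by (simp add: mult.commute)
  have "(p x - p t) / (x - t) = (p b - p a) / (b - a)" unfolding a_def b_def min_def max_def using that(3) by (auto simp: field_simps)
  thus ?thesis using \<xi> ab by (intro exI[of _ \<xi>]) (auto simp: a_def b_def)
 qed
 have "((%x. (p x - p t) / (x - t)) \<longlongrightarrow> G t) (at t within {0..T})" if t: "t \<in> {0..T}" for t unfolding tendsto_iff eventually_at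
 proof (intro allI impI)
  fix e :: real assume "0 < e"
  then obtain d where d: "0 < d" "!!x. x \<in> {0..T} ==> dist x t < d ==> dist (G x) (G t) < e" using Gc t unfolding continuous_on_iff by metis
  have "dist ((p x - p t) / (x - t)) (G t) < e" if x: "x \<in> {0..T}" "x ~= t" and "dist x t < d" for x
  proof -
   obtain \<xi> where "\<bar>\<xi> - t\<bar> <= \<bar>x - t\<bar>" "\<xi> \<in> {0..T}" "(p x - p t) / (x - t) = G \<xi>" using mv[OF t x] by blast
   thus ?thesis using d(2)[of \<xi>] \<open>dist x t < d\<close> by (simp add: dist_real_def)
  qed
  thus "\<exists>d>0. \<forall>x\<in>{0..T}. x ~= t & dist x t < d --> dist ((p x - p t) / (x - t)) (G t) < e" using d(1) by blast
 qed
 thus ?thesis using G(2) by (intro exI[of _ G]) (simp add: has_field_derivative_iff)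
qed

lemma derivative_unique_Icc:
 assumes "(f has_real_derivative D) (at t within {0..T})" "(f has_real_derivative D') (at t within {0..T})" "t \<in> {0..T}" "0 < T"
 shows "D = D'" using vector_derivative_unique_within_closed_interval[of 0 T t f D D'] assms by (simp add: has_real_derivative_iff_has_vector_derivative)

lemma AE_time_dense:
 assumes "AE t in lebT T. P t" "0 <= t" "t <= T" "0 < T" "0 < (e::real)"
 shows "\<exists>\<tau>\<in>{0<..<T}. \<bar>\<tau> - t\<bar> < e & P \<tau>"
proof (rule ccontr)
 assume n: "\<not> ?thesis"
 define c d where "c = max 0 (t - e)" and "d = min T (t + e)"
 have cd: "c < d" "{c<..<d} \<subseteq> {0<..<T}" using assms(2-) by (auto simp: c_def d_def)
 have "AE \<tau> in lebesgue. \<tau> \<notin> {c<..<d}" using assms(1)[unfolded AE_time_iff]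
 proof eventually_elim
  case (elim \<tau>)
  show ?case
  proof
   assume i: "\<tau> \<in> {c<..<d}"
   hence "P \<tau>" "\<tau> \<in> {0<..<T}" using elim cd by auto
   moreover have "\<bar>\<tau> - t\<bar> < e" using i by (auto simp: c_def d_def)
   ultimately show False using n by blast
  qed
 qed
 hence "{c<..<d} \<in> null_sets lebesgue" by (subst AE_iff_null_sets) auto
 thus False using cd(1) by (auto simp: null_sets_def)
qed

lemma tint_le_const:
 assumes "integrable (lebT T) f" "AE t in lebT T. t \<in> {a<..b} --> f t <= c" "0 <= a" "a <= b" "b <= T"
 shows "tint T f a b <= (b - a) * c"
proof -
 have "tint T f a b <= tint T (%_. c) a b"
  unfolding tint_def by (rule integral_mono_AE[OF tint_integrable[OF assms(1)] tint_integrable[OF const_integrable_time]])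
   (use assms(2) in \<open>eventually_elim, auto simp: indicator_def\<close>)
 thus ?thesis using tint_const[OF assms(3-5)] by simp
qed

lemma tint_lin:
 assumes "integrable (lebT T) f" "integrable (lebT T) g"
 shows "tint T (%t. f t + g t) a b = tint T f a b + tint T g a b" "tint T (%t. f t - g t) a b = tint T f a b - tint T g a b"
  "tint T (%t. c * f t) a b = c * tint T f a b" unfolding tint_def using tint_integrable[OF assms(1)] tint_integrable[OF assms(2)]
 by (simp_all add: distrib_left right_diff_distrib mult.left_commute[of _ c])

lemma tint_cong_AE:
 assumes "integrable (lebT T) f" "integrable (lebT T) g" "AE t in lebT T. f t = g t"
 shows "tint T f a b = tint T g a b" by (rule antisym) (rule tint_mono, use assms in \<open>auto elim: eventually_mono\<close>)+

lemma tint_abs_le: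
 assumes "integrable (lebT T) f" "integrable (lebT T) g" "AE t in lebT T. \<bar>f t\<bar> <= g t"
 shows "\<bar>tint T f a b\<bar> <= tint T g a b"
proof -
 have "tint T f a b <= tint T g a b" by (rule tint_mono[OF assms(1,2)]) (use assms(3) in \<open>auto elim: eventually_mono\<close>)
 moreover have "tint T (%t. -1 * f t) a b <= tint T g a b" by (rule tint_mono) (use assms in \<open>auto elim: eventually_mono\<close>)
 ultimately show ?thesis using tint_lin(3)[OF assms(1,1), of "-1" a b] by simp
qed

subsection \<open>Bochner norms\<close>

text \<open>The infimum of the essential bounds is itself such a bound, since countably many
  exceptional null sets may be united.\<close>

lemma Linf_norm_nonneg: "g \<in> bochner_Linf T X N ==> 0 <= bochner_Linf_norm T N g"
 and Linf_norm_AE: "g \<in> bochner_Linf T X N ==> AE t in lebT T. N (g t) <= bochner_Linf_norm T N g"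
proof -
 let ?S = "{M. 0 <= M & (AE t in lebT T. N (g t) <= M)}"
 assume "g \<in> bochner_Linf T X N"
 then obtain M where "AE t in lebT T. N (g t) <= M" by (auto simp: bochner_Linf_def)
 hence "\<bar>M\<bar> \<in> ?S" by (auto elim: eventually_mono)
 hence ne: "?S ~= {}" by blast
 show "0 <= bochner_Linf_norm T N g" unfolding bochner_Linf_norm_def by (rule cInf_greatest[OF ne]) simp
 have "AE t in lebT T. N (g t) <= bochner_Linf_norm T N g + 1 / real (Suc n)" for n
 proof -
  have "Inf ?S < bochner_Linf_norm T N g + 1 / real (Suc n)" by (simp add: bochner_Linf_norm_def)
  then obtain M where "M \<in> ?S" "M < bochner_Linf_norm T N g + 1 / real (Suc n)" using cInf_lessD[OF ne] by blast
  thus ?thesis by (auto elim: eventually_mono)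
 qed
 hence "AE t in lebT T. \<forall>n. N (g t) <= bochner_Linf_norm T N g + 1 / real (Suc n)" by (simp add: AE_all_countable)
 thus "AE t in lebT T. N (g t) <= bochner_Linf_norm T N g"
 proof eventually_elim
  case (elim t)
  have "(%n. bochner_Linf_norm T N g + 1 / real (Suc n)) \<longlonglongrightarrow> bochner_Linf_norm T N g + 0"
   by (intro tendsto_intros LIMSEQ_Suc[OF lim_1_over_n])
  hence "N (g t) <= bochner_Linf_norm T N g + 0" by (rule LIMSEQ_le_const) (use elim in blast)
  thus ?case by simp
 qed
qed

lemma (in seminormed_fn) L2_norm_integrable:
 assumes "g \<in> bochner_L2 T X N" shows "integrable (lebT T) (%t. N (g t))"
proof (rule Bochner_Integration.integrable_bound)
 show "integrable (lebT T) (%t. 1 + (N (g t))^2)" using assms by (intro Bochner_Integration.integrable_add const_integrable_time) (simp add: bochner_L2_def)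
 show "(%t. N (g t)) \<in> borel_measurable (lebT T)" using assms by (intro strongly_measurable_norm) (simp add: bochner_L2_def)
 have "\<bar>x\<bar> <= 1 + x^2" for x :: real
 proof -
  have "0 <= (\<bar>x\<bar> - 1 / 2)^2" by simp
  thus ?thesis by (simp add: power2_eq_square algebra_simps)
 qed
 thus "AE t in lebT T. norm (N (g t)) <= norm (1 + (N (g t))^2)" by (intro AE_I2) (simp add: abs_of_nonneg)
qed

text \<open>Cauchy--Schwarz in time against the constant 1, through the discriminant criterion; this
  is the origin of \<open>sqrt T\<close> in the final constant.\<close>

lemma (in seminormed_fn) tint_le_L2_norm:
 assumes g: "g \<in> bochner_L2 T X N" and ab: "0 <= a" "a <= b" "b <= T"
 shows "tint T (%t. N (g t)) a b <= sqrt T * bochner_L2_norm T N g"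
proof -
 let ?M = "lebT T" and ?q = "tint T (%t. N (g t)) a b" and ?I = "LINT t|lebT T. (N (g t))^2"
 have i: "integrable ?M (%t. (N (g t))^2)" using g by (simp add: bochner_L2_def)
 note i1 = L2_norm_integrable[OF g]
 have "?q^2 <= tint T (%t. (N (g t))^2) a b * (b - a)"
 proof (rule quadratic_nonneg_imp_square_le)
  fix c :: real
  have "0 <= tint T (%t. ((N (g t))^2 + (2 * c) * N (g t)) + c^2) a b" unfolding tint_def
  proof (intro integral_nonneg_AE AE_I2 mult_nonneg_nonneg)
   show "0 <= ((N (g t))^2 + 2 * c * N (g t)) + c^2" for t using zero_le_power2[of "N (g t) + c"] by (simp add: power2_sum algebra_simps)
  qed simp
  also have "... = tint T (%t. (N (g t))^2) a b + 2 * c * ?q + (b - a) * c^2" using i i1 by (simp add: tint_lin const_integrable_time tint_const ab)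
  finally show "0 <= tint T (%t. (N (g t))^2) a b + 2 * c * ?q + c^2 * (b - a)" by (simp add: mult.commute)
 qed (use ab in simp)
 also have "... <= ?I * T"
 proof (intro mult_mono)
  show "tint T (%t. (N (g t))^2) a b <= ?I" unfolding tint_def by (intro integral_mono_AE tint_integrable i AE_I2) (auto simp: indicator_def)
  show "0 <= ?I" by (intro integral_nonneg_AE AE_I2) simp
 qed (use ab in auto)
 finally have "sqrt (?q^2) <= sqrt (?I * T)" by (rule real_sqrt_le_mono)
 hence "\<bar>?q\<bar> <= sqrt T * sqrt ?I" by (simp add: real_sqrt_mult mult.commute)
 thus ?thesis unfolding bochner_L2_norm_def by linarith
qed

lemma L2_norm_nonneg: "0 <= bochner_L2_norm T N g" unfolding bochner_L2_norm_def by (intro real_sqrt_ge_zero integral_nonneg_AE AE_I2) simp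

lemma L2_Cauchy_Schwarz: "v \<in> L2 U ==> w \<in> L2 U ==> \<bar>ip U v w\<bar> <= L2norm U w * L2norm U v"
 using L2.Cauchy_Schwarz[of v U w] by (simp add: L2norm_def mult.commute)

lemma L2_pairing_integrable:
 assumes g: "g \<in> bochner_L2 T (L2 U) (L2norm U)" and z: "z \<in> L2 U"
 shows "integrable (lebT T) (%t. ip U (g t) z)" "AE t in lebT T. \<bar>ip U (g t) z\<bar> <= L2norm U z * L2norm U (g t)"
proof -
 interpret S: seminormed_fn "L2 U" "L2norm U" by (rule seminormed_L2)
 have sm: "strongly_measurable T (L2 U) (L2norm U) g" using g by (simp add: bochner_L2_def)
 hence "AE t in lebT T. g t \<in> L2 U" by (simp add: strongly_measurable_def)
 thus b: "AE t in lebT T. \<bar>ip U (g t) z\<bar> <= L2norm U z * L2norm U (g t)"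
 proof eventually_elim
  case (elim t)
  thus ?case using L2_Cauchy_Schwarz[of "g t" U z] z by blast
 qed
 show "integrable (lebT T) (%t. ip U (g t) z)"
 proof (rule Bochner_Integration.integrable_bound[of _ "%t. L2norm U z * L2norm U (g t)"])
  show "integrable (lebT T) (%t. L2norm U z * L2norm U (g t))" using S.L2_norm_integrable[OF g] by simp
  show "(%t. ip U (g t) z) \<in> borel_measurable (lebT T)"
  proof (rule S.strongly_measurable_functional[OF sm])
   show "\<bar>ip U u z - ip U v z\<bar> <= L2norm U z * L2norm U (fminus u v)" if "u \<in> L2 U" "v \<in> L2 U" for u v
    using L2_Cauchy_Schwarz[OF L2.fminus_mem[OF that] z] L2.diff_left[OF that z] by simp
  qed
  show "AE t in lebT T. norm (ip U (g t) z) <= norm (L2norm U z * L2norm U (g t))" using b by eventually_elim simp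
 qed
qed

subsection \<open>Classical functions of time\<close>

lemma time_deriv_ip:
 assumes g: "time_deriv T X (L2norm U) g g'" and X: "X \<subseteq> L2 U" and z: "z \<in> L2 U" and t: "t \<in> {0..T}"
 shows "((%s. ip U (g s) z) has_real_derivative ip U (g' t) z) (at t within {0..T})"
proof -
 let ?F = "at t within {0..T}" and ?D = "%s x. (g s x - g t x) / (s - t) - g' t x"
 have m: "g s \<in> L2 U" "g' s \<in> L2 U" if "s \<in> {0..T}" for s using g X that by (auto simp: time_deriv_def)
 have lim: "((%s. L2norm U (?D s)) \<longlongrightarrow> 0) ?F" using g t by (simp add: time_deriv_def)
 have "\<forall>\<^sub>F s in ?F. s \<in> {0..T} & s ~= t" by (auto simp: eventually_at_filter)
 hence "\<forall>\<^sub>F s in ?F. norm ((ip U (g s) z - ip U (g t) z) / (s - t) - ip U (g' t) z) <= L2norm U z * L2norm U (?D s)"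
 proof eventually_elim
  case (elim s)
  have D: "?D s = lincomb (1 / (s - t)) (fminus (g s) (g t)) (-1) (g' t)" by (simp add: fun_eq_iff)
  have f: "fminus (g s) (g t) \<in> L2 U" by (rule L2.fminus_mem) (use m elim t in auto)
  have mem: "?D s \<in> L2 U" unfolding D by (rule L2.lincomb_mem[OF f m(2)[OF t]])
  have "ip U (?D s) z = (ip U (g s) z - ip U (g t) z) / (s - t) - ip U (g' t) z"
   unfolding D L2.lin[OF f m(2)[OF t] z] using L2.diff_left[OF m(1) m(1) z, of s t] elim t by simp
  thus ?case using L2_Cauchy_Schwarz[OF mem z] by simp
 qed
 hence "((%s. (ip U (g s) z - ip U (g t) z) / (s - t) - ip U (g' t) z) \<longlongrightarrow> 0) ?F"
  by (rule Lim_null_comparison[OF _ tendsto_mult_right_zero[OF lim]])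
 thus ?thesis by (simp add: has_field_derivative_iff LIM_zero_iff)
qed

lemma (in seminormed_fn) time_cont_bounded:
 assumes g: "time_cont T X N g" shows "\<exists>B. \<forall>t\<in>{0..T}. N (g t) <= B"
proof -
 have "continuous_on {0..T} (%t. N (g t))" unfolding continuous_on_def
 proof
  fix t assume t: "t \<in> {0..T}"
  hence lim: "((%s. N (fminus (g s) (g t))) \<longlongrightarrow> 0) (at t within {0..T})" using g by (simp add: time_cont_def)
  have "\<forall>\<^sub>F s in at t within {0..T}. norm (N (g s) - N (g t)) <= N (fminus (g s) (g t))"
   using t diff g by (auto simp: eventually_at_filter time_cont_def)
  hence "((%s. N (g s) - N (g t)) \<longlongrightarrow> 0) (at t within {0..T})" by (rule Lim_null_comparison[OF _ lim])
  thus "((%t. N (g t)) \<longlongrightarrow> N (g t)) (at t within {0..T})" by (simp add: LIM_zero_iff)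
 qed
 hence "bounded ((%t. N (g t)) ` {0..T})" by (intro compact_imp_bounded compact_continuous_image) auto
 then obtain B where "\<forall>y\<in>(\<lambda>t. N (g t)) ` {0..T}. norm y <= B" by (auto simp: bounded_iff)
 thus ?thesis by (intro exI[of _ B]) (auto dest: bspec)
qed

lemma (in seminormed_fn) time_deriv_cont:
 assumes g: "time_deriv T X N g g'" shows "time_cont T X N g" unfolding time_cont_def
proof (intro ballI conjI)
 fix t assume t: "t \<in> {0..T}"
 let ?F = "at t within {0..T}" and ?D = "%s x. (g s x - g t x) / (s - t) - g' t x"
 have m: "g s \<in> X" "g' s \<in> X" if "s \<in> {0..T}" for s using g that by (auto simp: time_deriv_def)
 show "g t \<in> X" using m t by blast
 have lim: "((%s. N (?D s)) \<longlongrightarrow> 0) ?F" using g t by (simp add: time_deriv_def)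
 have "\<forall>\<^sub>F s in ?F. s \<in> {0..T} & s ~= t" by (auto simp: eventually_at_filter)
 hence le: "\<forall>\<^sub>F s in ?F. norm (N (fminus (g s) (g t))) <= \<bar>s - t\<bar> * N (?D s) + \<bar>s - t\<bar> * N (g' t)"
 proof eventually_elim
  case (elim s)
  have D: "?D s = lincomb (1 / (s - t)) (fminus (g s) (g t)) (-1) (g' t)" by (simp add: fun_eq_iff)
  have f: "fminus (g s) (g t) \<in> X" by (rule fm) (use m elim t in auto)
  have mem: "?D s \<in> X" unfolding D by (rule lc[OF f m(2)[OF t]])
  have "fminus (g s) (g t) = lincomb (s - t) (?D s) (s - t) (g' t)" using elim by (simp add: fun_eq_iff field_simps)
  thus ?case using tri[OF mem m(2)[OF t], of "s - t" "s - t"] nn[OF f] by simp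
 qed
 have lm: "((%s. \<bar>s - t\<bar> * N (?D s) + \<bar>s - t\<bar> * N (g' t)) \<longlongrightarrow> \<bar>t - t\<bar> * 0 + \<bar>t - t\<bar> * N (g' t)) ?F"
  by (intro tendsto_intros lim)
 show "((%s. N (fminus (g s) (g t))) \<longlongrightarrow> 0) ?F" by (rule Lim_null_comparison[OF le]) (use lm in simp)
qed

lemma time_cont_ip:
 assumes g: "time_cont T X (L2norm U) g" and X: "X \<subseteq> L2 U" and z: "z \<in> L2 U"
 shows "continuous_on {0..T} (%s. ip U (g s) z)" unfolding continuous_on_def
proof
 fix t assume t: "t \<in> {0..T}"
 hence lim: "((%s. L2norm U (fminus (g s) (g t))) \<longlongrightarrow> 0) (at t within {0..T})" using g by (simp add: time_cont_def)
 have m: "g s \<in> L2 U" if "s \<in> {0..T}" for s using g X that by (auto simp: time_cont_def)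
 have "norm (ip U (g s) z - ip U (g t) z) <= L2norm U z * L2norm U (fminus (g s) (g t))" if "s \<in> {0..T}" for s
  using L2_Cauchy_Schwarz[OF L2.fminus_mem[OF m[OF that] m[OF t]] z] L2.diff_left[OF m[OF that] m[OF t] z] by simp
 hence "\<forall>\<^sub>F s in at t within {0..T}. norm (ip U (g s) z - ip U (g t) z) <= L2norm U z * L2norm U (fminus (g s) (g t))"
  by (auto simp: eventually_at_filter)
 hence "((%s. ip U (g s) z - ip U (g t) z) \<longlongrightarrow> 0) (at t within {0..T})" by (rule Lim_null_comparison[OF _ tendsto_mult_right_zero[OF lim]])
 thus "((%s. ip U (g s) z) \<longlongrightarrow> ip U (g t) z) (at t within {0..T})" by (simp add: LIM_zero_iff)
qed

lemma FTC_tint: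
 assumes "!!t. t \<in> {0..T} ==> (p has_real_derivative p' t) (at t within {0..T})" "continuous_on {0..T} p'" "0 <= a" "a <= b" "b <= T"
 shows "p b - p a = tint T p' a b"
proof -
 have "(p' has_integral (p b - p a)) {a..b}"
 proof (rule fundamental_theorem_of_calculus)
  fix x assume "x \<in> {a..b}"
  hence "(p has_real_derivative p' x) (at x within {a..b})" by (intro DERIV_subset[OF assms(1)]) (use assms in auto)
  thus "(p has_vector_derivative p' x) (at x within {a..b})" by (simp add: has_real_derivative_iff_has_vector_derivative)
 qed (rule assms)
 thus ?thesis using tint_continuous(1)[OF assms(2-5)] by (simp add: integral_unique)
qed

text \<open>Paired with \<open>z\<close>, \<open>u\<close> has the classical derivative
  \<open>ut\<close>, and the weak derivative of \<open>ut\<close> is \<open>utt\<close>.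
  \<open>antiderivative_C1_closed\<close> gives a derivative of \<open>u\<close> with the desired
  increments, and uniqueness identifies it with \<open>ut\<close> at every time.\<close>

lemma weak_deriv_increment:
 assumes "0 < T" and u: "time_deriv T (L2 U) (L2norm U) u ut" and ut: "time_cont T (L2 U) (L2norm U) ut"
  and w: "weak_time_deriv U T ut utt" and z: "z \<in> L2 U" and ab: "0 <= a" "a <= b" "b <= T"
 shows "ip U (ut b) z - ip U (ut a) z = tint T (%t. ip U (utt t) z) a b"
proof -
 note d = time_deriv_ip[OF u order_refl z] and c = time_cont_ip[OF ut order_refl z]
 interpret W: weak_1D T "%t. ip U (ut t) z" "%t. ip U (utt t) z" using w z L2_pairing_integrable(1)[OF _ z] by unfold_locales (auto simp: weak_time_deriv_def)
 obtain G where G: "!!t. t \<in> {0..T} ==> ((%t. ip U (u t) z) has_real_derivative G t) (at t within {0..T})" "!!s t. s <= t ==> G t - G s = tint T (%t. ip U (utt t) z) s t"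
  using W.antiderivative_C1_closed[OF \<open>0 < T\<close> FTC_tint[OF d c]] by blast
 have "G t = ip U (ut t) z" if "t \<in> {0..T}" for t using derivative_unique_Icc[OF G(1)[OF that] d[OF that] that \<open>0 < T\<close>] .
 thus ?thesis using G(2)[OF ab(2)] ab by simp
qed

subsection \<open>Time regularity in Sobolev norms\<close>

text \<open>The increment is the Bochner integral of \<open>g\<close>, known so far only through its
  pairings; \<open>Bochner_integral_Hs\<close> upgrades this to membership and a bound in the
  stronger norm.\<close>

lemma Hs_increment:
 assumes U: "open U" "bounded U" and g: "g \<in> bochner_Linf T (Hs s U) (Hs_norm s U)" and h: "!!t. t \<in> {0..T} ==> h t \<in> L2 U"
  and inc: "!!z a b. z \<in> L2 U ==> 0 <= a ==> a <= b ==> b <= T ==> ip U (h b) z - ip U (h a) z = tint T (%t. ip U (g t) z) a b"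
  and ab: "0 <= a" "a <= b" "b <= T"
 shows "fminus (h b) (h a) \<in> Hs s U" "Hs_norm s U (fminus (h b) (h a)) <= tint T (%t. Hs_norm s U (g t)) a b"
  "Hs_norm s U (fminus (h b) (h a)) <= (b - a) * bochner_Linf_norm T (Hs_norm s U) g"
proof -
 have sm: "strongly_measurable T (Hs s U) (Hs_norm s U) g" using g by (auto simp: bochner_Linf_def)
 have w: "fminus (h b) (h a) \<in> L2 U" by (rule L2.fminus_mem) (use h ab in auto)
 have eq: "ip U (fminus (h b) (h a)) z = tint T (%t. ip U (g t) z) a b" if "z \<in> L2 U" for z
  using inc[OF that ab] L2.diff_left[OF h h that, of b a] ab by simp
 note B = Bochner_integral_Hs[OF U sm Linf_norm_AE[OF g] w eq]
 show "fminus (h b) (h a) \<in> Hs s U" by (rule B(1))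
 show l: "Hs_norm s U (fminus (h b) (h a)) <= tint T (%t. Hs_norm s U (g t)) a b" by (rule B(2))
 have "tint T (%t. Hs_norm s U (g t)) a b <= (b - a) * bochner_Linf_norm T (Hs_norm s U) g"
  by (rule tint_le_const[OF B(3) _ ab]) (use Linf_norm_AE[OF g] in \<open>auto elim: eventually_mono\<close>)
 thus "Hs_norm s U (fminus (h b) (h a)) <= (b - a) * bochner_Linf_norm T (Hs_norm s U) g" using l by linarith
qed

text \<open>Times with the desired property are dense, and the Lipschitz estimate transports
  membership and bound from a nearby time to \<open>t\<close> with arbitrarily small loss.\<close>

lemma Hs_everywhere:
 assumes U: "open U" "bounded U" and T: "0 < T" and h: "h \<in> bochner_Linf T (Hs s U) (Hs_norm s U)"
  and lip: "!!a b. 0 <= a ==> a <= b ==> b <= T ==> fminus (h b) (h a) \<in> Hs s U & Hs_norm s U (fminus (h b) (h a)) <= (b - a) * L"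
  and L: "0 <= L" and t: "t \<in> {0..T}"
 shows "h t \<in> Hs s U" "Hs_norm s U (h t) <= bochner_Linf_norm T (Hs_norm s U) h"
proof -
 let ?N = "Hs_norm s U" and ?M = "bochner_Linf_norm T (Hs_norm s U) h"
 have ae: "AE t in lebT T. h t \<in> Hs s U & ?N (h t) <= ?M" using Linf_norm_AE[OF h] h by (auto simp: bochner_Linf_def strongly_measurable_def)
 have step: "h t \<in> Hs s U & ?N (h t) <= ?M + e * L" if e: "0 < e" for e
 proof -
  obtain \<tau> where \<tau>: "\<tau> \<in> {0<..<T}" "\<bar>\<tau> - t\<bar> < e" "h \<tau> \<in> Hs s U" "?N (h \<tau>) <= ?M" using AE_time_dense[OF ae _ _ T e, of t] t by auto
  have "\<exists>c D. \<bar>c\<bar> = 1 & D \<in> Hs s U & ?N D <= \<bar>\<tau> - t\<bar> * L & h t = lincomb 1 (h \<tau>) c D"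
  proof (cases "\<tau> <= t")
   case True
   thus ?thesis using lip[of \<tau> t] \<tau> t by (intro exI[of _ 1] exI[of _ "fminus (h t) (h \<tau>)"]) (auto simp: fun_eq_iff)
  next
   case False
   thus ?thesis using lip[of t \<tau>] \<tau> t by (intro exI[of _ "-1"] exI[of _ "fminus (h \<tau>) (h t)"]) (auto simp: fun_eq_iff)
  qed
  then obtain c D where D: "\<bar>c\<bar> = 1" "D \<in> Hs s U" "?N D <= \<bar>\<tau> - t\<bar> * L" "h t = lincomb 1 (h \<tau>) c D" by blast
  have "\<bar>\<tau> - t\<bar> * L <= e * L" using \<tau> L by (intro mult_right_mono) auto
  hence "?N (h t) <= ?M + e * L" using Hs_norm_lincomb[OF U \<tau>(3) D(2), of 1 c] D \<tau>(4) by simp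
  moreover have "h t \<in> Hs s U" unfolding D(4) by (rule Hs_lincomb[OF U \<tau>(3) D(2)])
  ultimately show ?thesis by blast
 qed
 show "h t \<in> Hs s U" using step[of 1] by simp
 have "(%n. ?M + 1 / real (Suc n) * L) \<longlonglongrightarrow> ?M + 0 * L" by (intro tendsto_intros LIMSEQ_Suc[OF lim_1_over_n])
 hence "?N (h t) <= ?M + 0 * L" by (rule LIMSEQ_le_const) (use step[of "1 / real (Suc n)" for n] in auto)
 thus "?N (h t) <= ?M" by simp
qed

text \<open>The remainder is the Bochner integral of \<open>g t - g c\<close>, whose norm is at most
  \<open>(b - a) L\<close> on the interval. The base point \<open>c\<close> may lie anywhere in it,
  so that both endpoints of the time interval can be treated.\<close>

lemma Hs_Taylor:
 assumes U: "open U" "bounded U" and g: "g \<in> bochner_Linf T (Hs s U) (Hs_norm s U)" and h: "!!t. t \<in> {0..T} ==> h t \<in> L2 U"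
  and inc: "!!z a b. z \<in> L2 U ==> 0 <= a ==> a <= b ==> b <= T ==> ip U (h b) z - ip U (h a) z = tint T (%t. ip U (g t) z) a b"
  and gH: "!!t. t \<in> {0..T} ==> g t \<in> Hs s U" and L: "0 <= L"
  and lip: "!!a b. 0 <= a ==> a <= b ==> b <= T ==> Hs_norm s U (fminus (g b) (g a)) <= (b - a) * L"
  and ip_int: "!!z. z \<in> L2 U ==> integrable (lebT T) (%t. ip U (g t) z)"
  and ab: "0 <= a" "a <= c" "c <= b" "b <= T"
 shows "lincomb 1 (fminus (h b) (h a)) (a - b) (g c) \<in> Hs s U" "Hs_norm s U (lincomb 1 (fminus (h b) (h a)) (a - b) (g c)) <= L * (b - a)^2"
proof -
 interpret H: seminormed_fn "Hs s U" "Hs_norm s U" by (rule seminormed_Hs[OF U])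
 let ?w = "lincomb 1 (fminus (h b) (h a)) (a - b) (g c)" and ?g = "%t. fminus (g t) (g c)" and ?N = "Hs_norm s U"
 have cT: "c \<in> {0..T}" and ab': "a <= b" using ab by auto
 have hd: "fminus (h b) (h a) \<in> L2 U" by (rule L2.fminus_mem) (use h ab in auto)
 have gL: "g t \<in> L2 U" if "t \<in> {0..T}" for t using Hs_L2[OF gH[OF that]] .
 have sm: "strongly_measurable T (Hs s U) ?N ?g"
  by (rule H.strongly_measurable_diff_simple[OF _ simple_const[OF gH[OF cT]]]) (use g in \<open>simp add: bochner_Linf_def\<close>)
 have lip': "?N (?g t) <= \<bar>t - c\<bar> * L" if "t \<in> {0..T}" for t
 proof (cases "c <= t")
  case True
  thus ?thesis using lip[of c t] that cT by simp
 next
  case False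
  thus ?thesis using lip[of t c] H.commute[OF gH[OF that] gH[OF cT]] that cT by simp
 qed
 have tI: "AE t in lebT T. t \<in> {0<..<T}" using AE_space[of "lebT T"] by simp
 have M: "AE t in lebT T. ?N (?g t) <= T * L" using tI
 proof eventually_elim
  case (elim t)
  have "\<bar>t - c\<bar> * L <= T * L" by (rule mult_right_mono) (use elim cT L in auto)
  thus ?case using lip'[of t] elim by simp
 qed
 have wL: "?w \<in> L2 U" by (rule L2.lincomb_mem[OF hd gL[OF cT]])
 have eq: "ip U ?w z = tint T (%t. ip U (?g t) z) a b" if z: "z \<in> L2 U" for z
 proof -
  have "tint T (%t. ip U (?g t) z) a b = tint T (%t. ip U (g t) z - ip U (g c) z) a b"
   unfolding tint_def by (intro Bochner_Integration.integral_cong refl) (use L2.diff_left[OF gL gL[OF cT] z] in simp)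
  also have "... = ip U (h b) z - ip U (h a) z - (b - a) * ip U (g c) z"
   using tint_lin(2)[OF ip_int[OF z] const_integrable_time] inc[OF z ab(1) ab' ab(4)] tint_const[OF ab(1) ab' ab(4)] by simp
  also have "... = ip U ?w z" unfolding L2.lin[OF hd gL[OF cT] z] using L2.diff_left[OF h h z, of b a] ab by (simp add: left_diff_distrib)
  finally show ?thesis by simp
 qed
 note B = Bochner_integral_Hs[OF U sm M wL eq]
 show "?w \<in> Hs s U" by (rule B(1))
 have "tint T (%t. ?N (?g t)) a b <= (b - a) * ((b - a) * L)"
 proof (rule tint_le_const[OF B(3) _ ab(1) ab' ab(4)])
  show "AE t in lebT T. t \<in> {a<..b} --> ?N (?g t) <= (b - a) * L" using tI
  proof eventually_elim
   case (elim t)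
   have "\<bar>t - c\<bar> * L <= (b - a) * L" if "t \<in> {a<..b}" by (rule mult_right_mono) (use that ab L in auto)
   thus ?case using lip'[of t] elim by auto
  qed
 qed
 thus "?N ?w <= L * (b - a)^2" using B(2) by (simp add: power2_eq_square mult_ac)
qed

subsection \<open>The space of clamped functions\<close>

lemma test_fun_Hs2:
 assumes "\<phi> \<in> test_fun U" "open U" "bounded U" shows "\<phi> \<in> Hs 2 U"
 using smooth_weak_deriv[OF test_funD(1)[OF assms(1)] assms(3,2)] by (auto simp: Hs_def)

lemma H20_iff:
 "v \<in> H20 U \<longleftrightarrow> v \<in> Hs 2 U & (\<forall>e>0. \<exists>\<phi>\<in>test_fun U. Hs_norm 2 U (fminus v \<phi>) < e)"
proof
 assume "v \<in> H20 U"
 then obtain \<phi> where \<phi>: "v \<in> Hs 2 U" "!!k. \<phi> k \<in> test_fun U" "(%k::nat. Hs_norm 2 U (fminus v (\<phi> k))) \<longlonglongrightarrow> 0" by (auto simp: H20_def)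
 have "\<exists>\<phi>\<in>test_fun U. Hs_norm 2 U (fminus v \<phi>) < e" if "0 < e" for e
  using order_tendstoD(2)[OF \<phi>(3) that] \<phi>(2) unfolding eventually_sequentially by blast
 thus "v \<in> Hs 2 U & (\<forall>e>0. \<exists>\<phi>\<in>test_fun U. Hs_norm 2 U (fminus v \<phi>) < e)" using \<phi>(1) by blast
next
 assume r: "v \<in> Hs 2 U & (\<forall>e>0. \<exists>\<phi>\<in>test_fun U. Hs_norm 2 U (fminus v \<phi>) < e)"
 have "\<forall>k::nat. \<exists>\<phi>\<in>test_fun U. Hs_norm 2 U (fminus v \<phi>) < 1 / real (Suc k)" using r by simp
 then obtain \<phi> where \<phi>: "!!k. \<phi> k \<in> test_fun U" "!!k. Hs_norm 2 U (fminus v (\<phi> k)) < 1 / real (Suc k)" by metis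
 have "(%k. Hs_norm 2 U (fminus v (\<phi> k))) \<longlonglongrightarrow> 0"
  by (rule Lim_null_comparison[OF _ LIMSEQ_Suc[OF lim_1_over_n]]) (use less_imp_le[OF \<phi>(2)] in \<open>auto intro!: always_eventually\<close>)
 thus "v \<in> H20 U" using r \<phi>(1) by (auto simp: H20_def)
qed

lemma H20_Hs: "v \<in> H20 U ==> v \<in> Hs 2 U" by (simp add: H20_iff)

lemma H20_lincomb:
 assumes U: "open U" "bounded U" and v: "v \<in> H20 U" and w: "w \<in> H20 U" shows "lincomb c v d w \<in> H20 U" unfolding H20_iff
proof (intro conjI allI impI)
 show "lincomb c v d w \<in> Hs 2 U" by (rule Hs_lincomb[OF U H20_Hs[OF v] H20_Hs[OF w]])
 fix e :: real assume e: "0 < e"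
 define e' where "e' = e / (\<bar>c\<bar> + \<bar>d\<bar> + 1)"
 have e': "0 < e'" "(\<bar>c\<bar> + \<bar>d\<bar>) * e' < e" using e by (auto simp: e'_def field_simps intro: add_nonneg_pos)
 obtain \<phi> \<psi> where \<phi>: "\<phi> \<in> test_fun U" "Hs_norm 2 U (fminus v \<phi>) < e'" and \<psi>: "\<psi> \<in> test_fun U" "Hs_norm 2 U (fminus w \<psi>) < e'"
  using v w e'(1) unfolding H20_iff by meson
 have "fminus (lincomb c v d w) (lincomb c \<phi> d \<psi>) = lincomb c (fminus v \<phi>) d (fminus w \<psi>)" by (simp add: fun_eq_iff algebra_simps)
 hence "Hs_norm 2 U (fminus (lincomb c v d w) (lincomb c \<phi> d \<psi>)) <= \<bar>c\<bar> * Hs_norm 2 U (fminus v \<phi>) + \<bar>d\<bar> * Hs_norm 2 U (fminus w \<psi>)"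
  using Hs_norm_lincomb[OF U Hs_fminus[OF U H20_Hs[OF v] test_fun_Hs2[OF \<phi>(1) U]] Hs_fminus[OF U H20_Hs[OF w] test_fun_Hs2[OF \<psi>(1) U]]] by simp
 also have "... <= \<bar>c\<bar> * e' + \<bar>d\<bar> * e'" using \<phi> \<psi> by (intro add_mono mult_left_mono) auto
 finally have "Hs_norm 2 U (fminus (lincomb c v d w) (lincomb c \<phi> d \<psi>)) < e" using e'(2) by (simp add: distrib_right)
 thus "\<exists>\<phi>\<in>test_fun U. Hs_norm 2 U (fminus (lincomb c v d w) \<phi>) < e" using test_fun_lincomb[OF \<phi>(1) \<psi>(1)] by blast
qed

lemma H20_cong:
 assumes "aeq U v w" "v \<in> H20 U" "open U" shows "w \<in> H20 U"
proof -
 have "Hs_norm 2 U (fminus w \<phi>) = Hs_norm 2 U (fminus v \<phi>)" for \<phi>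
 proof -
  have "aeq U (fminus w \<phi>) (fminus v \<phi>)" unfolding fminus_eq_lincomb by (rule aeq_lincomb[OF aeq_sym[OF assms(1)] aeq_refl])
  hence "wd U is (fminus w \<phi>) = wd U is (fminus v \<phi>)" for "is" by (rule wd_cong[OF _ assms(3)])
  thus ?thesis by (simp add: Hs_norm_def)
 qed
 thus ?thesis using assms(2) Hs_cong(1)[OF assms(1) H20_Hs[OF assms(2)] assms(3)] by (simp add: H20_iff)
qed

lemma H20_closed:
 assumes U: "open U" "bounded U" and v: "v \<in> Hs 2 U" and ap: "!!e. 0 < e ==> \<exists>w\<in>H20 U. Hs_norm 2 U (fminus v w) < e"
 shows "v \<in> H20 U" unfolding H20_iff
proof (intro conjI allI impI v)
 fix e :: real assume e: "0 < e"
 obtain w where w: "w \<in> H20 U" "Hs_norm 2 U (fminus v w) < e / 2" using ap[of "e / 2"] e by auto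
 obtain \<phi> where \<phi>: "\<phi> \<in> test_fun U" "Hs_norm 2 U (fminus w \<phi>) < e / 2" using w(1) e unfolding H20_iff by (meson half_gt_zero)
 have "fminus v \<phi> = lincomb 1 (fminus v w) 1 (fminus w \<phi>)" by (simp add: fun_eq_iff)
 hence "Hs_norm 2 U (fminus v \<phi>) < e"
  using Hs_norm_lincomb[OF U Hs_fminus[OF U v H20_Hs[OF w(1)]] Hs_fminus[OF U H20_Hs[OF w(1)] test_fun_Hs2[OF \<phi>(1) U]], of 1 1] w(2) \<phi>(2) by simp
 thus "\<exists>\<phi>\<in>test_fun U. Hs_norm 2 U (fminus v \<phi>) < e" using \<phi>(1) by blast
qed

lemma H20_zero: "open U ==> bounded U ==> (%x. 0) \<in> H20 U"
proof -
 assume U: "open U" "bounded U"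
 have "Hs_norm 2 U (fminus (%x. 0) (%x. 0)) = 0"
  using Hs_norm_lincomb[OF U test_fun_Hs2[OF zero_test_fun U] test_fun_Hs2[OF zero_test_fun U], of 0 0] Hs_norm_nonneg[of 2 U "%x. 0"] by (simp add: fminus_def lincomb_def)
 thus ?thesis unfolding H20_iff using test_fun_Hs2[OF zero_test_fun U] zero_test_fun by (metis (full_types))
qed

text \<open>The inequality of Friedrichs is applied twice in direction \<open>i\<close> to an
  approximating test function; each application costs \<open>2 B\<close>, which gives
  \<open>4 B^2\<close>. Pure second derivatives in a single direction suffice for clamped
  functions.\<close>

lemma H20_Friedrichs_null:
 assumes U: "open U" "bounded U" and w: "w \<in> H20 U" and z: "L2norm U (wd U [i, i] w) = 0"
 shows "L2norm U w = 0"
proof -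
 note Ul = open_lebesgue[OF U(1)]
 obtain B where B: "!!x. x \<in> U ==> norm x <= B" "0 < B" using U(2) by (auto simp: bounded_pos)
 have "L2norm U w <= (1 + 4 * B^2) * e" if e: "0 < e" for e
 proof -
  obtain \<phi> where \<phi>: "\<phi> \<in> test_fun U" "Hs_norm 2 U (fminus w \<phi>) < e" using w e unfolding H20_iff by blast
  note H = H20_Hs[OF w] test_fun_Hs2[OF \<phi>(1) U]
  note d = Hs_fminus[OF U H]
  have m: "dpart [i, i] \<phi> \<in> L2 U" by (rule test_fun_L2[OF \<phi>(1) Ul])
  have "aeq U (wd U [i, i] \<phi>) (dpart [i, i] \<phi>)" using wd_aeq[OF smooth_weak_deriv[OF test_funD(1)[OF \<phi>(1)] U(2,1), of "[i, i]"] U(1)] by simp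
  from L2norm_cong[OF aeq_sym[OF this] m Ul] have e1: "L2norm U (dpart [i, i] \<phi>) = L2norm U (wd U [i, i] \<phi>)" .
  have "aeq U (wd U [i, i] (fminus w \<phi>)) (fminus (wd U [i, i] w) (wd U [i, i] \<phi>))" unfolding fminus_eq_lincomb by (rule wd_lincomb[OF H _ U(1)]) simp
  from L2norm_cong[OF this wd2_mem[OF d] Ul] have "L2norm U (fminus (wd U [i, i] w) (wd U [i, i] \<phi>)) = L2norm U (wd U [i, i] (fminus w \<phi>))" by simp
  also have "... <= Hs_norm 2 U (fminus w \<phi>)" by (rule L2norm_wd_le_Hs_norm) simp
  finally have "L2norm U (wd U [i, i] \<phi>) <= e"
   using L2.nrm_diff[OF wd2_mem[OF H(1), of i i] wd2_mem[OF H(2), of i i]] z \<phi>(2) by (simp add: L2norm_def[symmetric])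
  hence d2: "L2norm U (dpart [i, i] \<phi>) <= e" using e1 by simp
  have "L2norm U \<phi> <= 2 * B * L2norm U (dpart [i] \<phi>)" by (rule Friedrichs_test_fun[OF \<phi>(1) Ul B(1) less_imp_le[OF B(2)]])
  also have "... <= 2 * B * (2 * B * L2norm U (dpart [i] (dpart [i] \<phi>)))"
   using Friedrichs_test_fun[OF test_fun_dpart[OF \<phi>(1), of "[i]"] Ul B(1) less_imp_le[OF B(2)], of i] B(2) by (intro mult_left_mono) auto
  also have "dpart [i] (dpart [i] \<phi>) = dpart [i, i] \<phi>" by (simp only: dpart.simps)
  also have "2 * B * (2 * B * L2norm U (dpart [i, i] \<phi>)) <= 2 * B * (2 * B * e)" using d2 B(2) by (intro mult_left_mono) auto
  finally have "L2norm U \<phi> <= 4 * B^2 * e" by (simp add: power2_eq_square)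
  moreover have "L2norm U w <= L2norm U \<phi> + L2norm U (fminus w \<phi>)" using L2.nrm_le_add[OF Hs_L2[OF H(1)] Hs_L2[OF H(2)]] by (simp add: L2norm_def)
  moreover have "L2norm U (fminus w \<phi>) <= Hs_norm 2 U (fminus w \<phi>)" by (rule L2norm_le_Hs_norm[OF Hs_L2[OF d] U(1)])
  ultimately show ?thesis using \<phi>(2) by (simp add: distrib_right)
 qed
 hence "L2norm U w <= 0 + e" if "0 < e" for e
 proof -
  have p: "0 < 1 + 4 * B^2" by (rule add_pos_nonneg) auto
  show ?thesis using \<open>!!e. 0 < e ==> L2norm U w <= (1 + 4 * B^2) * e\<close>[of "e / (1 + 4 * B^2)"] that p by simp
 qed
 hence "L2norm U w <= 0" by (rule field_le_epsilon)
 thus ?thesis using L2norm_nonneg[of U w] by linarith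
qed

subsection \<open>Finite-dimensional spaces\<close>

lemma fin_dim_lincomb:
 assumes V: "fin_dim_space V" and v: "v \<in> V" and w: "w \<in> V" shows "lincomb c v d w \<in> V"
proof -
 obtain B where B: "V = {%x. \<Sum>b\<in>B. c b * b x | c. True}" using V by (auto simp: fin_dim_space_def)
 obtain p q where pq: "v = (%x. \<Sum>b\<in>B. p b * b x)" "w = (%x. \<Sum>b\<in>B. q b * b x)" using v w B by blast
 have "lincomb c v d w = (%x. \<Sum>b\<in>B. (c * p b + d * q b) * b x)"
  unfolding pq lincomb_def by (simp add: sum_distrib_left sum.distrib[symmetric] algebra_simps)
 thus ?thesis unfolding B by (intro CollectI exI[of _ "%b. c * p b + d * q b"]) simp
qed

text \<open>Gram--Schmidt: a one-dimensional extension is orthogonalised by the projection onto the smaller space.\<close>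

lemma finite_dim_comparison:
 assumes V: "fin_dim_space V" and b1: "semi_ip V b1" and b2: "semi_ip V b2"
  and null: "!!v. v \<in> V ==> b1 v v = 0 ==> b2 v v = 0"
 shows "\<exists>\<Lambda>\<ge>0. \<forall>v\<in>V. b2 v v <= \<Lambda> * b1 v v"
proof -
 interpret A: semi_ip V b1 by (rule b1)
 interpret B: semi_ip V b2 by (rule b2)
 \<comment> \<open>The projection clause carries the induction: it provides the part of the next
   generator orthogonal to the space built so far.\<close>
 define good where "good W \<longleftrightarrow> W \<subseteq> V & (\<forall>v\<in>W. \<forall>w\<in>W. \<forall>c d. lincomb c v d w \<in> W) &
  (\<exists>\<Lambda>\<ge>0. \<forall>v\<in>W. b2 v v <= \<Lambda> * b1 v v) & (\<forall>x\<in>V. \<exists>w\<in>W. \<forall>y\<in>W. b1 (fminus x w) y = 0)" for W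
 have step: "good {lincomb 1 y c e | y c. y \<in> W}" if W: "good W" and e: "e \<in> V" for W e
 proof -
  have WV: "y \<in> V" if "y \<in> W" for y using W that by (auto simp: good_def)
  have Wl: "lincomb c v d w \<in> W" if "v \<in> W" "w \<in> W" for c d v w using W that by (auto simp: good_def)
  obtain \<Lambda> where \<Lambda>: "0 <= \<Lambda>" "!!v. v \<in> W ==> b2 v v <= \<Lambda> * b1 v v" using W by (auto simp: good_def)
  obtain p where p: "p \<in> W" "!!y. y \<in> W ==> b1 (fminus e p) y = 0" using W e unfolding good_def by blast
  define r where "r = fminus e p"
  have r: "r \<in> V" unfolding r_def by (rule A.fminus_mem[OF e WV[OF p(1)]])
  have r0: "b1 r y = 0" if "y \<in> W" for y using p(2)[OF that] by (simp add: r_def)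
  have r0': "b1 y r = 0" if "y \<in> W" for y using r0[OF that] A.sym[OF WV[OF that] r] by simp
  let ?W = "{lincomb 1 y c r | y c. y \<in> W}"
  have 1: "lincomb 1 y c e = lincomb 1 (lincomb 1 y c p) c r" for y c by (simp add: fun_eq_iff r_def algebra_simps)
  have 2: "lincomb 1 y c r = lincomb 1 (lincomb 1 y (-c) p) c e" for y c by (simp add: fun_eq_iff r_def algebra_simps)
  have W': "{lincomb 1 y c e | y c. y \<in> W} = ?W" using 1 2 Wl[OF _ p(1)] by blast
  \<comment> \<open>If \<open>r\<close> is null for the first form it is null for the second by
    assumption, so the ratio may be set to zero.\<close>
  define \<beta> where "\<beta> = (if b1 r r = 0 then 0 else b2 r r / b1 r r)"
  have \<beta>: "0 <= \<beta>" "b2 r r = \<beta> * b1 r r" using null[OF r] A.nonneg[OF r] B.nonneg[OF r] by (auto simp: \<beta>_def)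
  have bound: "b2 (lincomb 1 y c r) (lincomb 1 y c r) <= (2 * \<Lambda> + 2 * \<beta>) * b1 (lincomb 1 y c r) (lincomb 1 y c r)" if y: "y \<in> W" for y c
  proof -
   note yV = WV[OF y]
   have e1: "b1 (lincomb 1 y c r) (lincomb 1 y c r) = b1 y y + c^2 * b1 r r" using A.expand[OF yV r, of 1 c] r0'[OF y] by simp
   have "b2 (lincomb 1 y c r) (lincomb 1 y c r) <= 2 * b2 y y + 2 * (c^2 * b2 r r)"
    using B.expand[OF yV r, of 1 c] B.expand[OF yV r, of 1 "-c"] B.nonneg[OF B.lincomb_mem[OF yV r, of 1 "-c"]] by (simp add: algebra_simps)
   also have "... <= 2 * (\<Lambda> * b1 y y) + 2 * (\<beta> * (c^2 * b1 r r))" using \<Lambda>(2)[OF y] \<beta>(2) by (simp add: mult.left_commute)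
   also have "... <= (2 * \<Lambda> + 2 * \<beta>) * (b1 y y + c^2 * b1 r r)"
   proof -
    have "0 <= \<Lambda> * (c^2 * b1 r r)" "0 <= \<beta> * b1 y y" using \<Lambda>(1) \<beta>(1) A.nonneg[OF r] A.nonneg[OF yV] by auto
    thus ?thesis by (simp add: algebra_simps)
   qed
   finally show ?thesis using e1 by simp
  qed
  have proj: "\<exists>w\<in>?W. \<forall>y\<in>?W. b1 (fminus x w) y = 0" if x: "x \<in> V" for x
  proof -
   obtain w where w: "w \<in> W" "!!y. y \<in> W ==> b1 (fminus x w) y = 0" using W x unfolding good_def by blast
   define d where "d = (if b1 r r = 0 then 0 else b1 x r / b1 r r)"
   have d: "b1 x r = d * b1 r r" using A.null_left[OF r x] A.sym[OF x r] by (auto simp: d_def)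
   have xw: "fminus x w \<in> V" by (rule A.fminus_mem[OF x WV[OF w(1)]])
   have "b1 (fminus x (lincomb 1 w d r)) (lincomb 1 y c r) = 0" if y: "y \<in> W" for y c
   proof -
    have "fminus x (lincomb 1 w d r) = lincomb 1 (fminus x w) (-d) r" by (simp add: fun_eq_iff)
    hence "b1 (fminus x (lincomb 1 w d r)) (lincomb 1 y c r) = b1 (fminus x w) (lincomb 1 y c r) - d * b1 r (lincomb 1 y c r)"
     using A.lin[OF xw r A.lincomb_mem[OF WV[OF y] r], of 1 "-d" 1 c] by simp
    also have "... = 0"
     using A.lin_right[OF WV[OF y] r xw, of 1 c] A.lin_right[OF WV[OF y] r r, of 1 c] w(2)[OF y] r0[OF y] A.diff_left[OF x WV[OF w(1)] r] r0'[OF w(1)] d by simp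
    finally show ?thesis .
   qed
   thus ?thesis using w(1) by blast
  qed
  have lcW: "lincomb c v d w \<in> ?W" if vw: "v \<in> ?W" "w \<in> ?W" for c d v w
  proof -
   obtain y1 c1 y2 c2 where "v = lincomb 1 y1 c1 r" "w = lincomb 1 y2 c2 r" "y1 \<in> W" "y2 \<in> W" using vw by blast
   moreover have "lincomb c (lincomb 1 y1 c1 r) d (lincomb 1 y2 c2 r) = lincomb 1 (lincomb c y1 d y2) (c * c1 + d * c2) r" by (simp add: fun_eq_iff algebra_simps)
   ultimately show ?thesis using Wl by blast
  qed
  have subW: "?W \<subseteq> V" using A.lincomb_mem[OF WV r] by blast
  have bdW: "\<exists>\<Lambda>\<ge>0. \<forall>v\<in>?W. b2 v v <= \<Lambda> * b1 v v" using bound \<Lambda>(1) \<beta>(1) by (intro exI[of _ "2 * \<Lambda> + 2 * \<beta>"]) auto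
  show ?thesis unfolding W' good_def by (intro conjI ballI allI subW lcW bdW proj)
 qed
 obtain S where S: "finite S" "V = {%x. \<Sum>b\<in>S. c b * b x | c. True}" using V by (auto simp: fin_dim_space_def)
 have SV: "b \<in> V" if "b \<in> S" for b
 proof -
  have "(\<Sum>b'\<in>S. (if b' = b then 1 else 0) * b' x) = (\<Sum>b'\<in>S. if b' = b then b' x else 0)" for x by (intro sum.cong) auto
  hence "b = (%x. \<Sum>b'\<in>S. (if b' = b then 1 else 0) * b' x)" using S(1) that by (intro ext) simp
  thus ?thesis unfolding S(2) by (intro CollectI exI[of _ "%b'. if b' = b then 1 else 0"]) simp
 qed
 have "good {%x. \<Sum>b\<in>F. c b * b x | c. True}" if "finite F" "F \<subseteq> S" for F using that
 proof (induction F)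
  case empty
  have z: "(%x. 0) \<in> V" unfolding S(2) by (auto intro!: exI[of _ "%_. 0"])
  have bz: "b1 v (%x. 0) = 0" if "v \<in> V" for v using A.lin_right[OF z z that, of 0 0] by (simp add: lincomb_def)
  have "b2 (%x. 0) (%x. 0) = 0" using null[OF z bz[OF z]] .
  thus ?case unfolding good_def using z bz A.fminus_mem[OF _ z] by (auto simp: lincomb_def intro!: exI[of _ 0])
 next
  case (insert e F)
  have "{%x. \<Sum>b\<in>insert e F. c b * b x | c. True} = {lincomb 1 y c e | y c. y \<in> {%x. \<Sum>b\<in>F. c b * b x | c. True}}" (is "?L = ?R")
  proof
   show "?L \<subseteq> ?R"
   proof
    fix v assume "v \<in> ?L"
    then obtain c where "v = (%x. \<Sum>b\<in>insert e F. c b * b x)" by blast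
    hence "v = lincomb 1 (%x. \<Sum>b\<in>F. c b * b x) (c e) e" using insert(1,2) by (simp add: fun_eq_iff)
    thus "v \<in> ?R" by blast
   qed
   show "?R \<subseteq> ?L"
   proof
    fix v assume "v \<in> ?R"
    then obtain c d where v: "v = lincomb 1 (%x. \<Sum>b\<in>F. c b * b x) d e" by blast
    have "(\<Sum>b\<in>F. (c(e := d)) b * b x) = (\<Sum>b\<in>F. c b * b x)" for x by (rule sum.cong) (use insert(2) in auto)
    hence "v = (%x. \<Sum>b\<in>insert e F. (c(e := d)) b * b x)" unfolding v using insert(1,2) by (simp add: fun_eq_iff del: fun_upd_apply) simp
    thus "v \<in> ?L" by blast
   qed
  qed
  thus ?case using step[of "{%x. \<Sum>b\<in>F. c b * b x | c. True}" e] insert SV by simp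
 qed
 from this[OF S(1) order_refl] have "good V" using S(2) by simp
 thus ?thesis by (auto simp: good_def)
qed

subsection \<open>The abstract energy estimate\<close>

text \<open>On a partition into \<open>n + 1\<close> equal pieces the increments of \<Phi> and
  \<open>X\<close> telescope, while the terms carrying the step length sum to
  \<open>t / (n + 1)\<close> times the total increment of \<open>Y\<close> and disappear in the
  limit. This takes the place of differentiating the energy.\<close>

lemma partition_telescope:
 fixes \<Phi> X Y :: "real => real"
 assumes inc: "!!s t. 0 <= s ==> s < t ==> t <= T ==> \<Phi> t - \<Phi> s <= X t - X s + (t - s) * (Y t - Y s)" and t: "0 <= t" "t <= T"
 shows "\<Phi> t - \<Phi> 0 <= X t - X 0"
proof (cases "t = 0")
 case False
 hence t0: "0 < t" using t by simp
 have "\<Phi> t - \<Phi> 0 <= X t - X 0 + 1 / real (Suc n) * (t * (Y t - Y 0))" for n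
 proof -
  define q where "q i = real i * t / real (Suc n)" for i
  have d: "q (Suc i) - q i = t / real (Suc n)" for i unfolding q_def by (simp add: diff_divide_distrib[symmetric] left_diff_distrib[symmetric])
  have q0: "q 0 = 0" "q (Suc n) = t" by (auto simp: q_def)
  have le: "\<Phi> (q (Suc i)) - \<Phi> (q i) <= (X (q (Suc i)) - X (q i)) + t / real (Suc n) * (Y (q (Suc i)) - Y (q i))" if "i < Suc n" for i
  proof -
   have "q (Suc i) <= q (Suc n)" unfolding q_def using that t by (intro divide_right_mono mult_right_mono) auto
   moreover have "0 < t / real (Suc n)" using t0 by simp
   hence "q i < q (Suc i)" using d[of i] by linarith
   moreover have "0 <= q i" unfolding q_def using t by simp
   ultimately show ?thesis using inc[of "q i" "q (Suc i)"] d[of i] q0 t by simp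
  qed
  have "(\<Sum>i<Suc n. \<Phi> (q (Suc i)) - \<Phi> (q i)) <= (\<Sum>i<Suc n. (X (q (Suc i)) - X (q i)) + t / real (Suc n) * (Y (q (Suc i)) - Y (q i)))"
   by (rule sum_mono) (use le in auto)
  hence "\<Phi> t - \<Phi> 0 <= X t - X 0 + t / real (Suc n) * (Y t - Y 0)"
   by (simp only: sum.distrib sum_distrib_left[symmetric] sum_lessThan_telescope[of "%i. \<Phi> (q i)"] sum_lessThan_telescope[of "%i. X (q i)"] sum_lessThan_telescope[of "%i. Y (q i)"] q0)
  thus ?thesis by simp
 qed
 moreover have "(%n. X t - X 0 + 1 / real (Suc n) * (t * (Y t - Y 0))) \<longlonglongrightarrow> X t - X 0 + 0 * (t * (Y t - Y 0))"
  by (intro tendsto_add tendsto_mult tendsto_const LIMSEQ_Suc[OF lim_1_over_n])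
 ultimately have "\<Phi> t - \<Phi> 0 <= X t - X 0 + 0 * (t * (Y t - Y 0))" by (intro LIMSEQ_le_const) auto
 thus ?thesis by simp
qed simp

text \<open>The load \<open>G\<close> is tested with \<open>\<eta> = \<theta>\<^sub>t\<close>, which is not controlled by the energy in the norm of \<open>a\<close>;
 summation by parts in time moves the derivative onto \<open>G\<close>.\<close>

lemma energy_estimate:
 fixes \<eta> \<theta> :: "real => fn" and G :: "real => fn => real" and \<kappa> \<rho> :: "real => real"
 assumes m: "semi_ip V m" and a: "semi_ip V a" and T: "0 < T"
  and \<eta>: "!!t. t \<in> {0..T} ==> \<eta> t \<in> V" and \<theta>: "!!t. t \<in> {0..T} ==> \<theta> t \<in> V"
  and Glin: "!!t v w c d. t \<in> {0..T} ==> v \<in> V ==> w \<in> V ==> G t (lincomb c v d w) = c * G t v + d * G t w"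
  and G0: "!!t v. t \<in> {0..T} ==> v \<in> V ==> \<bar>G t v\<bar> <= g * sqrt (a v v)"
  and Gk: "!!s t v. 0 <= s ==> s <= t ==> t <= T ==> v \<in> V ==> \<bar>G t v - G s v\<bar> <= (\<kappa> t - \<kappa> s) * sqrt (a v v)"
  and eqn: "!!s t v. 0 <= s ==> s < t ==> t <= T ==> v \<in> V ==> \<exists>\<xi>\<in>{s..t}. m (fminus (\<eta> t) (\<eta> s)) v
    <= (\<rho> t - \<rho> s) * sqrt (m v v) + (t - s) * (G \<xi> v - a (\<theta> t) v + L * (t - s) * sqrt (a v v))"
  and tay: "!!s t w. 0 <= s ==> s < t ==> t <= T ==> w = lincomb 1 (fminus (\<theta> t) (\<theta> s)) (s - t) (\<eta> t) ==> sqrt (a w w) <= L * (t - s)^2"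
  and mono: "!!s t. 0 <= s ==> s <= t ==> t <= T ==> \<kappa> s <= \<kappa> t & \<rho> s <= \<rho> t" and \<kappa>0: "\<kappa> 0 = 0" and \<rho>0: "\<rho> 0 = 0"
  and gL: "0 <= g" "0 <= L"
  and B: "!!t. t \<in> {0..T} ==> sqrt (a (\<eta> t) (\<eta> t)) <= B & sqrt (a (\<theta> t) (\<theta> t)) <= B & sqrt (m (\<eta> t) (\<eta> t)) <= B"
  and init: "m (\<eta> 0) (\<eta> 0) = 0" "a (\<theta> 0) (\<theta> 0) = 0" and t: "t \<in> {0..T}"
 shows "sqrt (m (\<eta> t) (\<eta> t) + a (\<theta> t) (\<theta> t)) <= 2 * (g + \<rho> T + \<kappa> T)"
proof -
 interpret m: semi_ip V m by (rule m)
 interpret a: semi_ip V a by (rule a)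
 define E where "E t = m (\<eta> t) (\<eta> t) + a (\<theta> t) (\<theta> t)" for t
 define S where "S = Sup (E ` {0..T})"
 \<comment> \<open>\<open>S\<close> is the supremum of the energy. All terms kept in the limit are
   bounded with \<open>M\<close>, so the result is \<open>S <= 2 K M\<close> with
   \<open>S = M * M\<close>, and \<open>M\<close> can be divided out. The crude bound
   \<open>B\<close> only makes the supremum finite and enters second-order terms.\<close>
 define M where "M = sqrt S"
 define K where "K = g + \<rho> T + \<kappa> T"
 have parts: "0 <= m (\<eta> t) (\<eta> t)" "0 <= a (\<theta> t) (\<theta> t)" if "t \<in> {0..T}" for t using m.nonneg[OF \<eta>[OF that]] a.nonneg[OF \<theta>[OF that]] by auto
 have B0: "0 <= B" using order_trans[OF a.nrm_nonneg[OF \<eta>[of 0]]] B[of 0] T by simp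
 have sq: "x <= B^2" if "0 <= x" "sqrt x <= B" for x using power_mono[OF that(2) real_sqrt_ge_zero[OF that(1)], of 2] that(1) by simp
 have "E t <= 2 * B^2" if "t \<in> {0..T}" for t using sq[OF parts(1)[OF that]] sq[OF parts(2)[OF that]] B[OF that] by (simp add: E_def)
 hence "bdd_above (E ` {0..T})" by (intro bdd_aboveI[of _ "2 * B^2"]) auto
 hence ES: "E t <= S" if "t \<in> {0..T}" for t unfolding S_def using that by (intro cSup_upper) auto
 have M: "sqrt (m (\<eta> t) (\<eta> t)) <= M" "sqrt (a (\<theta> t) (\<theta> t)) <= M" "sqrt (E t) <= M" if "t \<in> {0..T}" for t
  unfolding M_def using ES[OF that] parts[OF that] by (auto simp: E_def)
 have M0: "0 <= M" using order_trans[OF real_sqrt_ge_zero[OF parts(1)[of 0]] M(1)[of 0]] T by simp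
 \<comment> \<open>Energy minus twice the load at \<theta>: this correction is the boundary term of
   the summation by parts.\<close>
 define \<Phi> where "\<Phi> t = E t - 2 * G t (\<theta> t)" for t
 \<comment> \<open>\<open>X\<close> collects the first-order terms, measured with \<open>M\<close>;
   \<open>Y\<close> collects everything multiplied by a further step length.\<close>
 define X where "X t = 2 * M * (\<rho> t + \<kappa> t)" for t
 define Y where "Y t = 2 * B * \<kappa> t + 2 * (g * L + 2 * L * B) * t" for t
 have "\<Phi> t - \<Phi> s <= X t - X s + (t - s) * (Y t - Y s)" if st: "0 <= s" "s < t" "t <= T" for s t
 proof -
  define \<Delta> where "\<Delta> = t - s"
  have \<Delta>: "0 < \<Delta>" using st by (simp add: \<Delta>_def)
  have sT: "s \<in> {0..T}" and tT: "t \<in> {0..T}" using st by auto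
  note tV = \<eta>[OF tT] \<theta>[OF tT] and sV = \<eta>[OF sT] \<theta>[OF sT]
  define d\<eta> d\<theta> where "d\<eta> = fminus (\<eta> t) (\<eta> s)" and "d\<theta> = fminus (\<theta> t) (\<theta> s)"
  have dV: "d\<eta> \<in> V" "d\<theta> \<in> V" unfolding d\<eta>_def d\<theta>_def by (rule m.fminus_mem a.fminus_mem, use tV sV in blast, use tV sV in blast)+
  define w where "w = lincomb 1 d\<theta> (s - t) (\<eta> t)"
  have wV: "w \<in> V" unfolding w_def by (rule a.lincomb_mem[OF dV(2) tV(1)])
  have wb: "sqrt (a w w) <= L * \<Delta>\<^sup>2" unfolding \<Delta>_def by (rule tay[OF st]) (simp add: w_def d\<theta>_def)
  have d\<theta>: "d\<theta> = lincomb 1 w \<Delta> (\<eta> t)" by (simp add: w_def \<Delta>_def fun_eq_iff algebra_simps)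
  \<comment> \<open>Backward differences: the square of the increment appears with a favourable sign
    and is dropped.\<close>
  have e1: "m (\<eta> t) (\<eta> t) - m (\<eta> s) (\<eta> s) <= 2 * m d\<eta> (\<eta> t)"
  proof -
   have "\<eta> s = lincomb 1 (\<eta> t) (-1) d\<eta>" by (simp add: fun_eq_iff d\<eta>_def)
   thus ?thesis using m.expand[OF tV(1) dV(1), of 1 "-1"] m.nonneg[OF dV(1)] m.sym[OF tV(1) dV(1)] by simp
  qed
  have e2: "a (\<theta> t) (\<theta> t) - a (\<theta> s) (\<theta> s) <= 2 * a d\<theta> (\<theta> t)"
  proof -
   have "\<theta> s = lincomb 1 (\<theta> t) (-1) d\<theta>" by (simp add: fun_eq_iff d\<theta>_def)
   thus ?thesis using a.expand[OF tV(2) dV(2), of 1 "-1"] a.nonneg[OF dV(2)] a.sym[OF tV(2) dV(2)] by simp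
  qed
  obtain \<xi> where \<xi>: "\<xi> \<in> {s..t}" and q: "m d\<eta> (\<eta> t) <= (\<rho> t - \<rho> s) * sqrt (m (\<eta> t) (\<eta> t)) + \<Delta> * (G \<xi> (\<eta> t) - a (\<theta> t) (\<eta> t) + L * \<Delta> * sqrt (a (\<eta> t) (\<eta> t)))"
   using eqn[OF st tV(1)] unfolding \<Delta>_def d\<eta>_def by blast
  have mn: "\<rho> s <= \<rho> t" "\<kappa> s <= \<kappa> t" "\<kappa> \<xi> <= \<kappa> t" "\<kappa> s <= \<kappa> \<xi>" using mono[of s t] mono[of \<xi> t] mono[of s \<xi>] st \<xi> by auto
  have q1: "(\<rho> t - \<rho> s) * sqrt (m (\<eta> t) (\<eta> t)) <= (\<rho> t - \<rho> s) * M" using M(1)[OF tT] mn by (intro mult_left_mono) auto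
  have "L * \<Delta> * sqrt (a (\<eta> t) (\<eta> t)) <= L * \<Delta> * B" using B[OF tT] gL \<Delta> by (intro mult_left_mono) auto
  moreover have "G \<xi> (\<eta> t) <= G s (\<eta> t) + (\<kappa> t - \<kappa> s) * B"
  proof -
   have "(\<kappa> \<xi> - \<kappa> s) * sqrt (a (\<eta> t) (\<eta> t)) <= (\<kappa> t - \<kappa> s) * B" using B[OF tT] mn a.nrm_nonneg[OF tV(1)] by (intro mult_mono) auto
   thus ?thesis using Gk[of s \<xi> "\<eta> t"] st \<xi> tV(1) by auto
  qed
  ultimately have "\<Delta> * (G \<xi> (\<eta> t) - a (\<theta> t) (\<eta> t) + L * \<Delta> * sqrt (a (\<eta> t) (\<eta> t))) <= \<Delta> * (G s (\<eta> t) + (\<kappa> t - \<kappa> s) * B - a (\<theta> t) (\<eta> t) + L * \<Delta> * B)"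
   using \<Delta> by (intro mult_left_mono) auto
  hence q2: "\<Delta> * (G \<xi> (\<eta> t) - a (\<theta> t) (\<eta> t) + L * \<Delta> * sqrt (a (\<eta> t) (\<eta> t)))
    <= \<Delta> * G s (\<eta> t) + \<Delta> * (\<kappa> t - \<kappa> s) * B - \<Delta> * a (\<theta> t) (\<eta> t) + L * B * \<Delta>\<^sup>2" by (simp add: algebra_simps power2_eq_square)
  have q3: "a d\<theta> (\<theta> t) <= L * B * \<Delta>\<^sup>2 + \<Delta> * a (\<theta> t) (\<eta> t)"
  proof -
   have "a w (\<theta> t) <= sqrt (a w w) * sqrt (a (\<theta> t) (\<theta> t))" using a.Cauchy_Schwarz[OF wV tV(2)] by simp
   also have "... <= L * \<Delta>\<^sup>2 * B" using wb B[OF tT] gL B0 a.nrm_nonneg[OF tV(2)] by (intro mult_mono) auto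
   finally show ?thesis unfolding d\<theta> using a.lin[OF wV tV(1) tV(2), of 1 \<Delta>] a.sym[OF tV] by (simp add: mult_ac)
  qed
  \<comment> \<open>Up to the Taylor remainder \<open>w\<close>, the step times \<eta> is the
    increment of \<theta>; the functional is frozen at \<open>s\<close>, so the load becomes an
    increment of its value at \<theta>.\<close>
  have q4: "\<Delta> * G s (\<eta> t) <= G s (\<theta> t) - G s (\<theta> s) + g * L * \<Delta>\<^sup>2"
  proof -
   have "G s d\<theta> = G s w + \<Delta> * G s (\<eta> t)" unfolding d\<theta> using Glin[OF sT wV tV(1), of 1 \<Delta>] by simp
   moreover have "G s d\<theta> = G s (\<theta> t) - G s (\<theta> s)" unfolding d\<theta>_def fminus_eq_lincomb using Glin[OF sT tV(2) sV(2), of 1 "-1"] by simp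
   moreover have "g * sqrt (a w w) <= g * (L * \<Delta>\<^sup>2)" using wb gL by (intro mult_left_mono) auto
   hence "\<bar>G s w\<bar> <= g * L * \<Delta>\<^sup>2" using G0[OF sT wV] by (simp add: mult_ac)
   ultimately show ?thesis by linarith
  qed
  have q5: "G s (\<theta> t) <= G t (\<theta> t) + (\<kappa> t - \<kappa> s) * M"
  proof -
   have "(\<kappa> t - \<kappa> s) * sqrt (a (\<theta> t) (\<theta> t)) <= (\<kappa> t - \<kappa> s) * M" using M(2)[OF tT] mn by (intro mult_left_mono) auto
   thus ?thesis using Gk[of s t "\<theta> t"] st tV(2) by auto
  qed
  have q6: "m d\<eta> (\<eta> t) <= (\<rho> t - \<rho> s) * M + (\<Delta> * G s (\<eta> t) + \<Delta> * (\<kappa> t - \<kappa> s) * B - \<Delta> * a (\<theta> t) (\<eta> t) + L * B * \<Delta>\<^sup>2)"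
   by (rule order_trans[OF q add_mono[OF q1 q2]])
  \<comment> \<open>The combination is isolated over plain reals. The variable \<open>H\<close>
    stands for the mixed term of \<theta> and \<eta> in \<open>a\<close>, which cancels between the
    two parts of the energy.\<close>
  have lin: "x1 - x2 + (y1 - y2) - 2 * g3 + 2 * g2 <= 2 * A + 2 * K2 + 2 * F + 2 * K1 + 4 * C"
   if "x1 - x2 <= 2 * p" "y1 - y2 <= 2 * r" "p <= A + (D + K1 - H + C)" "r <= C + H" "D <= g1 - g2 + F" "g1 <= g3 + K2"
   for x1 x2 y1 y2 p r A D K1 H C g1 g2 F g3 K2 :: real using that by linarith
  have "\<Phi> t - \<Phi> s = m (\<eta> t) (\<eta> t) - m (\<eta> s) (\<eta> s) + (a (\<theta> t) (\<theta> t) - a (\<theta> s) (\<theta> s)) - 2 * G t (\<theta> t) + 2 * G s (\<theta> s)"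
   by (simp add: \<Phi>_def E_def)
  also have "... <= 2 * ((\<rho> t - \<rho> s) * M) + 2 * ((\<kappa> t - \<kappa> s) * M) + 2 * (g * L * \<Delta>\<^sup>2) + 2 * (\<Delta> * (\<kappa> t - \<kappa> s) * B) + 4 * (L * B * \<Delta>\<^sup>2)"
   by (rule lin[OF e1 e2 q6 q3 q4 q5])
  also have "... = X t - X s + (t - s) * (Y t - Y s)" unfolding X_def Y_def \<Delta>_def by (simp add: algebra_simps power2_eq_square)
  finally show ?thesis .
 qed
 note tel = partition_telescope[where T = T and \<Phi> = \<Phi> and X = X and Y = Y, OF this]
 have K0: "g + \<rho> t + \<kappa> t <= K" if "t \<in> {0..T}" for t using mono[of t T] that by (auto simp: K_def)
 have Kn: "0 <= K" using K0[of 0] T \<kappa>0 \<rho>0 gL by simp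
 have "E t <= 2 * K * M" if tT: "t \<in> {0..T}" for t
 proof -
  have "G 0 (\<theta> 0) = 0" using G0[of 0 "\<theta> 0"] \<theta>[of 0] T init by simp
  hence "\<Phi> 0 = 0" by (simp add: \<Phi>_def E_def init)
  hence "E t <= 2 * G t (\<theta> t) + 2 * M * (\<rho> t + \<kappa> t)" using tel[of t] that \<kappa>0 \<rho>0 by (simp add: \<Phi>_def X_def)
  also have "G t (\<theta> t) <= g * M" using G0[OF tT \<theta>[OF tT]] mult_left_mono[OF M(2)[OF tT] gL(1)] by linarith
  also have "2 * (g * M) + 2 * M * (\<rho> t + \<kappa> t) = 2 * M * (g + \<rho> t + \<kappa> t)" by (simp add: algebra_simps)
  also have "... <= 2 * M * K" using K0[OF tT] M0 by (intro mult_left_mono) auto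
  finally show ?thesis by (simp add: mult_ac)
 qed
 hence "S <= 2 * K * M" unfolding S_def using T by (intro cSup_least) auto
 moreover have "S = M * M" using ES[of 0] parts[of 0] T by (simp add: M_def E_def)
 ultimately have "M <= 2 * K" using M0 Kn by (cases "M = 0") auto
 thus ?thesis using M(3)[OF t] by (simp add: E_def K_def)
qed

subsection \<open>The discrete space and the Ritz projection\<close>

locale galerkin = mesh \<Omega> \<T> for \<Omega> \<T> +
 fixes \<alpha> \<beta> C1 C2 \<gamma> :: real and V :: "fn set" and ah :: "fn => fn => real" and Q R :: "fn => fn"
 assumes pos: "0 < \<alpha>" "0 < C1" "0 < C2" "0 < \<gamma>" "\<gamma> <= 1"
  and fd: "fin_dim_space V" and VH: "V \<subseteq> pwHs 2 \<T>" and df: "discrete_form \<Omega> \<T> \<alpha> \<beta> V ah"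
  and QH: "!!v. v \<in> V ==> Q v \<in> H20 \<Omega>" and sm: "smoother_estimate \<Omega> \<T> C1 V Q"
  and rp: "ritz_projection \<Omega> V ah Q R" and re: "ritz_estimate \<Omega> \<T> \<gamma> C2 R"
begin

abbreviation h :: real where "h \<equiv> mesh_size \<T>"

lemma V_L2: "v \<in> V ==> v \<in> L2 \<Omega>" using VH pwHs_L2 by blast

lemma zero_V: "(%x. 0) \<in> V" using fd by (auto simp: fin_dim_space_def intro!: exI[of _ "%_. 0"])

text \<open>Bilinearity of \<open>ah\<close> is given on the sum with the Morley space. Adding zero
  embeds the discrete space into that sum.\<close>

lemma zero_morley: "(%x. 0) \<in> morley \<Omega> \<T>"
proof -
 have tr: "trace_at k (%x. 0) z = 0" "trace_at k (wd (tri k) [i] (%x. 0)) z = 0" if k: "k \<in> \<T>" and z: "z \<in> convex hull k" for k z i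
 proof -
  note K = tri_locale[OF k]
  have "weak_deriv (tri k) [i] (%x. 0) (%x. 0)" by (simp add: weak_deriv_def zero_L2 ip_def)
  from aeq_sym[OF wd_aeq[OF this triangle.K_props(1)[OF K]]] show "trace_at k (wd (tri k) [i] (%x. 0)) z = 0"
   using triangle.trace_at_eq[OF K, of "%x. 0" _ z] z by simp
  show "trace_at k (%x. 0) z = 0" using triangle.trace_at_eq[OF K, of "%x. 0" _ z] z aeq_refl by simp
 qed
 have v: "z \<in> convex hull k" if "k \<in> elements_of \<T> {z}" for k z using that by (auto simp: elements_of_def hull_inc)
 have b: "barycentre e \<in> convex hull k" if e: "e \<in> edges \<T>" and k: "k \<in> elements_of \<T> e" for k e
 proof -
  have ek: "card e = 2" "e \<subseteq> convex hull k" using edge_facts[OF e k] by auto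
  then obtain p q where pq: "e = {p, q}" "p ~= q" by (auto simp: card_2_iff)
  have "barycentre e = (1 / 2) *\<^sub>R p + (1 / 2) *\<^sub>R q" unfolding barycentre_def ek(1) using pq by (simp add: scaleR_add_right)
  thus ?thesis using convexD[OF convex_convex_hull, of p k q "1/2" "1/2"] ek(2) pq(1) by simp
 qed
 have nd: "normal_deriv_at k e (%x. 0) (barycentre e) = 0" if e: "e \<in> edges \<T>" and k: "k \<in> elements_of \<T> e" for k e
  unfolding normal_deriv_at_def using tr(2)[OF _ b[OF e k]] k by (simp add: elements_of_def)
 have tz: "trace_at k (%x. 0) z = 0" if "k \<in> elements_of \<T> {z}" for k z using tr(1)[OF _ v[OF that]] that by (simp add: elements_of_def)
 have "(%x. 0) \<in> pw_poly 2 \<T>" unfolding pw_poly_def poly_fn_def by (auto intro!: exI[of _ "%x. 0"] exI[of _ "%_ _. 0"] simp: aeq_refl)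
 thus ?thesis unfolding morley_def using tz nd by simp
qed

lemma semi_ip_ah: "semi_ip V ah"
proof
 have sb: "sym_bilinear_on (set_plus_fn V (morley \<Omega> \<T>)) ah" using df by (simp add: discrete_form_def)
 have VS: "v \<in> set_plus_fn V (morley \<Omega> \<T>)" if "v \<in> V" for v
 proof -
  have "v = lincomb 1 v 1 (%x. 0)" by (simp add: fun_eq_iff)
  thus ?thesis unfolding set_plus_fn_def using that zero_morley by blast
 qed
 show "lincomb c v d w \<in> V" if "v \<in> V" "w \<in> V" for v w c d by (rule fin_dim_lincomb[OF fd that])
 show "ah v w = ah w v" if "v \<in> V" "w \<in> V" for v w using sb VS that by (simp add: sym_bilinear_on_def)
 show "ah (lincomb c u d v) w = c * ah u w + d * ah v w" if "u \<in> V" "v \<in> V" "w \<in> V" for u v w c d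
  using sb VS that by (simp add: sym_bilinear_on_def)
 show "0 <= ah v v" if "v \<in> V" for v
 proof -
  have "0 <= \<alpha> * (hnorm \<T> v)^2" using pos by simp
  also have "... <= ah v v" using df that by (simp add: discrete_form_def)
  finally show ?thesis .
 qed
qed

lemma semi_ip_V: "semi_ip V (ip \<Omega>)" by unfold_locales (auto intro: fin_dim_lincomb[OF fd] V_L2 L2.sym L2.lin L2.nonneg)

sublocale m: semi_ip V "ip \<Omega>" by (rule semi_ip_V)
sublocale a: semi_ip V ah by (rule semi_ip_ah)

lemma m_norm: "sqrt (ip \<Omega> v v) = L2norm \<Omega> v" by (simp add: L2norm_def)

lemma hnorm_le_ah: "v \<in> V ==> hnorm \<T> v <= sqrt (ah v v) / sqrt \<alpha>"
proof -
 assume v: "v \<in> V"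
 have "\<alpha> * (hnorm \<T> v)^2 <= ah v v" using df v by (simp add: discrete_form_def)
 hence "sqrt (\<alpha> * (hnorm \<T> v)^2) <= sqrt (ah v v)" by (rule real_sqrt_le_mono)
 hence "sqrt \<alpha> * hnorm \<T> v <= sqrt (ah v v)" by (simp add: real_sqrt_mult)
 thus ?thesis using pos by (simp add: field_simps)
qed

lemma h_facts: "0 < h" "h <= diameter (closure \<Omega>)"
proof -
 have cl: "(\<Union>k\<in>\<T>. convex hull k) = closure \<Omega>" using conf by (simp add: conforming_triangulation_def)
 then obtain k where k: "k \<in> \<T>" using Omega(3) closure_subset[of \<Omega>] by auto
 have "card k = 3" using conf k by (simp add: conforming_triangulation_def)
 then obtain p q where pq: "p \<in> k" "q \<in> k" "p ~= q" by (auto simp: card_3_iff)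
 have "0 < dist p q" using pq by simp
 also have "... <= diameter (convex hull k)"
  by (rule diameter_bounded_bound[OF compact_imp_bounded[OF triangle.K_props(6)[OF tri_locale[OF k]]]]) (use pq in \<open>auto simp: hull_inc\<close>)
 also have "... <= h" unfolding mesh_size_def using fin k by (intro Max_ge) auto
 finally show "0 < h" .
 show "h <= diameter (closure \<Omega>)" unfolding mesh_size_def
 proof (subst Max_le_iff)
  show "\<forall>d\<in>(\<lambda>k. diameter (convex hull k)) ` \<T>. d <= diameter (closure \<Omega>)"
   using cl Omega(2) by (auto intro!: diameter_subset bounded_closure)
 qed (use fin k in auto)
qed

text \<open>The zero function is an admissible competitor in the minimum, which bounds it by the
  norm of \<open>v\<close>.\<close>

lemma smoother: assumes v: "v \<in> V" and s: "s \<in> {0..2}" shows "pwHs_norm s \<T> (fminus v (Q v)) <= C1 * h powr (2 - s) * hnorm \<T> v"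
proof -
 have "(INF w\<in>H20 \<Omega>. hnorm \<T> (fminus w v)) <= hnorm \<T> (fminus (%x. 0) v)"
  by (rule cINF_lower[OF _ H20_zero[OF Omega(1,2)]]) (auto intro!: bdd_belowI[of _ 0])
 also have "... <= hnorm \<T> v" using hnorm_minus VH v by blast
 finally have "C1 * h powr (2 - s) * (INF w\<in>H20 \<Omega>. hnorm \<T> (fminus w v)) <= C1 * h powr (2 - s) * hnorm \<T> v"
  using pos by (intro mult_left_mono) auto
 moreover have "pwHs_norm s \<T> (fminus v (Q v)) <= C1 * h powr (2 - s) * (INF w\<in>H20 \<Omega>. hnorm \<T> (fminus w v))"
  using sm v s unfolding smoother_estimate_def by blast
 ultimately show ?thesis by linarith
qed

lemma smoother_L2: assumes v: "v \<in> V" shows "L2norm \<Omega> (fminus (Q v) v) <= C1 * h powr 2 * hnorm \<T> v"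
proof -
 let ?d = "fminus v (Q v)"
 have QL: "Q v \<in> pwHs 2 \<T>" by (rule Hs_pwHs[OF H20_Hs[OF QH[OF v]]])
 have d: "?d \<in> L2 (tri k)" if "k \<in> \<T>" for k using L2.fminus_mem[OF Hs_L2 Hs_L2, OF pwHs_tri pwHs_tri] VH v QL that by blast
 have "(L2norm \<Omega> ?d)^2 = (\<Sum>k\<in>\<T>. (L2norm (tri k) ?d)^2)" by (rule L2_Omega(2)[OF d])
 also have "... <= (\<Sum>k\<in>\<T>. (Hs_norm 0 (tri k) ?d)^2)"
  by (intro sum_mono power_mono L2norm_le_Hs_norm d) (auto simp: triangle.K_props(1)[OF tri_locale])
 finally have "sqrt ((L2norm \<Omega> ?d)^2) <= pwHs_norm 0 \<T> ?d" unfolding pwHs_norm_def by (rule real_sqrt_le_mono)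
 hence "L2norm \<Omega> ?d <= C1 * h powr 2 * hnorm \<T> v" using smoother[OF v, of 0] by simp
 moreover have "L2norm \<Omega> (fminus (Q v) v) = L2norm \<Omega> ?d"
  using L2.nrm_commute[OF V_L2[OF v] Hs_L2[OF H20_Hs[OF QH[OF v]]]] by (simp add: L2norm_def)
 ultimately show ?thesis by simp
qed

text \<open>A null function has vanishing derivatives and traces on every triangle, so its discrete
  norm is zero, and \<open>ah\<close> is bounded by that norm. With \<open>ah_null_L2\<close> the
  two forms have the same null functions.\<close>

lemma L2_null_ah: assumes v: "v \<in> V" and z: "ip \<Omega> v v = 0" shows "ah v v = 0"
proof -
 have vp: "v \<in> pwHs 2 \<T>" using VH v by blast
 have vk: "v \<in> L2 (tri k)" if "k \<in> \<T>" for k by (rule Hs_L2[OF pwHs_tri[OF vp that]])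
 have "(\<Sum>k\<in>\<T>. (L2norm (tri k) v)^2) = 0" using L2_Omega(2)[OF vk] z by (simp add: L2norm_def)
 hence "L2norm (tri k) v = 0" if "k \<in> \<T>" for k using that fin by (simp add: sum_nonneg_eq_0_iff)
 hence "aeq (tri k) v (%x. 0)" if "k \<in> \<T>" for k using L2norm_eq_0_iff[OF vk[OF that]] that by (simp add: aeq_def)
 hence "hnorm \<T> v = 0" by (rule hnorm_aeq_0[OF vp])
 moreover have "ah v v <= \<beta> * hnorm \<T> v * hnorm \<T> v" using df v by (simp add: discrete_form_def)
 ultimately show ?thesis using a.nonneg[OF v] by simp
qed

text \<open>If \<open>v\<close> vanishes in the discrete norm, then \<open>v = Q v\<close> is a clamped function with vanishing second derivatives.\<close>

lemma ah_null_L2: assumes v: "v \<in> V" and z: "ah v v = 0" shows "L2norm \<Omega> v = 0"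
proof -
 have vp: "v \<in> pwHs 2 \<T>" using VH v by blast
 have q: "Q v \<in> Hs 2 \<Omega>" by (rule H20_Hs[OF QH[OF v]])
 have hn: "hnorm \<T> v = 0" using hnorm_le_ah[OF v] z hnorm_nonneg[of v] by simp
 have "L2norm \<Omega> (fminus (Q v) v) = 0" using smoother_L2[OF v] hn L2norm_nonneg[of \<Omega> "fminus (Q v) v"] by simp
 hence ae: "aeq \<Omega> (Q v) v" by (simp add: aeq_iff_L2norm[OF Hs_L2[OF q] V_L2[OF v]])
 have "(hnorm \<T> v)^2 = 0" using hn by simp
 hence "(\<Sum>k\<in>\<T>. hess_form (tri k) v v) = 0" unfolding hnorm_sq using sum_nonneg[of \<T> "%k. hess_form (tri k) v v"] hess_nonneg
   sum_nonneg[of "edges \<T>" "%e. \<Sum>z\<in>e. \<bar>jump_at \<T> e v z\<bar>\<^sup>2 / (edge_length e)^2"]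
   sum_nonneg[of "edges \<T>" "%e. \<bar>(1 / edge_length e) * (LINT x|edge_measure e. jump_normal \<T> e v x)\<bar>\<^sup>2"]
  by (smt (verit) divide_nonneg_nonneg sum_nonneg zero_le_power2)
 hence hk: "hess_form (tri k) v v = 0" if "k \<in> \<T>" for k using that fin hess_nonneg by (simp add: sum_nonneg_eq_0_iff)
 have null: "L2norm (tri k) (wd \<Omega> [i, i] (Q v)) = 0" "wd \<Omega> [i, i] (Q v) \<in> L2 (tri k)" if k: "k \<in> \<T>" for k i
 proof -
  note K = tri_locale[OF k] and vk = pwHs_tri[OF vp k]
  note Ko = triangle.K_props(1)[OF K] and Kl = triangle.K_leb[OF K]
  have "(\<Sum>i\<in>UNIV. \<Sum>j\<in>UNIV. (L2norm (tri k) (wd (tri k) [i, j] v))^2) = 0" using hk[OF k] hess_form_self[OF vk] by simp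
  hence "L2norm (tri k) (wd (tri k) [i, i] v) = 0" by (simp add: sum_nonneg_eq_0_iff sum_nonneg)
  moreover have "aeq (tri k) (Q v) v" using ae tri_subset[OF k] Kl Omega(4) unfolding aeq_def by (auto simp: AE_restrict_space_iff elim!: eventually_mono)
  hence "wd (tri k) [i, i] v = wd (tri k) [i, i] (Q v)" using wd_cong[OF _ Ko] by metis
  moreover have c: "aeq (tri k) (wd (tri k) [i, i] (Q v)) (wd \<Omega> [i, i] (Q v))" by (rule Hs_restrict(2)[OF q k]) simp
  moreover have mm: "wd (tri k) [i, i] (Q v) \<in> L2 (tri k)" by (rule wd2_mem[OF Hs_restrict(1)[OF q k]])
  ultimately show "L2norm (tri k) (wd \<Omega> [i, i] (Q v)) = 0" using L2norm_cong[OF c mm Kl] by simp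
  show "wd \<Omega> [i, i] (Q v) \<in> L2 (tri k)" by (rule L2_cong[OF c mm Kl])
 qed
 have "(L2norm \<Omega> (wd \<Omega> [i, i] (Q v)))^2 = 0" for i using L2_Omega(2)[OF null(2)] null(1) by simp
 hence "L2norm \<Omega> (Q v) = 0" using H20_Friedrichs_null[OF Omega(1,2) QH[OF v], of 1] by simp
 thus ?thesis using L2norm_cong[OF ae Hs_L2[OF q] Omega(4)] by simp
qed

text \<open>An inverse inequality obtained from finite dimension alone, with a constant that may
  depend on the mesh.\<close>

definition \<Lambda> :: real where "\<Lambda> = (SOME \<Lambda>. 0 <= \<Lambda> & (\<forall>v\<in>V. ah v v <= \<Lambda> * ip \<Omega> v v))"

lemma ah_le: "0 <= \<Lambda>" "v \<in> V ==> sqrt (ah v v) <= sqrt \<Lambda> * L2norm \<Omega> v"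
proof -
 have "\<exists>\<Lambda>. 0 <= \<Lambda> & (\<forall>v\<in>V. ah v v <= \<Lambda> * ip \<Omega> v v)" using finite_dim_comparison[OF fd semi_ip_V semi_ip_ah L2_null_ah] by blast
 from someI_ex[OF this] have L: "0 <= \<Lambda>" "\<forall>v\<in>V. ah v v <= \<Lambda> * ip \<Omega> v v" unfolding \<Lambda>_def[symmetric] by auto
 show "0 <= \<Lambda>" by (rule L(1))
 assume "v \<in> V"
 hence "sqrt (ah v v) <= sqrt (\<Lambda> * ip \<Omega> v v)" using L(2) by simp
 thus "sqrt (ah v v) <= sqrt \<Lambda> * L2norm \<Omega> v" by (simp add: real_sqrt_mult L2norm_def)
qed

lemma R_V: "w \<in> H20 \<Omega> ==> R w \<in> V" and R_eq: "w \<in> H20 \<Omega> ==> v \<in> V ==> ah (R w) v = hess_form \<Omega> w (Q v)"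
 using rp by (auto simp: ritz_projection_def)

text \<open>The variational equation determines the Ritz projection only up to functions with
  vanishing \<open>ah\<close>-norm, which are null by \<open>ah_null_L2\<close>. Hence the
  conclusion is a vanishing norm and not an equality.\<close>

lemma R_unique:
 assumes D: "D \<in> V" and w: "w \<in> H20 \<Omega>" and eq: "!!v. v \<in> V ==> ah D v = hess_form \<Omega> w (Q v)"
 shows "L2norm \<Omega> (fminus D (R w)) = 0"
proof -
 note d = a.fminus_mem[OF D R_V[OF w]]
 have "ah (fminus D (R w)) (fminus D (R w)) = 0" using a.diff_left[OF D R_V[OF w] d] eq[OF d] R_eq[OF w d] by simp
 thus ?thesis by (rule ah_null_L2[OF d])
qed

lemma R_lincomb:
 assumes v: "v \<in> H20 \<Omega>" and w: "w \<in> H20 \<Omega>"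
 shows "L2norm \<Omega> (fminus (lincomb c (R v) d (R w)) (R (lincomb c v d w))) = 0"
proof (rule R_unique)
 show "lincomb c (R v) d (R w) \<in> V" by (rule a.lincomb_mem[OF R_V[OF v] R_V[OF w]])
 show "lincomb c v d w \<in> H20 \<Omega>" by (rule H20_lincomb[OF Omega(1,2) v w])
 show "ah (lincomb c (R v) d (R w)) y = hess_form \<Omega> (lincomb c v d w) (Q y)" if y: "y \<in> V" for y
  using a.lin[OF R_V[OF v] R_V[OF w] y] R_eq[OF v y] R_eq[OF w y] hess_form_lincomb[OF Omega(1,2) H20_Hs[OF v] H20_Hs[OF w] H20_Hs[OF QH[OF y]]] by simp
qed

lemma ritz:
 assumes v: "v \<in> H20 \<Omega>" "v \<in> Hs (2 + \<gamma>) \<Omega>"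
 shows "L2norm \<Omega> (fminus v (R v)) <= C2 * h powr (2 * \<gamma>) * Hs_norm (2 + \<gamma>) \<Omega> v" "hnorm \<T> (fminus v (R v)) <= C2 * h powr \<gamma> * Hs_norm (2 + \<gamma>) \<Omega> v"
  "L2norm \<Omega> (R v) <= (1 + C2 * h powr (2 * \<gamma>)) * Hs_norm (2 + \<gamma>) \<Omega> v"
proof -
 have e: "L2norm \<Omega> (fminus v (R v)) + h powr \<gamma> * hnorm \<T> (fminus v (R v)) <= C2 * h powr (2 * \<gamma>) * Hs_norm (2 + \<gamma>) \<Omega> v"
  using re v unfolding ritz_estimate_def by blast
 have "0 <= h powr \<gamma> * hnorm \<T> (fminus v (R v))" by simp
 thus e1: "L2norm \<Omega> (fminus v (R v)) <= C2 * h powr (2 * \<gamma>) * Hs_norm (2 + \<gamma>) \<Omega> v" using e by linarith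
 have "h powr \<gamma> * hnorm \<T> (fminus v (R v)) <= C2 * h powr (2 * \<gamma>) * Hs_norm (2 + \<gamma>) \<Omega> v" using e L2norm_nonneg[of \<Omega> "fminus v (R v)"] by linarith
 also have "... = h powr \<gamma> * (C2 * h powr \<gamma> * Hs_norm (2 + \<gamma>) \<Omega> v)" unfolding mult_2 powr_add by (simp only: mult_ac)
 finally show "hnorm \<T> (fminus v (R v)) <= C2 * h powr \<gamma> * Hs_norm (2 + \<gamma>) \<Omega> v" by (rule mult_left_le_imp_le) (use h_facts in simp)
 have "L2norm \<Omega> (R v) <= L2norm \<Omega> v + L2norm \<Omega> (fminus v (R v))"
  using L2.nrm_diff[OF Hs_L2[OF v(2)] V_L2[OF R_V[OF v(1)]]] unfolding L2norm_def by linarith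
 also have "... <= Hs_norm (2 + \<gamma>) \<Omega> v + C2 * h powr (2 * \<gamma>) * Hs_norm (2 + \<gamma>) \<Omega> v" using e1 L2norm_le_Hs_norm[OF Hs_L2[OF v(2)] Omega(1)] by (intro add_mono)
 finally show "L2norm \<Omega> (R v) <= (1 + C2 * h powr (2 * \<gamma>)) * Hs_norm (2 + \<gamma>) \<Omega> v" by (simp add: distrib_right)
qed

lemma ah_time_Lipschitz:
 assumes g: "!!t. t \<in> {0..T} ==> g t \<in> V" and lip: "!!s t. 0 <= s ==> s < t ==> t <= T ==> L2norm \<Omega> (fminus (g t) (g s)) <= K * (t - s)"
  and v: "v \<in> V" and st: "0 <= s" "s <= t" "t <= T"
 shows "\<bar>ah (g t) v - ah (g s) v\<bar> <= sqrt \<Lambda> * \<bar>K\<bar> * (t - s) * sqrt (ah v v)"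
proof (cases "s = t")
 case False
 have m: "g t \<in> V" "g s \<in> V" using g st by auto
 note d = a.fminus_mem[OF m]
 have "sqrt (ah (fminus (g t) (g s)) (fminus (g t) (g s))) <= sqrt \<Lambda> * L2norm \<Omega> (fminus (g t) (g s))" by (rule ah_le(2)[OF d])
 also have "... <= sqrt \<Lambda> * (K * (t - s))" using lip[of s t] st False ah_le(1) by (intro mult_left_mono) auto
 also have "... <= sqrt \<Lambda> * (\<bar>K\<bar> * (t - s))" using st ah_le(1) by (intro mult_left_mono mult_right_mono) auto
 also have "... = sqrt \<Lambda> * \<bar>K\<bar> * (t - s)" by simp
 finally have "sqrt (ah (fminus (g t) (g s)) (fminus (g t) (g s))) * sqrt (ah v v) <= sqrt \<Lambda> * \<bar>K\<bar> * (t - s) * sqrt (ah v v)"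
  by (rule mult_right_mono[OF _ a.nrm_nonneg[OF v]])
 thus ?thesis using a.Cauchy_Schwarz[OF d v] a.diff_left[OF m v] by simp
qed simp

end

subsection \<open>The error equation\<close>

lemma continuous_mult_integrable:
 assumes f: "integrable (lebT T) f" and h: "continuous_on UNIV (h :: real => real)"
 shows "integrable (lebT T) (%t. h t * f t)"
proof -
 have "bounded (h ` {0..T})" by (intro compact_imp_bounded compact_continuous_image continuous_on_subset[OF h]) auto
 then obtain B where "\<forall>y\<in>h ` {0..T}. norm y <= B" unfolding bounded_iff by blast
 hence B: "\<bar>h t\<bar> <= B" if "t \<in> {0..T}" for t using that by auto
 have "integrable (lebT T) (%t. (indicator {0..T} t * h t) * f t)"
 proof (rule bounded_mult_integrable[OF f, where B = "\<bar>B\<bar>"])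
  show "(%t. indicator {0..T} t * h t) \<in> borel_measurable borel" using borel_measurable_continuous_onI[OF h] by simp
  show "\<bar>indicator {0..T} t * h t\<bar> <= \<bar>B\<bar>" for t using B[of t] by (auto simp: indicator_def)
 qed
 thus ?thesis by (subst Bochner_Integration.integrable_cong[OF refl]) auto
qed

lemma weak_1D_diff:
 assumes "weak_1D T g k" "weak_1D T g' k'" shows "weak_1D T (%t. g t - g' t) (%t. k t - k' t)"
proof -
 interpret A: weak_1D T g k by (rule assms)
 interpret B: weak_1D T g' k' by (rule assms)
 show ?thesis
 proof
  fix \<phi> assume \<phi>: "\<phi> \<in> time_test_fun T"
  have d: "(deriv ^^ n) \<phi> differentiable at t" for n t using \<phi> by (simp add: time_test_fun_def)
  have c: "continuous_on UNIV \<phi>" "continuous_on UNIV (deriv \<phi>)"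
   using d[of 0] d[of 1] by (auto intro!: differentiable_imp_continuous_on simp: differentiable_on_def)
  show "(LINT t|lebT T. deriv \<phi> t * (g t - g' t)) = - (LINT t|lebT T. \<phi> t * (k t - k' t))"
   using A.wk[OF \<phi>] B.wk[OF \<phi>] continuous_mult_integrable[OF A.gi c(2)] continuous_mult_integrable[OF B.gi c(2)]
    continuous_mult_integrable[OF A.ki c(1)] continuous_mult_integrable[OF B.ki c(1)] by (simp add: right_diff_distrib)
 qed (use A.gi A.ki B.gi B.ki in auto)
qed

lemma weak_time_deriv_1D: "weak_time_deriv U T g g' ==> z \<in> L2 U ==> weak_1D T (%t. ip U (g t) z) (%t. ip U (g' t) z)"
 using L2_pairing_integrable(1)[of g T U z] L2_pairing_integrable(1)[of g' T U z] by unfold_locales (auto simp: weak_time_deriv_def)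

lemma MVT_Icc:
 assumes "!!t. t \<in> {0..T} ==> (p has_real_derivative p' t) (at t within {0..T})" "0 <= a" "a < b" "b <= T"
 shows "\<exists>\<xi>\<in>{a<..<b}. p b - p a = (b - a) * p' \<xi>"
proof -
 have "\<exists>\<xi>\<in>{a<..<b}. p b - p a = (%y. p' \<xi> * y) (b - a)"
 proof (rule mvt_simple[OF assms(3)])
  fix x assume "a <= x" "x <= b"
  hence "(p has_real_derivative p' x) (at x within {a..b})" by (intro DERIV_subset[OF assms(1)]) (use assms in auto)
  thus "(p has_derivative (%y. p' x * y)) (at x within {a..b})" by (simp add: has_field_derivative_def)
 qed
 thus ?thesis by (simp add: mult.commute)
qed

lemma derivative_bound_Icc:
 assumes d: "(p has_real_derivative D) (at t within {0..T})" and t: "t \<in> {0..T}" and T: "0 < T"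
  and lip: "!!a b. 0 <= a ==> a <= b ==> b <= T ==> \<bar>p b - p a\<bar> <= (b - a) * K"
 shows "\<bar>D\<bar> <= K"
proof (rule tendsto_upperbound)
 show "((%s. \<bar>(p s - p t) / (s - t)\<bar>) \<longlongrightarrow> \<bar>D\<bar>) (at t within {0..T})" using d unfolding has_field_derivative_iff by (rule tendsto_rabs)
 have "\<bar>(p s - p t) / (s - t)\<bar> <= K" if "s \<in> {0..T}" "s ~= t" for s
 proof -
  have "\<bar>p s - p t\<bar> <= \<bar>s - t\<bar> * K" using lip[of s t] lip[of t s] that t by (cases "s <= t") (auto simp: abs_minus_commute)
  thus ?thesis using that by (simp add: divide_le_eq mult.commute)
 qed
 thus "\<forall>\<^sub>F s in at t within {0..T}. \<bar>(p s - p t) / (s - t)\<bar> <= K" by (auto simp: eventually_at_filter)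
 have "t islimpt {0..T}" by (rule connected_imp_perfect[OF connected_Icc t]) (use T in \<open>auto dest: set_eq_iff[THEN iffD1]\<close>)
 thus "at t within {0..T} ~= bot" by (simp add: trivial_limit_within)
qed

section \<open>Temporal regularity of the exact and the semidiscrete solution\<close>

locale wave = galerkin +
 fixes T :: real and f ft u ut utt uttt uh uht uhtt :: "real => fn" and u0 v0 :: fn
 assumes T: "0 < T" and fc: "time_cont T (L2 \<Omega>) (L2norm \<Omega>) f" and fw: "weak_time_deriv \<Omega> T f ft"
  and ws: "weak_solution \<Omega> T f u0 v0 u ut utt" and uw: "weak_time_deriv \<Omega> T utt uttt"
  and uX: "{u, ut, utt} \<subseteq> bochner_Linf T (Hs (2 + \<gamma>) \<Omega>) (Hs_norm (2 + \<gamma>) \<Omega>)" and uL: "utt \<in> bochner_Linf T (L2 \<Omega>) (L2norm \<Omega>)"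
  and ss: "semidiscrete_solution \<Omega> T V ah R f u0 v0 uh uht uhtt"
begin

abbreviation "X \<equiv> Hs (2 + \<gamma>) \<Omega>"
abbreviation "N \<equiv> Hs_norm (2 + \<gamma>) \<Omega>"
abbreviation "NI \<equiv> bochner_Linf_norm T"
abbreviation "N2 \<equiv> bochner_L2_norm T"
abbreviation "nL \<equiv> L2norm \<Omega>"

lemma sol: "time_cont T (H20 \<Omega>) (Hs_norm 2 \<Omega>) u" "time_deriv T (L2 \<Omega>) nL u ut" "time_cont T (L2 \<Omega>) nL ut" "weak_time_deriv \<Omega> T ut utt"
  "v \<in> H20 \<Omega> ==> AE t in lebT T. ip \<Omega> (utt t) v + hess_form \<Omega> (u t) v = ip \<Omega> (f t) v"
  "aeq \<Omega> (u 0) u0" "aeq \<Omega> (ut 0) v0" using ws by (auto simp: weak_solution_def)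

lemma mem: "t \<in> {0..T} ==> u t \<in> H20 \<Omega>" "t \<in> {0..T} ==> ut t \<in> L2 \<Omega>" "t \<in> {0..T} ==> u t \<in> L2 \<Omega>" "t \<in> {0..T} ==> f t \<in> L2 \<Omega>"
 using sol(1,2) fc by (auto simp: time_cont_def time_deriv_def)

lemma Linf: "u \<in> bochner_Linf T X N" "ut \<in> bochner_Linf T X N" "utt \<in> bochner_Linf T X N" "f \<in> bochner_Linf T (L2 \<Omega>) nL"
proof -
 obtain B where "\<forall>t\<in>{0..T}. nL (f t) <= B" using seminormed_fn.time_cont_bounded[OF seminormed_L2 fc] by blast
 hence "AE t in lebT T. nL (f t) <= B" by (auto simp: AE_time_iff)
 thus "f \<in> bochner_Linf T (L2 \<Omega>) nL" using fw by (auto simp: bochner_Linf_def weak_time_deriv_def bochner_L2_def)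
qed (use uX in auto)

lemma L2s: "f \<in> bochner_L2 T (L2 \<Omega>) nL" "ft \<in> bochner_L2 T (L2 \<Omega>) nL" "utt \<in> bochner_L2 T (L2 \<Omega>) nL" "uttt \<in> bochner_L2 T (L2 \<Omega>) nL"
 using fw uw by (auto simp: weak_time_deriv_def)

lemma utt_L2: "utt \<in> bochner_L2 T X N"
proof -
 interpret S: seminormed_fn X N by (rule seminormed_Hs[OF Omega(1,2)])
 have m: "strongly_measurable T X N utt" using Linf(3) by (simp add: bochner_Linf_def)
 have "integrable (lebT T) (%t. (N (utt t))^2)"
 proof (rule Bochner_Integration.integrable_bound[OF const_integrable_time[of T "(NI N utt)^2"]])
  show "(%t. (N (utt t))^2) \<in> borel_measurable (lebT T)" using S.strongly_measurable_norm[OF m] by simp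
  show "AE t in lebT T. norm ((N (utt t))^2) <= norm ((NI N utt)^2)" using Linf_norm_AE[OF Linf(3)] by eventually_elim (simp add: power_mono)
 qed
 thus ?thesis using m by (simp add: bochner_L2_def)
qed

lemma inc:
 assumes z: "z \<in> L2 \<Omega>" and ab: "0 <= a" "a <= b" "b <= T"
 shows "ip \<Omega> (u b) z - ip \<Omega> (u a) z = tint T (%t. ip \<Omega> (ut t) z) a b" "ip \<Omega> (ut b) z - ip \<Omega> (ut a) z = tint T (%t. ip \<Omega> (utt t) z) a b"
 using FTC_tint[OF time_deriv_ip[OF sol(2) order_refl z] time_cont_ip[OF sol(3) order_refl z] ab] weak_deriv_increment[OF T sol(2-4) z ab] by simp_all

lemma ut_increment:
 assumes ab: "0 <= a" "a <= b" "b <= T"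
 shows "fminus (ut b) (ut a) \<in> X" "N (fminus (ut b) (ut a)) <= tint T (%t. N (utt t)) a b" "N (fminus (ut b) (ut a)) <= (b - a) * NI N utt"
 by (rule Hs_increment[OF Omega(1,2) Linf(3) mem(2) inc(2) ab]; assumption)+

lemma reg: "t \<in> {0..T} ==> u t \<in> X" "t \<in> {0..T} ==> N (u t) <= NI N u" "t \<in> {0..T} ==> ut t \<in> X" "t \<in> {0..T} ==> N (ut t) <= NI N ut"
proof -
 note i = Hs_increment[OF Omega(1,2) Linf(2) mem(3) inc(1)]
 note e1 = Hs_everywhere[OF Omega(1,2) T Linf(1) _ Linf_norm_nonneg[OF Linf(2)]] and e2 = Hs_everywhere[OF Omega(1,2) T Linf(2) _ Linf_norm_nonneg[OF Linf(3)]]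
 show "t \<in> {0..T} ==> u t \<in> X" "t \<in> {0..T} ==> N (u t) <= NI N u" by (rule e1; use i(1,3) in blast)+
 show "t \<in> {0..T} ==> ut t \<in> X" "t \<in> {0..T} ==> N (ut t) <= NI N ut" by (rule e2; use ut_increment(1,3) in blast)+
qed

lemma ut_pairing: "z \<in> L2 \<Omega> ==> integrable (lebT T) (%t. ip \<Omega> (ut t) z)"
 using L2_pairing_integrable(1)[of ut T \<Omega> z] sol(4) by (auto simp: weak_time_deriv_def)

lemma u_Taylor:
 assumes ab: "0 <= a" "a <= c" "c <= b" "b <= T"
 shows "lincomb 1 (fminus (u b) (u a)) (a - b) (ut c) \<in> X" "N (lincomb 1 (fminus (u b) (u a)) (a - b) (ut c)) <= NI N utt * (b - a)^2"
 by (rule Hs_Taylor[OF Omega(1,2) Linf(2) mem(3) inc(1) reg(3) Linf_norm_nonneg[OF Linf(3)] ut_increment(3) ut_pairing ab]; assumption)+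

text \<open>Difference quotients of \<open>u\<close> converge to \<open>ut c\<close> in \<open>H\<^sup>2\<close>, so the clamped boundary conditions persist.\<close>

lemma ut_H20: assumes c: "c \<in> {0..T}" shows "ut c \<in> H20 \<Omega>"
proof (rule H20_closed[OF Omega(1,2)])
 have g2: "2 <= 2 + \<gamma>" using pos by simp
 show "ut c \<in> Hs 2 \<Omega>" by (rule Hs_mono[OF reg(3)[OF c] g2])
 fix e :: real assume e: "0 < e"
 define L where "L = NI N utt"
 have L: "0 <= L" unfolding L_def by (rule Linf_norm_nonneg[OF Linf(3)])
 \<comment> \<open>A window of length \<delta> inside the time interval that contains
   \<open>c\<close>, also when \<open>c\<close> is an endpoint. The bound with \<open>L + 1\<close>
   makes the Taylor error \<open>L \<delta>\<close> of the quotient smaller than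
   \<open>e\<close>.\<close>
 define \<delta> a b where "\<delta> = min T (e / (L + 1))" and "a = min c (T - \<delta>)" and "b = a + \<delta>"
 have \<delta>: "0 < \<delta>" "\<delta> <= T" "\<delta> <= e / (L + 1)" using T e L by (auto simp: \<delta>_def)
 hence \<delta>': "\<delta> * (L + 1) <= e" using L by (simp add: pos_le_divide_eq)
 have ab: "0 <= a" "a <= c" "c <= b" "b <= T" "b - a = \<delta>" using \<delta> c by (auto simp: a_def b_def)
 let ?W = "lincomb 1 (fminus (u b) (u a)) (a - b) (ut c)" and ?w = "lincomb (1 / \<delta>) (u b) (- 1 / \<delta>) (u a)"
 have w: "?w \<in> H20 \<Omega>" by (rule H20_lincomb[OF Omega(1,2)]) (use mem(1) ab in auto)
 have d: "a - b = - \<delta>" using ab(5) by simp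
 have "fminus (ut c) ?w = lincomb (- 1 / \<delta>) ?W 0 ?W" unfolding d using \<delta>(1) by (simp add: fun_eq_iff field_simps)
 hence "N (fminus (ut c) ?w) <= (1 / \<delta>) * N ?W" using Hs_norm_lincomb[OF Omega(1,2) u_Taylor(1)[OF ab(1-4)] u_Taylor(1)[OF ab(1-4)], of "- 1 / \<delta>" 0] \<delta>(1) by simp
 also have "... <= (1 / \<delta>) * (L * \<delta>\<^sup>2)" using u_Taylor(2)[OF ab(1-4)] \<delta>(1) unfolding ab(5) L_def by (intro mult_left_mono) auto
 also have "... < e" using \<delta>(1) \<delta>' by (simp add: power2_eq_square algebra_simps)
 finally have "Hs_norm 2 \<Omega> (fminus (ut c) ?w) < e" using Hs2_norm_le[OF g2, of \<Omega> "fminus (ut c) ?w"] by linarith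
 thus "\<exists>w\<in>H20 \<Omega>. Hs_norm 2 \<Omega> (fminus (ut c) w) < e" using w by blast
qed

lemma disc: "time_deriv T V nL uh uht" "time_deriv T V nL uht uhtt" "t \<in> {0..T} ==> v \<in> V ==> ip \<Omega> (uhtt t) v + ah (uh t) v = ip \<Omega> (f t) v"
  "aeq \<Omega> (uh 0) (R u0)" "aeq \<Omega> (uht 0) (R v0)" "t \<in> {0..T} ==> uh t \<in> V" "t \<in> {0..T} ==> uht t \<in> V" "t \<in> {0..T} ==> uhtt t \<in> V"
 using ss by (auto simp: semidiscrete_solution_def time_deriv_def)

text \<open>No continuity of \<open>uhtt\<close> is assumed, so its bound comes from the
  semidiscrete equation by duality within \<open>V\<close>; the other two functions are continuous
  in time.\<close>

lemma disc_bound: "\<exists>B\<ge>0. \<forall>t\<in>{0..T}. nL (uh t) <= B & nL (uht t) <= B & nL (uhtt t) <= B"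
proof -
 interpret S: seminormed_fn V nL by unfold_locales (auto simp: zero_V m.lincomb_mem m.nrm_lincomb L2norm_def m.nonneg)
 obtain B1 B2 Bf where B: "!!t. t \<in> {0..T} ==> nL (uh t) <= B1" "!!t. t \<in> {0..T} ==> nL (uht t) <= B2" "!!t. t \<in> {0..T} ==> nL (f t) <= Bf"
  using S.time_cont_bounded[OF S.time_deriv_cont[OF disc(1)]] S.time_cont_bounded[OF S.time_deriv_cont[OF disc(2)]] seminormed_fn.time_cont_bounded[OF seminormed_L2 fc] by metis
 let ?K = "Bf + sqrt \<Lambda> * B1 * sqrt \<Lambda>"
 have "nL (uhtt t) <= \<bar>?K\<bar>" if t: "t \<in> {0..T}" for t
 proof -
  have "ip \<Omega> (uhtt t) w <= ?K * sqrt (ip \<Omega> w w)" if w: "w \<in> V" for w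
  proof -
   have "ip \<Omega> (f t) w <= nL w * nL (f t)" using L2_Cauchy_Schwarz[OF mem(4)[OF t] V_L2[OF w]] by linarith
   also have "... <= nL w * Bf" using B(3)[OF t] by (intro mult_left_mono) auto
   finally have 1: "ip \<Omega> (f t) w <= nL w * Bf" .
   have "- ah (uh t) w <= sqrt (ah (uh t) (uh t)) * sqrt (ah w w)" using a.Cauchy_Schwarz[OF disc(6)[OF t] w] by linarith
   also have "... <= (sqrt \<Lambda> * B1) * (sqrt \<Lambda> * nL w)"
   proof (rule mult_mono)
    show "sqrt (ah (uh t) (uh t)) <= sqrt \<Lambda> * B1" by (rule order_trans[OF ah_le(2)[OF disc(6)[OF t]]]) (use B(1)[OF t] ah_le(1) in \<open>auto intro: mult_left_mono\<close>)
    thus "0 <= sqrt \<Lambda> * B1" using a.nrm_nonneg[OF disc(6)[OF t]] by linarith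
   qed (use ah_le(2)[OF w] a.nrm_nonneg[OF w] in auto)
   finally show ?thesis using 1 disc(3)[OF t w] by (simp add: m_norm algebra_simps)
  qed
  from m.bounded_by_test[OF disc(8)[OF t] this] show ?thesis by (auto simp: m_norm)
 qed
 hence "nL (uh t) <= \<bar>B1\<bar> + \<bar>B2\<bar> + \<bar>?K\<bar> & nL (uht t) <= \<bar>B1\<bar> + \<bar>B2\<bar> + \<bar>?K\<bar> & nL (uhtt t) <= \<bar>B1\<bar> + \<bar>B2\<bar> + \<bar>?K\<bar>" if "t \<in> {0..T}" for t
  using B(1,2)[OF that] that by (smt (verit))
 thus ?thesis by (intro exI[of _ "\<bar>B1\<bar> + \<bar>B2\<bar> + \<bar>?K\<bar>"]) simp
qed

definition B :: real where "B = (SOME B. 0 <= B & (\<forall>t\<in>{0..T}. nL (uh t) <= B & nL (uht t) <= B & nL (uhtt t) <= B))"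

lemma B: "0 <= B" "t \<in> {0..T} ==> nL (uh t) <= B" "t \<in> {0..T} ==> nL (uht t) <= B" "t \<in> {0..T} ==> nL (uhtt t) <= B"
 using someI_ex[OF disc_bound[unfolded Bex_def]] unfolding B_def[symmetric] by auto

text \<open>The remainder is paired with itself, which makes the functions of time scalar; the mean
  value theorem applied twice then exposes \<open>uhtt\<close> at an intermediate time.\<close>

lemma uh_Taylor: assumes st: "0 <= s" "s < t" "t <= T" shows "nL (lincomb 1 (fminus (uh t) (uh s)) (s - t) (uht t)) <= B * (t - s)^2"
proof -
 have tT: "t \<in> {0..T}" "s \<in> {0..T}" using st by auto
 let ?z = "lincomb 1 (fminus (uh t) (uh s)) (s - t) (uht t)"
 note d = m.fminus_mem[OF disc(6)[OF tT(1)] disc(6)[OF tT(2)]]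
 have z: "?z \<in> V" by (rule m.lincomb_mem[OF d disc(7)[OF tT(1)]])
 have VL: "V \<subseteq> L2 \<Omega>" using V_L2 by blast
 obtain \<xi> where \<xi>: "\<xi> \<in> {s<..<t}" "ip \<Omega> (uh t) ?z - ip \<Omega> (uh s) ?z = (t - s) * ip \<Omega> (uht \<xi>) ?z"
  using MVT_Icc[OF time_deriv_ip[OF disc(1) VL V_L2[OF z]] st] by blast
 obtain \<zeta> where \<zeta>: "\<zeta> \<in> {\<xi><..<t}" "ip \<Omega> (uht t) ?z - ip \<Omega> (uht \<xi>) ?z = (t - \<xi>) * ip \<Omega> (uhtt \<zeta>) ?z"
  using MVT_Icc[OF time_deriv_ip[OF disc(2) VL V_L2[OF z]], of \<xi> t] \<xi>(1) st by auto
 have e: "ip \<Omega> (uht \<xi>) ?z = ip \<Omega> (uht t) ?z - (t - \<xi>) * ip \<Omega> (uhtt \<zeta>) ?z" using \<zeta>(2) by simp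
 have \<zeta>T: "\<zeta> \<in> {0..T}" using \<zeta> \<xi> st by auto
 have "nL ?z * nL ?z = ip \<Omega> ?z ?z" using m.nonneg[OF z] by (simp add: L2norm_def)
 also have "... = (ip \<Omega> (uh t) ?z - ip \<Omega> (uh s) ?z) + (s - t) * ip \<Omega> (uht t) ?z"
  using m.lin[OF d disc(7)[OF tT(1)] z, of 1 "s - t"] m.diff_left[OF disc(6)[OF tT(1)] disc(6)[OF tT(2)] z] by simp
 also have "... = (t - s) * ((t - \<xi>) * - ip \<Omega> (uhtt \<zeta>) ?z)" unfolding \<xi>(2) e by (simp add: algebra_simps)
 also have "... <= (t - s) * ((t - s) * (nL ?z * B))"
 proof (rule mult_left_mono)
  have "- ip \<Omega> (uhtt \<zeta>) ?z <= nL ?z * nL (uhtt \<zeta>)" using L2_Cauchy_Schwarz[OF V_L2[OF disc(8)[OF \<zeta>T]] V_L2[OF z]] by linarith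
  also have "... <= nL ?z * B" using B(4)[OF \<zeta>T] by (intro mult_left_mono) auto
  finally have "(t - \<xi>) * - ip \<Omega> (uhtt \<zeta>) ?z <= (t - \<xi>) * (nL ?z * B)" using \<xi>(1) by (intro mult_left_mono) auto
  also have "... <= (t - s) * (nL ?z * B)" using \<xi>(1) B(1) by (intro mult_right_mono) auto
  finally show "(t - \<xi>) * - ip \<Omega> (uhtt \<zeta>) ?z <= (t - s) * (nL ?z * B)" .
 qed (use st in simp)
 also have "... = nL ?z * (B * (t - s)^2)" by (simp add: power2_eq_square mult_ac)
 finally show ?thesis using B(1) L2norm_nonneg[of \<Omega> ?z] by (cases "nL ?z = 0") (auto simp: mult_le_cancel_left_pos)
qed

lemma Taylor_Lipschitz:
 assumes "!!t. t \<in> {0..T} ==> p t \<in> V" "!!t. t \<in> {0..T} ==> q t \<in> V" and b: "!!t. t \<in> {0..T} ==> nL (q t) <= K" and K: "0 <= K" "0 <= L"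
  and ty: "!!s t. 0 <= s ==> s < t ==> t <= T ==> nL (lincomb 1 (fminus (p t) (p s)) (s - t) (q t)) <= L * (t - s)^2"
  and st: "0 <= s" "s < t" "t <= T"
 shows "nL (fminus (p t) (p s)) <= (L * T + K) * (t - s)"
proof -
 let ?w = "lincomb 1 (fminus (p t) (p s)) (s - t) (q t)"
 have tT: "t \<in> {0..T}" "s \<in> {0..T}" using st by auto
 have w: "?w \<in> V" "q t \<in> V" using assms(1)[OF tT(1)] assms(1)[OF tT(2)] assms(2)[OF tT(1)] by (auto intro!: m.lincomb_mem m.fminus_mem)
 have "fminus (p t) (p s) = lincomb 1 ?w (t - s) (q t)" by (simp add: fun_eq_iff algebra_simps)
 hence "nL (fminus (p t) (p s)) <= nL ?w + (t - s) * nL (q t)" using m.nrm_lincomb[OF w, of 1 "t - s"] st by (simp add: m_norm)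
 also have "... <= L * (t - s)^2 + (t - s) * K" using ty[OF st] b[OF tT(1)] st by (intro add_mono mult_left_mono) auto
 also have "L * (t - s)^2 <= L * (T * (t - s))" unfolding power2_eq_square using st K by (intro mult_left_mono mult_right_mono) auto
 finally show ?thesis by (simp add: algebra_simps)
qed

section \<open>Discrete error, its equation and its load\<close>

definition \<theta> :: "real => fn" where "\<theta> t = fminus (R (u t)) (uh t)"
definition \<eta> :: "real => fn" where "\<eta> t = fminus (R (ut t)) (uht t)"
text \<open>Norm of the Ritz projection from \<open>X\<close> to \<open>L\<^sup>2\<close>, read off
  from the Ritz estimate and the triangle inequality.\<close>

definition c\<^sub>R :: real where "c\<^sub>R = 1 + C2 * h powr (2 * \<gamma>)"

lemma RV: "t \<in> {0..T} ==> R (u t) \<in> V" "t \<in> {0..T} ==> R (ut t) \<in> V" "t \<in> {0..T} ==> \<theta> t \<in> V" "t \<in> {0..T} ==> \<eta> t \<in> V"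
 unfolding \<theta>_def \<eta>_def by (auto intro!: m.fminus_mem R_V mem ut_H20 disc)

lemma cR: "1 <= c\<^sub>R" using pos by (simp add: c\<^sub>R_def)

lemma bounds: "t \<in> {0..T} ==> nL (\<theta> t) <= c\<^sub>R * NI N u + B" "t \<in> {0..T} ==> nL (\<eta> t) <= c\<^sub>R * NI N ut + B"
proof -
 assume t: "t \<in> {0..T}"
 have fm: "nL (fminus v w) <= nL v + nL w" if "v \<in> V" "w \<in> V" for v w
  unfolding fminus_eq_lincomb using m.nrm_lincomb[OF that, of 1 "-1"] by (simp add: m_norm)
 have "nL (R (u t)) <= c\<^sub>R * NI N u"
  by (rule order_trans[OF ritz(3)[OF mem(1)[OF t] reg(1)[OF t], folded c\<^sub>R_def] mult_left_mono[OF reg(2)[OF t]]]) (use cR in simp)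
 thus "nL (\<theta> t) <= c\<^sub>R * NI N u + B" unfolding \<theta>_def using fm[OF RV(1)[OF t] disc(6)[OF t]] B(2)[OF t] by linarith
 have "nL (R (ut t)) <= c\<^sub>R * NI N ut"
  by (rule order_trans[OF ritz(3)[OF ut_H20[OF t] reg(3)[OF t], folded c\<^sub>R_def] mult_left_mono[OF reg(4)[OF t]]]) (use cR in simp)
 thus "nL (\<eta> t) <= c\<^sub>R * NI N ut + B" unfolding \<eta>_def using fm[OF RV(2)[OF t] disc(7)[OF t]] B(3)[OF t] by linarith
qed

definition L :: real where "L = c\<^sub>R * NI N utt + B"

text \<open>The Ritz projection is linear up to null functions, so it maps the Taylor remainder of
  \<open>u\<close> to that of \<open>R (u t)\<close>. The remainder of \<open>u\<close> is small in
  \<open>X\<close>, where \<open>R\<close> is bounded into \<open>L\<^sup>2\<close>.\<close>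

lemma \<theta>_Taylor: assumes st: "0 <= s" "s < t" "t <= T" shows "nL (lincomb 1 (fminus (\<theta> t) (\<theta> s)) (s - t) (\<eta> t)) <= L * (t - s)^2"
proof -
 have tT: "t \<in> {0..T}" "s \<in> {0..T}" using st by auto
 let ?W = "lincomb 1 (fminus (u t) (u s)) (s - t) (ut t)" and ?D = "lincomb 1 (fminus (R (u t)) (R (u s))) (s - t) (R (ut t))"
  and ?E = "lincomb 1 (fminus (uh t) (uh s)) (s - t) (uht t)"
 note du = H20_lincomb[OF Omega(1,2) mem(1)[OF tT(1)] mem(1)[OF tT(2)], of 1 "-1", folded fminus_eq_lincomb]
 have W: "?W \<in> H20 \<Omega>" by (rule H20_lincomb[OF Omega(1,2) du ut_H20[OF tT(1)]])
 have W': "?W \<in> X" "N ?W <= NI N utt * (t - s)^2" using u_Taylor[of s t t] st by auto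
 note dR = m.fminus_mem[OF RV(1)[OF tT(1)] RV(1)[OF tT(2)]]
 have D: "?D \<in> V" by (rule m.lincomb_mem[OF dR RV(2)[OF tT(1)]])
 have E: "?E \<in> V" by (intro m.lincomb_mem m.fminus_mem disc tT)
 have "nL (fminus ?D (R ?W)) = 0"
 proof (rule R_unique[OF D W])
  fix v assume v: "v \<in> V"
  note q = H20_Hs[OF QH[OF v]]
  have "hess_form \<Omega> (fminus (u t) (u s)) (Q v) = hess_form \<Omega> (u t) (Q v) - hess_form \<Omega> (u s) (Q v)"
   unfolding fminus_eq_lincomb hess_form_lincomb[OF Omega(1,2) H20_Hs[OF mem(1)[OF tT(1)]] H20_Hs[OF mem(1)[OF tT(2)]] q] by simp
  thus "ah ?D v = hess_form \<Omega> ?W (Q v)" using a.lin[OF dR RV(2)[OF tT(1)] v, of 1 "s - t"] a.diff_left[OF RV(1)[OF tT(1)] RV(1)[OF tT(2)] v]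
    R_eq[OF mem(1)[OF tT(1)] v] R_eq[OF mem(1)[OF tT(2)] v] R_eq[OF ut_H20[OF tT(1)] v]
    hess_form_lincomb[OF Omega(1,2) H20_Hs[OF du] H20_Hs[OF ut_H20[OF tT(1)]] q, of 1 "s - t"] by simp
 qed
 hence "nL ?D <= nL (R ?W)" using m.nrm_le_add[OF D R_V[OF W]] by (simp add: m_norm)
 also have "... <= c\<^sub>R * (NI N utt * (t - s)^2)" by (rule order_trans[OF ritz(3)[OF W W'(1), folded c\<^sub>R_def] mult_left_mono[OF W'(2)]]) (use cR in simp)
 finally have "nL ?D + nL ?E <= L * (t - s)^2" using uh_Taylor[OF st] by (simp add: L_def distrib_right)
 moreover have "lincomb 1 (fminus (\<theta> t) (\<theta> s)) (s - t) (\<eta> t) = lincomb 1 ?D (-1) ?E" by (simp add: fun_eq_iff \<theta>_def \<eta>_def algebra_simps)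
 ultimately show ?thesis using m.nrm_lincomb[OF D E, of 1 "-1"] by (simp add: m_norm)
qed

lemma L_nonneg: "0 <= L" unfolding L_def using cR B(1) Linf_norm_nonneg[OF Linf(3)] by simp

definition K\<^sub>\<theta> :: real where "K\<^sub>\<theta> = L * T + (c\<^sub>R * NI N ut + B)"

lemma Lipschitz:
 assumes v: "v \<in> V" and st: "0 <= s" "s <= t" "t <= T"
 shows "\<bar>ah (\<theta> t) v - ah (\<theta> s) v\<bar> <= sqrt \<Lambda> * \<bar>K\<^sub>\<theta>\<bar> * (t - s) * sqrt (ah v v)" "\<bar>ah (uh t) v - ah (uh s) v\<bar> <= sqrt \<Lambda> * \<bar>B * T + B\<bar> * (t - s) * sqrt (ah v v)"
proof -
 have k: "0 <= c\<^sub>R * NI N ut + B" using cR B(1) Linf_norm_nonneg[OF Linf(2)] by simp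
 show "\<bar>ah (\<theta> t) v - ah (\<theta> s) v\<bar> <= sqrt \<Lambda> * \<bar>K\<^sub>\<theta>\<bar> * (t - s) * sqrt (ah v v)"
  by (rule ah_time_Lipschitz[OF RV(3) Taylor_Lipschitz[OF RV(3) RV(4) bounds(2) k L_nonneg \<theta>_Taylor, folded K\<^sub>\<theta>_def] v st])
 show "\<bar>ah (uh t) v - ah (uh s) v\<bar> <= sqrt \<Lambda> * \<bar>B * T + B\<bar> * (t - s) * sqrt (ah v v)"
  by (rule ah_time_Lipschitz[OF disc(6) Taylor_Lipschitz[OF disc(6) disc(7) B(3) B(1) B(1) uh_Taylor] v st])
qed

lemma Lipschitz_continuous:
 assumes "!!s t. 0 <= s ==> s <= t ==> t <= T ==> \<bar>p t - p s\<bar> <= K * (t - s) * M" "0 <= K" "0 <= M"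
 shows "continuous_on {0..T} (p :: real => real)"
proof (rule lipschitz_on_continuous_on[of "K * M"], rule lipschitz_onI)
 fix s t assume "s \<in> {0..T}" "t \<in> {0..T}"
 thus "dist (p s) (p t) <= K * M * dist s t" using assms(1)[of s t] assms(1)[of t s] by (cases "s <= t") (auto simp: dist_real_def abs_minus_commute mult_ac)
qed (use assms in simp)

lemma ah_continuous: assumes v: "v \<in> V" shows "continuous_on {0..T} (%t. ah (\<theta> t) v)" "continuous_on {0..T} (%t. ah (uh t) v)"
 using Lipschitz_continuous[OF Lipschitz(1)[OF v]] Lipschitz_continuous[OF Lipschitz(2)[OF v]] ah_le(1) a.nonneg[OF v] by simp_all

text \<open>The error equation integrated in time. The continuous equation holds only for almost
  every time, with an exceptional set that may depend on the test function, so the load is recovered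
  later as the derivative of \<open>H v\<close>.\<close>

definition H :: "fn => real => real" where "H v t = ip \<Omega> (ut t) v - ip \<Omega> (uht t) v + tint T (%\<tau>. ah (\<theta> \<tau>) v) 0 t"

lemma ah_\<theta>_integrable: "v \<in> V ==> integrable (lebT T) (%t. ah (\<theta> t) v)" using tint_continuous(2)[OF ah_continuous(1), of v 0 0] T by simp

text \<open>The continuous equation is tested with \<open>Q v\<close>, the semidiscrete one with
  \<open>v\<close>. By the definition of \<open>R\<close> the two stiffness terms differ exactly by
  \<theta>, and the remaining data act on \<open>Q v - v\<close>.\<close>

lemma H_increment:
 assumes v: "v \<in> V" and ab: "0 <= a" "a <= b" "b <= T"
 shows "H v b - H v a = tint T (%t. ip \<Omega> (f t) (fminus (Q v) v) - ip \<Omega> (utt t) (fminus (Q v) v)) a b"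
proof -
 let ?M = "lebT T"
 have vL: "v \<in> L2 \<Omega>" by (rule V_L2[OF v])
 have qL: "Q v \<in> L2 \<Omega>" by (rule Hs_L2[OF H20_Hs[OF QH[OF v]]])
 let ?z = "fminus (Q v) v"
 have zL: "?z \<in> L2 \<Omega>" by (rule L2.fminus_mem[OF qL vL])
 have "continuous_on {0..T} (%t. ip \<Omega> (f t) v - ah (uh t) v)" by (intro continuous_intros ah_continuous(2)[OF v] time_cont_ip[OF fc order_refl vL])
 hence c: "continuous_on {0..T} (%t. ip \<Omega> (uhtt t) v)" by (rule continuous_on_eq) (use disc(3)[OF _ v] in \<open>auto simp: algebra_simps\<close>)
 have VL: "V \<subseteq> L2 \<Omega>" using V_L2 by blast
 have d: "ip \<Omega> (uht b) v - ip \<Omega> (uht a) v = tint T (%t. ip \<Omega> (uhtt t) v) a b" by (rule FTC_tint[OF time_deriv_ip[OF disc(2) VL vL] c ab])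
 note i = L2_pairing_integrable(1)[OF L2s(3) vL] tint_continuous(2)[OF c ab] ah_\<theta>_integrable[OF v]
  and j = L2_pairing_integrable(1)[OF L2s(1) zL] L2_pairing_integrable(1)[OF L2s(3) zL]
 have "H v b - H v a = tint T (%t. ip \<Omega> (utt t) v) a b - tint T (%t. ip \<Omega> (uhtt t) v) a b + tint T (%\<tau>. ah (\<theta> \<tau>) v) a b"
  using inc(2)[OF vL ab] d tint_add[OF i(3), of 0 a b] ab by (simp add: H_def)
 also have "... = tint T (%t. ip \<Omega> (utt t) v - ip \<Omega> (uhtt t) v + ah (\<theta> t) v) a b" using i by (simp add: tint_lin)
 also have "... = tint T (%t. ip \<Omega> (f t) ?z - ip \<Omega> (utt t) ?z) a b"
 proof (rule tint_cong_AE)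
  have tI: "AE t in ?M. t \<in> {0<..<T}" using AE_space[of ?M] by simp
  have "AE t in ?M. utt t \<in> L2 \<Omega>" using L2s(3) by (simp add: bochner_L2_def strongly_measurable_def)
  with sol(5)[OF QH[OF v]] tI show "AE t in ?M. ip \<Omega> (utt t) v - ip \<Omega> (uhtt t) v + ah (\<theta> t) v = ip \<Omega> (f t) ?z - ip \<Omega> (utt t) ?z"
  proof eventually_elim
   case (elim t)
   have t: "t \<in> {0..T}" using elim(2) by simp
   have "ah (\<theta> t) v = hess_form \<Omega> (u t) (Q v) - ah (uh t) v" unfolding \<theta>_def a.diff_left[OF RV(1)[OF t] disc(6)[OF t] v] R_eq[OF mem(1)[OF t] v] ..
   thus ?case using elim(1) disc(3)[OF t v] L2.diff_right[OF qL vL mem(4)[OF t]] L2.diff_right[OF qL vL elim(3)] by linarith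
  qed
 qed (use i j in auto)
 finally show ?thesis .
qed

definition c\<^sub>Q :: real where "c\<^sub>Q = C1 * h powr 2 / sqrt \<alpha>"

lemma z_bound: "v \<in> V ==> nL (fminus (Q v) v) <= c\<^sub>Q * sqrt (ah v v)"
 using order_trans[OF smoother_L2 mult_left_mono[OF hnorm_le_ah]] pos by (simp add: c\<^sub>Q_def)

text \<open>The three quantities fed into \<open>energy_estimate\<close>: a bound of the load, a
  bound of its variation up to time \<open>t\<close>, and the accumulated Ritz error of
  \<open>utt\<close>, each relative to the norm in which it is tested.\<close>

definition g\<^sub>0 :: real where "g\<^sub>0 = c\<^sub>Q * (NI nL f + NI nL utt)"
definition \<kappa> :: "real => real" where "\<kappa> t = c\<^sub>Q * tint T (%t. nL (ft t) + nL (uttt t)) 0 t"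
definition \<rho> :: "real => real" where "\<rho> t = C2 * h powr (2 * \<gamma>) * tint T (%t. N (utt t)) 0 t"

lemma cQ: "0 <= c\<^sub>Q" using pos by (simp add: c\<^sub>Q_def)

lemma loads_integrable: "integrable (lebT T) (%t. nL (ft t) + nL (uttt t))" "integrable (lebT T) (%t. N (utt t))"
 using seminormed_fn.L2_norm_integrable[OF seminormed_L2 L2s(2)] seminormed_fn.L2_norm_integrable[OF seminormed_L2 L2s(4)]
  seminormed_fn.L2_norm_integrable[OF seminormed_Hs[OF Omega(1,2)] utt_L2] by auto

text \<open>The load \<open>f - utt\<close>, paired with \<open>Q v - v\<close>, has the weak
  derivative \<open>ft - uttt\<close>. Hence its antiderivative \<open>H v\<close> is differentiable
  at every time, and the derivative is a representative of the load with controlled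
  variation.\<close>

lemma load_derivative:
 assumes v: "v \<in> V"
 shows "\<exists>G. (\<forall>t\<in>{0..T}. (H v has_real_derivative G t) (at t within {0..T}) & \<bar>G t\<bar> <= g\<^sub>0 * sqrt (ah v v)) &
  (\<forall>s t. 0 <= s --> s <= t --> t <= T --> \<bar>G t - G s\<bar> <= (\<kappa> t - \<kappa> s) * sqrt (ah v v))"
proof -
 let ?M = "lebT T" and ?z = "fminus (Q v) v"
 have zL: "?z \<in> L2 \<Omega>" by (rule L2.fminus_mem[OF Hs_L2[OF H20_Hs[OF QH[OF v]]] V_L2[OF v]])
 interpret W: weak_1D T "%t. ip \<Omega> (f t) ?z - ip \<Omega> (utt t) ?z" "%t. ip \<Omega> (ft t) ?z - ip \<Omega> (uttt t) ?z"
  by (rule weak_1D_diff[OF weak_time_deriv_1D[OF fw zL] weak_time_deriv_1D[OF uw zL]])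
 obtain G where G: "!!t. t \<in> {0..T} ==> (H v has_real_derivative G t) (at t within {0..T})"
  "!!s t. s <= t ==> G t - G s = tint T (%t. ip \<Omega> (ft t) ?z - ip \<Omega> (uttt t) ?z) s t"
  using W.antiderivative_C1_closed[OF T H_increment[OF v]] by blast
 have "\<bar>G t\<bar> <= nL ?z * (NI nL f + NI nL utt)" if t: "t \<in> {0..T}" for t
 proof (rule derivative_bound_Icc[OF G(1)[OF t] t T])
  fix a b assume ab: "0 <= a" "a <= b" "b <= T"
  have "\<bar>tint T (%t. ip \<Omega> (f t) ?z - ip \<Omega> (utt t) ?z) a b\<bar> <= tint T (%_. nL ?z * (NI nL f + NI nL utt)) a b"
  proof (rule tint_abs_le[OF W.gi const_integrable_time])
   show "AE t in ?M. \<bar>ip \<Omega> (f t) ?z - ip \<Omega> (utt t) ?z\<bar> <= nL ?z * (NI nL f + NI nL utt)"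
    using L2_pairing_integrable(2)[OF L2s(1) zL] L2_pairing_integrable(2)[OF L2s(3) zL] Linf_norm_AE[OF Linf(4)] Linf_norm_AE[OF uL]
   proof eventually_elim
    case (elim t)
    have "nL ?z * nL (f t) + nL ?z * nL (utt t) <= nL ?z * (NI nL f + NI nL utt)" unfolding distrib_left using elim(3,4) by (intro add_mono mult_left_mono) auto
    thus ?case using elim(1,2) by linarith
   qed
  qed
  thus "\<bar>H v b - H v a\<bar> <= (b - a) * (nL ?z * (NI nL f + NI nL utt))" using H_increment[OF v ab] tint_const[OF ab] by simp
 qed
 moreover have "nL ?z * (NI nL f + NI nL utt) <= g\<^sub>0 * sqrt (ah v v)"
  using mult_right_mono[OF z_bound[OF v], of "NI nL f + NI nL utt"] Linf_norm_nonneg[OF Linf(4)] Linf_norm_nonneg[OF uL] by (simp add: g\<^sub>0_def mult_ac)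
 moreover have "\<bar>G t - G s\<bar> <= (\<kappa> t - \<kappa> s) * sqrt (ah v v)" if st: "0 <= s" "s <= t" "t <= T" for s t
 proof -
  let ?J = "tint T (%t. nL (ft t) + nL (uttt t)) s t"
  have "\<bar>G t - G s\<bar> <= tint T (%t. nL ?z * (nL (ft t) + nL (uttt t))) s t" unfolding G(2)[OF st(2)]
  proof (rule tint_abs_le[OF W.ki])
   show "AE t in ?M. \<bar>ip \<Omega> (ft t) ?z - ip \<Omega> (uttt t) ?z\<bar> <= nL ?z * (nL (ft t) + nL (uttt t))"
    using L2_pairing_integrable(2)[OF L2s(2) zL] L2_pairing_integrable(2)[OF L2s(4) zL] by eventually_elim (simp add: distrib_left)
  qed (use loads_integrable in simp)
  also have "... = nL ?z * ?J" by (rule tint_lin(3)[OF loads_integrable(1) loads_integrable(1)])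
  also have "... <= (c\<^sub>Q * sqrt (ah v v)) * ?J"
  proof (rule mult_right_mono[OF z_bound[OF v]])
   show "0 <= ?J" unfolding tint_def by (intro integral_nonneg_AE AE_I2) simp
  qed
  also have "... = (\<kappa> t - \<kappa> s) * sqrt (ah v v)" using tint_add[OF loads_integrable(1) st(1,2)] by (simp add: \<kappa>_def algebra_simps)
  finally show ?thesis .
 qed
 ultimately show ?thesis using G(1) by (intro exI[of _ G]) (meson order_trans)
qed

lemma H_lincomb: assumes v: "v \<in> V" and w: "w \<in> V" and t: "t \<in> {0..T}" shows "H (lincomb c v d w) t = c * H v t + d * H w t"
proof -
 have "tint T (%\<tau>. ah (\<theta> \<tau>) (lincomb c v d w)) 0 t = tint T (%\<tau>. c * ah (\<theta> \<tau>) v + d * ah (\<theta> \<tau>) w) 0 t"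
  unfolding tint_def by (intro Bochner_Integration.integral_cong refl) (use a.lin_right[OF v w RV(3)] in simp)
 also have "... = c * tint T (%\<tau>. ah (\<theta> \<tau>) v) 0 t + d * tint T (%\<tau>. ah (\<theta> \<tau>) w) 0 t"
  using ah_\<theta>_integrable[OF v] ah_\<theta>_integrable[OF w] by (simp add: tint_lin)
 finally show ?thesis unfolding H_def using L2.lin_right[OF V_L2[OF v] V_L2[OF w] mem(2)[OF t]] m.lin_right[OF v w disc(7)[OF t]] by (simp add: algebra_simps)
qed

text \<open>Plays the part of the integral of \<open>(R utt - utt, v)\<close> from \<open>s\<close>
  to \<open>t\<close>: the Ritz estimate is applied to the increment of \<open>ut\<close>, whose
  norm is bounded by the integral of the norm of \<open>utt\<close>.\<close>

lemma P_increment: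
 assumes st: "0 <= s" "s <= t" "t <= T" and v: "v \<in> V"
 shows "ip \<Omega> (fminus (R (ut t)) (R (ut s))) v - (ip \<Omega> (ut t) v - ip \<Omega> (ut s) v) <= (\<rho> t - \<rho> s) * nL v"
proof -
 have tT: "t \<in> {0..T}" "s \<in> {0..T}" using st by auto
 let ?d = "fminus (ut t) (ut s)" and ?r = "fminus (R (ut t)) (R (ut s))"
 have d: "?d \<in> H20 \<Omega>" unfolding fminus_eq_lincomb by (rule H20_lincomb[OF Omega(1,2) ut_H20[OF tT(1)] ut_H20[OF tT(2)]])
 have dL: "?d \<in> L2 \<Omega>" by (rule L2.fminus_mem[OF mem(2)[OF tT(1)] mem(2)[OF tT(2)]])
 have rV: "?r \<in> V" by (rule m.fminus_mem[OF RV(2)[OF tT(1)] RV(2)[OF tT(2)]])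
 have "nL (fminus ?r (R ?d)) = 0" using R_lincomb[OF ut_H20[OF tT(1)] ut_H20[OF tT(2)], of 1 "-1"] by (simp only: fminus_eq_lincomb)
 hence "nL (fminus ?r ?d) <= nL (fminus (R ?d) ?d)" using L2.nrm_triangle[OF V_L2[OF rV] V_L2[OF R_V[OF d]] dL] by (simp add: m_norm)
 also have "... = nL (fminus ?d (R ?d))" using L2.nrm_commute[OF V_L2[OF R_V[OF d]] dL] by (simp add: m_norm)
 also have "... <= C2 * h powr (2 * \<gamma>) * N ?d" by (rule ritz(1)[OF d ut_increment(1)[OF st]])
 also have "... <= C2 * h powr (2 * \<gamma>) * tint T (%t. N (utt t)) s t" using ut_increment(2)[OF st] pos by (intro mult_left_mono) auto
 also have "... = \<rho> t - \<rho> s" using tint_add[OF loads_integrable(2) st(1,2)] by (simp add: \<rho>_def algebra_simps)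
 finally have "nL v * nL (fminus ?r ?d) <= nL v * (\<rho> t - \<rho> s)" by (rule mult_left_mono) simp
 thus ?thesis using L2_Cauchy_Schwarz[OF L2.fminus_mem[OF V_L2[OF rV] dL] V_L2[OF v]] L2.diff_left[OF V_L2[OF rV] dL V_L2[OF v]]
   L2.diff_left[OF mem(2)[OF tT(1)] mem(2)[OF tT(2)] V_L2[OF v]] by (simp add: mult.commute)
qed

text \<open>The initial conditions hold almost everywhere on both sides, and \<open>R\<close>
  respects this only up to null functions; so the initial errors have norm zero without being
  zero.\<close>

lemma initial: "nL (\<theta> 0) = 0" "nL (\<eta> 0) = 0"
proof -
 have 0: "0 \<in> {0..T}" using T by simp
 have *: "nL (fminus (R w) p) = 0" if w: "w \<in> H20 \<Omega>" and ae: "aeq \<Omega> w w'" and p: "p \<in> V" "aeq \<Omega> p (R w')" for w w' p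
 proof -
  note w' = H20_cong[OF ae w Omega(1)]
  have "nL (fminus (R w) (R w')) = 0" by (rule R_unique[OF R_V[OF w] w']) (simp add: R_eq[OF w] hess_form_cong[OF ae Omega(1)])
  moreover have "nL (fminus p (R w')) = 0" using aeq_iff_L2norm[OF V_L2[OF p(1)] V_L2[OF R_V[OF w']]] p(2) by simp
  ultimately show ?thesis using L2.nrm_triangle[OF V_L2[OF R_V[OF w]] V_L2[OF R_V[OF w']] V_L2[OF p(1)]] L2.nrm_commute[OF V_L2[OF R_V[OF w']] V_L2[OF p(1)]]
    L2norm_nonneg[of \<Omega> "fminus (R w) p"] unfolding m_norm by linarith
 qed
 show "nL (\<theta> 0) = 0" unfolding \<theta>_def by (rule *[OF mem(1)[OF 0] sol(6) disc(6)[OF 0] disc(4)])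
 show "nL (\<eta> 0) = 0" unfolding \<eta>_def by (rule *[OF ut_H20[OF 0] sol(7) disc(7)[OF 0] disc(5)])
qed

lemma discrete_error:
 assumes t: "t \<in> {0..T}"
 shows "sqrt (ip \<Omega> (\<eta> t) (\<eta> t) + ah (\<theta> t) (\<theta> t)) <= 2 * (g\<^sub>0 + \<rho> T + \<kappa> T)"
proof -
 have "\<forall>v\<in>V. \<exists>G. (\<forall>t\<in>{0..T}. (H v has_real_derivative G t) (at t within {0..T}) & \<bar>G t\<bar> <= g\<^sub>0 * sqrt (ah v v)) &
  (\<forall>s t. 0 <= s --> s <= t --> t <= T --> \<bar>G t - G s\<bar> <= (\<kappa> t - \<kappa> s) * sqrt (ah v v))" using load_derivative by blast
 \<comment> \<open>The derivatives are chosen separately for each \<open>v\<close>; linearity in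
   \<open>v\<close> is recovered below from uniqueness of derivatives.\<close>
 from bchoice[OF this] obtain F where F: "!!v t. v \<in> V ==> t \<in> {0..T} ==> (H v has_real_derivative F v t) (at t within {0..T})"
  "!!v t. v \<in> V ==> t \<in> {0..T} ==> \<bar>F v t\<bar> <= g\<^sub>0 * sqrt (ah v v)"
  "!!v s t. v \<in> V ==> 0 <= s ==> s <= t ==> t <= T ==> \<bar>F v t - F v s\<bar> <= (\<kappa> t - \<kappa> s) * sqrt (ah v v)" by blast
 \<comment> \<open>One constant for two purposes: the Taylor remainder of \<theta> measured by
   \<open>ah\<close>, and the Lipschitz constant of \<theta> used to freeze it at the right
   endpoint.\<close>
 define M where "M = sqrt \<Lambda> * L + sqrt \<Lambda> * \<bar>K\<^sub>\<theta>\<bar>"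
 define B' where "B' = (sqrt \<Lambda> + 1) * (c\<^sub>R * NI N u + B) + (sqrt \<Lambda> + 1) * (c\<^sub>R * NI N ut + B)"
 note \<Lambda>0 = real_sqrt_ge_zero[OF ah_le(1)]
 have M0: "0 <= sqrt \<Lambda> * L" "0 <= sqrt \<Lambda> * \<bar>K\<^sub>\<theta>\<bar>" using \<Lambda>0 L_nonneg by auto
 show ?thesis
 proof (rule energy_estimate[OF semi_ip_V semi_ip_ah T RV(4) RV(3), where G = "%t v. F v t" and L = M and B = B' and \<kappa> = \<kappa> and \<rho> = \<rho> and g = g\<^sub>0])
  show "F (lincomb c v d w) t = c * F v t + d * F w t" if t: "t \<in> {0..T}" and v: "v \<in> V" and w: "w \<in> V" for t v w c d
  proof (rule derivative_unique_Icc[OF F(1)[OF m.lincomb_mem[OF v w] t] _ t T])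
   have "((%s. c * H v s + d * H w s) has_real_derivative c * F v t + d * F w t) (at t within {0..T})" by (intro DERIV_add DERIV_cmult F v w t)
   thus "(H (lincomb c v d w) has_real_derivative c * F v t + d * F w t) (at t within {0..T})"
    by (rule has_field_derivative_transform_within[OF _ zero_less_one t]) (simp add: H_lincomb[OF v w])
  qed
  show "\<exists>\<xi>\<in>{s..t}. ip \<Omega> (fminus (\<eta> t) (\<eta> s)) v <= (\<rho> t - \<rho> s) * sqrt (ip \<Omega> v v) + (t - s) * (F v \<xi> - ah (\<theta> t) v + M * (t - s) * sqrt (ah v v))"
   if st: "0 <= s" "s < t" "t <= T" and v: "v \<in> V" for s t v
  proof -
   have tT: "t \<in> {0..T}" "s \<in> {0..T}" using st by auto
   \<comment> \<open>Replaces the average load over the step by its value at one time, as the energy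
     lemma expects.\<close>
   obtain \<xi> where \<xi>: "\<xi> \<in> {s<..<t}" "H v t - H v s = (t - s) * F v \<xi>" using MVT_Icc[OF F(1)[OF v] st] by blast
   have "tint T (%\<tau>. -1 * ah (\<theta> \<tau>) v) s t <= (t - s) * (- ah (\<theta> t) v + M * (t - s) * sqrt (ah v v))"
   proof (rule tint_le_const)
    show "AE \<tau> in lebT T. \<tau> \<in> {s<..t} --> -1 * ah (\<theta> \<tau>) v <= - ah (\<theta> t) v + M * (t - s) * sqrt (ah v v)"
    proof (intro AE_I2 impI)
     fix \<tau> assume \<tau>: "\<tau> \<in> {s<..t}"
     have "sqrt \<Lambda> * \<bar>K\<^sub>\<theta>\<bar> * (t - \<tau>) * sqrt (ah v v) <= M * (t - s) * sqrt (ah v v)"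
      using \<tau> M0 a.nrm_nonneg[OF v] by (intro mult_right_mono mult_mono) (auto simp: M_def)
     thus "-1 * ah (\<theta> \<tau>) v <= - ah (\<theta> t) v + M * (t - s) * sqrt (ah v v)" using Lipschitz(1)[OF v, of \<tau> t] \<tau> st by auto
    qed
   qed (use ah_\<theta>_integrable[OF v] st in auto)
   hence "- tint T (%\<tau>. ah (\<theta> \<tau>) v) s t <= (t - s) * (- ah (\<theta> t) v + M * (t - s) * sqrt (ah v v))"
    using tint_lin(3)[OF ah_\<theta>_integrable[OF v] ah_\<theta>_integrable[OF v], of "-1"] by simp
   \<comment> \<open>Adding and subtracting the increment of \<open>ut\<close> separates the Ritz
     residual from the increment of \<open>H v\<close>.\<close>
   moreover have "ip \<Omega> (fminus (\<eta> t) (\<eta> s)) v = (ip \<Omega> (fminus (R (ut t)) (R (ut s))) v - (ip \<Omega> (ut t) v - ip \<Omega> (ut s) v)) + (H v t - H v s) - tint T (%\<tau>. ah (\<theta> \<tau>) v) s t"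
    using m.diff_left[OF RV(4)[OF tT(1)] RV(4)[OF tT(2)] v] m.diff_left[OF RV(2)[OF tT(1)] RV(2)[OF tT(2)] v]
     m.diff_left[OF RV(2)[OF tT(1)] disc(7)[OF tT(1)] v] m.diff_left[OF RV(2)[OF tT(2)] disc(7)[OF tT(2)] v]
     tint_add[OF ah_\<theta>_integrable[OF v], of 0 s t] st unfolding H_def \<eta>_def by simp
   moreover have "(t - s) * (F v \<xi> - ah (\<theta> t) v + M * (t - s) * sqrt (ah v v)) = (t - s) * F v \<xi> + (t - s) * (- ah (\<theta> t) v + M * (t - s) * sqrt (ah v v))"
    by (simp add: algebra_simps)
   ultimately have "ip \<Omega> (fminus (\<eta> t) (\<eta> s)) v <= (\<rho> t - \<rho> s) * sqrt (ip \<Omega> v v) + (t - s) * (F v \<xi> - ah (\<theta> t) v + M * (t - s) * sqrt (ah v v))"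
    using P_increment[OF st(1) less_imp_le[OF st(2)] st(3) v] \<xi>(2) unfolding m_norm by linarith
   thus ?thesis using \<xi>(1) by (intro bexI[of _ \<xi>]) auto
  qed
  show "sqrt (ah w w) <= M * (t - s)^2" if st: "0 <= s" "s < t" "t <= T" and w: "w = lincomb 1 (fminus (\<theta> t) (\<theta> s)) (s - t) (\<eta> t)" for s t w
  proof -
   have "w \<in> V" unfolding w by (intro m.lincomb_mem m.fminus_mem RV) (use st in auto)
   hence "sqrt (ah w w) <= sqrt \<Lambda> * nL w" by (rule ah_le(2))
   also have "... <= sqrt \<Lambda> * (L * (t - s)^2)" unfolding w by (rule mult_left_mono[OF \<theta>_Taylor[OF st] \<Lambda>0])
   also have "... <= M * (t - s)^2" unfolding M_def mult.assoc[symmetric] using M0 by (intro mult_right_mono) auto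
   finally show ?thesis .
  qed
  have nn: "0 <= tint T g s t" if "!!t. 0 <= g t" for g s t unfolding tint_def using that by (intro integral_nonneg_AE AE_I2) simp
  show "\<kappa> s <= \<kappa> t & \<rho> s <= \<rho> t" if "0 <= s" "s <= t" "t <= T" for s t
   unfolding \<kappa>_def \<rho>_def tint_add[OF loads_integrable(1) that(1,2)] tint_add[OF loads_integrable(2) that(1,2)]
   using nn cQ pos by (auto intro!: mult_left_mono)
  show "\<kappa> 0 = 0" "\<rho> 0 = 0" by (auto simp: \<kappa>_def \<rho>_def tint_def)
  show "0 <= g\<^sub>0" unfolding g\<^sub>0_def using cQ Linf_norm_nonneg[OF Linf(4)] Linf_norm_nonneg[OF uL] by simp
  show "0 <= M" using M0 by (simp add: M_def)
  show "sqrt (ah (\<eta> t) (\<eta> t)) <= B' & sqrt (ah (\<theta> t) (\<theta> t)) <= B' & sqrt (ip \<Omega> (\<eta> t) (\<eta> t)) <= B'" if t: "t \<in> {0..T}" for t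
  proof -
   let ?a = "c\<^sub>R * NI N u + B" and ?b = "c\<^sub>R * NI N ut + B"
   have ab: "0 <= ?a" "0 <= ?b" using order_trans[OF L2norm_nonneg bounds(1)[OF t]] order_trans[OF L2norm_nonneg bounds(2)[OF t]] .
   define p q where "p = sqrt \<Lambda> * ?a" and "q = sqrt \<Lambda> * ?b"
   have "0 <= p" "0 <= q" unfolding p_def q_def using ab \<Lambda>0 by auto
   moreover have "sqrt (ah (\<eta> t) (\<eta> t)) <= q" unfolding q_def by (rule order_trans[OF ah_le(2)[OF RV(4)[OF t]] mult_left_mono[OF bounds(2)[OF t] \<Lambda>0]])
   moreover have "sqrt (ah (\<theta> t) (\<theta> t)) <= p" unfolding p_def by (rule order_trans[OF ah_le(2)[OF RV(3)[OF t]] mult_left_mono[OF bounds(1)[OF t] \<Lambda>0]])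
   moreover have "B' = p + ?a + (q + ?b)" by (simp only: B'_def p_def q_def distrib_right mult_1)
   ultimately show ?thesis using bounds(2)[OF t] ab unfolding m_norm by (intro conjI) linarith+
  qed
  have 0: "0 \<in> {0..T}" using T by simp
  show "ip \<Omega> (\<eta> 0) (\<eta> 0) = 0" using initial(2) m.nonneg[OF RV(4)[OF 0]] by (simp add: L2norm_def)
  show "ah (\<theta> 0) (\<theta> 0) = 0" using ah_le(2)[OF RV(3)[OF 0]] initial(1) a.nonneg[OF RV(3)[OF 0]] by simp
 qed (use F t in auto)
qed

section \<open>The final estimate\<close>

text \<open>Both errors are split at the Ritz projection. The discrete parts are bounded by the
  energy; coercivity converts the \<open>ah\<close>-norm of \<theta> into the mesh-dependent norm at
  the cost of \<open>1 / sqrt \<alpha>\<close>.\<close>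

lemma error_bound:
 assumes t: "t \<in> {0..T}"
 shows "nL (fminus (ut t) (uht t)) + hnorm \<T> (fminus (u t) (uh t))
  <= C2 * h powr (2 * \<gamma>) * NI N ut + C2 * h powr \<gamma> * NI N u + (1 + 1 / sqrt \<alpha>) * (2 * (g\<^sub>0 + \<rho> T + \<kappa> T))"
proof -
 let ?M = "2 * (g\<^sub>0 + \<rho> T + \<kappa> T)"
 have nn: "0 <= ip \<Omega> (\<eta> t) (\<eta> t)" "0 <= ah (\<theta> t) (\<theta> t)" using m.nonneg[OF RV(4)[OF t]] a.nonneg[OF RV(3)[OF t]] .
 have 1: "nL (\<eta> t) <= ?M" "sqrt (ah (\<theta> t) (\<theta> t)) <= ?M"
  using discrete_error[OF t] real_sqrt_le_mono[of "ip \<Omega> (\<eta> t) (\<eta> t)" "ip \<Omega> (\<eta> t) (\<eta> t) + ah (\<theta> t) (\<theta> t)"]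
   real_sqrt_le_mono[of "ah (\<theta> t) (\<theta> t)" "ip \<Omega> (\<eta> t) (\<eta> t) + ah (\<theta> t) (\<theta> t)"] nn unfolding L2norm_def by linarith+
 have "nL (fminus (ut t) (uht t)) <= nL (fminus (ut t) (R (ut t))) + nL (\<eta> t)"
  using L2.nrm_triangle[OF mem(2)[OF t] V_L2[OF RV(2)[OF t]] V_L2[OF disc(7)[OF t]]] by (simp add: m_norm \<eta>_def)
 also have "nL (fminus (ut t) (R (ut t))) <= C2 * h powr (2 * \<gamma>) * NI N ut"
  by (rule order_trans[OF ritz(1)[OF ut_H20[OF t] reg(3)[OF t]] mult_left_mono[OF reg(4)[OF t]]]) (use pos in simp)
 finally have 2: "nL (fminus (ut t) (uht t)) <= C2 * h powr (2 * \<gamma>) * NI N ut + ?M" using 1(1) by linarith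
 have "hnorm \<T> (fminus (u t) (uh t)) <= hnorm \<T> (fminus (u t) (R (u t))) + hnorm \<T> (\<theta> t)"
  unfolding \<theta>_def by (rule hnorm_triangle[OF Hs_pwHs[OF H20_Hs[OF mem(1)[OF t]]]]) (use VH RV(1)[OF t] disc(6)[OF t] in auto)
 also have "hnorm \<T> (\<theta> t) <= ?M / sqrt \<alpha>" by (rule order_trans[OF hnorm_le_ah[OF RV(3)[OF t]] divide_right_mono[OF 1(2)]]) (use pos in simp)
 also have "hnorm \<T> (fminus (u t) (R (u t))) <= C2 * h powr \<gamma> * NI N u"
  by (rule order_trans[OF ritz(2)[OF mem(1)[OF t] reg(1)[OF t]] mult_left_mono[OF reg(2)[OF t]]]) (use pos in simp)
 finally have "hnorm \<T> (fminus (u t) (uh t)) <= C2 * h powr \<gamma> * NI N u + ?M / sqrt \<alpha>" by simp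
 moreover have "(1 + 1 / sqrt \<alpha>) * ?M = ?M + ?M / sqrt \<alpha>" by (simp add: distrib_right)
 ultimately show ?thesis using 2 by linarith
qed

text \<open>The single \<open>C2\<close> is the Ritz error of \<open>u\<close> and
  \<open>ut\<close>; \<open>C1 / sqrt \<alpha>\<close> is the smoother measured in the energy norm,
  once for the size of the load and once with \<open>sqrt T\<close> for its variation;
  \<open>C2 sqrt T\<close> is the Ritz residual. The prefactor stems from lowering powers of
  \<open>h\<close>.\<close>

lemma convergence:
 assumes t: "t \<in> {0..T}"
 shows "nL (fminus (ut t) (uht t)) + hnorm \<T> (fminus (u t) (uh t))
  <= ((1 + diameter (closure \<Omega>)) powr 2 * (C2 + (1 + 1 / sqrt \<alpha>) * 2 * (C1 / sqrt \<alpha> * (1 + sqrt T) + C2 * sqrt T))) * h powr \<gamma> * L_fu \<Omega> T \<gamma> f ft u ut utt uttt"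
proof -
 define A E q where "A = (1 + 1 / sqrt \<alpha>) * 2" and "E = C1 / sqrt \<alpha>" and "q = (1 + diameter (closure \<Omega>)) powr 2 * h powr \<gamma>"
 have AE: "0 <= A" "0 <= E" "0 <= sqrt T" using pos T by (auto simp: A_def E_def)
 \<comment> \<open>The surplus power has an exponent between 0 and 2 and is bounded through the
   diameter; the added 1 makes the base at least 1, so the exponent can be raised to 2.\<close>
 have hq: "h powr s <= q" if "\<gamma> <= s" "s <= 2" for s
 proof -
  have "h powr s = h powr (s - \<gamma>) * h powr \<gamma>" by (simp add: powr_add[symmetric])
  also have "h powr (s - \<gamma>) <= (1 + diameter (closure \<Omega>)) powr (s - \<gamma>)" using h_facts that by (intro powr_mono2) auto
  also have "... <= (1 + diameter (closure \<Omega>)) powr 2" using h_facts that pos by (intro powr_mono) auto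
  finally show ?thesis by (simp add: q_def mult_right_mono)
 qed
 have q0: "0 <= q" by (simp add: q_def)
 have q: "h powr 2 <= q" "h powr (2 * \<gamma>) <= q" "h powr \<gamma> <= q" using hq[of 2] hq[of "2 * \<gamma>"] hq[of \<gamma>] pos by auto
 note nn = Linf_norm_nonneg[OF Linf(1)] Linf_norm_nonneg[OF Linf(2)] Linf_norm_nonneg[OF Linf(4)] Linf_norm_nonneg[OF uL]
  L2_norm_nonneg[of T nL ft] L2_norm_nonneg[of T nL uttt] L2_norm_nonneg[of T N utt]
 have TT: "0 <= (0::real)" "0 <= T" "T <= T" using T by auto
 let ?K = "C2 + A * (E * (1 + sqrt T) + C2 * sqrt T)"
 have "c\<^sub>Q <= E * q" using q(1) pos by (simp add: c\<^sub>Q_def E_def field_simps)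
 hence g: "g\<^sub>0 <= (E * q) * (NI nL f + NI nL utt)" unfolding g\<^sub>0_def using nn by (intro mult_right_mono) auto
 have "tint T (%t. nL (ft t) + nL (uttt t)) 0 T <= sqrt T * (N2 nL ft + N2 nL uttt)"
  using seminormed_fn.tint_le_L2_norm[OF seminormed_L2 L2s(2) TT] seminormed_fn.tint_le_L2_norm[OF seminormed_L2 L2s(4) TT]
   tint_lin(1)[OF seminormed_fn.L2_norm_integrable[OF seminormed_L2 L2s(2)] seminormed_fn.L2_norm_integrable[OF seminormed_L2 L2s(4)]] by (simp add: distrib_left)
 hence k: "\<kappa> T <= (E * q) * (sqrt T * (N2 nL ft + N2 nL uttt))"
  unfolding \<kappa>_def using \<open>c\<^sub>Q <= E * q\<close> cQ by (intro mult_mono) (auto simp: tint_def intro!: integral_nonneg_AE)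
 have r: "\<rho> T <= (C2 * q) * (sqrt T * N2 N utt)"
  unfolding \<rho>_def using seminormed_fn.tint_le_L2_norm[OF seminormed_Hs[OF Omega(1,2)] utt_L2 TT] q(2) pos q0
  by (intro mult_mono mult_left_mono) (auto simp: tint_def intro!: integral_nonneg_AE)
 have "nL (fminus (ut t) (uht t)) + hnorm \<T> (fminus (u t) (uh t)) <= C2 * q * NI N ut + C2 * q * NI N u
   + A * ((E * q) * (NI nL f + NI nL utt) + (C2 * q) * (sqrt T * N2 N utt) + (E * q) * (sqrt T * (N2 nL ft + N2 nL uttt)))"
 proof (rule order_trans[OF error_bound[OF t]], intro add_mono)
  show "(1 + 1 / sqrt \<alpha>) * (2 * (g\<^sub>0 + \<rho> T + \<kappa> T)) <= A * ((E * q) * (NI nL f + NI nL utt) + (C2 * q) * (sqrt T * N2 N utt) + (E * q) * (sqrt T * (N2 nL ft + N2 nL uttt)))"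
   unfolding A_def mult.assoc[of _ 2] using g k r pos by (intro mult_left_mono add_mono) auto
 qed (use q pos nn in \<open>auto intro!: mult_right_mono mult_left_mono\<close>)
 also have "... = q * (C2 * NI N ut + C2 * NI N u + A * E * NI nL f + A * E * NI nL utt + A * (C2 * sqrt T) * N2 N utt + A * (E * sqrt T) * N2 nL ft + A * (E * sqrt T) * N2 nL uttt)"
  by (simp add: algebra_simps)
 also have "... <= q * (?K * NI N ut + ?K * NI N u + ?K * NI nL f + ?K * NI nL utt + ?K * N2 N utt + ?K * N2 nL ft + ?K * N2 nL uttt)"
 proof (intro mult_left_mono add_mono mult_right_mono)
  have p: "0 <= A * E" "0 <= A * (E * sqrt T)" "0 <= A * (C2 * sqrt T)" using AE pos by auto
  have K: "?K = C2 + A * E + A * (E * sqrt T) + A * (C2 * sqrt T)" by (simp add: algebra_simps)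
  show "C2 <= ?K" "C2 <= ?K" "A * E <= ?K" "A * E <= ?K" "A * (C2 * sqrt T) <= ?K" "A * (E * sqrt T) <= ?K" "A * (E * sqrt T) <= ?K"
   unfolding K using p pos by auto
 qed (use nn q_def in auto)
 also have "... = ((1 + diameter (closure \<Omega>)) powr 2 * ?K) * h powr \<gamma> * L_fu \<Omega> T \<gamma> f ft u ut utt uttt"
  by (simp add: L_fu_def q_def distrib_left mult_ac)
 finally show ?thesis unfolding A_def E_def .
qed

end

theorem theorem2p7:
  fixes \<Omega> :: "pt set" and T \<gamma>\<^sub>0 \<alpha> \<beta> C\<^sub>1 C\<^sub>2 :: real
    and \<mu> :: "nat \<Rightarrow> real" and \<psi> :: "nat \<Rightarrow> fn"
  assumes "polygonal_lipschitz_domain \<Omega>" and "0 < T"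
    and "0 < \<alpha>" and "0 < \<beta>" and "0 < C\<^sub>1" and "0 < C\<^sub>2"
    and "eigensystem \<Omega> \<mu> \<psi>"
    and "regularity_index \<Omega> \<gamma>\<^sub>0"
  shows "\<exists>C>0. \<forall>(\<kappa>::real) (\<T>::mesh) (V\<^sub>h::fn set) (a\<^sub>h::fn \<Rightarrow> fn \<Rightarrow> real)
      (I\<^sub>M::fn \<Rightarrow> fn) (J::fn \<Rightarrow> fn) (R\<^sub>h::fn \<Rightarrow> fn)
      (u\<^sub>0::fn) (v\<^sub>0::fn) f ft ftt fttt u ut utt uttt utttt u\<^sub>h u\<^sub>ht u\<^sub>htt.
      conforming_triangulation \<Omega> \<T> \<and> shape_regular \<kappa> \<T> \<and>
      fin_dim_space V\<^sub>h \<and> V\<^sub>h \<subseteq> pwHs 2 \<T> \<and>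
      discrete_form \<Omega> \<T> \<alpha> \<beta> V\<^sub>h a\<^sub>h \<and>
      extended_morley_interpolation \<Omega> \<T> I\<^sub>M \<and> companion \<Omega> \<T> J \<and>
      smoother_estimate \<Omega> \<T> C\<^sub>1 V\<^sub>h (J \<circ> I\<^sub>M) \<and>
      ritz_projection \<Omega> V\<^sub>h a\<^sub>h (J \<circ> I\<^sub>M) R\<^sub>h \<and>
      ritz_estimate \<Omega> \<T> \<gamma>\<^sub>0 C\<^sub>2 R\<^sub>h \<and>
      admissible_data \<Omega> T \<mu> \<psi> u\<^sub>0 v\<^sub>0 f ft ftt fttt \<and>
      weak_solution \<Omega> T f u\<^sub>0 v\<^sub>0 u ut utt \<and>
      solution_regularity \<Omega> T \<gamma>\<^sub>0 u ut utt uttt utttt \<and>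
      semidiscrete_solution \<Omega> T V\<^sub>h a\<^sub>h R\<^sub>h f u\<^sub>0 v\<^sub>0 u\<^sub>h u\<^sub>ht u\<^sub>htt \<longrightarrow>
      (\<forall>t\<in>{0<..T}.
         L2norm \<Omega> (fminus (ut t) (u\<^sub>ht t)) + hnorm \<T> (fminus (u t) (u\<^sub>h t))
           \<le> C * mesh_size \<T> powr \<gamma>\<^sub>0 * L_fu \<Omega> T \<gamma>\<^sub>0 f ft u ut utt uttt)"
proof -
 \<comment> \<open>The domain enters only through its diameter, and nothing here depends on the
   triangulation or the discrete space.\<close>
 let ?C = "(1 + diameter (closure \<Omega>)) powr 2 * (C\<^sub>2 + (1 + 1 / sqrt \<alpha>) * 2 * (C\<^sub>1 / sqrt \<alpha> * (1 + sqrt T) + C\<^sub>2 * sqrt T))"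
 have bd: "bounded \<Omega>" using assms(1) by (simp add: polygonal_lipschitz_domain_def)
 have "0 <= diameter (closure \<Omega>)" by (rule diameter_ge_0[OF bounded_closure[OF bd]])
 hence C: "0 < ?C" using assms(2-6) by (intro mult_pos_pos add_pos_nonneg) auto
 show ?thesis
 proof (intro exI[of _ ?C] conjI C allI impI ballI)
  fix \<kappa> :: real and \<T> :: mesh and V\<^sub>h a\<^sub>h I\<^sub>M J R\<^sub>h u\<^sub>0 v\<^sub>0 f ft ftt fttt u ut utt uttt utttt u\<^sub>h u\<^sub>ht u\<^sub>htt and t :: real
  assume A: "conforming_triangulation \<Omega> \<T> & shape_regular \<kappa> \<T> &
   fin_dim_space V\<^sub>h & V\<^sub>h \<subseteq> pwHs 2 \<T> &
   discrete_form \<Omega> \<T> \<alpha> \<beta> V\<^sub>h a\<^sub>h &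
   extended_morley_interpolation \<Omega> \<T> I\<^sub>M & companion \<Omega> \<T> J &
   smoother_estimate \<Omega> \<T> C\<^sub>1 V\<^sub>h (J \<circ> I\<^sub>M) &
   ritz_projection \<Omega> V\<^sub>h a\<^sub>h (J \<circ> I\<^sub>M) R\<^sub>h &
   ritz_estimate \<Omega> \<T> \<gamma>\<^sub>0 C\<^sub>2 R\<^sub>h &
   admissible_data \<Omega> T \<mu> \<psi> u\<^sub>0 v\<^sub>0 f ft ftt fttt &
   weak_solution \<Omega> T f u\<^sub>0 v\<^sub>0 u ut utt &
   solution_regularity \<Omega> T \<gamma>\<^sub>0 u ut utt uttt utttt &
   semidiscrete_solution \<Omega> T V\<^sub>h a\<^sub>h R\<^sub>h f u\<^sub>0 v\<^sub>0 u\<^sub>h u\<^sub>ht u\<^sub>htt"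
   and t: "t \<in> {0<..T}"
  have Q: "(J \<circ> I\<^sub>M) v \<in> H20 \<Omega>" if "v \<in> V\<^sub>h" for v
   using A that unfolding extended_morley_interpolation_def companion_def by auto
  interpret wave \<Omega> \<T> \<alpha> \<beta> C\<^sub>1 C\<^sub>2 \<gamma>\<^sub>0 V\<^sub>h a\<^sub>h "J \<circ> I\<^sub>M" R\<^sub>h T f ft u ut utt uttt u\<^sub>h u\<^sub>ht u\<^sub>htt u\<^sub>0 v\<^sub>0
  proof
   show "0 < \<gamma>\<^sub>0" "\<gamma>\<^sub>0 <= 1" using assms(8) by (auto simp: regularity_index_def)
  qed (use A Q assms(1-6) in \<open>auto simp: admissible_data_def solution_regularity_def\<close>)
  show "L2norm \<Omega> (fminus (ut t) (u\<^sub>ht t)) + hnorm \<T> (fminus (u t) (u\<^sub>h t)) <= ?C * mesh_size \<T> powr \<gamma>\<^sub>0 * L_fu \<Omega> T \<gamma>\<^sub>0 f ft u ut utt uttt"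
   using convergence[of t] t by simp
 qed
qed

end
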